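(* Suppose $\text{E-HA}^{\omega*}_{\mathrm{st}\lor} + \mathsf{OS}^*_\lor + \mathsf{US}^*_\lor + \mathsf{NU} + \mathsf{AC}^{\mathrm{st}} + \mathsf{IP}_{\forall \, \lor}^{\mathrm{st}} + \Delta_\lor \vdash \Phi(\underline{a})$, where $\Delta_\lor$ is a set of internal, $\lor$-free sentences. Let $\Phi(\underline{a})^U = \exists^{\mathrm{st}} \underline{x}\,\forall^{\mathrm{st}} \underline{y} \, \varphi_U(\underline{x},\underline{y},\underline{a})$. Then from the proof one can extract a tuple of closed terms $\underline{t}$ such that $\text{E-HA}^{\omega*}_\lor + \Delta_\lor \vdash \forall \underline{y} \, \varphi_U(\underline{t}, \underline{y}, \underline{a})$.
   Context: $\text{E-HA}^{\omega*}$ is extensional Heyting arithmetic in all finite types over the types generated by $0$, $\sigma\to\tau$ and $\sigma^*$ (finite sequences), with constants for the empty sequence $\langle\rangle$, prepending $C$, a list recursor, and the axiom that every sequence is empty or a prepend; $\langle x\rangle$ is the one-element sequence, $a\in s :\equiv \exists i<|s|\,(a=s_i)$, $s'\subseteq s :\equiv\forall x(x\in s'\to x\in s)$. $\text{E-HA}^{\omega*}_{\mathrm{st}}$ adds predicates $\mathrm{st}_\sigma$ and external quantifiers $\forall^{\mathrm{st}}x\,\Phi :\leftrightarrow \forall x(\mathrm{st}(x)\to\Phi)$, $\exists^{\mathrm{st}}x\,\Phi :\leftrightarrow \exists x(\mathrm{st}(x)\land\Phi)$; internal formulae (lowercase Greek) are those not containing $\mathrm{st}$. Axioms: those of $\text{E-HA}^{\omega*}$,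 $\mathrm{st}(x)\land x=y\to\mathrm{st}(y)$, $\mathrm{st}(a)$ for closed terms $a$, $\mathrm{st}(f)\land\mathrm{st}(x)\to\mathrm{st}(fx)$, and external induction for all formulae. $\text{E-HA}^{\omega*}_\lor$ and $\text{E-HA}^{\omega*}_{\mathrm{st}\lor}$ are $\text{E-HA}^{\omega*}$ and $\text{E-HA}^{\omega*}_{\mathrm{st}}$ with the internal induction schema restricted to internal $\lor$-free formulae. $\mathrm{hyper}(s):=\forall^{\mathrm{st}}x\,(x\in s)$. Principles (all types; $\varphi$ internal and $\lor$-free; $\Phi,\Psi$ arbitrary): $\mathsf{OS}^*_\lor$: $\forall^{\mathrm{st}}s:\sigma^*\,\varphi(s)\to\exists s:\sigma^*(\mathrm{hyper}(s)\land\varphi(s))$; $\mathsf{US}^*_\lor$: $\forall s:\sigma^*(\mathrm{hyper}(s)\to\varphi(s))\to\exists^{\mathrm{st}}s\,\varphi(s)$; $\mathsf{NU}$: $\forall y\,\exists^{\mathrm{st}}x\,\Phi(x,y)\to\exists^{\mathrm{st}}x\,\forall y\,\Phi(x,y)$; $\mathsf{AC}^{\mathrm{st}}$: $\forall^{\mathrm{st}}x:\sigma\,\exists^{\mathrm{st}}y:\tau\,\Phi(x,y)\to\exists^{\mathrm{st}}f:\sigma\to\tau\,\forall^{\mathrm{st}}x\,\Phi(x,fx)$; $\mathsf{IP}^{\mathrm{st}}_{\forall\lor}$: $(\forall^{\mathrm{st}}x\,\varphi(x)\to\exists^{\mathrm{st}}y\,\Psi(y))\to\exists^{\mathrm{st}}y(\forall^{\mathrm{st}}x\,\varphi(x)\to\Psi(y))$.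 The uniform Diller-Nahm translation assigns to each formula $\Phi(\underline{a})$ a formula $\exists^{\mathrm{st}}\underline{x}\,\forall^{\mathrm{st}}\underline{y}\,\varphi_U(\underline{x},\underline{y},\underline{a})$ with $\varphi_U$ internal and $\lor$-free (tuples of variables underlined), inductively: $\varphi^U:=\varphi$ for internal atomic $\varphi$; $\mathrm{st}_\sigma(x)^U:=\exists^{\mathrm{st}}y:\sigma\,(y=x)$; and if $\Phi^U=\exists^{\mathrm{st}}\underline{x}\forall^{\mathrm{st}}\underline{y}\,\varphi_U(\underline{x},\underline{y},\underline{a})$, $\Psi^U=\exists^{\mathrm{st}}\underline{u}\forall^{\mathrm{st}}\underline{v}\,\psi_U(\underline{u},\underline{v},\underline{b})$: $(\Phi\land\Psi)^U:=\exists^{\mathrm{st}}\underline{x},\underline{u}\,\forall^{\mathrm{st}}\underline{y},\underline{v}(\varphi_U\land\psi_U)$; $(\Phi\lor\Psi)^U:=\exists^{\mathrm{st}}z{:}0,\underline{x},\underline{u}\,\forall^{\mathrm{st}}\underline{y},\underline{v}\,\big((z=0\to\varphi_U(\underline{x},\underline{y},\underline{a}))\land(\neg z=0\to\psi_U(\underline{u},\underline{v},\underline{b}))\big)$; $(\Phi\to\Psi)^U:=\exists^{\mathrm{st}}\underline{U},\underline{Y}\,\forall^{\mathrm{st}}\underline{x},\underline{v}\,\big(\forall\underline{y}\in\underline{Y}\underline{x}\underline{v}\,\varphi_U(\underline{x},\underline{y},\underline{a})\to\psi_U(\underline{U}\underline{x},\underline{v},\underline{b})\big)$ (the $\underline{Y}\underline{x}\underline{v}$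 are finite sequences); $(\exists z\,\Phi(z))^U:=\exists^{\mathrm{st}}\underline{x}\,\forall^{\mathrm{st}}\underline{y}\,\exists z\,\forall\underline{y}'\in\underline{y}\,\varphi_U(\underline{x},\underline{y}',z,\underline{a})$ (here $\underline{y}$ ranges over sequences); $(\forall z\,\Phi(z))^U:=\exists^{\mathrm{st}}\underline{x}\,\forall^{\mathrm{st}}\underline{y}\,\forall z\,\varphi_U(\underline{x},\underline{y},z,\underline{a})$; $(\exists^{\mathrm{st}}z\,\Phi(z))^U:=\exists^{\mathrm{st}}z,\underline{x}\,\forall^{\mathrm{st}}\underline{y}\,\varphi_U(\underline{x},\underline{y},z,\underline{a})$; $(\forall^{\mathrm{st}}z\,\Phi(z))^U:=\exists^{\mathrm{st}}\underline{X}\,\forall^{\mathrm{st}}\underline{y},z\,\varphi_U(\underline{X}z,\underline{y},z,\underline{a})$.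
   Formalization: The axiom that every sequence is empty or a prepend is taken in the ∨-free form ∃n((n=0→s=⟨⟩)∧(¬n=0→∃a,s' s=C a s')), since with a literal ∨ it is inconsistent with NU; "one can extract" is stated as existence of the closed terms. *)

theory Defs
  imports Main
begin

section \<open>Types and terms\<close>

datatype ty =
    N
  | Fn ty ty  (infixr "\<^bold>\<rightarrow>" 65)
  | Seq ty

text \<open>\<open>Rec \<sigma>s i\<close> is the \<open>i\<close>-th component of the simultaneous recursor for the tuple of types
  \<open>\<sigma>s\<close>, the usual primitive when there are no product types; \<open>Rec [\<sigma>] 0\<close> is the ordinary
  recursor.\<close>

datatype cst =
    Zero
  | Succ
  | CombK ty ty
  | CombS ty ty ty
  | Rec "ty list" nat
  | Empty ty
  | Prep ty
  | LRec ty ty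

text \<open>Variables are de Bruijn indices, typed by a context \<open>\<Gamma>\<close> in which index \<open>i\<close> has type \<open>\<Gamma> ! i\<close>.\<close>

datatype tm =
    Var nat
  | Cst cst
  | App tm tm  (infixl "\<^bold>\<cdot>" 75)

definition arrs :: "ty list \<Rightarrow> ty \<Rightarrow> ty" where
  "arrs \<sigma>s \<tau> = foldr Fn \<sigma>s \<tau>"

definition apps :: "tm \<Rightarrow> tm list \<Rightarrow> tm" where
  "apps t ts = foldl App t ts"

inductive cst_ty :: "cst \<Rightarrow> ty \<Rightarrow> bool" where
  "cst_ty Zero N"
| "cst_ty Succ (N \<^bold>\<rightarrow> N)"
| "cst_ty (CombK \<sigma> \<tau>) (\<sigma> \<^bold>\<rightarrow> \<tau> \<^bold>\<rightarrow> \<sigma>)"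
| "cst_ty (CombS \<rho> \<sigma> \<tau>) ((\<rho> \<^bold>\<rightarrow> \<sigma> \<^bold>\<rightarrow> \<tau>) \<^bold>\<rightarrow> (\<rho> \<^bold>\<rightarrow> \<sigma>) \<^bold>\<rightarrow> \<rho> \<^bold>\<rightarrow> \<tau>)"
| "i < length \<sigma>s \<Longrightarrow>
   cst_ty (Rec \<sigma>s i) (arrs (\<sigma>s @ map (\<lambda>\<tau>. N \<^bold>\<rightarrow> arrs \<sigma>s \<tau>) \<sigma>s) (N \<^bold>\<rightarrow> \<sigma>s ! i))"
| "cst_ty (Empty \<sigma>) (Seq \<sigma>)"
| "cst_ty (Prep \<sigma>) (\<sigma> \<^bold>\<rightarrow> Seq \<sigma> \<^bold>\<rightarrow> Seq \<sigma>)"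
| "cst_ty (LRec \<sigma> \<rho>) (\<rho> \<^bold>\<rightarrow> (\<sigma> \<^bold>\<rightarrow> Seq \<sigma> \<^bold>\<rightarrow> \<rho> \<^bold>\<rightarrow> \<rho>) \<^bold>\<rightarrow> Seq \<sigma> \<^bold>\<rightarrow> \<rho>)"

inductive has_ty :: "ty list \<Rightarrow> tm \<Rightarrow> ty \<Rightarrow> bool" where
  "i < length \<Gamma> \<Longrightarrow> has_ty \<Gamma> (Var i) (\<Gamma> ! i)"
| "cst_ty c \<sigma> \<Longrightarrow> has_ty \<Gamma> (Cst c) \<sigma>"
| "has_ty \<Gamma> f (\<sigma> \<^bold>\<rightarrow> \<tau>) \<Longrightarrow> has_ty \<Gamma> t \<sigma> \<Longrightarrow> has_ty \<Gamma> (f \<^bold>\<cdot> t) \<tau>"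

primrec tsubst :: "(nat \<Rightarrow> tm) \<Rightarrow> tm \<Rightarrow> tm" where
  "tsubst \<theta> (Var i) = \<theta> i"
| "tsubst \<theta> (Cst c) = Cst c"
| "tsubst \<theta> (f \<^bold>\<cdot> t) = tsubst \<theta> f \<^bold>\<cdot> tsubst \<theta> t"

definition tlift :: "nat \<Rightarrow> tm \<Rightarrow> tm" where
  "tlift n = tsubst (\<lambda>i. Var (i + n))"

definition up :: "(nat \<Rightarrow> tm) \<Rightarrow> nat \<Rightarrow> tm" where
  "up \<theta> = case_nat (Var 0) (\<lambda>i. tlift 1 (\<theta> i))"

text \<open>The variables bound by a block of \<open>n\<close> quantifiers, outermost first.\<close>

definition vars :: "nat \<Rightarrow> tm list" where
  "vars n = map Var (rev [0..<n])"

abbreviation zero :: tm where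
  "zero \<equiv> Cst Zero"

abbreviation suc :: "tm \<Rightarrow> tm" where
  "suc t \<equiv> Cst Succ \<^bold>\<cdot> t"

definition plus_tm :: "tm \<Rightarrow> tm \<Rightarrow> tm" where
  "plus_tm m n = Cst (Rec [N] 0) \<^bold>\<cdot> m \<^bold>\<cdot> (Cst (CombK (N \<^bold>\<rightarrow> N) N) \<^bold>\<cdot> Cst Succ) \<^bold>\<cdot> n"

primrec null_tm :: "ty \<Rightarrow> tm" where
  "null_tm N = zero"
| "null_tm (\<sigma> \<^bold>\<rightarrow> \<tau>) = Cst (CombK \<tau> \<sigma>) \<^bold>\<cdot> null_tm \<tau>"
| "null_tm (Seq \<sigma>) = Cst (Empty \<sigma>)"

text \<open>\<open>|s|\<close> is recursion with step \<open>\<lambda>a s' n. S n\<close>; the head and the tail are recursions with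
  steps \<open>\<lambda>a s' r. a\<close> and \<open>\<lambda>a s' r. s'\<close>; and \<open>s\<^sub>i\<close> is the head of the \<open>i\<close>-th iterated tail
  (so it is \<open>null_tm \<sigma>\<close> for \<open>i \<ge> |s|\<close>).\<close>

definition len_tm :: "ty \<Rightarrow> tm \<Rightarrow> tm" where
  "len_tm \<sigma> s =
    Cst (LRec \<sigma> N) \<^bold>\<cdot> zero \<^bold>\<cdot>
      (Cst (CombK (Seq \<sigma> \<^bold>\<rightarrow> N \<^bold>\<rightarrow> N) \<sigma>) \<^bold>\<cdot> (Cst (CombK (N \<^bold>\<rightarrow> N) (Seq \<sigma>)) \<^bold>\<cdot> Cst Succ)) \<^bold>\<cdot> s"

definition head_tm :: "ty \<Rightarrow> tm \<Rightarrow> tm" where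
  "head_tm \<sigma> s =
    Cst (LRec \<sigma> \<sigma>) \<^bold>\<cdot> null_tm \<sigma> \<^bold>\<cdot>
      (Cst (CombS \<sigma> (\<sigma> \<^bold>\<rightarrow> \<sigma>) (Seq \<sigma> \<^bold>\<rightarrow> \<sigma> \<^bold>\<rightarrow> \<sigma>)) \<^bold>\<cdot>
        (Cst (CombK ((\<sigma> \<^bold>\<rightarrow> \<sigma>) \<^bold>\<rightarrow> Seq \<sigma> \<^bold>\<rightarrow> \<sigma> \<^bold>\<rightarrow> \<sigma>) \<sigma>) \<^bold>\<cdot> Cst (CombK (\<sigma> \<^bold>\<rightarrow> \<sigma>) (Seq \<sigma>))) \<^bold>\<cdot>
        Cst (CombK \<sigma> \<sigma>)) \<^bold>\<cdot> s"

definition tail_fn :: "ty \<Rightarrow> tm" where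
  "tail_fn \<sigma> =
    Cst (LRec \<sigma> (Seq \<sigma>)) \<^bold>\<cdot> Cst (Empty \<sigma>) \<^bold>\<cdot>
      (Cst (CombK (Seq \<sigma> \<^bold>\<rightarrow> Seq \<sigma> \<^bold>\<rightarrow> Seq \<sigma>) \<sigma>) \<^bold>\<cdot> Cst (CombK (Seq \<sigma>) (Seq \<sigma>)))"

definition nth_tm :: "ty \<Rightarrow> tm \<Rightarrow> tm \<Rightarrow> tm" where
  "nth_tm \<sigma> s i =
    head_tm \<sigma> (Cst (Rec [Seq \<sigma>] 0) \<^bold>\<cdot> s \<^bold>\<cdot> (Cst (CombK (Seq \<sigma> \<^bold>\<rightarrow> Seq \<sigma>) N) \<^bold>\<cdot> tail_fn \<sigma>) \<^bold>\<cdot> i)"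

section \<open>Formulae\<close>

datatype fm =
    Bot
  | Eq ty tm tm
  | St ty tm
  | And fm fm
  | Or fm fm
  | Imp fm fm
  | All ty fm
  | Ex ty fm
  | AllSt ty fm
  | ExSt ty fm

abbreviation Neg :: "fm \<Rightarrow> fm" where
  "Neg \<phi> \<equiv> Imp \<phi> Bot"

primrec wff :: "ty list \<Rightarrow> fm \<Rightarrow> bool" where
  "wff \<Gamma> Bot = True"
| "wff \<Gamma> (Eq \<sigma> t u) = (has_ty \<Gamma> t \<sigma> \<and> has_ty \<Gamma> u \<sigma>)"
| "wff \<Gamma> (St \<sigma> t) = has_ty \<Gamma> t \<sigma>"
| "wff \<Gamma> (And \<phi> \<psi>) = (wff \<Gamma> \<phi> \<and> wff \<Gamma> \<psi>)"
| "wff \<Gamma> (Or \<phi> \<psi>) = (wff \<Gamma> \<phi> \<and> wff \<Gamma> \<psi>)"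
| "wff \<Gamma> (Imp \<phi> \<psi>) = (wff \<Gamma> \<phi> \<and> wff \<Gamma> \<psi>)"
| "wff \<Gamma> (All \<sigma> \<phi>) = wff (\<sigma> # \<Gamma>) \<phi>"
| "wff \<Gamma> (Ex \<sigma> \<phi>) = wff (\<sigma> # \<Gamma>) \<phi>"
| "wff \<Gamma> (AllSt \<sigma> \<phi>) = wff (\<sigma> # \<Gamma>) \<phi>"
| "wff \<Gamma> (ExSt \<sigma> \<phi>) = wff (\<sigma> # \<Gamma>) \<phi>"

abbreviation sentence :: "fm \<Rightarrow> bool" where
  "sentence \<equiv> wff []"

primrec internal :: "fm \<Rightarrow> bool" where
  "internal Bot = True"
| "internal (Eq \<sigma> t u) = True"
| "internal (St \<sigma> t) = False"
| "internal (And \<phi> \<psi>) = (internal \<phi> \<and> internal \<psi>)"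
| "internal (Or \<phi> \<psi>) = (internal \<phi> \<and> internal \<psi>)"
| "internal (Imp \<phi> \<psi>) = (internal \<phi> \<and> internal \<psi>)"
| "internal (All \<sigma> \<phi>) = internal \<phi>"
| "internal (Ex \<sigma> \<phi>) = internal \<phi>"
| "internal (AllSt \<sigma> \<phi>) = False"
| "internal (ExSt \<sigma> \<phi>) = False"

primrec or_free :: "fm \<Rightarrow> bool" where
  "or_free Bot = True"
| "or_free (Eq \<sigma> t u) = True"
| "or_free (St \<sigma> t) = True"
| "or_free (And \<phi> \<psi>) = (or_free \<phi> \<and> or_free \<psi>)"
| "or_free (Or \<phi> \<psi>) = False"
| "or_free (Imp \<phi> \<psi>) = (or_free \<phi> \<and> or_free \<psi>)"
| "or_free (All \<sigma> \<phi>) = or_free \<phi>"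
| "or_free (Ex \<sigma> \<phi>) = or_free \<phi>"
| "or_free (AllSt \<sigma> \<phi>) = or_free \<phi>"
| "or_free (ExSt \<sigma> \<phi>) = or_free \<phi>"

primrec fsubst :: "(nat \<Rightarrow> tm) \<Rightarrow> fm \<Rightarrow> fm" where
  "fsubst \<theta> Bot = Bot"
| "fsubst \<theta> (Eq \<sigma> t u) = Eq \<sigma> (tsubst \<theta> t) (tsubst \<theta> u)"
| "fsubst \<theta> (St \<sigma> t) = St \<sigma> (tsubst \<theta> t)"
| "fsubst \<theta> (And \<phi> \<psi>) = And (fsubst \<theta> \<phi>) (fsubst \<theta> \<psi>)"
| "fsubst \<theta> (Or \<phi> \<psi>) = Or (fsubst \<theta> \<phi>) (fsubst \<theta> \<psi>)"
| "fsubst \<theta> (Imp \<phi> \<psi>) = Imp (fsubst \<theta> \<phi>) (fsubst \<theta> \<psi>)"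
| "fsubst \<theta> (All \<sigma> \<phi>) = All \<sigma> (fsubst (up \<theta>) \<phi>)"
| "fsubst \<theta> (Ex \<sigma> \<phi>) = Ex \<sigma> (fsubst (up \<theta>) \<phi>)"
| "fsubst \<theta> (AllSt \<sigma> \<phi>) = AllSt \<sigma> (fsubst (up \<theta>) \<phi>)"
| "fsubst \<theta> (ExSt \<sigma> \<phi>) = ExSt \<sigma> (fsubst (up \<theta>) \<phi>)"

definition flift :: "fm \<Rightarrow> fm" where
  "flift = fsubst (\<lambda>i. Var (Suc i))"

definition finst :: "tm \<Rightarrow> fm \<Rightarrow> fm" where
  "finst t = fsubst (case_nat t Var)"

text \<open>\<open>\<phi>(S n)\<close>, where \<open>n\<close> is variable 0 and stays free.\<close>

definition fsucc :: "fm \<Rightarrow> fm" where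
  "fsucc = fsubst (case_nat (suc (Var 0)) (\<lambda>i. Var (Suc i)))"

definition Alls :: "ty list \<Rightarrow> fm \<Rightarrow> fm" where
  "Alls \<sigma>s \<phi> = foldr All \<sigma>s \<phi>"

definition Less :: "tm \<Rightarrow> tm \<Rightarrow> fm" where
  "Less m n = Ex N (Eq N (plus_tm (tlift 1 m) (suc (Var 0))) (tlift 1 n))"

definition Mem :: "ty \<Rightarrow> tm \<Rightarrow> tm \<Rightarrow> fm" where
  "Mem \<sigma> a s = Ex N (And (Less (Var 0) (len_tm \<sigma> (tlift 1 s)))
                         (Eq \<sigma> (tlift 1 a) (nth_tm \<sigma> (tlift 1 s) (Var 0))))"

text \<open>\<open>\<forall>y\<^sub>1\<in>s\<^sub>1 \<dots> \<forall>y\<^sub>n\<in>s\<^sub>n \<phi>\<close>; the matrix \<open>\<phi>\<close> lives under the \<open>n\<close> binders, the \<open>s\<^sub>i\<close> do not.\<close>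

fun BAlls :: "ty list \<Rightarrow> tm list \<Rightarrow> fm \<Rightarrow> fm" where
  "BAlls (\<tau> # \<tau>s) (s # ss) \<phi> =
     All \<tau> (Imp (Mem \<tau> (Var 0) (tlift 1 s)) (BAlls \<tau>s (map (tlift 1) ss) \<phi>))"
| "BAlls _ _ \<phi> = \<phi>"

definition hyper :: "ty \<Rightarrow> tm \<Rightarrow> fm" where
  "hyper \<sigma> s = AllSt \<sigma> (Mem \<sigma> (Var 0) (tlift 1 s))"

section \<open>Intuitionistic predicate logic\<close>

text \<open>\<open>prv L Ax \<Gamma> H \<phi>\<close>: natural deduction over the language \<open>L\<close> with axioms \<open>Ax\<close>, free variables
  declared in \<open>\<Gamma>\<close> and open assumptions \<open>H\<close>. Since \<open>Ax\<close> collects instances of schemata for all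
  contexts, well-formedness in \<open>\<Gamma>\<close> is checked when an axiom is used.\<close>

inductive prv :: "fm set \<Rightarrow> fm set \<Rightarrow> ty list \<Rightarrow> fm list \<Rightarrow> fm \<Rightarrow> bool"
  for L :: "fm set" and Ax :: "fm set" where
  ax: "\<phi> \<in> Ax \<Longrightarrow> \<phi> \<in> L \<Longrightarrow> wff \<Gamma> \<phi> \<Longrightarrow> prv L Ax \<Gamma> H \<phi>"
| hyp: "\<phi> \<in> set H \<Longrightarrow> prv L Ax \<Gamma> H \<phi>"
| botE: "prv L Ax \<Gamma> H Bot \<Longrightarrow> \<phi> \<in> L \<Longrightarrow> wff \<Gamma> \<phi> \<Longrightarrow> prv L Ax \<Gamma> H \<phi>"
| andI: "prv L Ax \<Gamma> H \<phi> \<Longrightarrow> prv L Ax \<Gamma> H \<psi> \<Longrightarrow> prv L Ax \<Gamma> H (And \<phi> \<psi>)"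
| andE1: "prv L Ax \<Gamma> H (And \<phi> \<psi>) \<Longrightarrow> prv L Ax \<Gamma> H \<phi>"
| andE2: "prv L Ax \<Gamma> H (And \<phi> \<psi>) \<Longrightarrow> prv L Ax \<Gamma> H \<psi>"
| orI1: "prv L Ax \<Gamma> H \<phi> \<Longrightarrow> \<psi> \<in> L \<Longrightarrow> wff \<Gamma> \<psi> \<Longrightarrow> prv L Ax \<Gamma> H (Or \<phi> \<psi>)"
| orI2: "prv L Ax \<Gamma> H \<psi> \<Longrightarrow> \<phi> \<in> L \<Longrightarrow> wff \<Gamma> \<phi> \<Longrightarrow> prv L Ax \<Gamma> H (Or \<phi> \<psi>)"
| orE: "prv L Ax \<Gamma> H (Or \<phi> \<psi>) \<Longrightarrow> prv L Ax \<Gamma> (\<phi> # H) \<chi> \<Longrightarrow> prv L Ax \<Gamma> (\<psi> # H) \<chi> \<Longrightarrow>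
    prv L Ax \<Gamma> H \<chi>"
| impI: "\<phi> \<in> L \<Longrightarrow> wff \<Gamma> \<phi> \<Longrightarrow> prv L Ax \<Gamma> (\<phi> # H) \<psi> \<Longrightarrow> prv L Ax \<Gamma> H (Imp \<phi> \<psi>)"
| impE: "prv L Ax \<Gamma> H (Imp \<phi> \<psi>) \<Longrightarrow> prv L Ax \<Gamma> H \<phi> \<Longrightarrow> prv L Ax \<Gamma> H \<psi>"
| allI: "prv L Ax (\<sigma> # \<Gamma>) (map flift H) \<phi> \<Longrightarrow> prv L Ax \<Gamma> H (All \<sigma> \<phi>)"
| allE: "prv L Ax \<Gamma> H (All \<sigma> \<phi>) \<Longrightarrow> has_ty \<Gamma> t \<sigma> \<Longrightarrow> prv L Ax \<Gamma> H (finst t \<phi>)"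
| exI: "Ex \<sigma> \<phi> \<in> L \<Longrightarrow> wff \<Gamma> (Ex \<sigma> \<phi>) \<Longrightarrow> has_ty \<Gamma> t \<sigma> \<Longrightarrow> prv L Ax \<Gamma> H (finst t \<phi>) \<Longrightarrow>
    prv L Ax \<Gamma> H (Ex \<sigma> \<phi>)"
| exE: "prv L Ax \<Gamma> H (Ex \<sigma> \<phi>) \<Longrightarrow> prv L Ax (\<sigma> # \<Gamma>) (\<phi> # map flift H) (flift \<chi>) \<Longrightarrow>
    prv L Ax \<Gamma> H \<chi>"

section \<open>The theories\<close>

text \<open>Axioms of E-HA\<omega>*\<or>. In \<open>seq_cases\<close>, ``empty or a prepend'' is stated
  with the \<open>\<or>\<close>-free arithmetical rendering
  \<open>\<exists>n ((n = 0 \<longrightarrow> A) \<and> (\<not> n = 0 \<longrightarrow> B))\<close> of disjunction, as is appropriate for the \<open>\<or>\<close>-free setting: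
  with a literal internal \<open>\<or>\<close>, the principle NU would yield a single standard \<open>n\<close>
  deciding emptiness for all sequences at once, a contradiction.\<close>

inductive_set EHA_or_ax :: "fm set" where
  eq_refl: "Eq \<sigma> t t \<in> EHA_or_ax"
| eq_sym: "Imp (Eq \<sigma> t u) (Eq \<sigma> u t) \<in> EHA_or_ax"
| eq_trans: "Imp (And (Eq \<sigma> t u) (Eq \<sigma> u v)) (Eq \<sigma> t v) \<in> EHA_or_ax"
| eq_app: "Imp (And (Eq (\<sigma> \<^bold>\<rightarrow> \<tau>) f g) (Eq \<sigma> t u)) (Eq \<tau> (f \<^bold>\<cdot> t) (g \<^bold>\<cdot> u)) \<in> EHA_or_ax"
| extensionality:
    "Imp (All \<sigma> (Eq \<tau> (tlift 1 f \<^bold>\<cdot> Var 0) (tlift 1 g \<^bold>\<cdot> Var 0))) (Eq (\<sigma> \<^bold>\<rightarrow> \<tau>) f g) \<in> EHA_or_ax"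
| suc_not_zero: "Neg (Eq N (suc t) zero) \<in> EHA_or_ax"
| suc_inject: "Imp (Eq N (suc t) (suc u)) (Eq N t u) \<in> EHA_or_ax"
| comb_k: "Eq \<sigma> (Cst (CombK \<sigma> \<tau>) \<^bold>\<cdot> t \<^bold>\<cdot> u) t \<in> EHA_or_ax"
| comb_s: "Eq \<tau> (Cst (CombS \<rho> \<sigma> \<tau>) \<^bold>\<cdot> t \<^bold>\<cdot> u \<^bold>\<cdot> v) (t \<^bold>\<cdot> v \<^bold>\<cdot> (u \<^bold>\<cdot> v)) \<in> EHA_or_ax"
| rec_zero: "length ts = length \<sigma>s \<Longrightarrow> length us = length \<sigma>s \<Longrightarrow> i < length \<sigma>s \<Longrightarrow>
    Eq (\<sigma>s ! i) (apps (Cst (Rec \<sigma>s i)) (ts @ us) \<^bold>\<cdot> zero) (ts ! i) \<in> EHA_or_ax"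
| rec_suc: "length ts = length \<sigma>s \<Longrightarrow> length us = length \<sigma>s \<Longrightarrow> i < length \<sigma>s \<Longrightarrow>
    Eq (\<sigma>s ! i) (apps (Cst (Rec \<sigma>s i)) (ts @ us) \<^bold>\<cdot> suc v)
       (apps (us ! i \<^bold>\<cdot> v)
          (map (\<lambda>j. apps (Cst (Rec \<sigma>s j)) (ts @ us) \<^bold>\<cdot> v) [0..<length \<sigma>s])) \<in> EHA_or_ax"
| lrec_empty: "Eq \<rho> (Cst (LRec \<sigma> \<rho>) \<^bold>\<cdot> t \<^bold>\<cdot> u \<^bold>\<cdot> Cst (Empty \<sigma>)) t \<in> EHA_or_ax"
| lrec_prep:
    "Eq \<rho> (Cst (LRec \<sigma> \<rho>) \<^bold>\<cdot> t \<^bold>\<cdot> u \<^bold>\<cdot> (Cst (Prep \<sigma>) \<^bold>\<cdot> a \<^bold>\<cdot> s))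
          (u \<^bold>\<cdot> a \<^bold>\<cdot> s \<^bold>\<cdot> (Cst (LRec \<sigma> \<rho>) \<^bold>\<cdot> t \<^bold>\<cdot> u \<^bold>\<cdot> s)) \<in> EHA_or_ax"
| seq_cases:
    "Ex N (And
       (Imp (Eq N (Var 0) zero) (Eq (Seq \<sigma>) (tlift 1 s) (Cst (Empty \<sigma>))))
       (Imp (Neg (Eq N (Var 0) zero))
         (Ex \<sigma> (Ex (Seq \<sigma>) (Eq (Seq \<sigma>) (tlift 3 s) (Cst (Prep \<sigma>) \<^bold>\<cdot> Var 1 \<^bold>\<cdot> Var 0))))))
     \<in> EHA_or_ax"
| induction: "internal \<phi> \<Longrightarrow> or_free \<phi> \<Longrightarrow>
    Imp (And (finst zero \<phi>) (All N (Imp \<phi> (fsucc \<phi>)))) (All N \<phi>) \<in> EHA_or_ax"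

text \<open>The external quantifiers are primitive, as the translation below has separate clauses for
  them; their defining equivalences are axioms.\<close>

inductive_set st_ax :: "fm set" where
  allst1: "Imp (AllSt \<sigma> \<Phi>) (All \<sigma> (Imp (St \<sigma> (Var 0)) \<Phi>)) \<in> st_ax"
| allst2: "Imp (All \<sigma> (Imp (St \<sigma> (Var 0)) \<Phi>)) (AllSt \<sigma> \<Phi>) \<in> st_ax"
| exst1: "Imp (ExSt \<sigma> \<Phi>) (Ex \<sigma> (And (St \<sigma> (Var 0)) \<Phi>)) \<in> st_ax"
| exst2: "Imp (Ex \<sigma> (And (St \<sigma> (Var 0)) \<Phi>)) (ExSt \<sigma> \<Phi>) \<in> st_ax"
| st_eq: "Imp (And (St \<sigma> t) (Eq \<sigma> t u)) (St \<sigma> u) \<in> st_ax"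
| st_closed: "has_ty [] t \<sigma> \<Longrightarrow> St \<sigma> t \<in> st_ax"
| st_app: "Imp (And (St (\<sigma> \<^bold>\<rightarrow> \<tau>) f) (St \<sigma> t)) (St \<tau> (f \<^bold>\<cdot> t)) \<in> st_ax"
| ext_induction:
    "Imp (And (finst zero \<Phi>) (AllSt N (Imp \<Phi> (fsucc \<Phi>)))) (AllSt N \<Phi>) \<in> st_ax"

inductive_set OS_or :: "fm set" where
  "internal \<phi> \<Longrightarrow> or_free \<phi> \<Longrightarrow>
   Imp (AllSt (Seq \<sigma>) \<phi>) (Ex (Seq \<sigma>) (And (hyper \<sigma> (Var 0)) \<phi>)) \<in> OS_or"

inductive_set US_or :: "fm set" where
  "internal \<phi> \<Longrightarrow> or_free \<phi> \<Longrightarrow>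
   Imp (All (Seq \<sigma>) (Imp (hyper \<sigma> (Var 0)) \<phi>)) (ExSt (Seq \<sigma>) \<phi>) \<in> US_or"

text \<open>In \<open>\<forall>y \<exists>\<^sup>s\<^sup>tx \<Phi>\<close> variable 0 of \<open>\<Phi>\<close> is \<open>x\<close> and variable 1 is \<open>y\<close>; exchanging the
  quantifiers exchanges these indices.\<close>

inductive_set NU :: "fm set" where
  "Imp (All \<tau> (ExSt \<sigma> \<Phi>))
       (ExSt \<sigma> (All \<tau> (fsubst (case_nat (Var 1) (case_nat (Var 0) (\<lambda>i. Var (i + 2)))) \<Phi>))) \<in> NU"

text \<open>In \<open>\<forall>\<^sup>s\<^sup>tx \<exists>\<^sup>s\<^sup>ty \<Phi>\<close> variable 0 of \<open>\<Phi>\<close> is \<open>y\<close> and variable 1 is \<open>x\<close>; under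
  \<open>\<exists>\<^sup>s\<^sup>tf \<forall>\<^sup>s\<^sup>tx\<close> variable 0 is \<open>x\<close> and variable 1 is \<open>f\<close>.\<close>

inductive_set AC_st :: "fm set" where
  "Imp (AllSt \<sigma> (ExSt \<tau> \<Phi>))
       (ExSt (\<sigma> \<^bold>\<rightarrow> \<tau>) (AllSt \<sigma>
         (fsubst (case_nat (Var 1 \<^bold>\<cdot> Var 0) (case_nat (Var 0) (\<lambda>i. Var (i + 2)))) \<Phi>))) \<in> AC_st"

inductive_set IP_or :: "fm set" where
  "internal \<phi> \<Longrightarrow> or_free \<phi> \<Longrightarrow>
   Imp (Imp (AllSt \<sigma> \<phi>) (ExSt \<tau> \<Psi>))
       (ExSt \<tau> (Imp (flift (AllSt \<sigma> \<phi>)) \<Psi>)) \<in> IP_or"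

text \<open>\<open>EHA_or \<Delta> \<Gamma> \<phi>\<close> and \<open>EHA_st_or P \<Gamma> \<Phi>\<close>: provability, with free variables in \<open>\<Gamma>\<close>, in
  E-HA\<omega>*\<or> \<open>+ \<Delta>\<close> and in E-HA\<omega>*st\<or> \<open>+ P\<close>.\<close>

definition EHA_or :: "fm set \<Rightarrow> ty list \<Rightarrow> fm \<Rightarrow> bool" where
  "EHA_or \<Delta> \<Gamma> \<phi> = prv {\<psi>. internal \<psi>} (EHA_or_ax \<union> \<Delta>) \<Gamma> [] \<phi>"

definition EHA_st_or :: "fm set \<Rightarrow> ty list \<Rightarrow> fm \<Rightarrow> bool" where
  "EHA_st_or P \<Gamma> \<Phi> = prv UNIV (EHA_or_ax \<union> st_ax \<union> P) \<Gamma> [] \<Phi>"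

section \<open>The uniform Diller-Nahm translation\<close>

text \<open>The translation \<open>\<exists>\<^sup>s\<^sup>tx \<forall>\<^sup>s\<^sup>ty \<phi>\<^sub>U(x,y,a)\<close> of \<open>\<Phi>(a)\<close> is given by the types of the tuples
  \<open>x\<close> (first component of \<open>Uty\<close>) and \<open>y\<close> (second component), and by its matrix.\<close>

primrec Uty :: "fm \<Rightarrow> ty list \<times> ty list" where
  "Uty Bot = ([], [])"
| "Uty (Eq \<sigma> t u) = ([], [])"
| "Uty (St \<sigma> t) = ([\<sigma>], [])"
| "Uty (And \<Phi> \<Psi>) = (fst (Uty \<Phi>) @ fst (Uty \<Psi>), snd (Uty \<Phi>) @ snd (Uty \<Psi>))"
| "Uty (Or \<Phi> \<Psi>) = (N # fst (Uty \<Phi>) @ fst (Uty \<Psi>), snd (Uty \<Phi>) @ snd (Uty \<Psi>))"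
| "Uty (Imp \<Phi> \<Psi>) =
    (map (arrs (fst (Uty \<Phi>))) (fst (Uty \<Psi>)) @
       map (\<lambda>\<tau>. arrs (fst (Uty \<Phi>) @ snd (Uty \<Psi>)) (Seq \<tau>)) (snd (Uty \<Phi>)),
     fst (Uty \<Phi>) @ snd (Uty \<Psi>))"
| "Uty (Ex \<sigma> \<Phi>) = (fst (Uty \<Phi>), map Seq (snd (Uty \<Phi>)))"
| "Uty (All \<sigma> \<Phi>) = Uty \<Phi>"
| "Uty (ExSt \<sigma> \<Phi>) = (\<sigma> # fst (Uty \<Phi>), snd (Uty \<Phi>))"
| "Uty (AllSt \<sigma> \<Phi>) = (map (Fn \<sigma>) (fst (Uty \<Phi>)), snd (Uty \<Phi>) @ [\<sigma>])"

abbreviation Uex :: "fm \<Rightarrow> ty list" where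
  "Uex \<Phi> \<equiv> fst (Uty \<Phi>)"

abbreviation Uall :: "fm \<Rightarrow> ty list" where
  "Uall \<Phi> \<equiv> snd (Uty \<Phi>)"

text \<open>\<open>Umat \<Phi> as xs ys\<close> is \<open>\<phi>\<^sub>U(xs, ys, as)\<close> for terms \<open>xs\<close>, \<open>ys\<close> of types \<open>Uex \<Phi>\<close>, \<open>Uall \<Phi>\<close>,
  where \<open>as i\<close> is the term put for the free variable \<open>i\<close> of \<open>\<Phi>\<close>. Passing these terms down makes the
  substitutions of the clauses part of the recursion; under a binder they are lifted. Tuples of
  concatenated form are split by \<open>take\<close> and \<open>drop\<close>.\<close>

primrec Umat :: "fm \<Rightarrow> (nat \<Rightarrow> tm) \<Rightarrow> tm list \<Rightarrow> tm list \<Rightarrow> fm" where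
  "Umat Bot as xs ys = Bot"
| "Umat (Eq \<sigma> t u) as xs ys = Eq \<sigma> (tsubst as t) (tsubst as u)"
| "Umat (St \<sigma> t) as xs ys = Eq \<sigma> (hd xs) (tsubst as t)"
| "Umat (And \<Phi> \<Psi>) as xus yvs =
    (let m = length (Uex \<Phi>); n = length (Uall \<Phi>) in
      And (Umat \<Phi> as (take m xus) (take n yvs)) (Umat \<Psi> as (drop m xus) (drop n yvs)))"
| "Umat (Or \<Phi> \<Psi>) as zxus yvs =
    (let m = length (Uex \<Phi>); n = length (Uall \<Phi>); z = hd zxus; xus = tl zxus in
      And (Imp (Eq N z zero) (Umat \<Phi> as (take m xus) (take n yvs)))
          (Imp (Neg (Eq N z zero)) (Umat \<Psi> as (drop m xus) (drop n yvs))))"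
| "Umat (Imp \<Phi> \<Psi>) as UYs xvs =
    (let Us = take (length (Uex \<Psi>)) UYs; Ys = drop (length (Uex \<Psi>)) UYs;
         xs = take (length (Uex \<Phi>)) xvs; vs = drop (length (Uex \<Phi>)) xvs;
         n = length (Uall \<Phi>) in
      Imp (BAlls (Uall \<Phi>) (map (\<lambda>Y. apps Y (xs @ vs)) Ys)
             (Umat \<Phi> (tlift n \<circ> as) (map (tlift n) xs) (vars n)))
          (Umat \<Psi> as (map (\<lambda>U. apps U xs) Us) vs))"
| "Umat (Ex \<sigma> \<Phi>) as xs ys =
    (let n = length (Uall \<Phi>) in
      Ex \<sigma> (BAlls (Uall \<Phi>) (map (tlift 1) ys)
             (Umat \<Phi> (tlift n \<circ> up as) (map (tlift (n + 1)) xs) (vars n))))"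
| "Umat (All \<sigma> \<Phi>) as xs ys = All \<sigma> (Umat \<Phi> (up as) (map (tlift 1) xs) (map (tlift 1) ys))"
| "Umat (ExSt \<sigma> \<Phi>) as zxs ys = Umat \<Phi> (case_nat (hd zxs) as) (tl zxs) ys"
| "Umat (AllSt \<sigma> \<Phi>) as Xs yzs =
    (let z = last yzs in Umat \<Phi> (case_nat z as) (map (\<lambda>X. X \<^bold>\<cdot> z) Xs) (butlast yzs))"

definition Utrans :: "fm \<Rightarrow> fm" where
  "Utrans \<Phi> =
    (let m = length (Uex \<Phi>); n = length (Uall \<Phi>) in
      foldr ExSt (Uex \<Phi>) (foldr AllSt (Uall \<Phi>)
        (Umat \<Phi> (\<lambda>i. Var (i + m + n)) (map (tlift n) (vars m)) (vars n))))"

end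

theory Submission
  imports Defs "HOL-Library.FSet"
begin

text \<open>A sequent \<open>\<Phi> \<turnstile> \<Psi>\<close> is interpreted by two operations that are given by open terms: \<open>f\<close> turns
  realizers of \<open>\<Phi>\<close> into realizers of \<open>\<Psi>\<close>, and \<open>g\<close> turns a realizer of \<open>\<Phi>\<close> and a challenge to \<open>\<Psi>\<close>
  into finite sequences of challenges to \<open>\<Phi>\<close> such that the matrix of \<open>\<Psi>\<close> follows if that of \<open>\<Phi>\<close>
  holds for all members of these sequences. Contraction appends the sequences, composition takes
  unions over the members of a sequence, so the matrix need not be decidable; the internal
  quantifiers leave the realizers unchanged. The characteristic principles and the standardness
  axioms have premises and conclusions with nearly identical interpretations.

  To verify the realizers, provability in the internal theory is treated as forcing over finite
  sets of hypotheses, where all free variables are drawn from one fixed supply that contains every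
  type infinitely often: \<open>\<longrightarrow>\<close> then quantifies over larger worlds, \<open>\<forall>\<close> over all terms, and \<open>\<exists>\<close> is
  characterised by an elimination rule. This replaces derivations by semantic arguments about the
  matrix. The supply can be chosen to start with the free variables of the conclusion, and closed
  terms are substituted for the others in the end.\<close>

section \<open>Substitution\<close>

lemma tsubst_Var [simp]: "tsubst Var t = t"
  by (induction t) auto

lemma tsubst_tsubst: "tsubst \<theta> (tsubst \<eta> t) = tsubst (\<lambda>i. tsubst \<theta> (\<eta> i)) t"
  by (induction t) auto

lemma tlift_simps [simp]:
  "tlift n (Var i) = Var (i + n)" "tlift n (Cst c) = Cst c"
    "tlift n (f \<^bold>\<cdot> t) = tlift n f \<^bold>\<cdot> tlift n t"
  by (simp_all add: tlift_def)

lemma tlift_0 [simp]: "tlift 0 t = t"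
  by (simp add: tlift_def)

lemma tlift_tlift [simp]: "tlift m (tlift n t) = tlift (n + m) t"
  by (simp add: tlift_def tsubst_tsubst add.assoc)

lemma tsubst_tlift: "tsubst \<theta> (tlift n t) = tsubst (\<lambda>i. \<theta> (i + n)) t"
  by (simp add: tlift_def tsubst_tsubst)

lemma tlift_tsubst: "tlift n (tsubst \<theta> t) = tsubst (\<lambda>i. tlift n (\<theta> i)) t"
  by (simp add: tlift_def tsubst_tsubst)

lemma tsubst_case_nat_tlift [simp]: "tsubst (case_nat t \<theta>) (tlift (Suc n) u) = tsubst \<theta> (tlift n u)"
  by (simp add: tsubst_tlift)

lemma up_0 [simp]: "up \<theta> 0 = Var 0"
  by (simp add: up_def)

lemma up_Suc [simp]: "up \<theta> (Suc i) = tlift 1 (\<theta> i)"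
  by (simp add: up_def)

lemma up_Var [simp]: "up Var = Var"
  by (rule ext) (simp add: up_def split: nat.split)

lemma tsubst_up_tlift:
  "tsubst (up \<theta>) (tlift (Suc n) t) = tlift (Suc 0) (tsubst \<theta> (tlift n t))"
  by (simp add: tsubst_tlift tlift_tsubst)

lemma tsubst_up_up: "tsubst (up \<theta>) (up \<eta> i) = up (\<lambda>i. tsubst \<theta> (\<eta> i)) i"
  by (cases i) (simp_all add: tsubst_tlift tlift_tsubst)

lemma tsubst_case_nat_up: "tsubst (case_nat t \<theta>) (up \<eta> i) = case_nat t (\<lambda>i. tsubst \<theta> (\<eta> i)) i"
  by (cases i) (simp_all add: tsubst_tlift)

lemma tsubst_case_nat: "tsubst \<theta> (case_nat t \<eta> i) = case_nat (tsubst \<theta> t) (\<lambda>i. tsubst \<theta> (\<eta> i)) i"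
  by (cases i) simp_all

lemma funpow_up: "(up ^^ n) \<theta> i = (if i < n then Var i else tlift n (\<theta> (i - n)))"
proof (induction n arbitrary: i)
  case (Suc n)
  then show ?case by (cases i) auto
qed simp

lemma tsubst_funpow_up_tlift: "tsubst ((up ^^ n) \<theta>) (tlift n t) = tlift n (tsubst \<theta> t)"
  by (simp add: tsubst_tlift funpow_up tlift_tsubst)

lemma fsubst_Var [simp]: "fsubst Var \<phi> = \<phi>"
  by (induction \<phi>) auto

lemma fsubst_fsubst: "fsubst \<theta> (fsubst \<eta> \<phi>) = fsubst (\<lambda>i. tsubst \<theta> (\<eta> i)) \<phi>"
  by (induction \<phi> arbitrary: \<theta> \<eta>) (simp_all add: tsubst_tsubst tsubst_up_up)

lemma finst_fsubst_up [simp]: "finst t (fsubst (up \<theta>) \<phi>) = fsubst (case_nat t \<theta>) \<phi>"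
  by (simp add: finst_def fsubst_fsubst tsubst_case_nat_up cong: nat.case_cong)

lemma fsubst_finst: "fsubst \<theta> (finst t \<phi>) = fsubst (case_nat (tsubst \<theta> t) \<theta>) \<phi>"
  by (simp add: finst_def fsubst_fsubst tsubst_case_nat cong: nat.case_cong)

lemma fsubst_flift: "fsubst \<theta> (flift \<phi>) = fsubst (\<lambda>i. \<theta> (Suc i)) \<phi>"
  by (simp add: flift_def fsubst_fsubst)

lemma fsubst_up_flift: "fsubst (up \<theta>) (flift \<phi>) = flift (fsubst \<theta> \<phi>)"
  by (simp add: fsubst_flift) (simp add: flift_def fsubst_fsubst tlift_def)

lemma finst_flift [simp]: "finst t (flift \<phi>) = \<phi>"
  by (simp add: finst_def fsubst_flift)

lemma fsubst_up_fsucc: "fsubst (up \<theta>) (fsucc \<phi>) = fsucc (fsubst (up \<theta>) \<phi>)"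
proof -
  have "tsubst (up \<theta>) (case_nat (suc (Var 0)) (\<lambda>i. Var (Suc i)) i) =
      tsubst (case_nat (suc (Var 0)) (\<lambda>i. Var (Suc i))) (up \<theta> i)" for i
    by (cases i) (simp_all add: tsubst_tlift, simp add: tlift_def)
  then show ?thesis by (simp add: fsucc_def fsubst_fsubst)
qed

lemma finst_fsucc: "finst t (fsucc \<phi>) = finst (suc t) \<phi>"
  by (simp add: finst_def fsucc_def fsubst_fsubst tsubst_case_nat cong: nat.case_cong)

lemma fsucc_flift: "fsucc (flift \<phi>) = flift \<phi>"
  by (simp add: fsucc_def fsubst_flift) (simp add: flift_def)

lemma finst_simps [simp]:
  "finst t Bot = Bot"
  "finst t (Eq \<sigma> u v) = Eq \<sigma> (tsubst (case_nat t Var) u) (tsubst (case_nat t Var) v)"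
  "finst t (And \<phi> \<psi>) = And (finst t \<phi>) (finst t \<psi>)"
  "finst t (Imp \<phi> \<psi>) = Imp (finst t \<phi>) (finst t \<psi>)"
  "finst t (All \<sigma> \<phi>) = All \<sigma> (fsubst (up (case_nat t Var)) \<phi>)"
  "finst t (Ex \<sigma> \<phi>) = Ex \<sigma> (fsubst (up (case_nat t Var)) \<phi>)"
  by (simp_all add: finst_def)

lemma internal_fsubst [simp]: "internal (fsubst \<theta> \<phi>) = internal \<phi>"
  by (induction \<phi> arbitrary: \<theta>) auto

lemma or_free_fsubst [simp]: "or_free (fsubst \<theta> \<phi>) = or_free \<phi>"
  by (induction \<phi> arbitrary: \<theta>) auto

lemma internal_finst [simp]: "internal (finst t \<phi>) = internal \<phi>"
  and or_free_finst [simp]: "or_free (finst t \<phi>) = or_free \<phi>"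
  by (simp_all add: finst_def)

lemma internal_flift [simp]: "internal (flift \<phi>) = internal \<phi>"
  and or_free_flift [simp]: "or_free (flift \<phi>) = or_free \<phi>"
  by (simp_all add: flift_def)

lemma internal_fsucc [simp]: "internal (fsucc \<phi>) = internal \<phi>"
  and or_free_fsucc [simp]: "or_free (fsucc \<phi>) = or_free \<phi>"
  by (simp_all add: fsucc_def)

lemma apps_simps [simp]: "apps t [] = t" "apps t (u # us) = apps (t \<^bold>\<cdot> u) us"
  by (simp_all add: apps_def)

lemma apps_append: "apps t (us @ vs) = apps (apps t us) vs"
  by (simp add: apps_def)

lemma tsubst_apps: "tsubst \<theta> (apps t ts) = apps (tsubst \<theta> t) (map (tsubst \<theta>) ts)"
  by (induction ts arbitrary: t) simp_all

lemma arrs_simps [simp]: "arrs [] \<tau> = \<tau>" "arrs (\<sigma> # \<sigma>s) \<tau> = \<sigma> \<^bold>\<rightarrow> arrs \<sigma>s \<tau>"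
  by (simp_all add: arrs_def)

lemma arrs_singleton [simp]: "arrs [\<sigma>] = Fn \<sigma>"
  by (simp add: fun_eq_iff)

lemma arrs_append [simp]: "arrs (\<sigma>s @ \<tau>s) \<rho> = arrs \<sigma>s (arrs \<tau>s \<rho>)"
  by (simp add: arrs_def)

section \<open>Typing\<close>

lemma cst_ty_iff [simp]:
  "cst_ty Zero \<rho> \<longleftrightarrow> \<rho> = N"
  "cst_ty Succ \<rho> \<longleftrightarrow> \<rho> = (N \<^bold>\<rightarrow> N)"
  "cst_ty (CombK \<sigma> \<tau>) \<rho> \<longleftrightarrow> \<rho> = (\<sigma> \<^bold>\<rightarrow> \<tau> \<^bold>\<rightarrow> \<sigma>)"
  "cst_ty (CombS \<sigma> \<tau> \<upsilon>) \<rho> \<longleftrightarrow> \<rho> = ((\<sigma> \<^bold>\<rightarrow> \<tau> \<^bold>\<rightarrow> \<upsilon>) \<^bold>\<rightarrow> (\<sigma> \<^bold>\<rightarrow> \<tau>) \<^bold>\<rightarrow> \<sigma> \<^bold>\<rightarrow> \<upsilon>)"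
  "cst_ty (Rec \<sigma>s i) \<rho> \<longleftrightarrow>
    i < length \<sigma>s \<and> \<rho> = arrs (\<sigma>s @ map (\<lambda>\<tau>. N \<^bold>\<rightarrow> arrs \<sigma>s \<tau>) \<sigma>s) (N \<^bold>\<rightarrow> \<sigma>s ! i)"
  "cst_ty (Empty \<sigma>) \<rho> \<longleftrightarrow> \<rho> = Seq \<sigma>"
  "cst_ty (Prep \<sigma>) \<rho> \<longleftrightarrow> \<rho> = (\<sigma> \<^bold>\<rightarrow> Seq \<sigma> \<^bold>\<rightarrow> Seq \<sigma>)"
  "cst_ty (LRec \<sigma> \<tau>) \<rho> \<longleftrightarrow> \<rho> = (\<tau> \<^bold>\<rightarrow> (\<sigma> \<^bold>\<rightarrow> Seq \<sigma> \<^bold>\<rightarrow> \<tau> \<^bold>\<rightarrow> \<tau>) \<^bold>\<rightarrow> Seq \<sigma> \<^bold>\<rightarrow> \<tau>)"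
  by (subst cst_ty.simps; auto)+

lemma has_ty_iff [simp]:
  "has_ty \<Gamma> (Var i) \<tau> \<longleftrightarrow> i < length \<Gamma> \<and> \<tau> = \<Gamma> ! i"
  "has_ty \<Gamma> (Cst c) \<tau> \<longleftrightarrow> cst_ty c \<tau>"
  "has_ty \<Gamma> (f \<^bold>\<cdot> t) \<tau> \<longleftrightarrow> (\<exists>\<sigma>. has_ty \<Gamma> f (\<sigma> \<^bold>\<rightarrow> \<tau>) \<and> has_ty \<Gamma> t \<sigma>)"
  by (subst has_ty.simps; auto)+

lemma has_ty_apps:
  "has_ty \<Gamma> f (arrs \<sigma>s \<tau>) \<Longrightarrow> list_all2 (has_ty \<Gamma>) ts \<sigma>s \<Longrightarrow> has_ty \<Gamma> (apps f ts) \<tau>"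
proof (induction ts arbitrary: f \<sigma>s)
  case (Cons t ts)
  then obtain \<rho> \<rho>s where "\<sigma>s = \<rho> # \<rho>s" "has_ty \<Gamma> t \<rho>" "list_all2 (has_ty \<Gamma>) ts \<rho>s"
    by (auto simp: list_all2_Cons1)
  then show ?case using Cons.IH[of "f \<^bold>\<cdot> t" \<rho>s] Cons.prems(1) by auto
qed simp

definition subst_ty :: "ty list \<Rightarrow> (nat \<Rightarrow> tm) \<Rightarrow> ty list \<Rightarrow> bool" where
  "subst_ty \<Gamma>' \<theta> \<Gamma> \<longleftrightarrow> (\<forall>i<length \<Gamma>. has_ty \<Gamma>' (\<theta> i) (\<Gamma> ! i))"

lemma has_ty_tsubst: "has_ty \<Gamma> t \<tau> \<Longrightarrow> subst_ty \<Gamma>' \<theta> \<Gamma> \<Longrightarrow> has_ty \<Gamma>' (tsubst \<theta> t) \<tau>"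
  by (induction t arbitrary: \<tau>) (auto simp: subst_ty_def)

lemma has_ty_append: "has_ty \<Gamma> t \<tau> \<Longrightarrow> has_ty (\<Gamma> @ \<Gamma>') t \<tau>"
  by (induction t arbitrary: \<tau>) (auto simp: nth_append)

lemma has_ty_tlift: "has_ty \<Gamma> t \<tau> \<Longrightarrow> length \<Gamma>' = n \<Longrightarrow> has_ty (\<Gamma>' @ \<Gamma>) (tlift n t) \<tau>"
  by (induction t arbitrary: \<tau>) (auto simp: nth_append)

lemma tsubst_cong: "has_ty \<Gamma> t \<tau> \<Longrightarrow> \<forall>i<length \<Gamma>. \<theta> i = \<theta>' i \<Longrightarrow> tsubst \<theta> t = tsubst \<theta>' t"
  by (induction t arbitrary: \<tau>) auto

lemma has_ty_closed: "has_ty [] t \<tau> \<Longrightarrow> has_ty \<Gamma> t \<tau>"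
  using has_ty_append[of "[]"] by simp

lemma tsubst_closed: "has_ty [] t \<tau> \<Longrightarrow> tsubst \<theta> t = t"
  using tsubst_cong[of "[]" t \<tau> \<theta> Var] by simp

lemma has_ty_null: "has_ty [] (null_tm \<sigma>) \<sigma>"
  by (induction \<sigma>) auto

lemma subst_ty_Var: "subst_ty (\<Gamma> @ \<Gamma>') Var \<Gamma>"
  by (simp add: subst_ty_def nth_append)

lemma subst_ty_case_nat: "has_ty \<Gamma>' t \<sigma> \<Longrightarrow> subst_ty \<Gamma>' \<theta> \<Gamma> \<Longrightarrow> subst_ty \<Gamma>' (case_nat t \<theta>) (\<sigma> # \<Gamma>)"
  by (auto simp: subst_ty_def less_Suc_eq_0_disj)

lemma subst_ty_up: "subst_ty \<Gamma>' \<theta> \<Gamma> \<Longrightarrow> subst_ty (\<sigma> # \<Gamma>') (up \<theta>) (\<sigma> # \<Gamma>)"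
  by (auto simp: subst_ty_def less_Suc_eq_0_disj intro!: has_ty_tlift[of _ _ _ "[_]", simplified])

lemma wff_fsubst: "wff \<Gamma> \<phi> \<Longrightarrow> subst_ty \<Gamma>' \<theta> \<Gamma> \<Longrightarrow> wff \<Gamma>' (fsubst \<theta> \<phi>)"
  by (induction \<phi> arbitrary: \<Gamma> \<Gamma>' \<theta>) (auto intro: has_ty_tsubst subst_ty_up)

lemma wff_append: "wff \<Gamma> \<phi> \<Longrightarrow> wff (\<Gamma> @ \<Gamma>') \<phi>"
  using wff_fsubst[OF _ subst_ty_Var[of \<Gamma> \<Gamma>'], of \<phi>] by simp

lemma wff_finst: "wff (\<sigma> # \<Gamma>) \<phi> \<Longrightarrow> has_ty \<Gamma> t \<sigma> \<Longrightarrow> wff \<Gamma> (finst t \<phi>)"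
  unfolding finst_def
  by (erule wff_fsubst) (use subst_ty_Var[of \<Gamma> "[]"] in \<open>simp add: subst_ty_case_nat\<close>)

lemma wff_flift: "wff \<Gamma> \<phi> \<Longrightarrow> wff (\<sigma> # \<Gamma>) (flift \<phi>)"
  unfolding flift_def by (erule wff_fsubst) (simp add: subst_ty_def)

lemma wff_fliftD: "wff (\<sigma> # \<Gamma>) (flift \<phi>) \<Longrightarrow> wff \<Gamma> \<phi>"
  using wff_finst[of \<sigma> \<Gamma> "flift \<phi>" "null_tm \<sigma>"] has_ty_closed[OF has_ty_null] by simp

lemma wff_fsucc: "wff (N # \<Gamma>) \<phi> \<Longrightarrow> wff (N # \<Gamma>) (fsucc \<phi>)"
  unfolding fsucc_def by (erule wff_fsubst) (auto simp: subst_ty_def less_Suc_eq_0_disj)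

lemma up_cong: "\<forall>i<length \<Gamma>. \<theta> i = \<theta>' i \<Longrightarrow> \<forall>i<length (\<sigma> # \<Gamma>). up \<theta> i = up \<theta>' i"
  by (auto simp: less_Suc_eq_0_disj)

lemma fsubst_cong: "wff \<Gamma> \<phi> \<Longrightarrow> \<forall>i<length \<Gamma>. \<theta> i = \<theta>' i \<Longrightarrow> fsubst \<theta> \<phi> = fsubst \<theta>' \<phi>"
proof (induction \<phi> arbitrary: \<Gamma> \<theta> \<theta>')
  case (Eq \<sigma> t u)
  show ?case using Eq.prems(1) by (simp add: tsubst_cong[OF _ Eq.prems(2), of _ \<sigma>])
next
  case (St \<sigma> t)
  show ?case using St.prems(1) by (simp add: tsubst_cong[OF _ St.prems(2), of _ \<sigma>])
next
  case (And \<phi> \<psi>)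
  then show ?case by simp blast
next
  case (Or \<phi> \<psi>)
  then show ?case by simp blast
next
  case (Imp \<phi> \<psi>)
  then show ?case by simp blast
next
  case (All \<sigma> \<phi>)
  show ?case using All.IH[OF _ up_cong[OF All.prems(2)], of \<sigma>] All.prems(1) by simp
next
  case (Ex \<sigma> \<phi>)
  show ?case using Ex.IH[OF _ up_cong[OF Ex.prems(2)], of \<sigma>] Ex.prems(1) by simp
next
  case (AllSt \<sigma> \<phi>)
  show ?case using AllSt.IH[OF _ up_cong[OF AllSt.prems(2)], of \<sigma>] AllSt.prems(1) by simp
next
  case (ExSt \<sigma> \<phi>)
  show ?case using ExSt.IH[OF _ up_cong[OF ExSt.prems(2)], of \<sigma>] ExSt.prems(1) by simp
qed simp

lemma fsubst_sentence: "sentence \<phi> \<Longrightarrow> fsubst \<theta> \<phi> = \<phi>"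
  using fsubst_cong[of "[]" \<phi> \<theta> Var] by simp

section \<open>Derivations\<close>

lemma EHA_or_ax_fsubst: "\<phi> \<in> EHA_or_ax \<Longrightarrow> fsubst \<theta> \<phi> \<in> EHA_or_ax"
proof (induction rule: EHA_or_ax.induct)
  case (extensionality \<sigma> \<tau> f g)
  then show ?case
    using EHA_or_ax.extensionality[of \<sigma> \<tau> "tsubst \<theta> f" "tsubst \<theta> g"]
    by (simp add: tsubst_tlift tlift_tsubst)
next
  case (rec_zero ts \<sigma>s us i)
  then show ?case
    using EHA_or_ax.rec_zero[of "map (tsubst \<theta>) ts" \<sigma>s "map (tsubst \<theta>) us" i]
    by (simp add: tsubst_apps)
next
  case (rec_suc ts \<sigma>s us i v)
  then show ?case
    using EHA_or_ax.rec_suc[of "map (tsubst \<theta>) ts" \<sigma>s "map (tsubst \<theta>) us" i "tsubst \<theta> v"]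
    by (simp add: tsubst_apps o_def)
next
  case (seq_cases \<sigma> s)
  have "up (up (up \<theta>)) (i + 3) = tlift 3 (\<theta> i)" for i
    using tlift_tlift[of 1 2 "\<theta> i"] by (simp add: numeral_3_eq_3 numeral_2_eq_2)
  then show ?case
    using EHA_or_ax.seq_cases[of \<sigma> "tsubst \<theta> s"] by (simp add: tsubst_tlift tlift_tsubst)
next
  case (induction \<phi>)
  then show ?case
    using EHA_or_ax.induction[of "fsubst (up \<theta>) \<phi>"] by (simp add: fsubst_finst fsubst_up_fsucc)
qed (auto intro: EHA_or_ax.intros)

lemma EHA_or_ax_internal: "\<phi> \<in> EHA_or_ax \<Longrightarrow> internal \<phi> \<and> or_free \<phi>"
  by (induction rule: EHA_or_ax.induct) auto

lemma prv_weaken: "prv L Ax \<Gamma> H \<phi> \<Longrightarrow> set H \<subseteq> set H' \<Longrightarrow> prv L Ax \<Gamma> H' \<phi>"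
proof (induction arbitrary: H' rule: prv.induct)
  case (orE \<Gamma> H \<phi> \<psi> \<chi>)
  show ?case by (rule prv.orE[OF orE.IH(1,2,3)]) (use orE.prems in auto)
next
  case (impI \<phi> \<Gamma> H \<psi>)
  show ?case by (rule prv.impI) (use impI in \<open>auto intro!: impI.IH\<close>)
next
  case (allI \<sigma> \<Gamma> H \<phi>)
  show ?case by (rule prv.allI[OF allI.IH]) (use allI.prems in auto)
next
  case (exE \<Gamma> H \<sigma> \<phi> \<chi>)
  show ?case by (rule prv.exE[OF exE.IH(1,2)]) (use exE.prems in auto)
qed (auto intro: prv.intros)

lemma prv_wff: "prv L Ax \<Gamma> H \<phi> \<Longrightarrow> \<forall>h\<in>set H. wff \<Gamma> h \<Longrightarrow> wff \<Gamma> \<phi>"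
proof (induction rule: prv.induct)
  case (allE \<Gamma> H \<sigma> \<phi> t)
  then show ?case by (auto intro: wff_finst)
next
  case (exE \<Gamma> H \<sigma> \<phi> \<chi>)
  then have "wff (\<sigma> # \<Gamma>) (flift \<chi>)" by (auto intro: wff_flift)
  then show ?case by (rule wff_fliftD)
qed (auto intro: wff_flift)

lemma prv_internal:
  "prv {\<psi>. internal \<psi>} Ax \<Gamma> H \<phi> \<Longrightarrow> \<forall>h\<in>set H. internal h \<Longrightarrow> internal \<phi>"
  by (induction rule: prv.induct) auto

lemma prv_fsubst:
  assumes "prv L Ax \<Gamma> H \<phi>" and "subst_ty \<Gamma>' \<theta> \<Gamma>"
    and L: "\<And>\<phi> \<theta>. \<phi> \<in> L \<Longrightarrow> fsubst \<theta> \<phi> \<in> L" and Ax: "\<And>\<phi> \<theta>. \<phi> \<in> Ax \<Longrightarrow> fsubst \<theta> \<phi> \<in> Ax"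
  shows "prv L Ax \<Gamma>' (map (fsubst \<theta>) H) (fsubst \<theta> \<phi>)"
  using assms(1,2)
proof (induction arbitrary: \<Gamma>' \<theta> rule: prv.induct)
  case (ax \<phi> \<Gamma> H)
  then show ?case by (auto intro!: prv.ax L Ax wff_fsubst)
next
  case (hyp \<phi> H \<Gamma>)
  then show ?case by (auto intro!: prv.hyp)
next
  case (botE \<Gamma> H \<phi>)
  then show ?case by (auto intro: prv.botE L wff_fsubst)
next
  case (orI1 \<Gamma> H \<phi> \<psi>)
  then show ?case by (auto intro!: prv.orI1 L wff_fsubst)
next
  case (orI2 \<Gamma> H \<phi> \<psi>)
  then show ?case by (auto intro!: prv.orI2 L wff_fsubst)
next
  case (orE \<Gamma> H \<phi> \<psi> \<chi>)
  then show ?case using prv.orE[of L Ax \<Gamma>' "map (fsubst \<theta>) H" "fsubst \<theta> \<phi>" "fsubst \<theta> \<psi>"] by simp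
next
  case (impI \<phi> \<Gamma> H \<psi>)
  then show ?case by (auto intro!: prv.impI L wff_fsubst)
next
  case (impE \<Gamma> H \<phi> \<psi>)
  then show ?case using prv.impE[of L Ax \<Gamma>' "map (fsubst \<theta>) H" "fsubst \<theta> \<phi>"] by simp
next
  case (allI \<sigma> \<Gamma> H \<phi>)
  then show ?case using subst_ty_up[OF allI.prems, of \<sigma>]
    by (auto simp: fsubst_up_flift o_def intro!: prv.allI dest!: allI.IH)
next
  case (allE \<Gamma> H \<sigma> \<phi> t)
  have "prv L Ax \<Gamma>' (map (fsubst \<theta>) H) (finst (tsubst \<theta> t) (fsubst (up \<theta>) \<phi>))"
    by (rule prv.allE) (use allE in \<open>auto intro!: has_ty_tsubst\<close>)
  then show ?case by (simp add: fsubst_finst)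
next
  case (exI \<sigma> \<phi> \<Gamma> t H)
  have "Ex \<sigma> (fsubst (up \<theta>) \<phi>) \<in> L" using L[OF exI.hyps(1), of \<theta>] by simp
  then show ?case
    using exI wff_fsubst[OF exI.hyps(2) exI.prems] has_ty_tsubst[OF exI.hyps(3) exI.prems]
    by (auto simp: fsubst_finst intro: prv.exI[of _ _ L])
next
  case (exE \<Gamma> H \<sigma> \<phi> \<chi>)
  have "prv L Ax (\<sigma> # \<Gamma>') (fsubst (up \<theta>) \<phi> # map flift (map (fsubst \<theta>) H)) (flift (fsubst \<theta> \<chi>))"
    using exE.IH(2)[OF subst_ty_up[OF exE.prems]] by (simp add: fsubst_up_flift o_def)
  moreover have "prv L Ax \<Gamma>' (map (fsubst \<theta>) H) (Ex \<sigma> (fsubst (up \<theta>) \<phi>))"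
    using exE.IH(1)[OF exE.prems] by simp
  ultimately show ?case by (rule prv.exE[rotated])
qed (auto intro: prv.intros)

section \<open>Typing over an infinite supply of variables\<close>

locale variable_supply =
  fixes \<nu> :: "nat \<Rightarrow> ty"
  assumes infinite_supply: "infinite {i. \<nu> i = \<sigma>}"
begin

definition ctx :: "nat \<Rightarrow> ty list" where
  "ctx n = map \<nu> [0..<n]"

definition typed :: "ty list \<Rightarrow> tm \<Rightarrow> ty \<Rightarrow> bool" where
  "typed \<Gamma> t \<sigma> \<longleftrightarrow> (\<exists>n. has_ty (\<Gamma> @ ctx n) t \<sigma>)"

definition well_formed :: "ty list \<Rightarrow> fm \<Rightarrow> bool" where
  "well_formed \<Gamma> \<phi> \<longleftrightarrow> (\<exists>n. wff (\<Gamma> @ ctx n) \<phi>)"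

definition typed_subst :: "ty list \<Rightarrow> (nat \<Rightarrow> tm) \<Rightarrow> ty list \<Rightarrow> bool" where
  "typed_subst \<Gamma>' \<theta> \<Gamma> \<longleftrightarrow> (\<forall>i<length \<Gamma>. typed \<Gamma>' (\<theta> i) (\<Gamma> ! i))"

abbreviation of_type :: "tm \<Rightarrow> ty \<Rightarrow> bool" (infix "\<^bold>:" 50) where
  "t \<^bold>: \<sigma> \<equiv> typed [] t \<sigma>"

abbreviation of_types :: "tm list \<Rightarrow> ty list \<Rightarrow> bool" (infix "\<^bold>:\<^bold>:" 50) where
  "ts \<^bold>:\<^bold>: \<sigma>s \<equiv> list_all2 (\<^bold>:) ts \<sigma>s"

lemma fresh_variable: "\<exists>v\<ge>k. \<nu> v = \<sigma>"
  using infinite_supply[of \<sigma>] by (auto simp: finite_nat_set_iff_bounded) (metis linorder_not_less)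

lemma length_ctx [simp]: "length (ctx n) = n"
  by (simp add: ctx_def)

lemma nth_ctx [simp]: "i < n \<Longrightarrow> ctx n ! i = \<nu> i"
  by (simp add: ctx_def)

lemma ctx_prefix: "m \<le> n \<Longrightarrow> \<exists>\<Gamma>. ctx n = ctx m @ \<Gamma>"
  using upt_add_eq_append[of 0 m "n - m"] by (auto simp: ctx_def)

lemma has_ty_ctx_mono: "has_ty (\<Gamma> @ ctx m) t \<sigma> \<Longrightarrow> m \<le> n \<Longrightarrow> has_ty (\<Gamma> @ ctx n) t \<sigma>"
  by (metis append_assoc ctx_prefix has_ty_append)

lemma wff_ctx_mono: "wff (\<Gamma> @ ctx m) \<phi> \<Longrightarrow> m \<le> n \<Longrightarrow> wff (\<Gamma> @ ctx n) \<phi>"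
  by (metis append_assoc ctx_prefix wff_append)

lemma typed_Var [simp]:
  "typed \<Gamma> (Var i) \<sigma> \<longleftrightarrow> \<sigma> = (if i < length \<Gamma> then \<Gamma> ! i else \<nu> (i - length \<Gamma>))"
proof
  show "typed \<Gamma> (Var i) \<sigma> \<Longrightarrow> \<sigma> = (if i < length \<Gamma> then \<Gamma> ! i else \<nu> (i - length \<Gamma>))"
    by (auto simp: typed_def nth_append)
  assume "\<sigma> = (if i < length \<Gamma> then \<Gamma> ! i else \<nu> (i - length \<Gamma>))"
  then have "has_ty (\<Gamma> @ ctx (Suc i)) (Var i) \<sigma>" by (simp add: nth_append)
  then show "typed \<Gamma> (Var i) \<sigma>" unfolding typed_def by blast
qed

lemma typed_Cst [simp]: "typed \<Gamma> (Cst c) \<sigma> \<longleftrightarrow> cst_ty c \<sigma>"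
  by (simp add: typed_def)

lemma typed_App [simp]: "typed \<Gamma> (f \<^bold>\<cdot> t) \<tau> \<longleftrightarrow> (\<exists>\<sigma>. typed \<Gamma> f (\<sigma> \<^bold>\<rightarrow> \<tau>) \<and> typed \<Gamma> t \<sigma>)"
proof
  show "typed \<Gamma> (f \<^bold>\<cdot> t) \<tau> \<Longrightarrow> \<exists>\<sigma>. typed \<Gamma> f (\<sigma> \<^bold>\<rightarrow> \<tau>) \<and> typed \<Gamma> t \<sigma>"
    unfolding typed_def by auto
  assume "\<exists>\<sigma>. typed \<Gamma> f (\<sigma> \<^bold>\<rightarrow> \<tau>) \<and> typed \<Gamma> t \<sigma>"
  then obtain \<sigma> m n where "has_ty (\<Gamma> @ ctx m) f (\<sigma> \<^bold>\<rightarrow> \<tau>)" "has_ty (\<Gamma> @ ctx n) t \<sigma>"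
    unfolding typed_def by blast
  then have "has_ty (\<Gamma> @ ctx (max m n)) f (\<sigma> \<^bold>\<rightarrow> \<tau>)" "has_ty (\<Gamma> @ ctx (max m n)) t \<sigma>"
    by (auto elim: has_ty_ctx_mono)
  then have "has_ty (\<Gamma> @ ctx (max m n)) (f \<^bold>\<cdot> t) \<tau>" by auto
  then show "typed \<Gamma> (f \<^bold>\<cdot> t) \<tau>" unfolding typed_def by blast
qed

lemma has_ty_imp_typed: "has_ty \<Gamma> t \<sigma> \<Longrightarrow> typed \<Gamma> t \<sigma>"
  unfolding typed_def using has_ty_append by blast

lemma closed_imp_typed: "has_ty [] t \<sigma> \<Longrightarrow> typed \<Gamma> t \<sigma>"
  by (rule has_ty_imp_typed) (rule has_ty_closed)

lemma well_formed_ctx_common: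
  assumes "well_formed \<Gamma> \<phi>" "well_formed \<Gamma> \<psi>"
  obtains n where "wff (\<Gamma> @ ctx n) \<phi>" "wff (\<Gamma> @ ctx n) \<psi>"
proof -
  obtain m n where "wff (\<Gamma> @ ctx m) \<phi>" "wff (\<Gamma> @ ctx n) \<psi>"
    using assms unfolding well_formed_def by blast
  then show thesis
    using wff_ctx_mono[of \<Gamma> m \<phi> "max m n"] wff_ctx_mono[of \<Gamma> n \<psi> "max m n"] that by simp
qed

lemma well_formed_simps [simp]:
  "well_formed \<Gamma> Bot"
  "well_formed \<Gamma> (Eq \<sigma> t u) \<longleftrightarrow> typed \<Gamma> t \<sigma> \<and> typed \<Gamma> u \<sigma>"
  "well_formed \<Gamma> (And \<phi> \<psi>) \<longleftrightarrow> well_formed \<Gamma> \<phi> \<and> well_formed \<Gamma> \<psi>"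
  "well_formed \<Gamma> (Imp \<phi> \<psi>) \<longleftrightarrow> well_formed \<Gamma> \<phi> \<and> well_formed \<Gamma> \<psi>"
  "well_formed \<Gamma> (All \<sigma> \<phi>) \<longleftrightarrow> well_formed (\<sigma> # \<Gamma>) \<phi>"
  "well_formed \<Gamma> (Ex \<sigma> \<phi>) \<longleftrightarrow> well_formed (\<sigma> # \<Gamma>) \<phi>"
proof -
  show "well_formed \<Gamma> (Eq \<sigma> t u) \<longleftrightarrow> typed \<Gamma> t \<sigma> \<and> typed \<Gamma> u \<sigma>"
  proof
    assume "typed \<Gamma> t \<sigma> \<and> typed \<Gamma> u \<sigma>"
    then obtain m n where "has_ty (\<Gamma> @ ctx m) t \<sigma>" "has_ty (\<Gamma> @ ctx n) u \<sigma>"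
      unfolding typed_def by blast
    then have "wff (\<Gamma> @ ctx (max m n)) (Eq \<sigma> t u)" by (auto elim: has_ty_ctx_mono)
    then show "well_formed \<Gamma> (Eq \<sigma> t u)" unfolding well_formed_def by blast
  qed (auto simp: typed_def well_formed_def)
  show "well_formed \<Gamma> (And \<phi> \<psi>) \<longleftrightarrow> well_formed \<Gamma> \<phi> \<and> well_formed \<Gamma> \<psi>"
    "well_formed \<Gamma> (Imp \<phi> \<psi>) \<longleftrightarrow> well_formed \<Gamma> \<phi> \<and> well_formed \<Gamma> \<psi>"
    using well_formed_ctx_common[of \<Gamma> \<phi> \<psi>] by (auto simp: well_formed_def)
qed (simp_all add: well_formed_def)

lemma typed_subst_ctx:
  assumes "typed_subst \<Gamma>' \<theta> \<Gamma>"
  obtains n where "subst_ty (\<Gamma>' @ ctx n) \<theta> \<Gamma>"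
proof -
  obtain N where N: "\<And>i. i < length \<Gamma> \<Longrightarrow> has_ty (\<Gamma>' @ ctx (N i)) (\<theta> i) (\<Gamma> ! i)"
    using assms unfolding typed_subst_def typed_def by metis
  have "N i \<le> (\<Sum>i<length \<Gamma>. N i)" if "i < length \<Gamma>" for i
    using that by (intro member_le_sum) auto
  then have "subst_ty (\<Gamma>' @ ctx (\<Sum>i<length \<Gamma>. N i)) \<theta> \<Gamma>"
    unfolding subst_ty_def using has_ty_ctx_mono[OF N] by blast
  then show thesis by (rule that)
qed

lemma typed_tsubst: "has_ty \<Gamma> t \<tau> \<Longrightarrow> typed_subst \<Gamma>' \<theta> \<Gamma> \<Longrightarrow> typed \<Gamma>' (tsubst \<theta> t) \<tau>"
  unfolding typed_def by (metis typed_subst_ctx has_ty_tsubst)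

lemma well_formed_fsubst: "wff \<Gamma> \<phi> \<Longrightarrow> typed_subst \<Gamma>' \<theta> \<Gamma> \<Longrightarrow> well_formed \<Gamma>' (fsubst \<theta> \<phi>)"
  unfolding well_formed_def by (metis typed_subst_ctx wff_fsubst)

lemma typed_subst_Var: "typed_subst [] Var (ctx n)"
  by (simp add: typed_subst_def)

lemma typed_subst_case_nat:
  "typed \<Gamma>' t \<sigma> \<Longrightarrow> typed_subst \<Gamma>' \<theta> \<Gamma> \<Longrightarrow> typed_subst \<Gamma>' (case_nat t \<theta>) (\<sigma> # \<Gamma>)"
  by (auto simp: typed_subst_def less_Suc_eq_0_disj)

lemma typed_tlift: "typed \<Gamma> t \<sigma> \<Longrightarrow> length \<Gamma>' = n \<Longrightarrow> typed (\<Gamma>' @ \<Gamma>) (tlift n t) \<sigma>"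
  unfolding typed_def using has_ty_tlift[of "\<Gamma> @ ctx _" t \<sigma> \<Gamma>' n] by auto

lemma typed_tlift1 [simp]: "typed (\<tau> # \<Gamma>) (tlift (Suc 0) t) \<sigma> \<longleftrightarrow> typed \<Gamma> t \<sigma>"
  by (induction t arbitrary: \<sigma>) auto

lemma typed_subst_up: "typed_subst \<Gamma>' \<theta> \<Gamma> \<Longrightarrow> typed_subst (\<sigma> # \<Gamma>') (up \<theta>) (\<sigma> # \<Gamma>)"
  by (auto simp: typed_subst_def less_Suc_eq_0_disj)

lemma typed_subst_tlift:
  "typed_subst \<Gamma>' \<theta> \<Gamma> \<Longrightarrow> length \<Theta> = n \<Longrightarrow> typed_subst (\<Theta> @ \<Gamma>') (tlift n \<circ> \<theta>) \<Gamma>"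
  by (auto simp: typed_subst_def typed_tlift)

lemma typed_null [simp]: "typed \<Gamma> (null_tm \<sigma>) \<tau> \<longleftrightarrow> \<tau> = \<sigma>"
  by (induction \<sigma> arbitrary: \<tau>) auto

lemma typed_apps: "typed \<Gamma> f (arrs \<sigma>s \<tau>) \<Longrightarrow> list_all2 (typed \<Gamma>) ts \<sigma>s \<Longrightarrow> typed \<Gamma> (apps f ts) \<tau>"
proof (induction ts arbitrary: f \<sigma>s)
  case (Cons t ts)
  then obtain \<rho> \<rho>s where "\<sigma>s = \<rho> # \<rho>s" "typed \<Gamma> t \<rho>" "list_all2 (typed \<Gamma>) ts \<rho>s"
    by (auto simp: list_all2_Cons1)
  then show ?case using Cons.IH[of "f \<^bold>\<cdot> t" \<rho>s] Cons.prems(1) by auto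
qed simp

lemma well_formed_finst: "well_formed [\<sigma>] \<phi> \<Longrightarrow> t \<^bold>: \<sigma> \<Longrightarrow> well_formed [] (finst t \<phi>)"
  unfolding finst_def well_formed_def[of "[\<sigma>]"]
  by (auto intro!: well_formed_fsubst typed_subst_case_nat typed_subst_Var)

lemma well_formed_flift: "well_formed \<Gamma> \<phi> \<Longrightarrow> well_formed (\<sigma> # \<Gamma>) (flift \<phi>)"
  by (auto simp: well_formed_def intro: wff_flift)

end

section \<open>Provability as forcing\<close>

locale internal_theory = variable_supply +
  fixes \<Delta> :: "fm set"
  assumes Delta: "\<delta> \<in> \<Delta> \<Longrightarrow> sentence \<delta> \<and> internal \<delta> \<and> or_free \<delta>"
begin

text \<open>A world is a finite set of hypotheses; ill-formed or external members are ignored.\<close>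

definition hyps :: "fm fset \<Rightarrow> fm list" where
  "hyps W = (SOME H. set H = {h. h |\<in>| W \<and> well_formed [] h \<and> internal h})"

abbreviation derivable :: "nat \<Rightarrow> fm list \<Rightarrow> fm \<Rightarrow> bool" where
  "derivable n \<equiv> prv {\<psi>. internal \<psi>} (EHA_or_ax \<union> \<Delta>) (ctx n)"

definition forces :: "fm fset \<Rightarrow> fm \<Rightarrow> bool" (infix "\<tturnstile>" 50) where
  "W \<tturnstile> \<phi> \<longleftrightarrow> (\<exists>n. derivable n (hyps W) \<phi>)"

lemma set_hyps: "set (hyps W) = {h. h |\<in>| W \<and> well_formed [] h \<and> internal h}"
proof -
  have "finite {h. h |\<in>| W \<and> well_formed [] h \<and> internal h}"
    by (rule finite_subset[OF _ finite_fset[of W]]) auto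
  then show ?thesis unfolding hyps_def by (rule someI_ex[OF finite_list])
qed

lemma hyps_finsert:
  "well_formed [] \<phi> \<Longrightarrow> internal \<phi> \<Longrightarrow> set (hyps (finsert \<phi> W)) = set (\<phi> # hyps W)"
  by (auto simp: set_hyps)

lemma hyps_mono: "W \<le> W' \<Longrightarrow> set (hyps W) \<subseteq> set (hyps W')"
  by (auto simp: set_hyps)

lemma hyps_ctx: "\<exists>k. \<forall>h\<in>set (hyps W). wff (ctx k) h"
proof -
  have "\<forall>h\<in>set (hyps W). \<exists>k. wff (ctx k) h"
    by (auto simp: set_hyps well_formed_def)
  then obtain K where "\<forall>h\<in>set (hyps W). wff (ctx (K h)) h" by metis
  moreover have "K h \<le> sum K (set (hyps W))" if "h \<in> set (hyps W)" for h
    using that by (intro member_le_sum) auto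
  ultimately show ?thesis using wff_ctx_mono[of "[]"] by (metis append_Nil)
qed

lemma ax_fsubst: "\<phi> \<in> EHA_or_ax \<union> \<Delta> \<Longrightarrow> fsubst \<theta> \<phi> \<in> EHA_or_ax \<union> \<Delta>"
  using EHA_or_ax_fsubst Delta fsubst_sentence by auto

lemma ax_internal: "\<phi> \<in> EHA_or_ax \<union> \<Delta> \<Longrightarrow> internal \<phi> \<and> or_free \<phi>"
  using EHA_or_ax_internal Delta by auto

lemma derivable_mono: "derivable m H \<phi> \<Longrightarrow> m \<le> n \<Longrightarrow> derivable n H \<phi>"
proof -
  assume "derivable m H \<phi>" "m \<le> n"
  moreover have "subst_ty (ctx n) Var (ctx m)" if "m \<le> n"
    using that by (simp add: subst_ty_def)
  ultimately have "derivable n (map (fsubst Var) H) (fsubst Var \<phi>)"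
    using ax_fsubst by (intro prv_fsubst) auto
  then show ?thesis by (simp add: map_idI)
qed

lemma forces_common:
  assumes "W \<tturnstile> \<phi>" "W \<tturnstile> \<psi>"
  obtains n where "derivable n (hyps W) \<phi>" "derivable n (hyps W) \<psi>"
proof -
  obtain m n where "derivable m (hyps W) \<phi>" "derivable n (hyps W) \<psi>"
    using assms unfolding forces_def by blast
  then show thesis
    by (intro that[of "max m n"]; elim derivable_mono) simp_all
qed

lemma forces_well_formed: "W \<tturnstile> \<phi> \<Longrightarrow> well_formed [] \<phi>"
proof -
  assume "W \<tturnstile> \<phi>"
  then obtain n where n: "derivable n (hyps W) \<phi>" unfolding forces_def by blast
  obtain k where k: "\<forall>h\<in>set (hyps W). wff (ctx k) h" using hyps_ctx by blast
  have "wff (ctx (max n k)) \<phi>"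
  proof (rule prv_wff)
    show "derivable (max n k) (hyps W) \<phi>" using n by (rule derivable_mono) simp
    show "\<forall>h\<in>set (hyps W). wff (ctx (max n k)) h"
      using k wff_ctx_mono[of "[]" k _ "max n k"] by simp
  qed
  then show ?thesis by (auto simp: well_formed_def)
qed

lemma forces_internal: "W \<tturnstile> \<phi> \<Longrightarrow> internal \<phi>"
  unfolding forces_def by (auto simp: set_hyps dest: prv_internal)

lemma forces_mono: "W \<tturnstile> \<phi> \<Longrightarrow> W \<le> W' \<Longrightarrow> W' \<tturnstile> \<phi>"
  unfolding forces_def using prv_weaken hyps_mono by blast

lemma forces_ax:
  assumes "\<phi> \<in> EHA_or_ax \<union> \<Delta>" "well_formed [] \<phi>"
  shows "W \<tturnstile> \<phi>"
  using assms ax_internal by (auto simp: well_formed_def forces_def intro!: prv.ax)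

lemma forces_finsert: "well_formed [] \<phi> \<Longrightarrow> internal \<phi> \<Longrightarrow> finsert \<phi> W \<tturnstile> \<phi>"
  unfolding forces_def by (auto simp: hyps_finsert intro!: prv.hyp)

lemma forces_BotE:
  assumes "W \<tturnstile> Bot" "well_formed [] \<phi>" "internal \<phi>"
  shows "W \<tturnstile> \<phi>"
proof -
  obtain m n where "derivable m (hyps W) Bot" "wff (ctx n) \<phi>"
    using assms unfolding forces_def well_formed_def by auto
  then have "derivable (max m n) (hyps W) Bot" "wff (ctx (max m n)) \<phi>"
    using derivable_mono wff_ctx_mono[of "[]"] by auto
  then show ?thesis using assms(3) unfolding forces_def by (blast intro: prv.botE)
qed

lemma forces_And [simp]: "W \<tturnstile> And \<phi> \<psi> \<longleftrightarrow> W \<tturnstile> \<phi> \<and> W \<tturnstile> \<psi>"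
proof
  show "W \<tturnstile> And \<phi> \<psi> \<Longrightarrow> W \<tturnstile> \<phi> \<and> W \<tturnstile> \<psi>"
    unfolding forces_def by (blast intro: prv.andE1 prv.andE2)
  assume "W \<tturnstile> \<phi> \<and> W \<tturnstile> \<psi>"
  then obtain n where "derivable n (hyps W) \<phi>" "derivable n (hyps W) \<psi>"
    using forces_common by blast
  then show "W \<tturnstile> And \<phi> \<psi>" unfolding forces_def by (blast intro: prv.andI)
qed

lemma forces_mp: "W \<tturnstile> Imp \<phi> \<psi> \<Longrightarrow> W \<tturnstile> \<phi> \<Longrightarrow> W \<tturnstile> \<psi>"
  by (erule (1) forces_common) (auto simp: forces_def intro: prv.impE)

lemma forces_ImpI:
  assumes "well_formed [] \<phi>" "internal \<phi>" "\<And>W'. W \<le> W' \<Longrightarrow> W' \<tturnstile> \<phi> \<Longrightarrow> W' \<tturnstile> \<psi>"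
  shows "W \<tturnstile> Imp \<phi> \<psi>"
proof -
  have "finsert \<phi> W \<tturnstile> \<psi>" using assms by (auto intro: forces_finsert)
  then obtain m where m: "derivable m (\<phi> # hyps W) \<psi>"
    using hyps_finsert[OF assms(1,2)] prv_weaken unfolding forces_def by blast
  obtain n where n: "wff (ctx n) \<phi>" using assms(1) by (auto simp: well_formed_def)
  have "derivable (max m n) (hyps W) (Imp \<phi> \<psi>)"
    using assms(2) derivable_mono[OF m, of "max m n"] wff_ctx_mono[of "[]" n \<phi> "max m n"] n
    by (auto intro: prv.impI)
  then show ?thesis unfolding forces_def by blast
qed

lemma forces_Imp:
  "well_formed [] \<phi> \<Longrightarrow> internal \<phi> \<Longrightarrow> W \<tturnstile> Imp \<phi> \<psi> \<longleftrightarrow> (\<forall>W'\<ge>W. W' \<tturnstile> \<phi> \<longrightarrow> W' \<tturnstile> \<psi>)"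
  using forces_ImpI forces_mp forces_mono by blast

lemma forces_allE: "W \<tturnstile> All \<sigma> \<phi> \<Longrightarrow> t \<^bold>: \<sigma> \<Longrightarrow> W \<tturnstile> finst t \<phi>"
proof -
  assume "W \<tturnstile> All \<sigma> \<phi>" "t \<^bold>: \<sigma>"
  then obtain m n where "derivable m (hyps W) (All \<sigma> \<phi>)" "has_ty (ctx n) t \<sigma>"
    unfolding forces_def typed_def by auto
  then have "derivable (max m n) (hyps W) (All \<sigma> \<phi>)" "has_ty (ctx (max m n)) t \<sigma>"
    using derivable_mono has_ty_ctx_mono[of "[]"] by auto
  then show ?thesis unfolding forces_def by (blast intro: prv.allE)
qed

lemma forces_exI:
  assumes "W \<tturnstile> finst t \<phi>" "t \<^bold>: \<sigma>" "well_formed [\<sigma>] \<phi>"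
  shows "W \<tturnstile> Ex \<sigma> \<phi>"
proof -
  obtain k m n where "derivable k (hyps W) (finst t \<phi>)" "has_ty (ctx m) t \<sigma>" "wff (\<sigma> # ctx n) \<phi>"
    using assms unfolding forces_def typed_def well_formed_def by auto
  then have "derivable (max k (max m n)) (hyps W) (finst t \<phi>)"
    "has_ty (ctx (max k (max m n))) t \<sigma>" "wff (\<sigma> # ctx (max k (max m n))) \<phi>"
    using derivable_mono has_ty_ctx_mono[of "[]" m] wff_ctx_mono[of "[\<sigma>]" n] by auto
  moreover have "internal \<phi>" using forces_internal[OF assms(1)] by simp
  ultimately show ?thesis unfolding forces_def by (fastforce intro: prv.exI)
qed

text \<open>The quantifier rules speak about variable 0; moving a fresh variable \<open>v\<close> there turns a
  statement about \<open>Var v\<close> into one about all terms.\<close>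

definition move_var :: "nat \<Rightarrow> nat \<Rightarrow> tm" where
  "move_var v i = (if i = v then Var 0 else Var (Suc i))"

lemma fsubst_move_var: "wff (ctx v) \<phi> \<Longrightarrow> fsubst (move_var v) \<phi> = flift \<phi>"
  unfolding flift_def by (erule fsubst_cong) (simp add: move_var_def)

lemma fsubst_move_var_finst:
  assumes "wff (\<sigma> # ctx v) \<phi>"
  shows "fsubst (move_var v) (finst (Var v) \<phi>) = \<phi>"
proof -
  have "fsubst (move_var v) (finst (Var v) \<phi>) = fsubst Var \<phi>"
    unfolding fsubst_finst using assms
    by (rule fsubst_cong) (auto simp: move_var_def split: nat.split)
  then show ?thesis by simp
qed

lemma derivable_move_var:
  assumes "derivable n H \<chi>" "\<nu> v = \<sigma>"
  shows "prv {\<psi>. internal \<psi>} (EHA_or_ax \<union> \<Delta>) (\<sigma> # ctx n)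
    (map (fsubst (move_var v)) H) (fsubst (move_var v) \<chi>)"
  by (rule prv_fsubst[OF assms(1) _ _ ax_fsubst])
    (use assms(2) in \<open>auto simp: subst_ty_def move_var_def\<close>)

lemma fresh_for_world:
  assumes "well_formed [\<sigma>] \<phi>"
  obtains v where "\<nu> v = \<sigma>" "wff (\<sigma> # ctx v) \<phi>"
    "map (fsubst (move_var v)) (hyps W) = map flift (hyps W)"
proof -
  obtain k m where k: "\<forall>h\<in>set (hyps W). wff (ctx k) h" and m: "wff ([\<sigma>] @ ctx m) \<phi>"
    using hyps_ctx assms unfolding well_formed_def by blast
  obtain v where v: "v \<ge> max k m" "\<nu> v = \<sigma>" using fresh_variable by blast
  have "wff ([\<sigma>] @ ctx v) \<phi>" using m by (rule wff_ctx_mono) (use v(1) in simp)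
  moreover have "wff (ctx v) h" if "h \<in> set (hyps W)" for h
    using wff_ctx_mono[of "[]" k h v] k that v(1) by simp
  ultimately show thesis using that v(2) fsubst_move_var by simp
qed

lemma forces_allI:
  assumes "well_formed [\<sigma>] \<phi>" "\<And>t. t \<^bold>: \<sigma> \<Longrightarrow> W \<tturnstile> finst t \<phi>"
  shows "W \<tturnstile> All \<sigma> \<phi>"
proof -
  obtain v where v: "\<nu> v = \<sigma>" "wff (\<sigma> # ctx v) \<phi>"
    "map (fsubst (move_var v)) (hyps W) = map flift (hyps W)"
    using fresh_for_world[OF assms(1)] by blast
  then have "W \<tturnstile> finst (Var v) \<phi>" using assms(2) by simp
  then obtain n where "derivable n (hyps W) (finst (Var v) \<phi>)" unfolding forces_def by blast
  from derivable_move_var[OF this v(1)]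
  have "derivable n (hyps W) (All \<sigma> \<phi>)"
    by (simp add: v(3) fsubst_move_var_finst[OF v(2)] prv.allI)
  then show ?thesis unfolding forces_def by blast
qed

lemma forces_All: "well_formed [\<sigma>] \<phi> \<Longrightarrow> W \<tturnstile> All \<sigma> \<phi> \<longleftrightarrow> (\<forall>t. t \<^bold>: \<sigma> \<longrightarrow> W \<tturnstile> finst t \<phi>)"
  using forces_allI forces_allE by blast

lemma forces_exE:
  assumes "W \<tturnstile> Ex \<sigma> \<phi>" "well_formed [] \<chi>"
    and "\<And>W' t. W \<le> W' \<Longrightarrow> t \<^bold>: \<sigma> \<Longrightarrow> W' \<tturnstile> finst t \<phi> \<Longrightarrow> W' \<tturnstile> \<chi>"
  shows "W \<tturnstile> \<chi>"
proof -
  have \<phi>: "well_formed [\<sigma>] \<phi>" "internal \<phi>"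
    using forces_well_formed[OF assms(1)] forces_internal[OF assms(1)] by auto
  obtain v where v: "\<nu> v = \<sigma>" "wff (\<sigma> # ctx v) (And \<phi> (flift \<chi>))"
    "map (fsubst (move_var v)) (hyps W) = map flift (hyps W)"
    using fresh_for_world[of \<sigma> "And \<phi> (flift \<chi>)" W] \<phi> well_formed_flift[OF assms(2)] by auto
  have "well_formed [] (finst (Var v) \<phi>)" using well_formed_finst[OF \<phi>(1)] v(1) by simp
  then have "finsert (finst (Var v) \<phi>) W \<tturnstile> \<chi>"
    using \<phi>(2) v(1) by (intro assms(3)[of _ "Var v"] fsubset_finsertI forces_finsert) auto
  then obtain n where n: "derivable n (finst (Var v) \<phi> # hyps W) \<chi>"
    using hyps_finsert[OF \<open>well_formed [] (finst (Var v) \<phi>)\<close>] \<phi>(2) prv_weaken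
    unfolding forces_def by (metis internal_finst order_refl)
  obtain m where m: "derivable m (hyps W) (Ex \<sigma> \<phi>)" using assms(1) unfolding forces_def by blast
  have "fsubst (move_var v) \<chi> = flift \<chi>"
    using fsubst_move_var[OF wff_fliftD[of \<sigma>]] v(2) by simp
  with derivable_move_var[OF derivable_mono[OF n, of "max m n"] v(1)]
  have "prv {\<psi>. internal \<psi>} (EHA_or_ax \<union> \<Delta>) (\<sigma> # ctx (max m n)) (\<phi> # map flift (hyps W)) (flift \<chi>)"
    using v(2,3) by (simp add: fsubst_move_var_finst[of \<sigma>])
  then have "derivable (max m n) (hyps W) \<chi>"
    using derivable_mono[OF m, of "max m n"] by (auto intro: prv.exE)
  then show ?thesis unfolding forces_def by blast
qed

end

section \<open>Equality and contexts with a hole\<close>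

context internal_theory
begin

lemma forces_EqD: "W \<tturnstile> Eq \<sigma> t u \<Longrightarrow> t \<^bold>: \<sigma> \<and> u \<^bold>: \<sigma>"
  by (drule forces_well_formed) simp

lemma forces_eq_refl: "t \<^bold>: \<sigma> \<Longrightarrow> W \<tturnstile> Eq \<sigma> t t"
  by (rule forces_ax) (auto intro: EHA_or_ax.intros)

lemma forces_eq_sym: "W \<tturnstile> Eq \<sigma> t u \<Longrightarrow> W \<tturnstile> Eq \<sigma> u t"
  by (rule forces_mp[OF forces_ax[OF UnI1[OF EHA_or_ax.eq_sym]]]) (auto dest: forces_EqD)

lemma forces_eq_trans [trans]: "W \<tturnstile> Eq \<sigma> t u \<Longrightarrow> W \<tturnstile> Eq \<sigma> u v \<Longrightarrow> W \<tturnstile> Eq \<sigma> t v"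
  by (rule forces_mp[OF forces_ax[OF UnI1[OF EHA_or_ax.eq_trans]]]) (auto dest: forces_EqD)

lemma forces_eq_app:
  "W \<tturnstile> Eq (\<sigma> \<^bold>\<rightarrow> \<tau>) f g \<Longrightarrow> W \<tturnstile> Eq \<sigma> t u \<Longrightarrow> W \<tturnstile> Eq \<tau> (f \<^bold>\<cdot> t) (g \<^bold>\<cdot> u)"
  by (rule forces_mp[OF forces_ax[OF UnI1[OF EHA_or_ax.eq_app]]]) (auto dest!: forces_EqD)

lemma forces_eq_fun: "W \<tturnstile> Eq (\<sigma> \<^bold>\<rightarrow> \<tau>) f g \<Longrightarrow> t \<^bold>: \<sigma> \<Longrightarrow> W \<tturnstile> Eq \<tau> (f \<^bold>\<cdot> t) (g \<^bold>\<cdot> t)"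
  by (intro forces_eq_app forces_eq_refl)

definition eq_subst :: "fm fset \<Rightarrow> ty list \<Rightarrow> (nat \<Rightarrow> tm) \<Rightarrow> (nat \<Rightarrow> tm) \<Rightarrow> bool" where
  "eq_subst W \<Gamma> \<theta> \<theta>' \<longleftrightarrow> (\<forall>i<length \<Gamma>. W \<tturnstile> Eq (\<Gamma> ! i) (\<theta> i) (\<theta>' i))"

lemma eq_subst_refl: "typed_subst [] \<theta> \<Gamma> \<Longrightarrow> eq_subst W \<Gamma> \<theta> \<theta>"
  by (simp add: eq_subst_def typed_subst_def forces_eq_refl)

lemma eq_subst_sym: "eq_subst W \<Gamma> \<theta> \<theta>' \<Longrightarrow> eq_subst W \<Gamma> \<theta>' \<theta>"
  by (simp add: eq_subst_def forces_eq_sym)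

lemma eq_subst_mono: "eq_subst W \<Gamma> \<theta> \<theta>' \<Longrightarrow> W \<le> W' \<Longrightarrow> eq_subst W' \<Gamma> \<theta> \<theta>'"
  using forces_mono by (auto simp: eq_subst_def)

lemma eq_subst_typed: "eq_subst W \<Gamma> \<theta> \<theta>' \<Longrightarrow> typed_subst [] \<theta> \<Gamma>"
  by (auto simp: eq_subst_def typed_subst_def dest: forces_EqD)

lemma eq_subst_case_nat:
  "W \<tturnstile> Eq \<sigma> t u \<Longrightarrow> eq_subst W \<Gamma> \<theta> \<theta>' \<Longrightarrow> eq_subst W (\<sigma> # \<Gamma>) (case_nat t \<theta>) (case_nat u \<theta>')"
  by (auto simp: eq_subst_def less_Suc_eq_0_disj)

lemma forces_tsubst_cong:
  "has_ty \<Gamma> t \<tau> \<Longrightarrow> eq_subst W \<Gamma> \<theta> \<theta>' \<Longrightarrow> W \<tturnstile> Eq \<tau> (tsubst \<theta> t) (tsubst \<theta>' t)"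
  by (induction t arbitrary: \<tau>)
    (auto simp: eq_subst_def intro: forces_eq_app forces_eq_refl)

lemma eq_subst_typed_right: "eq_subst W \<Gamma> \<theta> \<theta>' \<Longrightarrow> typed_subst [] \<theta>' \<Gamma>"
  by (rule eq_subst_typed[OF eq_subst_sym])

theorem forces_fsubst_cong:
  assumes "eq_subst W \<Gamma> \<theta> \<theta>'" "wff \<Gamma> \<phi>" "internal \<phi>" "or_free \<phi>" "W \<tturnstile> fsubst \<theta> \<phi>"
  shows "W \<tturnstile> fsubst \<theta>' \<phi>"
  using assms
proof (induction \<phi> arbitrary: W \<Gamma> \<theta> \<theta>')
  case (Eq \<sigma> t u)
  then have typed: "has_ty \<Gamma> t \<sigma>" "has_ty \<Gamma> u \<sigma>" by simp_all
  have "W \<tturnstile> Eq \<sigma> (tsubst \<theta>' t) (tsubst \<theta> t)"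
    by (rule forces_tsubst_cong[OF typed(1) eq_subst_sym[OF Eq.prems(1)]])
  also have "W \<tturnstile> Eq \<sigma> (tsubst \<theta> t) (tsubst \<theta> u)" using Eq.prems(5) by simp
  also have "W \<tturnstile> Eq \<sigma> (tsubst \<theta> u) (tsubst \<theta>' u)"
    by (rule forces_tsubst_cong[OF typed(2) Eq.prems(1)])
  finally show ?case by simp
next
  case (Imp \<phi> \<psi>)
  note eq = Imp.prems(1)
  have \<phi>: "well_formed [] (fsubst \<theta>' \<phi>)" "internal (fsubst \<theta>' \<phi>)"
    using Imp.prems well_formed_fsubst[OF _ eq_subst_typed_right[OF eq]] by auto
  show ?case unfolding fsubst.simps forces_Imp[OF \<phi>]
  proof (intro HOL.allI HOL.impI)
    fix W' assume W': "W \<le> W'" "W' \<tturnstile> fsubst \<theta>' \<phi>"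
    have "W' \<tturnstile> fsubst \<theta> \<phi>"
      by (rule Imp.IH(1)[OF eq_subst_sym[OF eq_subst_mono[OF eq W'(1)]]])
        (use Imp.prems W'(2) in auto)
    with forces_mono[OF Imp.prems(5) W'(1)] have "W' \<tturnstile> fsubst \<theta> \<psi>"
      by (auto intro: forces_mp)
    then show "W' \<tturnstile> fsubst \<theta>' \<psi>"
      by (rule Imp.IH(2)[OF eq_subst_mono[OF eq W'(1)], rotated -1]) (use Imp.prems in auto)
  qed
next
  case (All \<sigma> \<phi>)
  have "well_formed [\<sigma>] (fsubst (up \<theta>') \<phi>)"
    by (rule well_formed_fsubst[OF _ typed_subst_up[OF eq_subst_typed_right[OF All.prems(1)]]])
      (use All.prems in simp)
  then show ?case unfolding fsubst.simps
  proof (rule forces_allI)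
    fix t assume t: "t \<^bold>: \<sigma>"
    have "W \<tturnstile> fsubst (case_nat t \<theta>) \<phi>" using forces_allE[OF _ t] All.prems(5) by fastforce
    then show "W \<tturnstile> finst t (fsubst (up \<theta>') \<phi>)"
      using All.IH[OF eq_subst_case_nat[OF forces_eq_refl[OF t] All.prems(1)]] All.prems by simp
  qed
next
  case (Ex \<sigma> \<phi>)
  have wf: "well_formed [\<sigma>] (fsubst (up \<theta>') \<phi>)"
    by (rule well_formed_fsubst[OF _ typed_subst_up[OF eq_subst_typed_right[OF Ex.prems(1)]]])
      (use Ex.prems in simp)
  show ?case using Ex.prems(5) unfolding fsubst.simps
  proof (rule forces_exE)
    fix W' t assume W': "W \<le> W'" and t: "t \<^bold>: \<sigma>" and "W' \<tturnstile> finst t (fsubst (up \<theta>) \<phi>)"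
    then have "W' \<tturnstile> fsubst (case_nat t \<theta>') \<phi>"
      using Ex.IH[OF eq_subst_case_nat[OF forces_eq_refl[OF t] eq_subst_mono[OF Ex.prems(1) W']]]
        Ex.prems by simp
    then show "W' \<tturnstile> Ex \<sigma> (fsubst (up \<theta>') \<phi>)" using t wf by (auto intro: forces_exI)
  qed (use wf in simp)
qed auto

text \<open>Contexts with one hole, represented as functions, keep de Bruijn indices out of the
  statements of the congruence and induction principles.\<close>

definition term_ctxt :: "ty \<Rightarrow> ty \<Rightarrow> (tm \<Rightarrow> tm) \<Rightarrow> bool" where
  "term_ctxt \<sigma> \<tau> f \<longleftrightarrow> (\<exists>u. typed [\<sigma>] u \<tau> \<and> (\<forall>t. f t = tsubst (case_nat t Var) u))"

definition formula_ctxt :: "ty \<Rightarrow> (tm \<Rightarrow> fm) \<Rightarrow> bool" where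
  "formula_ctxt \<sigma> Q \<longleftrightarrow>
    (\<exists>\<phi>. well_formed [\<sigma>] \<phi> \<and> internal \<phi> \<and> or_free \<phi> \<and> (\<forall>t. Q t = finst t \<phi>))"

lemma term_ctxt_id: "term_ctxt \<sigma> \<sigma> (\<lambda>t. t)"
  unfolding term_ctxt_def by (intro HOL.exI[of _ "Var 0"]) simp

lemma term_ctxt_const: "u \<^bold>: \<tau> \<Longrightarrow> term_ctxt \<sigma> \<tau> (\<lambda>_. u)"
  unfolding term_ctxt_def by (intro HOL.exI[of _ "tlift (Suc 0) u"]) simp

lemma term_ctxt_App:
  "term_ctxt \<sigma> (\<rho> \<^bold>\<rightarrow> \<tau>) f \<Longrightarrow> term_ctxt \<sigma> \<rho> g \<Longrightarrow> term_ctxt \<sigma> \<tau> (\<lambda>t. f t \<^bold>\<cdot> g t)"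
  unfolding term_ctxt_def by (metis typed_App tsubst.simps(3))

lemma formula_ctxt_relation:
  assumes "term_ctxt \<sigma> \<tau> f" "term_ctxt \<sigma> \<rho> g"
    and "\<And>\<theta> t u. fsubst \<theta> (R t u) = R (tsubst \<theta> t) (tsubst \<theta> u)"
    and "\<And>t u. typed [\<sigma>] t \<tau> \<Longrightarrow> typed [\<sigma>] u \<rho> \<Longrightarrow>
      well_formed [\<sigma>] (R t u) \<and> internal (R t u) \<and> or_free (R t u)"
  shows "formula_ctxt \<sigma> (\<lambda>t. R (f t) (g t))"
proof -
  obtain t u where "typed [\<sigma>] t \<tau>" "typed [\<sigma>] u \<rho>"
    "\<And>x. f x = tsubst (case_nat x Var) t" "\<And>x. g x = tsubst (case_nat x Var) u"
    using assms(1,2) unfolding term_ctxt_def by blast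
  then show ?thesis
    unfolding formula_ctxt_def
    by (intro HOL.exI[of _ "R t u"]) (simp add: finst_def assms(3,4))
qed

lemma formula_ctxt_Eq:
  "term_ctxt \<sigma> \<tau> f \<Longrightarrow> term_ctxt \<sigma> \<tau> g \<Longrightarrow> formula_ctxt \<sigma> (\<lambda>t. Eq \<tau> (f t) (g t))"
  by (rule formula_ctxt_relation) simp_all

lemma formula_ctxt_Imp:
  assumes "formula_ctxt \<sigma> P" "formula_ctxt \<sigma> Q"
  shows "formula_ctxt \<sigma> (\<lambda>t. Imp (P t) (Q t))"
proof -
  obtain \<phi> \<psi> where "well_formed [\<sigma>] \<phi>" "internal \<phi>" "or_free \<phi>" "\<And>t. P t = finst t \<phi>"
    "well_formed [\<sigma>] \<psi>" "internal \<psi>" "or_free \<psi>" "\<And>t. Q t = finst t \<psi>"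
    using assms unfolding formula_ctxt_def by blast
  then show ?thesis unfolding formula_ctxt_def by (intro HOL.exI[of _ "Imp \<phi> \<psi>"]) simp
qed

lemma formula_ctxt_const:
  "well_formed [] \<phi> \<Longrightarrow> internal \<phi> \<Longrightarrow> or_free \<phi> \<Longrightarrow> formula_ctxt \<sigma> (\<lambda>_. \<phi>)"
  unfolding formula_ctxt_def by (intro HOL.exI[of _ "flift \<phi>"]) (simp add: well_formed_flift)

lemma term_ctxtD: "term_ctxt \<sigma> \<tau> f \<Longrightarrow> t \<^bold>: \<sigma> \<Longrightarrow> f t \<^bold>: \<tau>"
  unfolding term_ctxt_def typed_def[of "[\<sigma>]"]
  by (auto intro!: typed_tsubst typed_subst_case_nat typed_subst_Var)

lemma formula_ctxtD:
  "formula_ctxt \<sigma> Q \<Longrightarrow> t \<^bold>: \<sigma> \<Longrightarrow> well_formed [] (Q t) \<and> internal (Q t) \<and> or_free (Q t)"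
  unfolding formula_ctxt_def by (auto intro: well_formed_finst)

lemma forces_formula_ctxt_cong:
  assumes "formula_ctxt \<sigma> Q" "W \<tturnstile> Eq \<sigma> t u" "W \<tturnstile> Q t"
  shows "W \<tturnstile> Q u"
proof -
  obtain \<phi> n where \<phi>: "wff (\<sigma> # ctx n) \<phi>" "internal \<phi>" "or_free \<phi>" "\<And>t. Q t = finst t \<phi>"
    using assms(1) unfolding formula_ctxt_def well_formed_def by auto
  have "eq_subst W (\<sigma> # ctx n) (case_nat t Var) (case_nat u Var)"
    by (rule eq_subst_case_nat[OF assms(2) eq_subst_refl[OF typed_subst_Var]])
  from forces_fsubst_cong[OF this \<phi>(1-3)] show ?thesis
    using assms(3) by (simp add: \<phi>(4) finst_def)
qed

lemma forces_term_ctxt_cong: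
  assumes "term_ctxt \<sigma> \<tau> f" "W \<tturnstile> Eq \<sigma> t u"
  shows "W \<tturnstile> Eq \<tau> (f t) (f u)"
proof -
  have "f t \<^bold>: \<tau>" using forces_EqD[OF assms(2)] by (intro term_ctxtD[OF assms(1)]) simp
  then have "formula_ctxt \<sigma> (\<lambda>x. Eq \<tau> (f t) (f x))"
    by (intro formula_ctxt_Eq term_ctxt_const assms(1))
  then show ?thesis
    using assms(2) by (rule forces_formula_ctxt_cong) (rule forces_eq_refl[OF \<open>f t \<^bold>: \<tau>\<close>])
qed

end

section \<open>Arithmetic\<close>

lemma tsubst_plus [simp]: "tsubst \<theta> (plus_tm m n) = plus_tm (tsubst \<theta> m) (tsubst \<theta> n)"
  by (simp add: plus_tm_def)

lemma fsubst_Less [simp]: "fsubst \<theta> (Less m n) = Less (tsubst \<theta> m) (tsubst \<theta> n)"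
  by (simp add: Less_def tsubst_up_tlift)

lemma internal_Less [simp]: "internal (Less m n)" and or_free_Less [simp]: "or_free (Less m n)"
  by (simp_all add: Less_def)

definition cond :: "ty \<Rightarrow> tm \<Rightarrow> tm \<Rightarrow> tm \<Rightarrow> tm" where
  "cond \<sigma> z a b =
    Cst (Rec [\<sigma>] 0) \<^bold>\<cdot> a \<^bold>\<cdot> (Cst (CombK (\<sigma> \<^bold>\<rightarrow> \<sigma>) N) \<^bold>\<cdot> (Cst (CombK \<sigma> \<sigma>) \<^bold>\<cdot> b)) \<^bold>\<cdot> z"

lemma tsubst_cond [simp]:
  "tsubst \<theta> (cond \<sigma> z a b) = cond \<sigma> (tsubst \<theta> z) (tsubst \<theta> a) (tsubst \<theta> b)"
  by (simp add: cond_def)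

lemma has_ty_cond [simp]:
  "has_ty \<Gamma> (cond \<sigma> z a b) \<tau> \<longleftrightarrow> \<tau> = \<sigma> \<and> has_ty \<Gamma> z N \<and> has_ty \<Gamma> a \<sigma> \<and> has_ty \<Gamma> b \<sigma>"
  by (auto simp: cond_def)

context variable_supply
begin

lemma typed_plus [simp]: "typed \<Gamma> (plus_tm m n) \<tau> \<longleftrightarrow> \<tau> = N \<and> typed \<Gamma> m N \<and> typed \<Gamma> n N"
  by (auto simp: plus_tm_def)

lemma typed_cond [simp]:
  "typed \<Gamma> (cond \<sigma> z a b) \<tau> \<longleftrightarrow> \<tau> = \<sigma> \<and> typed \<Gamma> z N \<and> typed \<Gamma> a \<sigma> \<and> typed \<Gamma> b \<sigma>"
  by (auto simp: cond_def)

lemma well_formed_Less [simp]: "well_formed \<Gamma> (Less m n) \<longleftrightarrow> typed \<Gamma> m N \<and> typed \<Gamma> n N"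
  by (simp add: Less_def)

end

context internal_theory
begin

lemma forces_comb_k: "t \<^bold>: \<sigma> \<Longrightarrow> u \<^bold>: \<tau> \<Longrightarrow> W \<tturnstile> Eq \<sigma> (Cst (CombK \<sigma> \<tau>) \<^bold>\<cdot> t \<^bold>\<cdot> u) t"
  by (rule forces_ax) (auto intro: EHA_or_ax.intros)

lemma forces_comb_s:
  "t \<^bold>: \<rho> \<^bold>\<rightarrow> \<sigma> \<^bold>\<rightarrow> \<tau> \<Longrightarrow> u \<^bold>: \<rho> \<^bold>\<rightarrow> \<sigma> \<Longrightarrow> v \<^bold>: \<rho> \<Longrightarrow>
    W \<tturnstile> Eq \<tau> (Cst (CombS \<rho> \<sigma> \<tau>) \<^bold>\<cdot> t \<^bold>\<cdot> u \<^bold>\<cdot> v) (t \<^bold>\<cdot> v \<^bold>\<cdot> (u \<^bold>\<cdot> v))"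
  by (rule forces_ax) (auto intro: EHA_or_ax.intros)

lemma forces_rec_zero:
  "t \<^bold>: \<sigma> \<Longrightarrow> u \<^bold>: N \<^bold>\<rightarrow> \<sigma> \<^bold>\<rightarrow> \<sigma> \<Longrightarrow> W \<tturnstile> Eq \<sigma> (Cst (Rec [\<sigma>] 0) \<^bold>\<cdot> t \<^bold>\<cdot> u \<^bold>\<cdot> zero) t"
  using EHA_or_ax.rec_zero[of "[t]" "[\<sigma>]" "[u]" 0] by (auto intro!: forces_ax)

lemma forces_rec_suc:
  "t \<^bold>: \<sigma> \<Longrightarrow> u \<^bold>: N \<^bold>\<rightarrow> \<sigma> \<^bold>\<rightarrow> \<sigma> \<Longrightarrow> v \<^bold>: N \<Longrightarrow>
    W \<tturnstile> Eq \<sigma> (Cst (Rec [\<sigma>] 0) \<^bold>\<cdot> t \<^bold>\<cdot> u \<^bold>\<cdot> suc v) (u \<^bold>\<cdot> v \<^bold>\<cdot> (Cst (Rec [\<sigma>] 0) \<^bold>\<cdot> t \<^bold>\<cdot> u \<^bold>\<cdot> v))"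
  using EHA_or_ax.rec_suc[of "[t]" "[\<sigma>]" "[u]" 0 v] by (auto intro!: forces_ax)

lemma forces_nat_induct:
  assumes "formula_ctxt N Q" "t \<^bold>: N" "W \<tturnstile> Q zero"
    and suc: "\<And>W' t. W \<le> W' \<Longrightarrow> t \<^bold>: N \<Longrightarrow> W' \<tturnstile> Q t \<Longrightarrow> W' \<tturnstile> Q (suc t)"
  shows "W \<tturnstile> Q t"
proof -
  obtain \<phi> where \<phi>: "well_formed [N] \<phi>" "internal \<phi>" "or_free \<phi>" and Q: "\<And>t. Q t = finst t \<phi>"
    using assms(1) unfolding formula_ctxt_def by blast
  have wf_step: "well_formed [N] (Imp \<phi> (fsucc \<phi>))"
    using \<phi>(1) by (auto simp: well_formed_def intro: wff_fsucc)
  have "W \<tturnstile> All N (Imp \<phi> (fsucc \<phi>))"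
  proof (rule forces_allI[OF wf_step])
    fix t assume "t \<^bold>: N"
    then show "W \<tturnstile> finst t (Imp \<phi> (fsucc \<phi>))"
      using suc well_formed_finst[OF \<phi>(1)] \<phi>(2) by (auto simp: Q finst_fsucc intro: forces_ImpI)
  qed
  moreover have "W \<tturnstile> Imp (And (finst zero \<phi>) (All N (Imp \<phi> (fsucc \<phi>)))) (All N \<phi>)"
    using wf_step well_formed_finst[OF \<phi>(1), of zero]
    by (intro forces_ax UnI1 EHA_or_ax.induction \<phi>) auto
  ultimately have "W \<tturnstile> All N \<phi>" using assms(3) unfolding Q by (auto intro: forces_mp)
  then show ?thesis using assms(2) unfolding Q by (rule forces_allE)
qed

lemma forces_nat_cases:
  assumes "t \<^bold>: N" and \<chi>: "well_formed [] \<chi>" "internal \<chi>" "or_free \<chi>"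
    and zero: "\<And>W'. W \<le> W' \<Longrightarrow> W' \<tturnstile> Eq N t zero \<Longrightarrow> W' \<tturnstile> \<chi>"
    and suc: "\<And>W' u. W \<le> W' \<Longrightarrow> u \<^bold>: N \<Longrightarrow> W' \<tturnstile> Eq N t (suc u) \<Longrightarrow> W' \<tturnstile> \<chi>"
  shows "W \<tturnstile> \<chi>"
proof -
  have "formula_ctxt N (\<lambda>n. Imp (Eq N t n) \<chi>)"
    using assms(1) \<chi>
    by (intro formula_ctxt_Imp formula_ctxt_Eq term_ctxt_const term_ctxt_id formula_ctxt_const)
  then have "W \<tturnstile> Imp (Eq N t t) \<chi>"
  proof (rule forces_nat_induct[OF _ assms(1)])
    show "W \<tturnstile> Imp (Eq N t zero) \<chi>" using zero assms(1) by (auto intro: forces_ImpI)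
    fix W' u assume "W \<le> W'" "u \<^bold>: N"
    then show "W' \<tturnstile> Imp (Eq N t (suc u)) \<chi>"
      using suc assms(1) by (auto intro!: forces_ImpI elim: order_trans)
  qed
  then show ?thesis using forces_eq_refl[OF assms(1)] by (rule forces_mp)
qed

lemma forces_suc_cong: "W \<tturnstile> Eq N t u \<Longrightarrow> W \<tturnstile> Eq N (suc t) (suc u)"
  by (rule forces_eq_app[of _ N]) (simp_all add: forces_eq_refl)

lemma forces_suc_eq_zeroD: "W \<tturnstile> Eq N (suc t) zero \<Longrightarrow> W \<tturnstile> Bot"
  by (rule forces_mp[OF forces_ax[OF UnI1[OF EHA_or_ax.suc_not_zero]]])
    (auto dest: forces_EqD)

lemma forces_suc_injectD: "W \<tturnstile> Eq N (suc t) (suc u) \<Longrightarrow> W \<tturnstile> Eq N t u"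
  by (rule forces_mp[OF forces_ax[OF UnI1[OF EHA_or_ax.suc_inject]]])
    (auto dest: forces_EqD)

lemma forces_Neg_eq_zero:
  assumes "W \<tturnstile> Eq N t (suc u)"
  shows "W \<tturnstile> Neg (Eq N t zero)"
proof (rule forces_ImpI)
  show "well_formed [] (Eq N t zero)" using forces_EqD[OF assms] by simp
  fix W' assume "W \<le> W'" "W' \<tturnstile> Eq N t zero"
  then have "W' \<tturnstile> Eq N (suc u) zero"
    using forces_eq_trans[OF forces_eq_sym[OF forces_mono[OF assms]]] by blast
  then show "W' \<tturnstile> Bot" by (rule forces_suc_eq_zeroD)
qed simp

lemma forces_cond_zero:
  assumes "a \<^bold>: \<sigma>" "b \<^bold>: \<sigma>" "W \<tturnstile> Eq N z zero"
  shows "W \<tturnstile> Eq \<sigma> (cond \<sigma> z a b) a"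
proof -
  have "W \<tturnstile> Eq \<sigma> (cond \<sigma> z a b) (cond \<sigma> zero a b)"
    unfolding cond_def by (rule forces_eq_app[OF forces_eq_refl assms(3)]) (use assms in auto)
  also have "W \<tturnstile> Eq \<sigma> (cond \<sigma> zero a b) a"
    unfolding cond_def by (rule forces_rec_zero) (use assms in auto)
  finally show ?thesis .
qed

lemma forces_cond_suc:
  assumes "a \<^bold>: \<sigma>" "b \<^bold>: \<sigma>" "W \<tturnstile> Eq N z (suc u)"
  shows "W \<tturnstile> Eq \<sigma> (cond \<sigma> z a b) b"
proof -
  let ?step = "Cst (CombK (\<sigma> \<^bold>\<rightarrow> \<sigma>) N) \<^bold>\<cdot> (Cst (CombK \<sigma> \<sigma>) \<^bold>\<cdot> b)"
  have u: "u \<^bold>: N" using forces_EqD[OF assms(3)] by simp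
  have "W \<tturnstile> Eq \<sigma> (cond \<sigma> z a b) (cond \<sigma> (suc u) a b)"
    unfolding cond_def by (rule forces_eq_app[OF forces_eq_refl assms(3)]) (use assms in auto)
  also have "W \<tturnstile> Eq \<sigma> (cond \<sigma> (suc u) a b) (?step \<^bold>\<cdot> u \<^bold>\<cdot> cond \<sigma> u a b)"
    unfolding cond_def by (rule forces_rec_suc) (use assms u in auto)
  also have "W \<tturnstile> Eq \<sigma> (?step \<^bold>\<cdot> u \<^bold>\<cdot> cond \<sigma> u a b) (Cst (CombK \<sigma> \<sigma>) \<^bold>\<cdot> b \<^bold>\<cdot> cond \<sigma> u a b)"
    by (rule forces_eq_fun[OF forces_comb_k]) (use assms u in auto)
  also have "W \<tturnstile> Eq \<sigma> (Cst (CombK \<sigma> \<sigma>) \<^bold>\<cdot> b \<^bold>\<cdot> cond \<sigma> u a b) b"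
    by (rule forces_comb_k) (use assms u in auto)
  finally show ?thesis .
qed

lemma forces_plus_zero: "m \<^bold>: N \<Longrightarrow> W \<tturnstile> Eq N (plus_tm m zero) m"
  unfolding plus_tm_def by (rule forces_rec_zero) auto

lemma forces_plus_suc:
  assumes "m \<^bold>: N" "n \<^bold>: N"
  shows "W \<tturnstile> Eq N (plus_tm m (suc n)) (suc (plus_tm m n))"
proof -
  let ?step = "Cst (CombK (N \<^bold>\<rightarrow> N) N) \<^bold>\<cdot> Cst Succ"
  have "W \<tturnstile> Eq N (plus_tm m (suc n)) (?step \<^bold>\<cdot> n \<^bold>\<cdot> plus_tm m n)"
    unfolding plus_tm_def by (rule forces_rec_suc) (use assms in auto)
  also have "W \<tturnstile> Eq N (?step \<^bold>\<cdot> n \<^bold>\<cdot> plus_tm m n) (suc (plus_tm m n))"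
    by (rule forces_eq_fun[OF forces_comb_k]) (use assms in auto)
  finally show ?thesis .
qed

lemma term_ctxt_suc: "term_ctxt \<sigma> N f \<Longrightarrow> term_ctxt \<sigma> N (\<lambda>t. suc (f t))"
  by (rule term_ctxt_App[OF term_ctxt_const]) auto

lemma term_ctxt_plus:
  "term_ctxt \<sigma> N f \<Longrightarrow> term_ctxt \<sigma> N g \<Longrightarrow> term_ctxt \<sigma> N (\<lambda>t. plus_tm (f t) (g t))"
  unfolding plus_tm_def
  by (rule term_ctxt_App[OF term_ctxt_App[OF term_ctxt_App[OF term_ctxt_const] term_ctxt_const]])
    auto

lemma forces_zero_plus:
  assumes "n \<^bold>: N"
  shows "W \<tturnstile> Eq N (plus_tm zero n) n"
proof (rule forces_nat_induct[where Q = "\<lambda>n. Eq N (plus_tm zero n) n", OF _ assms])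
  show "formula_ctxt N (\<lambda>n. Eq N (plus_tm zero n) n)"
    by (intro formula_ctxt_Eq term_ctxt_plus term_ctxt_const term_ctxt_id) simp
  show "W \<tturnstile> Eq N (plus_tm zero zero) zero" by (rule forces_plus_zero) simp
  fix W' n assume "n \<^bold>: N" "W' \<tturnstile> Eq N (plus_tm zero n) n"
  then show "W' \<tturnstile> Eq N (plus_tm zero (suc n)) (suc n)"
    using forces_eq_trans[OF forces_plus_suc forces_suc_cong] by simp
qed

lemma forces_suc_plus:
  assumes "m \<^bold>: N" "n \<^bold>: N"
  shows "W \<tturnstile> Eq N (plus_tm (suc m) n) (suc (plus_tm m n))"
proof (rule forces_nat_induct[where Q = "\<lambda>n. Eq N (plus_tm (suc m) n) (suc (plus_tm m n))",
      OF _ assms(2)])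
  show "formula_ctxt N (\<lambda>n. Eq N (plus_tm (suc m) n) (suc (plus_tm m n)))"
    using assms(1)
    by (intro formula_ctxt_Eq term_ctxt_suc term_ctxt_plus term_ctxt_const term_ctxt_id) simp_all
  have "W \<tturnstile> Eq N (plus_tm (suc m) zero) (suc m)"
    by (rule forces_plus_zero) (use assms in simp)
  also have "W \<tturnstile> Eq N (suc m) (suc (plus_tm m zero))"
    by (rule forces_suc_cong[OF forces_eq_sym[OF forces_plus_zero[OF assms(1)]]])
  finally show "W \<tturnstile> Eq N (plus_tm (suc m) zero) (suc (plus_tm m zero))" .
  fix W' n assume n: "n \<^bold>: N" and IH: "W' \<tturnstile> Eq N (plus_tm (suc m) n) (suc (plus_tm m n))"
  have "W' \<tturnstile> Eq N (plus_tm (suc m) (suc n)) (suc (plus_tm (suc m) n))"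
    by (rule forces_plus_suc) (use assms n in simp_all)
  also have "W' \<tturnstile> Eq N (suc (plus_tm (suc m) n)) (suc (suc (plus_tm m n)))"
    using IH by (rule forces_suc_cong)
  also have "W' \<tturnstile> Eq N (suc (suc (plus_tm m n))) (suc (plus_tm m (suc n)))"
    by (rule forces_suc_cong[OF forces_eq_sym[OF forces_plus_suc[OF assms(1) n]]])
  finally show "W' \<tturnstile> Eq N (plus_tm (suc m) (suc n)) (suc (plus_tm m (suc n)))" .
qed

lemma formula_ctxt_Less:
  "term_ctxt \<sigma> N f \<Longrightarrow> term_ctxt \<sigma> N g \<Longrightarrow> formula_ctxt \<sigma> (\<lambda>t. Less (f t) (g t))"
  by (rule formula_ctxt_relation) simp_all

lemma forces_LessI: "W \<tturnstile> Eq N (plus_tm m (suc k)) n \<Longrightarrow> W \<tturnstile> Less m n"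
  unfolding Less_def by (rule forces_exI[of _ k]) (auto dest: forces_EqD)

lemma forces_LessE:
  assumes "W \<tturnstile> Less m n" "well_formed [] \<chi>"
    and "\<And>W' k. W \<le> W' \<Longrightarrow> k \<^bold>: N \<Longrightarrow> W' \<tturnstile> Eq N (plus_tm m (suc k)) n \<Longrightarrow> W' \<tturnstile> \<chi>"
  shows "W \<tturnstile> \<chi>"
  using assms(1) unfolding Less_def by (rule forces_exE) (use assms(2,3) in auto)

lemma forces_zero_less_suc: "n \<^bold>: N \<Longrightarrow> W \<tturnstile> Less zero (suc n)"
  by (rule forces_LessI[OF forces_zero_plus]) simp

lemma forces_less_zeroD:
  assumes "W \<tturnstile> Less m zero"
  shows "W \<tturnstile> Bot"
proof (rule forces_LessE[OF assms])
  have m: "m \<^bold>: N" using forces_well_formed[OF assms] by simp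
  fix W' k assume "k \<^bold>: N" "W' \<tturnstile> Eq N (plus_tm m (suc k)) zero"
  then show "W' \<tturnstile> Bot"
    using forces_suc_eq_zeroD forces_eq_trans[OF forces_eq_sym[OF forces_plus_suc[OF m]]] by blast
qed simp

lemma forces_suc_less_suc: "W \<tturnstile> Less (suc m) (suc n) \<longleftrightarrow> W \<tturnstile> Less m n"
proof
  assume less: "W \<tturnstile> Less m n"
  then have typed: "m \<^bold>: N" "n \<^bold>: N" by (auto dest: forces_well_formed)
  show "W \<tturnstile> Less (suc m) (suc n)"
  proof (rule forces_LessE[OF less])
    fix W' k assume "k \<^bold>: N" "W' \<tturnstile> Eq N (plus_tm m (suc k)) n"
    then have "W' \<tturnstile> Eq N (plus_tm (suc m) (suc k)) (suc n)"
      using typed by (intro forces_eq_trans[OF forces_suc_plus forces_suc_cong]) auto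
    then show "W' \<tturnstile> Less (suc m) (suc n)" by (rule forces_LessI)
  qed (use typed in simp)
next
  assume less: "W \<tturnstile> Less (suc m) (suc n)"
  then have typed: "m \<^bold>: N" "n \<^bold>: N" by (auto dest: forces_well_formed)
  show "W \<tturnstile> Less m n"
  proof (rule forces_LessE[OF less])
    fix W' k assume "k \<^bold>: N" and eq: "W' \<tturnstile> Eq N (plus_tm (suc m) (suc k)) (suc n)"
    then have "W' \<tturnstile> Eq N (suc (plus_tm m (suc k))) (suc n)"
      using typed by (intro forces_eq_trans[OF forces_eq_sym[OF forces_suc_plus] eq]) auto
    then show "W' \<tturnstile> Less m n" by (rule forces_LessI[OF forces_suc_injectD])
  qed (use typed in simp)
qed

end

section \<open>Finite sequences\<close>

abbreviation prep :: "ty \<Rightarrow> tm \<Rightarrow> tm \<Rightarrow> tm" where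
  "prep \<sigma> a s \<equiv> Cst (Prep \<sigma>) \<^bold>\<cdot> a \<^bold>\<cdot> s"

definition drop_tm :: "ty \<Rightarrow> tm \<Rightarrow> tm \<Rightarrow> tm" where
  "drop_tm \<sigma> s i = Cst (Rec [Seq \<sigma>] 0) \<^bold>\<cdot> s \<^bold>\<cdot> (Cst (CombK (Seq \<sigma> \<^bold>\<rightarrow> Seq \<sigma>) N) \<^bold>\<cdot> tail_fn \<sigma>) \<^bold>\<cdot> i"

definition append_step :: "ty \<Rightarrow> tm" where
  "append_step \<sigma> = Cst (CombS \<sigma> (Seq \<sigma> \<^bold>\<rightarrow> Seq \<sigma>) (Seq \<sigma> \<^bold>\<rightarrow> Seq \<sigma> \<^bold>\<rightarrow> Seq \<sigma>)) \<^bold>\<cdot>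
    (Cst (CombK ((Seq \<sigma> \<^bold>\<rightarrow> Seq \<sigma>) \<^bold>\<rightarrow> Seq \<sigma> \<^bold>\<rightarrow> Seq \<sigma> \<^bold>\<rightarrow> Seq \<sigma>) \<sigma>) \<^bold>\<cdot>
      Cst (CombK (Seq \<sigma> \<^bold>\<rightarrow> Seq \<sigma>) (Seq \<sigma>))) \<^bold>\<cdot> Cst (Prep \<sigma>)"

definition append_tm :: "ty \<Rightarrow> tm \<Rightarrow> tm \<Rightarrow> tm" where
  "append_tm \<sigma> s t = Cst (LRec \<sigma> (Seq \<sigma>)) \<^bold>\<cdot> t \<^bold>\<cdot> append_step \<sigma> \<^bold>\<cdot> s"

lemma nth_tm_drop: "nth_tm \<sigma> s i = head_tm \<sigma> (drop_tm \<sigma> s i)"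
  by (simp add: nth_tm_def drop_tm_def)

lemma tsubst_null [simp]: "tsubst \<theta> (null_tm \<sigma>) = null_tm \<sigma>"
  by (rule tsubst_closed[OF has_ty_null])

lemma tsubst_seq [simp]:
  "tsubst \<theta> (len_tm \<sigma> s) = len_tm \<sigma> (tsubst \<theta> s)"
  "tsubst \<theta> (nth_tm \<sigma> s i) = nth_tm \<sigma> (tsubst \<theta> s) (tsubst \<theta> i)"
  "tsubst \<theta> (append_tm \<sigma> s t) = append_tm \<sigma> (tsubst \<theta> s) (tsubst \<theta> t)"
  by (simp_all add: len_tm_def head_tm_def tail_fn_def nth_tm_def append_tm_def append_step_def)

lemma has_ty_append_tm [simp]:
  "has_ty \<Gamma> (append_tm \<sigma> s t) \<tau> \<longleftrightarrow> \<tau> = Seq \<sigma> \<and> has_ty \<Gamma> s (Seq \<sigma>) \<and> has_ty \<Gamma> t (Seq \<sigma>)"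
  by (auto simp: append_tm_def append_step_def)

lemma fsubst_Mem [simp]: "fsubst \<theta> (Mem \<sigma> a s) = Mem \<sigma> (tsubst \<theta> a) (tsubst \<theta> s)"
  by (simp add: Mem_def tsubst_up_tlift)

lemma internal_Mem [simp]: "internal (Mem \<sigma> a s)" and or_free_Mem [simp]: "or_free (Mem \<sigma> a s)"
  by (simp_all add: Mem_def)

context variable_supply
begin

lemma typed_seq [simp]:
  "typed \<Gamma> (len_tm \<sigma> s) \<tau> \<longleftrightarrow> \<tau> = N \<and> typed \<Gamma> s (Seq \<sigma>)"
  "typed \<Gamma> (head_tm \<sigma> s) \<tau> \<longleftrightarrow> \<tau> = \<sigma> \<and> typed \<Gamma> s (Seq \<sigma>)"
  "typed \<Gamma> (tail_fn \<sigma>) \<tau> \<longleftrightarrow> \<tau> = (Seq \<sigma> \<^bold>\<rightarrow> Seq \<sigma>)"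
  "typed \<Gamma> (drop_tm \<sigma> s i) \<tau> \<longleftrightarrow> \<tau> = Seq \<sigma> \<and> typed \<Gamma> s (Seq \<sigma>) \<and> typed \<Gamma> i N"
  "typed \<Gamma> (append_step \<sigma>) \<tau> \<longleftrightarrow> \<tau> = (\<sigma> \<^bold>\<rightarrow> Seq \<sigma> \<^bold>\<rightarrow> Seq \<sigma> \<^bold>\<rightarrow> Seq \<sigma>)"
  "typed \<Gamma> (append_tm \<sigma> s t) \<tau> \<longleftrightarrow> \<tau> = Seq \<sigma> \<and> typed \<Gamma> s (Seq \<sigma>) \<and> typed \<Gamma> t (Seq \<sigma>)"
  by (auto simp: len_tm_def head_tm_def tail_fn_def drop_tm_def append_tm_def append_step_def)

lemma typed_nth [simp]:
  "typed \<Gamma> (nth_tm \<sigma> s i) \<tau> \<longleftrightarrow> \<tau> = \<sigma> \<and> typed \<Gamma> s (Seq \<sigma>) \<and> typed \<Gamma> i N"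
  by (auto simp: nth_tm_drop)

lemma well_formed_Mem [simp]: "well_formed \<Gamma> (Mem \<sigma> a s) \<longleftrightarrow> typed \<Gamma> a \<sigma> \<and> typed \<Gamma> s (Seq \<sigma>)"
  by (auto simp: Mem_def)

end

context internal_theory
begin

lemma forces_lrec_empty:
  "t \<^bold>: \<rho> \<Longrightarrow> u \<^bold>: \<sigma> \<^bold>\<rightarrow> Seq \<sigma> \<^bold>\<rightarrow> \<rho> \<^bold>\<rightarrow> \<rho> \<Longrightarrow>
    W \<tturnstile> Eq \<rho> (Cst (LRec \<sigma> \<rho>) \<^bold>\<cdot> t \<^bold>\<cdot> u \<^bold>\<cdot> Cst (Empty \<sigma>)) t"
  by (rule forces_ax) (auto intro: EHA_or_ax.intros)

lemma forces_lrec_prep: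
  "t \<^bold>: \<rho> \<Longrightarrow> u \<^bold>: \<sigma> \<^bold>\<rightarrow> Seq \<sigma> \<^bold>\<rightarrow> \<rho> \<^bold>\<rightarrow> \<rho> \<Longrightarrow> a \<^bold>: \<sigma> \<Longrightarrow> s \<^bold>: Seq \<sigma> \<Longrightarrow>
    W \<tturnstile> Eq \<rho> (Cst (LRec \<sigma> \<rho>) \<^bold>\<cdot> t \<^bold>\<cdot> u \<^bold>\<cdot> prep \<sigma> a s)
      (u \<^bold>\<cdot> a \<^bold>\<cdot> s \<^bold>\<cdot> (Cst (LRec \<sigma> \<rho>) \<^bold>\<cdot> t \<^bold>\<cdot> u \<^bold>\<cdot> s))"
  by (rule forces_ax) (auto intro: EHA_or_ax.intros)

lemma forces_len_empty: "W \<tturnstile> Eq N (len_tm \<sigma> (Cst (Empty \<sigma>))) zero"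
  unfolding len_tm_def by (rule forces_lrec_empty) auto

lemma forces_len_prep:
  assumes "a \<^bold>: \<sigma>" "s \<^bold>: Seq \<sigma>"
  shows "W \<tturnstile> Eq N (len_tm \<sigma> (prep \<sigma> a s)) (suc (len_tm \<sigma> s))"
proof -
  let ?K_suc = "Cst (CombK (N \<^bold>\<rightarrow> N) (Seq \<sigma>)) \<^bold>\<cdot> Cst Succ"
  let ?step = "Cst (CombK (Seq \<sigma> \<^bold>\<rightarrow> N \<^bold>\<rightarrow> N) \<sigma>) \<^bold>\<cdot> ?K_suc"
  have "W \<tturnstile> Eq N (len_tm \<sigma> (prep \<sigma> a s)) (?step \<^bold>\<cdot> a \<^bold>\<cdot> s \<^bold>\<cdot> len_tm \<sigma> s)"
    unfolding len_tm_def by (rule forces_lrec_prep) (use assms in auto)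
  also have "W \<tturnstile> Eq N (?step \<^bold>\<cdot> a \<^bold>\<cdot> s \<^bold>\<cdot> len_tm \<sigma> s) (?K_suc \<^bold>\<cdot> s \<^bold>\<cdot> len_tm \<sigma> s)"
    by (rule forces_eq_fun[OF forces_eq_fun[OF forces_comb_k]]) (use assms in auto)
  also have "W \<tturnstile> Eq N (?K_suc \<^bold>\<cdot> s \<^bold>\<cdot> len_tm \<sigma> s) (suc (len_tm \<sigma> s))"
    by (rule forces_eq_fun[OF forces_comb_k]) (use assms in auto)
  finally show ?thesis .
qed

lemma forces_head_prep:
  assumes "a \<^bold>: \<sigma>" "s \<^bold>: Seq \<sigma>"
  shows "W \<tturnstile> Eq \<sigma> (head_tm \<sigma> (prep \<sigma> a s)) a"
proof -
  let ?K = "Cst (CombK \<sigma> \<sigma>)" and ?K_seq = "Cst (CombK (\<sigma> \<^bold>\<rightarrow> \<sigma>) (Seq \<sigma>))"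
  let ?KK = "Cst (CombK ((\<sigma> \<^bold>\<rightarrow> \<sigma>) \<^bold>\<rightarrow> Seq \<sigma> \<^bold>\<rightarrow> \<sigma> \<^bold>\<rightarrow> \<sigma>) \<sigma>) \<^bold>\<cdot> ?K_seq"
  let ?step = "Cst (CombS \<sigma> (\<sigma> \<^bold>\<rightarrow> \<sigma>) (Seq \<sigma> \<^bold>\<rightarrow> \<sigma> \<^bold>\<rightarrow> \<sigma>)) \<^bold>\<cdot> ?KK \<^bold>\<cdot> ?K"
  have "W \<tturnstile> Eq (Seq \<sigma> \<^bold>\<rightarrow> \<sigma> \<^bold>\<rightarrow> \<sigma>) (?step \<^bold>\<cdot> a) (?KK \<^bold>\<cdot> a \<^bold>\<cdot> (?K \<^bold>\<cdot> a))"
    by (rule forces_comb_s) (use assms in auto)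
  also have "W \<tturnstile> Eq (Seq \<sigma> \<^bold>\<rightarrow> \<sigma> \<^bold>\<rightarrow> \<sigma>) (?KK \<^bold>\<cdot> a \<^bold>\<cdot> (?K \<^bold>\<cdot> a)) (?K_seq \<^bold>\<cdot> (?K \<^bold>\<cdot> a))"
    by (rule forces_eq_fun[OF forces_comb_k]) (use assms in auto)
  finally have step: "W \<tturnstile> Eq (Seq \<sigma> \<^bold>\<rightarrow> \<sigma> \<^bold>\<rightarrow> \<sigma>) (?step \<^bold>\<cdot> a) (?K_seq \<^bold>\<cdot> (?K \<^bold>\<cdot> a))" .
  have "W \<tturnstile> Eq \<sigma> (head_tm \<sigma> (prep \<sigma> a s)) (?step \<^bold>\<cdot> a \<^bold>\<cdot> s \<^bold>\<cdot> head_tm \<sigma> s)"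
    unfolding head_tm_def by (rule forces_lrec_prep) (use assms in auto)
  also have "W \<tturnstile> Eq \<sigma> (?step \<^bold>\<cdot> a \<^bold>\<cdot> s \<^bold>\<cdot> head_tm \<sigma> s) (?K_seq \<^bold>\<cdot> (?K \<^bold>\<cdot> a) \<^bold>\<cdot> s \<^bold>\<cdot> head_tm \<sigma> s)"
    by (rule forces_eq_fun[OF forces_eq_fun[OF step]]) (use assms in auto)
  also have "W \<tturnstile> Eq \<sigma> (?K_seq \<^bold>\<cdot> (?K \<^bold>\<cdot> a) \<^bold>\<cdot> s \<^bold>\<cdot> head_tm \<sigma> s) (?K \<^bold>\<cdot> a \<^bold>\<cdot> head_tm \<sigma> s)"
    by (rule forces_eq_fun[OF forces_comb_k]) (use assms in auto)
  also have "W \<tturnstile> Eq \<sigma> (?K \<^bold>\<cdot> a \<^bold>\<cdot> head_tm \<sigma> s) a"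
    by (rule forces_comb_k) (use assms in auto)
  finally show ?thesis .
qed

lemma forces_tail_prep:
  assumes "a \<^bold>: \<sigma>" "s \<^bold>: Seq \<sigma>"
  shows "W \<tturnstile> Eq (Seq \<sigma>) (tail_fn \<sigma> \<^bold>\<cdot> prep \<sigma> a s) s"
proof -
  let ?K = "Cst (CombK (Seq \<sigma>) (Seq \<sigma>))"
  let ?step = "Cst (CombK (Seq \<sigma> \<^bold>\<rightarrow> Seq \<sigma> \<^bold>\<rightarrow> Seq \<sigma>) \<sigma>) \<^bold>\<cdot> ?K"
  have "W \<tturnstile> Eq (Seq \<sigma>) (tail_fn \<sigma> \<^bold>\<cdot> prep \<sigma> a s) (?step \<^bold>\<cdot> a \<^bold>\<cdot> s \<^bold>\<cdot> (tail_fn \<sigma> \<^bold>\<cdot> s))"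
    unfolding tail_fn_def by (rule forces_lrec_prep) (use assms in auto)
  also have "W \<tturnstile> Eq (Seq \<sigma>) (?step \<^bold>\<cdot> a \<^bold>\<cdot> s \<^bold>\<cdot> (tail_fn \<sigma> \<^bold>\<cdot> s)) (?K \<^bold>\<cdot> s \<^bold>\<cdot> (tail_fn \<sigma> \<^bold>\<cdot> s))"
    by (rule forces_eq_fun[OF forces_eq_fun[OF forces_comb_k]]) (use assms in auto)
  also have "W \<tturnstile> Eq (Seq \<sigma>) (?K \<^bold>\<cdot> s \<^bold>\<cdot> (tail_fn \<sigma> \<^bold>\<cdot> s)) s"
    by (rule forces_comb_k) (use assms in auto)
  finally show ?thesis .
qed

lemma forces_drop_zero: "s \<^bold>: Seq \<sigma> \<Longrightarrow> W \<tturnstile> Eq (Seq \<sigma>) (drop_tm \<sigma> s zero) s"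
  unfolding drop_tm_def by (rule forces_rec_zero) auto

lemma forces_drop_suc:
  assumes "s \<^bold>: Seq \<sigma>" "i \<^bold>: N"
  shows "W \<tturnstile> Eq (Seq \<sigma>) (drop_tm \<sigma> s (suc i)) (tail_fn \<sigma> \<^bold>\<cdot> drop_tm \<sigma> s i)"
proof -
  let ?step = "Cst (CombK (Seq \<sigma> \<^bold>\<rightarrow> Seq \<sigma>) N) \<^bold>\<cdot> tail_fn \<sigma>"
  have "W \<tturnstile> Eq (Seq \<sigma>) (drop_tm \<sigma> s (suc i)) (?step \<^bold>\<cdot> i \<^bold>\<cdot> drop_tm \<sigma> s i)"
    unfolding drop_tm_def by (rule forces_rec_suc) (use assms in auto)
  also have "W \<tturnstile> Eq (Seq \<sigma>) (?step \<^bold>\<cdot> i \<^bold>\<cdot> drop_tm \<sigma> s i) (tail_fn \<sigma> \<^bold>\<cdot> drop_tm \<sigma> s i)"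
    by (rule forces_eq_fun[OF forces_comb_k]) (use assms in auto)
  finally show ?thesis .
qed

lemma term_ctxt_len: "term_ctxt \<rho> (Seq \<sigma>) f \<Longrightarrow> term_ctxt \<rho> N (\<lambda>t. len_tm \<sigma> (f t))"
  unfolding len_tm_def by (rule term_ctxt_App[OF term_ctxt_const]) auto

lemma term_ctxt_head: "term_ctxt \<rho> (Seq \<sigma>) f \<Longrightarrow> term_ctxt \<rho> \<sigma> (\<lambda>t. head_tm \<sigma> (f t))"
  unfolding head_tm_def by (rule term_ctxt_App[OF term_ctxt_const]) auto

lemma term_ctxt_drop:
  "s \<^bold>: Seq \<sigma> \<Longrightarrow> term_ctxt \<rho> N f \<Longrightarrow> term_ctxt \<rho> (Seq \<sigma>) (\<lambda>t. drop_tm \<sigma> s (f t))"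
  unfolding drop_tm_def by (rule term_ctxt_App[OF term_ctxt_const]) auto

lemma term_ctxt_nth:
  "s \<^bold>: Seq \<sigma> \<Longrightarrow> term_ctxt \<rho> N f \<Longrightarrow> term_ctxt \<rho> \<sigma> (\<lambda>t. nth_tm \<sigma> s (f t))"
  unfolding nth_tm_drop by (intro term_ctxt_head term_ctxt_drop)

lemma term_ctxt_append:
  "term_ctxt \<rho> (Seq \<sigma>) f \<Longrightarrow> t \<^bold>: Seq \<sigma> \<Longrightarrow> term_ctxt \<rho> (Seq \<sigma>) (\<lambda>x. append_tm \<sigma> (f x) t)"
  unfolding append_tm_def by (rule term_ctxt_App[OF term_ctxt_const]) auto

lemma formula_ctxt_Mem:
  "term_ctxt \<rho> \<sigma> f \<Longrightarrow> term_ctxt \<rho> (Seq \<sigma>) g \<Longrightarrow> formula_ctxt \<rho> (\<lambda>t. Mem \<sigma> (f t) (g t))"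
  by (rule formula_ctxt_relation) simp_all

lemma forces_drop_prep_suc:
  assumes "a \<^bold>: \<sigma>" "s \<^bold>: Seq \<sigma>" "i \<^bold>: N"
  shows "W \<tturnstile> Eq (Seq \<sigma>) (drop_tm \<sigma> (prep \<sigma> a s) (suc i)) (drop_tm \<sigma> s i)"
    (is "W \<tturnstile> ?Q i")
proof (rule forces_nat_induct[where Q = ?Q, OF _ assms(3)])
  let ?as = "prep \<sigma> a s" and ?tail = "\<lambda>s. tail_fn \<sigma> \<^bold>\<cdot> s"
  have prep: "?as \<^bold>: Seq \<sigma>" using assms by auto
  show "formula_ctxt N ?Q"
    by (intro formula_ctxt_Eq term_ctxt_drop term_ctxt_suc term_ctxt_id assms prep)
  have tail_cong: "W \<tturnstile> Eq (Seq \<sigma>) (?tail t) (?tail u)" if "W \<tturnstile> Eq (Seq \<sigma>) t u" for W t u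
    using that by (rule forces_eq_app[OF forces_eq_refl, rotated]) simp
  have "W \<tturnstile> Eq (Seq \<sigma>) (drop_tm \<sigma> ?as (suc zero)) (?tail (drop_tm \<sigma> ?as zero))"
    by (rule forces_drop_suc[OF prep]) simp
  also have "W \<tturnstile> Eq (Seq \<sigma>) (?tail (drop_tm \<sigma> ?as zero)) (?tail ?as)"
    by (rule tail_cong[OF forces_drop_zero[OF prep]])
  also have "W \<tturnstile> Eq (Seq \<sigma>) (?tail ?as) s" by (rule forces_tail_prep[OF assms(1,2)])
  also have "W \<tturnstile> Eq (Seq \<sigma>) s (drop_tm \<sigma> s zero)"
    by (rule forces_eq_sym[OF forces_drop_zero[OF assms(2)]])
  finally show "W \<tturnstile> ?Q zero" .
  fix W' i assume i: "i \<^bold>: N" and IH: "W' \<tturnstile> ?Q i"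
  have "W' \<tturnstile> Eq (Seq \<sigma>) (drop_tm \<sigma> ?as (suc (suc i))) (?tail (drop_tm \<sigma> ?as (suc i)))"
    by (rule forces_drop_suc[OF prep]) (use i in simp)
  also have "W' \<tturnstile> Eq (Seq \<sigma>) (?tail (drop_tm \<sigma> ?as (suc i))) (?tail (drop_tm \<sigma> s i))"
    by (rule tail_cong[OF IH])
  also have "W' \<tturnstile> Eq (Seq \<sigma>) (?tail (drop_tm \<sigma> s i)) (drop_tm \<sigma> s (suc i))"
    by (rule forces_eq_sym[OF forces_drop_suc[OF assms(2) i]])
  finally show "W' \<tturnstile> ?Q (suc i)" .
qed

lemma forces_nth_prep_zero:
  assumes "a \<^bold>: \<sigma>" "s \<^bold>: Seq \<sigma>"
  shows "W \<tturnstile> Eq \<sigma> (nth_tm \<sigma> (prep \<sigma> a s) zero) a"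
proof -
  have "W \<tturnstile> Eq (Seq \<sigma>) (drop_tm \<sigma> (prep \<sigma> a s) zero) (prep \<sigma> a s)"
    by (rule forces_drop_zero) (use assms in auto)
  from forces_term_ctxt_cong[OF term_ctxt_head[OF term_ctxt_id] this] show ?thesis
    unfolding nth_tm_drop by (rule forces_eq_trans[OF _ forces_head_prep[OF assms]])
qed

lemma forces_nth_prep_suc:
  "a \<^bold>: \<sigma> \<Longrightarrow> s \<^bold>: Seq \<sigma> \<Longrightarrow> i \<^bold>: N \<Longrightarrow> W \<tturnstile> Eq \<sigma> (nth_tm \<sigma> (prep \<sigma> a s) (suc i)) (nth_tm \<sigma> s i)"
  unfolding nth_tm_drop
  by (rule forces_term_ctxt_cong[OF term_ctxt_head[OF term_ctxt_id] forces_drop_prep_suc])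

lemma forces_MemI:
  "W \<tturnstile> Less i (len_tm \<sigma> s) \<Longrightarrow> W \<tturnstile> Eq \<sigma> a (nth_tm \<sigma> s i) \<Longrightarrow> W \<tturnstile> Mem \<sigma> a s"
  unfolding Mem_def by (rule forces_exI[of _ i]) (auto simp: finst_def dest: forces_EqD)

lemma forces_MemE:
  assumes "W \<tturnstile> Mem \<sigma> a s" "well_formed [] \<chi>"
    and "\<And>W' i. W \<le> W' \<Longrightarrow> i \<^bold>: N \<Longrightarrow> W' \<tturnstile> Less i (len_tm \<sigma> s) \<Longrightarrow>
      W' \<tturnstile> Eq \<sigma> a (nth_tm \<sigma> s i) \<Longrightarrow> W' \<tturnstile> \<chi>"
  shows "W \<tturnstile> \<chi>"
  using assms(1) unfolding Mem_def
  by (rule forces_exE) (use assms(2,3) in \<open>auto simp: finst_def\<close>)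

lemma forces_MemD: "W \<tturnstile> Mem \<sigma> a s \<Longrightarrow> a \<^bold>: \<sigma> \<and> s \<^bold>: Seq \<sigma>"
  by (drule forces_well_formed) simp

lemma forces_Mem_cong:
  assumes "W \<tturnstile> Mem \<sigma> a s" "W \<tturnstile> Eq \<sigma> a b" "W \<tturnstile> Eq (Seq \<sigma>) s t"
  shows "W \<tturnstile> Mem \<sigma> b t"
proof -
  have "W \<tturnstile> Mem \<sigma> b s"
    using assms(2,1) by (rule forces_formula_ctxt_cong[where Q = "\<lambda>x. Mem \<sigma> x s", rotated])
      (use forces_MemD[OF assms(1)] in \<open>simp add: formula_ctxt_Mem term_ctxt_id term_ctxt_const\<close>)
  with assms(3) show ?thesis
    by (rule forces_formula_ctxt_cong[where Q = "Mem \<sigma> b", rotated])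
      (use forces_EqD[OF assms(2)] in \<open>simp add: formula_ctxt_Mem term_ctxt_id term_ctxt_const\<close>)
qed

lemma forces_Mem_emptyD:
  assumes "W \<tturnstile> Mem \<sigma> a (Cst (Empty \<sigma>))"
  shows "W \<tturnstile> Bot"
proof (rule forces_MemE[OF assms])
  fix W' i assume "i \<^bold>: N" "W' \<tturnstile> Less i (len_tm \<sigma> (Cst (Empty \<sigma>)))"
  then have "W' \<tturnstile> Less i zero"
    by (intro forces_formula_ctxt_cong[OF formula_ctxt_Less[OF term_ctxt_const term_ctxt_id]
          forces_len_empty])
  then show "W' \<tturnstile> Bot" by (rule forces_less_zeroD)
qed simp

lemma forces_less_len_prep:
  assumes "a \<^bold>: \<sigma>" "s \<^bold>: Seq \<sigma>" "i \<^bold>: N"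
  shows "W \<tturnstile> Less i (len_tm \<sigma> (prep \<sigma> a s)) \<longleftrightarrow> W \<tturnstile> Less i (suc (len_tm \<sigma> s))"
  using forces_formula_ctxt_cong[OF formula_ctxt_Less[OF term_ctxt_const[OF assms(3)] term_ctxt_id]]
    forces_len_prep[OF assms(1,2)] forces_eq_sym by blast

lemma forces_Mem_prep_head:
  assumes "a \<^bold>: \<sigma>" "s \<^bold>: Seq \<sigma>"
  shows "W \<tturnstile> Mem \<sigma> a (prep \<sigma> a s)"
proof (rule forces_MemI)
  show "W \<tturnstile> Less zero (len_tm \<sigma> (prep \<sigma> a s))"
    using assms by (simp add: forces_less_len_prep forces_zero_less_suc)
  show "W \<tturnstile> Eq \<sigma> a (nth_tm \<sigma> (prep \<sigma> a s) zero)"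
    by (rule forces_eq_sym[OF forces_nth_prep_zero[OF assms]])
qed

lemma forces_Mem_prep_tail:
  assumes "a \<^bold>: \<sigma>" "W \<tturnstile> Mem \<sigma> x s"
  shows "W \<tturnstile> Mem \<sigma> x (prep \<sigma> a s)"
proof (rule forces_MemE[OF assms(2)])
  have s: "x \<^bold>: \<sigma>" "s \<^bold>: Seq \<sigma>" using forces_MemD[OF assms(2)] by auto
  then show "well_formed [] (Mem \<sigma> x (prep \<sigma> a s))" using assms(1) by auto
  fix W' i assume i: "i \<^bold>: N" and less: "W' \<tturnstile> Less i (len_tm \<sigma> s)"
    and nth: "W' \<tturnstile> Eq \<sigma> x (nth_tm \<sigma> s i)"
  show "W' \<tturnstile> Mem \<sigma> x (prep \<sigma> a s)"
  proof (rule forces_MemI)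
    show "W' \<tturnstile> Less (suc i) (len_tm \<sigma> (prep \<sigma> a s))"
      using assms(1) s i less by (simp add: forces_less_len_prep forces_suc_less_suc)
    show "W' \<tturnstile> Eq \<sigma> x (nth_tm \<sigma> (prep \<sigma> a s) (suc i))"
      using nth by (rule forces_eq_trans[OF _ forces_eq_sym[OF forces_nth_prep_suc[OF assms(1)
        s(2) i]]])
  qed
qed

lemma forces_Mem_prepE:
  assumes "W \<tturnstile> Mem \<sigma> x (prep \<sigma> a s)"
    and \<chi>: "well_formed [] \<chi>" "internal \<chi>" "or_free \<chi>"
    and head: "\<And>W'. W \<le> W' \<Longrightarrow> W' \<tturnstile> Eq \<sigma> x a \<Longrightarrow> W' \<tturnstile> \<chi>"
    and tail: "\<And>W'. W \<le> W' \<Longrightarrow> W' \<tturnstile> Mem \<sigma> x s \<Longrightarrow> W' \<tturnstile> \<chi>"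
  shows "W \<tturnstile> \<chi>"
proof (rule forces_MemE[OF assms(1) \<chi>(1)])
  let ?as = "prep \<sigma> a s"
  have as: "a \<^bold>: \<sigma>" "s \<^bold>: Seq \<sigma>" using forces_MemD[OF assms(1)] by auto
  fix W1 i assume W1: "W \<le> W1" and i: "i \<^bold>: N"
    and less: "W1 \<tturnstile> Less i (len_tm \<sigma> ?as)" and nth: "W1 \<tturnstile> Eq \<sigma> x (nth_tm \<sigma> ?as i)"
  have nth_cong: "W2 \<tturnstile> Eq \<sigma> x (nth_tm \<sigma> ?as j)" if "W1 \<le> W2" "W2 \<tturnstile> Eq N i j" for W2 j
    using forces_eq_trans[OF forces_mono[OF nth that(1)]]
      forces_term_ctxt_cong[OF term_ctxt_nth[OF _ term_ctxt_id] that(2)] as by simp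
  show "W1 \<tturnstile> \<chi>"
  proof (rule forces_nat_cases[OF i \<chi>])
    fix W2 assume "W1 \<le> W2" "W2 \<tturnstile> Eq N i zero"
    then show "W2 \<tturnstile> \<chi>"
      using head[OF _ forces_eq_trans[OF nth_cong forces_nth_prep_zero[OF as]]] W1 order_trans
      by blast
  next
    fix W2 j assume W2: "W1 \<le> W2" and j: "j \<^bold>: N" and eq: "W2 \<tturnstile> Eq N i (suc j)"
    have "W2 \<tturnstile> Less (suc j) (len_tm \<sigma> ?as)"
      by (rule forces_formula_ctxt_cong[OF formula_ctxt_Less[OF term_ctxt_id term_ctxt_const] eq
            forces_mono[OF less W2]]) (use as in auto)
    then have "W2 \<tturnstile> Less j (len_tm \<sigma> s)"
      using as j by (simp add: forces_less_len_prep forces_suc_less_suc)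
    moreover have "W2 \<tturnstile> Eq \<sigma> x (nth_tm \<sigma> s j)"
      by (rule forces_eq_trans[OF nth_cong[OF W2 eq] forces_nth_prep_suc[OF as j]])
    ultimately show "W2 \<tturnstile> \<chi>" by (intro tail[OF order_trans[OF W1 W2]] forces_MemI)
  qed
qed

lemma forces_Ex_prepE:
  assumes "W \<tturnstile> Ex \<sigma> (Ex (Seq \<sigma>) (Eq (Seq \<sigma>) (tlift 2 s) (prep \<sigma> (Var 1) (Var 0))))"
    and "well_formed [] \<chi>"
    and "\<And>W' a s'. W \<le> W' \<Longrightarrow> a \<^bold>: \<sigma> \<Longrightarrow> s' \<^bold>: Seq \<sigma> \<Longrightarrow> W' \<tturnstile> Eq (Seq \<sigma>) s (prep \<sigma> a s') \<Longrightarrow> W' \<tturnstile> \<chi>"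
  shows "W \<tturnstile> \<chi>"
  using assms(1)
proof (rule forces_exE[OF _ assms(2)])
  fix W1 a assume W1: "W \<le> W1" and a: "a \<^bold>: \<sigma>"
    and "W1 \<tturnstile> finst a (Ex (Seq \<sigma>) (Eq (Seq \<sigma>) (tlift 2 s) (prep \<sigma> (Var 1) (Var 0))))"
  then have "W1 \<tturnstile> Ex (Seq \<sigma>) (Eq (Seq \<sigma>) (tlift 1 s) (prep \<sigma> (tlift 1 a) (Var 0)))"
    by (simp add: numeral_2_eq_2 tsubst_up_tlift)
  then show "W1 \<tturnstile> \<chi>"
  proof (rule forces_exE[OF _ assms(2)])
    fix W2 s'
    assume W2: "W1 \<le> W2" and s': "s' \<^bold>: Seq \<sigma>"
      and "W2 \<tturnstile> finst s' (Eq (Seq \<sigma>) (tlift 1 s) (prep \<sigma> (tlift 1 a) (Var 0)))"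
    then show "W2 \<tturnstile> \<chi>" by (intro assms(3)[OF order_trans[OF W1 W2] a s']) simp
  qed
qed

lemma forces_seq_cases:
  assumes s: "s \<^bold>: Seq \<sigma>" and \<chi>: "well_formed [] \<chi>" "internal \<chi>" "or_free \<chi>"
    and empty: "\<And>W'. W \<le> W' \<Longrightarrow> W' \<tturnstile> Eq (Seq \<sigma>) s (Cst (Empty \<sigma>)) \<Longrightarrow> W' \<tturnstile> \<chi>"
    and prep: "\<And>W' a s'. W \<le> W' \<Longrightarrow> a \<^bold>: \<sigma> \<Longrightarrow> s' \<^bold>: Seq \<sigma> \<Longrightarrow>
      W' \<tturnstile> Eq (Seq \<sigma>) s (prep \<sigma> a s') \<Longrightarrow> W' \<tturnstile> \<chi>"
  shows "W \<tturnstile> \<chi>"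
proof -
  have "typed [Seq \<sigma>, \<sigma>, N] (tlift 3 s) (Seq \<sigma>)"
    using typed_tlift[OF s, of "[Seq \<sigma>, \<sigma>, N]" 3] by simp
  then have "W \<tturnstile> Ex N (And (Imp (Eq N (Var 0) zero) (Eq (Seq \<sigma>) (tlift 1 s) (Cst (Empty \<sigma>))))
    (Imp (Neg (Eq N (Var 0) zero))
      (Ex \<sigma> (Ex (Seq \<sigma>) (Eq (Seq \<sigma>) (tlift 3 s) (prep \<sigma> (Var 1) (Var 0)))))))"
    using s by (intro forces_ax UnI1 EHA_or_ax.seq_cases) auto
  then show ?thesis
  proof (rule forces_exE[OF _ \<chi>(1)])
    let ?P = "Ex \<sigma> (Ex (Seq \<sigma>) (Eq (Seq \<sigma>) (tlift 2 s) (prep \<sigma> (Var 1) (Var 0))))"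
    fix W1 n assume W1: "W \<le> W1" and n: "n \<^bold>: N"
      and "W1 \<tturnstile> finst n (And (Imp (Eq N (Var 0) zero) (Eq (Seq \<sigma>) (tlift 1 s) (Cst (Empty \<sigma>))))
        (Imp (Neg (Eq N (Var 0) zero))
          (Ex \<sigma> (Ex (Seq \<sigma>) (Eq (Seq \<sigma>) (tlift 3 s) (prep \<sigma> (Var 1) (Var 0)))))))"
    then have zero: "W1 \<tturnstile> Imp (Eq N n zero) (Eq (Seq \<sigma>) s (Cst (Empty \<sigma>)))"
      and nonzero: "W1 \<tturnstile> Imp (Neg (Eq N n zero)) ?P"
      by (simp_all add: numeral_3_eq_3 numeral_2_eq_2 tsubst_up_tlift)
    show "W1 \<tturnstile> \<chi>"
    proof (rule forces_nat_cases[OF n \<chi>])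
      fix W2 assume W2: "W1 \<le> W2" and "W2 \<tturnstile> Eq N n zero"
      then show "W2 \<tturnstile> \<chi>"
        by (intro empty[OF order_trans[OF W1 W2]] forces_mp[OF forces_mono[OF zero W2]])
    next
      fix W2 m assume W2: "W1 \<le> W2" and "W2 \<tturnstile> Eq N n (suc m)"
      then have "W2 \<tturnstile> ?P" by (intro forces_mp[OF forces_mono[OF nonzero W2]] forces_Neg_eq_zero)
      then show "W2 \<tturnstile> \<chi>"
      proof (rule forces_Ex_prepE[OF _ \<chi>(1)])
        fix W3 a s'
        assume "W2 \<le> W3" "a \<^bold>: \<sigma>" "s' \<^bold>: Seq \<sigma>" "W3 \<tturnstile> Eq (Seq \<sigma>) s (prep \<sigma> a s')"
        then show "W3 \<tturnstile> \<chi>" by (intro prep[OF order_trans[OF W1 order_trans[OF W2]]])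
      qed
    qed
  qed
qed

lemma formula_ctxt_fibre:
  assumes "formula_ctxt \<sigma> Q" "term_ctxt \<sigma> \<tau> g"
  obtains P where "formula_ctxt \<tau> P"
    "\<And>W n. n \<^bold>: \<tau> \<Longrightarrow> W \<tturnstile> P n \<longleftrightarrow> (\<forall>s. s \<^bold>: \<sigma> \<longrightarrow> W \<tturnstile> Imp (Eq \<tau> (g s) n) (Q s))"
proof -
  obtain \<phi> m where \<phi>: "wff (\<sigma> # ctx m) \<phi>" "internal \<phi>" "or_free \<phi>" "\<And>t. Q t = finst t \<phi>"
    using assms(1) unfolding formula_ctxt_def well_formed_def by auto
  obtain u k where u: "has_ty (\<sigma> # ctx k) u \<tau>" "\<And>t. g t = tsubst (case_nat t Var) u"
    using assms(2) unfolding term_ctxt_def typed_def by auto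
  let ?lift = "up (\<lambda>i. Var (Suc i))"
  let ?\<psi> = "Imp (Eq \<tau> (tsubst ?lift u) (Var 1)) (fsubst ?lift \<phi>)"
  let ?P = "\<lambda>n. finst n (All \<sigma> ?\<psi>)"
  have "typed_subst [\<sigma>, \<tau>] ?lift (\<sigma> # ctx n)" for n
    by (intro typed_subst_up) (simp add: typed_subst_def)
  then have wf: "well_formed [\<sigma>, \<tau>] ?\<psi>"
    using typed_tsubst[OF u(1)] well_formed_fsubst[OF \<phi>(1)] by simp
  show thesis
  proof (rule that)
    show "formula_ctxt \<tau> ?P"
      unfolding formula_ctxt_def by (intro HOL.exI[of _ "All \<sigma> ?\<psi>"]) (use wf \<phi> in simp)
    fix W n assume n: "n \<^bold>: \<tau>"
    have "finst s (fsubst (up (case_nat n Var)) ?\<psi>) = Imp (Eq \<tau> (g s) n) (Q s)" for s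
    proof -
      have "tsubst (case_nat s (case_nat n Var)) (?lift i) = case_nat s Var i" for i
        by (cases i) auto
      then show ?thesis
        unfolding finst_fsubst_up by (simp add: fsubst_fsubst tsubst_tsubst \<phi>(4) u(2) finst_def)
    qed
    moreover have "well_formed [\<sigma>] (fsubst (up (case_nat n Var)) ?\<psi>)"
      using well_formed_finst[of \<tau> "All \<sigma> ?\<psi>" n] wf n by simp
    ultimately show "W \<tturnstile> ?P n \<longleftrightarrow> (\<forall>s. s \<^bold>: \<sigma> \<longrightarrow> W \<tturnstile> Imp (Eq \<tau> (g s) n) (Q s))"
      by (simp only: finst_simps forces_All)
  qed
qed

lemma forces_len_cases:
  assumes Q: "formula_ctxt (Seq \<sigma>) Q" and typed: "s \<^bold>: Seq \<sigma>" "n \<^bold>: N"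
    and empty: "W \<tturnstile> Q (Cst (Empty \<sigma>))"
    and prep: "\<And>W' a s'. W \<le> W' \<Longrightarrow> a \<^bold>: \<sigma> \<Longrightarrow> s' \<^bold>: Seq \<sigma> \<Longrightarrow>
      W' \<tturnstile> Eq N n (suc (len_tm \<sigma> s')) \<Longrightarrow> W' \<tturnstile> Q (prep \<sigma> a s')"
  shows "W \<tturnstile> Imp (Eq N (len_tm \<sigma> s) n) (Q s)"
proof (rule forces_ImpI)
  fix W1 assume W1: "W \<le> W1" and len: "W1 \<tturnstile> Eq N (len_tm \<sigma> s) n"
  show "W1 \<tturnstile> Q s"
  proof (rule forces_seq_cases[OF typed(1)])
    fix W2 assume W2: "W1 \<le> W2" and eq: "W2 \<tturnstile> Eq (Seq \<sigma>) s (Cst (Empty \<sigma>))"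
    show "W2 \<tturnstile> Q s"
      by (rule forces_formula_ctxt_cong[OF Q forces_eq_sym[OF eq] forces_mono[OF empty]])
        (rule order_trans[OF W1 W2])
  next
    fix W2 a s' assume W2: "W1 \<le> W2" and a: "a \<^bold>: \<sigma>" and s': "s' \<^bold>: Seq \<sigma>"
      and eq: "W2 \<tturnstile> Eq (Seq \<sigma>) s (prep \<sigma> a s')"
    have "W2 \<tturnstile> Eq N n (len_tm \<sigma> s)" by (rule forces_eq_sym[OF forces_mono[OF len W2]])
    also have "W2 \<tturnstile> Eq N (len_tm \<sigma> s) (len_tm \<sigma> (prep \<sigma> a s'))"
      by (rule forces_term_ctxt_cong[OF term_ctxt_len[OF term_ctxt_id] eq])
    also have "W2 \<tturnstile> Eq N (len_tm \<sigma> (prep \<sigma> a s')) (suc (len_tm \<sigma> s'))"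
      by (rule forces_len_prep[OF a s'])
    finally have "W2 \<tturnstile> Q (prep \<sigma> a s')" by (rule prep[OF order_trans[OF W1 W2] a s'])
    then show "W2 \<tturnstile> Q s" by (rule forces_formula_ctxt_cong[OF Q forces_eq_sym[OF eq]])
  qed (use formula_ctxtD[OF Q typed(1)] in auto)
qed (use typed in auto)

text \<open>Induction on the length, since the theory only has induction on numbers.\<close>

lemma forces_seq_induct:
  assumes Q: "formula_ctxt (Seq \<sigma>) Q" and s: "s \<^bold>: Seq \<sigma>"
    and empty: "W \<tturnstile> Q (Cst (Empty \<sigma>))"
    and prep: "\<And>W' a s. W \<le> W' \<Longrightarrow> a \<^bold>: \<sigma> \<Longrightarrow> s \<^bold>: Seq \<sigma> \<Longrightarrow> W' \<tturnstile> Q s \<Longrightarrow> W' \<tturnstile> Q (prep \<sigma> a s)"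
  shows "W \<tturnstile> Q s"
proof -
  obtain P where P: "formula_ctxt N P" "\<And>W n. n \<^bold>: N \<Longrightarrow>
      W \<tturnstile> P n \<longleftrightarrow> (\<forall>s. s \<^bold>: Seq \<sigma> \<longrightarrow> W \<tturnstile> Imp (Eq N (len_tm \<sigma> s) n) (Q s))"
    using formula_ctxt_fibre[OF Q term_ctxt_len[OF term_ctxt_id]] by blast
  have "W \<tturnstile> P (len_tm \<sigma> s)"
  proof (rule forces_nat_induct[OF P(1)])
    have "W \<tturnstile> Imp (Eq N (len_tm \<sigma> s) zero) (Q s)" if "s \<^bold>: Seq \<sigma>" for s
    proof (rule forces_len_cases[OF Q that _ empty])
      fix W' a s'
      assume typed: "a \<^bold>: \<sigma>" "s' \<^bold>: Seq \<sigma>" and eq: "W' \<tturnstile> Eq N zero (suc (len_tm \<sigma> s'))"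
      show "W' \<tturnstile> Q (prep \<sigma> a s')"
        by (rule forces_BotE[OF forces_suc_eq_zeroD[OF forces_eq_sym[OF eq]]])
          (use formula_ctxtD[OF Q, of "prep \<sigma> a s'"] typed in auto)
    qed simp
    then show "W \<tturnstile> P zero" by (simp add: P(2))
  next
    fix W1 n assume W1: "W \<le> W1" and n: "n \<^bold>: N" and IH: "W1 \<tturnstile> P n"
    have "W1 \<tturnstile> Imp (Eq N (len_tm \<sigma> s) (suc n)) (Q s)" if "s \<^bold>: Seq \<sigma>" for s
    proof (rule forces_len_cases[OF Q that _ forces_mono[OF empty W1]])
      fix W2 a s' assume W2: "W1 \<le> W2" and a: "a \<^bold>: \<sigma>" and s': "s' \<^bold>: Seq \<sigma>"
        and eq: "W2 \<tturnstile> Eq N (suc n) (suc (len_tm \<sigma> s'))"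
      have "W2 \<tturnstile> Imp (Eq N (len_tm \<sigma> s') n) (Q s')"
        using forces_mono[OF IH W2] s' by (simp add: P(2)[OF n])
      then have "W2 \<tturnstile> Q s'" using forces_eq_sym[OF forces_suc_injectD[OF eq]] by (rule forces_mp)
      then show "W2 \<tturnstile> Q (prep \<sigma> a s')" by (rule prep[OF order_trans[OF W1 W2] a s'])
    qed (use n in simp)
    then show "W1 \<tturnstile> P (suc n)" using n by (simp add: P(2))
  qed (use s in simp)
  then have "W \<tturnstile> Imp (Eq N (len_tm \<sigma> s) (len_tm \<sigma> s)) (Q s)"
    using s by (simp add: P(2))
  then show ?thesis by (rule forces_mp) (use s in \<open>simp add: forces_eq_refl\<close>)
qed

lemma forces_append_empty:
  "t \<^bold>: Seq \<sigma> \<Longrightarrow> W \<tturnstile> Eq (Seq \<sigma>) (append_tm \<sigma> (Cst (Empty \<sigma>)) t) t"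
  unfolding append_tm_def by (rule forces_lrec_empty) simp_all

lemma forces_append_prep:
  assumes "a \<^bold>: \<sigma>" "s \<^bold>: Seq \<sigma>" "t \<^bold>: Seq \<sigma>"
  shows "W \<tturnstile> Eq (Seq \<sigma>) (append_tm \<sigma> (prep \<sigma> a s) t) (prep \<sigma> a (append_tm \<sigma> s t))"
proof -
  let ?P = "Cst (Prep \<sigma>)" and ?K = "Cst (CombK (Seq \<sigma> \<^bold>\<rightarrow> Seq \<sigma>) (Seq \<sigma>))"
  let ?KK = "Cst (CombK ((Seq \<sigma> \<^bold>\<rightarrow> Seq \<sigma>) \<^bold>\<rightarrow> Seq \<sigma> \<^bold>\<rightarrow> Seq \<sigma> \<^bold>\<rightarrow> Seq \<sigma>) \<sigma>) \<^bold>\<cdot> ?K"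
  let ?st = "append_tm \<sigma> s t"
  have "W \<tturnstile> Eq (Seq \<sigma> \<^bold>\<rightarrow> Seq \<sigma> \<^bold>\<rightarrow> Seq \<sigma>) (append_step \<sigma> \<^bold>\<cdot> a) (?KK \<^bold>\<cdot> a \<^bold>\<cdot> (?P \<^bold>\<cdot> a))"
    unfolding append_step_def by (rule forces_comb_s) (use assms in auto)
  also have "W \<tturnstile> Eq (Seq \<sigma> \<^bold>\<rightarrow> Seq \<sigma> \<^bold>\<rightarrow> Seq \<sigma>) (?KK \<^bold>\<cdot> a \<^bold>\<cdot> (?P \<^bold>\<cdot> a)) (?K \<^bold>\<cdot> (?P \<^bold>\<cdot> a))"
    by (rule forces_eq_fun[OF forces_comb_k]) (use assms in auto)
  finally have step: "W \<tturnstile> Eq (Seq \<sigma> \<^bold>\<rightarrow> Seq \<sigma> \<^bold>\<rightarrow> Seq \<sigma>) (append_step \<sigma> \<^bold>\<cdot> a) (?K \<^bold>\<cdot> (?P \<^bold>\<cdot> a))" .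
  have "W \<tturnstile> Eq (Seq \<sigma>) (append_tm \<sigma> (prep \<sigma> a s) t) (append_step \<sigma> \<^bold>\<cdot> a \<^bold>\<cdot> s \<^bold>\<cdot> ?st)"
    unfolding append_tm_def by (rule forces_lrec_prep) (use assms in auto)
  also have "W \<tturnstile> Eq (Seq \<sigma>) (append_step \<sigma> \<^bold>\<cdot> a \<^bold>\<cdot> s \<^bold>\<cdot> ?st) (?K \<^bold>\<cdot> (?P \<^bold>\<cdot> a) \<^bold>\<cdot> s \<^bold>\<cdot> ?st)"
    by (rule forces_eq_fun[OF forces_eq_fun[OF step]]) (use assms in auto)
  also have "W \<tturnstile> Eq (Seq \<sigma>) (?K \<^bold>\<cdot> (?P \<^bold>\<cdot> a) \<^bold>\<cdot> s \<^bold>\<cdot> ?st) (prep \<sigma> a ?st)"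
    by (rule forces_eq_fun[OF forces_comb_k]) (use assms in auto)
  finally show ?thesis .
qed

lemma forces_Mem_append_right:
  assumes s: "s \<^bold>: Seq \<sigma>" and mem: "W \<tturnstile> Mem \<sigma> x t"
  shows "W \<tturnstile> Mem \<sigma> x (append_tm \<sigma> s t)"
proof (rule forces_seq_induct[where Q = "\<lambda>s. Mem \<sigma> x (append_tm \<sigma> s t)", OF _ s])
  have typed: "x \<^bold>: \<sigma>" "t \<^bold>: Seq \<sigma>" using forces_MemD[OF mem] by auto
  then show "formula_ctxt (Seq \<sigma>) (\<lambda>s. Mem \<sigma> x (append_tm \<sigma> s t))"
    by (intro formula_ctxt_Mem term_ctxt_append term_ctxt_const term_ctxt_id)
  show "W \<tturnstile> Mem \<sigma> x (append_tm \<sigma> (Cst (Empty \<sigma>)) t)"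
    using typed
    by (intro forces_Mem_cong[OF mem forces_eq_refl forces_eq_sym[OF forces_append_empty]])
  fix W' a s assume a: "a \<^bold>: \<sigma>" and s: "s \<^bold>: Seq \<sigma>" and IH: "W' \<tturnstile> Mem \<sigma> x (append_tm \<sigma> s t)"
  show "W' \<tturnstile> Mem \<sigma> x (append_tm \<sigma> (prep \<sigma> a s) t)"
    using typed a s by (intro forces_Mem_cong[OF forces_Mem_prep_tail[OF a IH] forces_eq_refl
          forces_eq_sym[OF forces_append_prep]])
qed

lemma forces_Mem_append_left:
  assumes t: "t \<^bold>: Seq \<sigma>" and mem: "W \<tturnstile> Mem \<sigma> x s"
  shows "W \<tturnstile> Mem \<sigma> x (append_tm \<sigma> s t)"
proof -
  let ?Q = "\<lambda>s. Imp (Mem \<sigma> x s) (Mem \<sigma> x (append_tm \<sigma> s t))"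
  have x: "x \<^bold>: \<sigma>" and s: "s \<^bold>: Seq \<sigma>" using forces_MemD[OF mem] by auto
  have "W \<tturnstile> ?Q s"
  proof (rule forces_seq_induct[where Q = ?Q, OF _ s])
    show "formula_ctxt (Seq \<sigma>) ?Q"
      by (intro formula_ctxt_Imp formula_ctxt_Mem term_ctxt_append term_ctxt_const term_ctxt_id x t)
    show "W \<tturnstile> ?Q (Cst (Empty \<sigma>))"
    proof (rule forces_ImpI)
      fix W' assume "W' \<tturnstile> Mem \<sigma> x (Cst (Empty \<sigma>))"
      then show "W' \<tturnstile> Mem \<sigma> x (append_tm \<sigma> (Cst (Empty \<sigma>)) t)"
        by (rule forces_BotE[OF forces_Mem_emptyD]) (use x t in simp_all)
    qed (use x in simp_all)
    fix W1 a s assume a: "a \<^bold>: \<sigma>" and s: "s \<^bold>: Seq \<sigma>" and IH: "W1 \<tturnstile> ?Q s"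
    let ?st = "append_tm \<sigma> s t" and ?ast = "append_tm \<sigma> (prep \<sigma> a s) t"
    have unfold: "W \<tturnstile> Eq (Seq \<sigma>) (prep \<sigma> a ?st) ?ast" for W
      by (rule forces_eq_sym[OF forces_append_prep[OF a s t]])
    show "W1 \<tturnstile> ?Q (prep \<sigma> a s)"
    proof (rule forces_ImpI)
      fix W2 assume W2: "W1 \<le> W2" and mem: "W2 \<tturnstile> Mem \<sigma> x (prep \<sigma> a s)"
      show "W2 \<tturnstile> Mem \<sigma> x ?ast"
      proof (rule forces_Mem_prepE[OF mem])
        fix W3 assume "W3 \<tturnstile> Eq \<sigma> x a"
        moreover have "W3 \<tturnstile> Mem \<sigma> a (prep \<sigma> a ?st)"
          by (rule forces_Mem_prep_head) (use a s t in auto)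
        ultimately show "W3 \<tturnstile> Mem \<sigma> x ?ast"
          using forces_Mem_cong[OF _ forces_eq_sym unfold] by blast
      next
        fix W3 assume W3: "W2 \<le> W3" and "W3 \<tturnstile> Mem \<sigma> x s"
        then have "W3 \<tturnstile> Mem \<sigma> x ?st"
          using forces_mp[OF forces_mono[OF IH order_trans[OF W2 W3]]] by blast
        then show "W3 \<tturnstile> Mem \<sigma> x ?ast"
          by (rule forces_Mem_cong[OF forces_Mem_prep_tail[OF a] forces_eq_refl[OF x] unfold])
      qed (use x a s t in auto)
    qed (use x a s in auto)
  qed
  then show ?thesis using mem by (rule forces_mp)
qed

end

section \<open>Combinatory completeness\<close>

definition inst :: "tm list \<Rightarrow> tm \<Rightarrow> tm" where
  "inst xs = tsubst (\<lambda>i. xs ! i)"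

lemma inst_simps [simp]:
  "inst xs (Var i) = xs ! i" "inst xs (Cst c) = Cst c" "inst xs (f \<^bold>\<cdot> t) = inst xs f \<^bold>\<cdot> inst xs t"
  by (simp_all add: inst_def)

lemma inst_closed: "has_ty [] t \<tau> \<Longrightarrow> inst xs t = t"
  unfolding inst_def by (rule tsubst_closed)

lemma has_ty_inst: "has_ty \<Gamma> t \<tau> \<Longrightarrow> list_all2 (has_ty \<Gamma>') xs \<Gamma> \<Longrightarrow> has_ty \<Gamma>' (inst xs t) \<tau>"
  unfolding inst_def
  by (erule has_ty_tsubst) (auto simp: subst_ty_def list_all2_conv_all_nth)

lemma inst_inst:
  "has_ty \<Gamma> t \<tau> \<Longrightarrow> length ts = length \<Gamma> \<Longrightarrow> inst (map (inst xs) ts) t = inst xs (inst ts t)"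
  unfolding inst_def tsubst_tsubst by (erule tsubst_cong) simp

lemma inst_append: "has_ty \<Gamma> t \<tau> \<Longrightarrow> length xs = length \<Gamma> \<Longrightarrow> inst (xs @ us) t = inst xs t"
  unfolding inst_def by (erule tsubst_cong) (simp add: nth_append)

lemma inst_apps: "inst xs (apps t us) = apps (inst xs t) (map (inst xs) us)"
  by (simp add: inst_def tsubst_apps)

context internal_theory
begin

lemma typed_inst: "has_ty \<Gamma> t \<tau> \<Longrightarrow> xs \<^bold>:\<^bold>: \<Gamma> \<Longrightarrow> inst xs t \<^bold>: \<tau>"
  unfolding inst_def
  by (erule typed_tsubst) (auto simp: typed_subst_def list_all2_conv_all_nth)

definition abstracts :: "ty list \<Rightarrow> ty \<Rightarrow> ty \<Rightarrow> tm \<Rightarrow> tm \<Rightarrow> bool" where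
  "abstracts \<Gamma> \<sigma> \<tau> t f \<longleftrightarrow> has_ty \<Gamma> f (\<sigma> \<^bold>\<rightarrow> \<tau>) \<and>
    (\<forall>W xs u. xs \<^bold>:\<^bold>: \<Gamma> \<longrightarrow> u \<^bold>: \<sigma> \<longrightarrow> W \<tturnstile> Eq \<tau> (inst xs f \<^bold>\<cdot> u) (inst (xs @ [u]) t))"

lemma abstracts_const:
  assumes "has_ty \<Gamma> t \<tau>"
  shows "abstracts \<Gamma> \<sigma> \<tau> t (Cst (CombK \<tau> \<sigma>) \<^bold>\<cdot> t)"
  unfolding abstracts_def
proof (intro conjI HOL.allI HOL.impI)
  fix W xs u assume "xs \<^bold>:\<^bold>: \<Gamma>" "u \<^bold>: \<sigma>"
  then show "W \<tturnstile> Eq \<tau> (inst xs (Cst (CombK \<tau> \<sigma>) \<^bold>\<cdot> t) \<^bold>\<cdot> u) (inst (xs @ [u]) t)"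
    using typed_inst[OF assms] inst_append[OF assms]
    by (auto simp: list_all2_lengthD intro: forces_comb_k)
qed (use assms in auto)

lemma abstracts_last_Var:
  "abstracts \<Gamma> \<sigma> \<sigma> (Var (length \<Gamma>))
    (Cst (CombS \<sigma> (\<sigma> \<^bold>\<rightarrow> \<sigma>) \<sigma>) \<^bold>\<cdot> Cst (CombK \<sigma> (\<sigma> \<^bold>\<rightarrow> \<sigma>)) \<^bold>\<cdot> Cst (CombK \<sigma> \<sigma>))"
  (is "abstracts \<Gamma> \<sigma> \<sigma> _ (?S \<^bold>\<cdot> ?K \<^bold>\<cdot> ?K')")
  unfolding abstracts_def
proof (intro conjI HOL.allI HOL.impI)
  fix W xs u assume xs: "xs \<^bold>:\<^bold>: \<Gamma>" and u: "u \<^bold>: \<sigma>"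
  have "W \<tturnstile> Eq \<sigma> (?S \<^bold>\<cdot> ?K \<^bold>\<cdot> ?K' \<^bold>\<cdot> u) (?K \<^bold>\<cdot> u \<^bold>\<cdot> (?K' \<^bold>\<cdot> u))"
    by (rule forces_comb_s) (use u in auto)
  also have "W \<tturnstile> Eq \<sigma> (?K \<^bold>\<cdot> u \<^bold>\<cdot> (?K' \<^bold>\<cdot> u)) u"
    by (rule forces_comb_k) (use u in auto)
  finally show "W \<tturnstile> Eq \<sigma> (inst xs (?S \<^bold>\<cdot> ?K \<^bold>\<cdot> ?K') \<^bold>\<cdot> u) (inst (xs @ [u]) (Var (length \<Gamma>)))"
    using list_all2_lengthD[OF xs] by (simp add: nth_append)
qed auto

lemma abstracts_App:
  assumes "abstracts \<Gamma> \<sigma> (\<rho> \<^bold>\<rightarrow> \<tau>) f f'" "abstracts \<Gamma> \<sigma> \<rho> t t'"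
  shows "abstracts \<Gamma> \<sigma> \<tau> (f \<^bold>\<cdot> t) (Cst (CombS \<sigma> \<rho> \<tau>) \<^bold>\<cdot> f' \<^bold>\<cdot> t')"
    (is "abstracts \<Gamma> \<sigma> \<tau> _ (?S \<^bold>\<cdot> f' \<^bold>\<cdot> t')")
  unfolding abstracts_def
proof (intro conjI HOL.allI HOL.impI)
  have typed: "has_ty \<Gamma> f' (\<sigma> \<^bold>\<rightarrow> \<rho> \<^bold>\<rightarrow> \<tau>)" "has_ty \<Gamma> t' (\<sigma> \<^bold>\<rightarrow> \<rho>)"
    using assms unfolding abstracts_def by auto
  then show "has_ty \<Gamma> (?S \<^bold>\<cdot> f' \<^bold>\<cdot> t') (\<sigma> \<^bold>\<rightarrow> \<tau>)" by auto
  fix W xs u assume xs: "xs \<^bold>:\<^bold>: \<Gamma>" and u: "u \<^bold>: \<sigma>"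
  have "W \<tturnstile> Eq \<tau> (?S \<^bold>\<cdot> inst xs f' \<^bold>\<cdot> inst xs t' \<^bold>\<cdot> u) (inst xs f' \<^bold>\<cdot> u \<^bold>\<cdot> (inst xs t' \<^bold>\<cdot> u))"
    by (rule forces_comb_s) (use typed_inst xs u typed in auto)
  also have "W \<tturnstile> Eq \<tau> (inst xs f' \<^bold>\<cdot> u \<^bold>\<cdot> (inst xs t' \<^bold>\<cdot> u)) (inst (xs @ [u]) (f \<^bold>\<cdot> t))"
    using assms xs u unfolding abstracts_def by (auto intro: forces_eq_app[of _ \<rho>])
  finally show "W \<tturnstile> Eq \<tau> (inst xs (?S \<^bold>\<cdot> f' \<^bold>\<cdot> t') \<^bold>\<cdot> u) (inst (xs @ [u]) (f \<^bold>\<cdot> t))" by simp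
qed

lemma bracket_abstraction: "has_ty (\<Gamma> @ [\<sigma>]) t \<tau> \<Longrightarrow> \<exists>f. abstracts \<Gamma> \<sigma> \<tau> t f"
proof (induction t arbitrary: \<tau>)
  case (Var i)
  then consider "has_ty \<Gamma> (Var i) \<tau>" | "i = length \<Gamma>" "\<tau> = \<sigma>"
    by (auto simp: nth_append less_Suc_eq split: if_splits)
  then show ?case by cases (use abstracts_const abstracts_last_Var in blast)+
next
  case (Cst c)
  then show ?case using abstracts_const[of \<Gamma> "Cst c"] by auto
next
  case (App f t)
  then show ?case using abstracts_App by fastforce
qed

theorem combinatory_completeness:
  "has_ty (\<Gamma> @ \<Gamma>') t \<tau> \<Longrightarrow> \<exists>f. has_ty \<Gamma> f (arrs \<Gamma>' \<tau>) \<and>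
    (\<forall>W xs us. xs \<^bold>:\<^bold>: \<Gamma> \<longrightarrow> us \<^bold>:\<^bold>: \<Gamma>' \<longrightarrow> W \<tturnstile> Eq \<tau> (apps (inst xs f) us) (inst (xs @ us) t))"
proof (induction \<Gamma>' arbitrary: t \<tau> rule: rev_induct)
  case Nil
  then show ?case by (auto intro!: HOL.exI[of _ t] forces_eq_refl typed_inst)
next
  case (snoc \<sigma> \<Gamma>')
  then obtain g where g: "abstracts (\<Gamma> @ \<Gamma>') \<sigma> \<tau> t g"
    using bracket_abstraction[of "\<Gamma> @ \<Gamma>'" \<sigma> t \<tau>] by auto
  then obtain f where f: "has_ty \<Gamma> f (arrs \<Gamma>' (\<sigma> \<^bold>\<rightarrow> \<tau>))"
    and eq: "\<And>W xs us. xs \<^bold>:\<^bold>: \<Gamma> \<Longrightarrow> us \<^bold>:\<^bold>: \<Gamma>' \<Longrightarrow>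
      W \<tturnstile> Eq (\<sigma> \<^bold>\<rightarrow> \<tau>) (apps (inst xs f) us) (inst (xs @ us) g)"
    using snoc.IH[of g "\<sigma> \<^bold>\<rightarrow> \<tau>"] unfolding abstracts_def by blast
  have "W \<tturnstile> Eq \<tau> (apps (inst xs f) us) (inst (xs @ us) t)"
    if xs: "xs \<^bold>:\<^bold>: \<Gamma>" and us: "us \<^bold>:\<^bold>: \<Gamma>' @ [\<sigma>]" for W xs us
  proof -
    obtain us' u where u: "us = us' @ [u]" "us' \<^bold>:\<^bold>: \<Gamma>'" "u \<^bold>: \<sigma>"
      using us by (auto simp: list_all2_append2 list_all2_Cons2)
    have "W \<tturnstile> Eq \<tau> (apps (inst xs f) us' \<^bold>\<cdot> u) (inst (xs @ us') g \<^bold>\<cdot> u)"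
      by (rule forces_eq_fun[OF eq[OF xs u(2)] u(3)])
    also have "W \<tturnstile> Eq \<tau> (inst (xs @ us') g \<^bold>\<cdot> u) (inst ((xs @ us') @ [u]) t)"
      using g list_all2_appendI[OF xs u(2)] u(3) unfolding abstracts_def by blast
    finally show ?thesis by (simp add: u(1) apps_append)
  qed
  then show ?case using f by (auto intro!: HOL.exI[of _ f])
qed

corollary closed_combinator:
  assumes "has_ty \<Gamma> t \<tau>"
  obtains f where "has_ty [] f (arrs \<Gamma> \<tau>)"
    "\<And>W us. us \<^bold>:\<^bold>: \<Gamma> \<Longrightarrow> W \<tturnstile> Eq \<tau> (apps f us) (inst us t)"
proof -
  obtain f where f: "has_ty [] f (arrs \<Gamma> \<tau>)" and
    f_eq: "\<And>W us. us \<^bold>:\<^bold>: \<Gamma> \<Longrightarrow> W \<tturnstile> Eq \<tau> (apps (inst [] f) us) (inst us t)"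
    using combinatory_completeness[of "[]" \<Gamma> t \<tau>] assms by auto
  show thesis by (rule that[OF f]) (use f_eq inst_closed[OF f] in simp)
qed

end

section \<open>Tuples of terms\<close>

fun list_all3 :: "('a \<Rightarrow> 'b \<Rightarrow> 'c \<Rightarrow> bool) \<Rightarrow> 'a list \<Rightarrow> 'b list \<Rightarrow> 'c list \<Rightarrow> bool" where
  "list_all3 P [] [] [] = True"
| "list_all3 P (a # as) (b # bs) (c # cs) = (P a b c \<and> list_all3 P as bs cs)"
| "list_all3 P _ _ _ = False"

lemma list_all3_conv_all_nth:
  "list_all3 P as bs cs \<longleftrightarrow> length bs = length as \<and> length cs = length as \<and>
    (\<forall>i<length as. P (as ! i) (bs ! i) (cs ! i))"
  by (induction P as bs cs rule: list_all3.induct) (auto simp: less_Suc_eq_0_disj)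

lemma list_all3_append:
  "length bs = length as \<Longrightarrow> length cs = length as \<Longrightarrow>
    list_all3 P (as @ as') (bs @ bs') (cs @ cs') \<longleftrightarrow> list_all3 P as bs cs \<and> list_all3 P as' bs' cs'"
  by (induction P as bs cs rule: list_all3.induct) auto

lemma list_all3_mono:
  "list_all3 P as bs cs \<Longrightarrow> (\<And>a b c. P a b c \<Longrightarrow> Q a b c) \<Longrightarrow> list_all3 Q as bs cs"
  by (simp add: list_all3_conv_all_nth)

lemma list_all2_split:
  assumes "list_all2 P xs (as @ bs)"
  shows "list_all2 P (take (length as) xs) as" "list_all2 P (drop (length as) xs) bs"
  using assms by (auto simp: list_all2_append2)

definition nulls :: "ty list \<Rightarrow> tm list" where
  "nulls \<tau>s = map null_tm \<tau>s"

definition singletons :: "ty list \<Rightarrow> tm list \<Rightarrow> tm list" where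
  "singletons \<tau>s ts = map2 (\<lambda>\<tau> t. prep \<tau> t (Cst (Empty \<tau>))) \<tau>s ts"

definition appends :: "ty list \<Rightarrow> tm list \<Rightarrow> tm list \<Rightarrow> tm list" where
  "appends \<tau>s Ss Ts = map2 (\<lambda>\<tau> (S, T). append_tm \<tau> S T) \<tau>s (zip Ss Ts)"

definition conds :: "ty list \<Rightarrow> tm \<Rightarrow> tm list \<Rightarrow> tm list \<Rightarrow> tm list" where
  "conds \<tau>s z ss ts = map2 (\<lambda>\<tau> (s, t). cond \<tau> z s t) \<tau>s (zip ss ts)"

text \<open>A bounded quantifier over a tuple of sequences is vacuous as soon as one of them is empty.
  To recover its instances for a single component, the other sequences are made nonempty.\<close>

definition pad :: "ty list \<Rightarrow> tm list \<Rightarrow> tm list" where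
  "pad \<tau>s Ss = map2 (\<lambda>\<tau> S. prep \<tau> (null_tm \<tau>) S) \<tau>s Ss"

lemma length_nulls [simp]: "length (nulls \<tau>s) = length \<tau>s"
  by (simp add: nulls_def)

lemma has_ty_nulls: "list_all2 (has_ty \<Gamma>) (nulls \<tau>s) \<tau>s"
  using has_ty_closed[OF has_ty_null] by (simp add: nulls_def list_all2_conv_all_nth)

context internal_theory
begin

abbreviation eqs :: "fm fset \<Rightarrow> ty list \<Rightarrow> tm list \<Rightarrow> tm list \<Rightarrow> bool" where
  "eqs W \<equiv> list_all3 (\<lambda>\<sigma> t u. W \<tturnstile> Eq \<sigma> t u)"

abbreviation mems :: "fm fset \<Rightarrow> ty list \<Rightarrow> tm list \<Rightarrow> tm list \<Rightarrow> bool" where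
  "mems W \<equiv> list_all3 (\<lambda>\<sigma> t s. W \<tturnstile> Mem \<sigma> t s)"

lemma eqs_mono: "eqs W \<sigma>s ts us \<Longrightarrow> W \<le> W' \<Longrightarrow> eqs W' \<sigma>s ts us"
  by (erule list_all3_mono) (rule forces_mono)

lemma mems_mono: "mems W \<sigma>s ts Ss \<Longrightarrow> W \<le> W' \<Longrightarrow> mems W' \<sigma>s ts Ss"
  by (erule list_all3_mono) (rule forces_mono)

lemma eqs_refl: "ts \<^bold>:\<^bold>: \<sigma>s \<Longrightarrow> eqs W \<sigma>s ts ts"
  by (simp add: list_all3_conv_all_nth list_all2_conv_all_nth forces_eq_refl)

lemma eqs_sym: "eqs W \<sigma>s ts us \<Longrightarrow> eqs W \<sigma>s us ts"
  by (simp add: list_all3_conv_all_nth forces_eq_sym)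

lemma eqs_trans: "eqs W \<sigma>s ts us \<Longrightarrow> eqs W \<sigma>s us vs \<Longrightarrow> eqs W \<sigma>s ts vs"
  by (simp add: list_all3_conv_all_nth) (metis forces_eq_trans)

lemma mems_cong: "mems W \<sigma>s ts Ss \<Longrightarrow> eqs W (map Seq \<sigma>s) Ss Ts \<Longrightarrow> mems W \<sigma>s ts Ts"
  by (auto simp: list_all3_conv_all_nth) (meson forces_Mem_cong forces_eq_refl forces_MemD)

lemma mems_typed: "mems W \<sigma>s ts Ss \<Longrightarrow> ts \<^bold>:\<^bold>: \<sigma>s"
  using forces_MemD by (auto simp: list_all3_conv_all_nth list_all2_conv_all_nth)

lemma nulls_typed: "nulls \<tau>s \<^bold>:\<^bold>: \<tau>s"
  by (rule list_all2_mono[OF has_ty_nulls]) (rule has_ty_imp_typed)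

lemma singletons_typed: "ts \<^bold>:\<^bold>: \<tau>s \<Longrightarrow> singletons \<tau>s ts \<^bold>:\<^bold>: map Seq \<tau>s"
  by (simp add: singletons_def list_all2_conv_all_nth)

lemma mems_singletons: "ts \<^bold>:\<^bold>: \<tau>s \<Longrightarrow> mems W \<tau>s ts (singletons \<tau>s ts)"
  by (simp add: singletons_def list_all3_conv_all_nth list_all2_conv_all_nth forces_Mem_prep_head)

lemma mems_nulls_pad: "Ss \<^bold>:\<^bold>: map Seq \<tau>s \<Longrightarrow> mems W \<tau>s (nulls \<tau>s) (pad \<tau>s Ss)"
  by (auto simp: nulls_def pad_def list_all3_conv_all_nth list_all2_conv_all_nth
      intro: forces_Mem_prep_head)

lemma mems_pad: "mems W \<tau>s ts Ss \<Longrightarrow> mems W \<tau>s ts (pad \<tau>s Ss)"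
  by (simp add: pad_def list_all3_conv_all_nth forces_Mem_prep_tail)

lemma mems_appends_left: "mems W \<tau>s ts Ss \<Longrightarrow> Ts \<^bold>:\<^bold>: map Seq \<tau>s \<Longrightarrow> mems W \<tau>s ts (appends \<tau>s Ss Ts)"
  by (auto simp: appends_def list_all3_conv_all_nth list_all2_conv_all_nth
      intro: forces_Mem_append_left)

lemma mems_appends_right: "mems W \<tau>s ts Ts \<Longrightarrow> Ss \<^bold>:\<^bold>: map Seq \<tau>s \<Longrightarrow> mems W \<tau>s ts (appends \<tau>s Ss Ts)"
  by (auto simp: appends_def list_all3_conv_all_nth list_all2_conv_all_nth
      intro: forces_Mem_append_right)

lemma conds_zero:
  "ss \<^bold>:\<^bold>: \<tau>s \<Longrightarrow> ts \<^bold>:\<^bold>: \<tau>s \<Longrightarrow> W \<tturnstile> Eq N z zero \<Longrightarrow> eqs W \<tau>s (conds \<tau>s z ss ts) ss"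
  by (simp add: conds_def list_all3_conv_all_nth list_all2_conv_all_nth forces_cond_zero)

lemma conds_suc:
  "ss \<^bold>:\<^bold>: \<tau>s \<Longrightarrow> ts \<^bold>:\<^bold>: \<tau>s \<Longrightarrow> W \<tturnstile> Eq N z (suc k) \<Longrightarrow> eqs W \<tau>s (conds \<tau>s z ss ts) ts"
  by (simp add: conds_def list_all3_conv_all_nth list_all2_conv_all_nth
    forces_cond_suc[of _ _ _ _ _ k])

end

section \<open>Definable operations on tuples\<close>

text \<open>The equation is syntactic, so that such operations compose without any conversion;
  combinators are needed only in \<open>definable_abstraction\<close>.\<close>

definition definable :: "ty list \<Rightarrow> (tm list \<Rightarrow> tm list) \<Rightarrow> ty list \<Rightarrow> bool" where
  "definable \<Gamma> f \<tau>s \<longleftrightarrow>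
    (\<exists>ts. list_all2 (has_ty \<Gamma>) ts \<tau>s \<and> (\<forall>xs. length xs = length \<Gamma> \<longrightarrow> f xs = map (inst xs) ts))"

lemma definableI:
  "list_all2 (has_ty \<Gamma>) ts \<tau>s \<Longrightarrow> (\<And>xs. length xs = length \<Gamma> \<Longrightarrow> f xs = map (inst xs) ts) \<Longrightarrow>
    definable \<Gamma> f \<tau>s"
  unfolding definable_def by blast

lemma definableE:
  assumes "definable \<Gamma> f \<tau>s"
  obtains ts where "list_all2 (has_ty \<Gamma>) ts \<tau>s"
    "\<And>xs. length xs = length \<Gamma> \<Longrightarrow> f xs = map (inst xs) ts"
  using assms unfolding definable_def by blast

lemma definable_length: "definable \<Gamma> f \<tau>s \<Longrightarrow> length xs = length \<Gamma> \<Longrightarrow> length (f xs) = length \<tau>s"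
  by (auto elim!: definableE dest: list_all2_lengthD)

lemma definable_closed: "definable [] f \<tau>s \<Longrightarrow> list_all2 (has_ty []) (f []) \<tau>s"
proof (elim definableE)
  fix ts assume ts: "list_all2 (has_ty []) ts \<tau>s"
    and f: "\<And>xs. length xs = length [] \<Longrightarrow> f xs = map (inst xs) ts"
  have "map (inst []) ts = ts"
    by (rule map_idI) (use ts in \<open>auto simp: list_all2_conv_all_nth in_set_conv_nth inst_closed\<close>)
  then show ?thesis using ts f[of "[]"] by simp
qed

lemma definable_id: "definable \<Gamma> (\<lambda>x. x) \<Gamma>"
  by (rule definableI[where ts = "map Var [0..<length \<Gamma>]"])
    (auto simp: list_all2_conv_all_nth intro!: nth_equalityI)

lemma definable_const:
  assumes "list_all2 (has_ty []) ts \<tau>s"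
  shows "definable \<Gamma> (\<lambda>x. ts) \<tau>s"
proof (rule definableI)
  show "list_all2 (has_ty \<Gamma>) ts \<tau>s" using assms by (rule list_all2_mono) (rule has_ty_closed)
  show "ts = map (inst xs) ts" for xs
    using assms by (auto simp: list_all2_conv_all_nth inst_closed intro!: nth_equalityI)
qed

lemma definable_nil [simp]: "definable \<Gamma> (\<lambda>x. []) []"
  by (rule definable_const) simp

lemma definable_nulls: "definable \<Gamma> (\<lambda>x. nulls \<tau>s) \<tau>s"
  by (rule definable_const) (rule has_ty_nulls)

lemma definable_comp:
  assumes "definable \<Gamma> f \<sigma>s" "definable \<sigma>s g \<tau>s"
  shows "definable \<Gamma> (\<lambda>x. g (f x)) \<tau>s"
proof -
  obtain ss where ss: "list_all2 (has_ty \<Gamma>) ss \<sigma>s"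
    "\<And>xs. length xs = length \<Gamma> \<Longrightarrow> f xs = map (inst xs) ss"
    using assms(1) unfolding definable_def by blast
  obtain ts where ts: "list_all2 (has_ty \<sigma>s) ts \<tau>s"
    "\<And>xs. length xs = length \<sigma>s \<Longrightarrow> g xs = map (inst xs) ts"
    using assms(2) unfolding definable_def by blast
  have length: "length ss = length \<sigma>s" using ss(1) by (rule list_all2_lengthD)
  show ?thesis
  proof (rule definableI[where ts = "map (inst ss) ts"])
    show "list_all2 (has_ty \<Gamma>) (map (inst ss) ts) \<tau>s"
      using ts(1) unfolding list_all2_map1 by (rule list_all2_mono) (rule has_ty_inst[OF _ ss(1)])
    have "inst (map (inst xs) ss) t = inst xs (inst ss t)" if t: "t \<in> set ts" for t xs
    proof -
      obtain \<tau> where "has_ty \<sigma>s t \<tau>"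
        using t ts(1) by (auto simp: list_all2_conv_all_nth in_set_conv_nth)
      then show ?thesis using length by (rule inst_inst)
    qed
    then show "g (f xs) = map (inst xs) (map (inst ss) ts)" if "length xs = length \<Gamma>" for xs
      using ts(2) length by (simp add: ss(2)[OF that])
  qed
qed

lemma definable_op2:
  assumes "definable \<Gamma> f \<rho>s" "definable \<Gamma> g \<sigma>s"
    and typed: "\<And>ss ts. list_all2 (has_ty \<Gamma>) ss \<rho>s \<Longrightarrow> list_all2 (has_ty \<Gamma>) ts \<sigma>s \<Longrightarrow>
      list_all2 (has_ty \<Gamma>) (op ss ts) \<tau>s"
    and inst: "\<And>xs ss ts. length ss = length \<rho>s \<Longrightarrow> length ts = length \<sigma>s \<Longrightarrow>
      op (map (inst xs) ss) (map (inst xs) ts) = map (inst xs) (op ss ts)"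
  shows "definable \<Gamma> (\<lambda>x. op (f x) (g x)) \<tau>s"
proof -
  obtain ss where ss: "list_all2 (has_ty \<Gamma>) ss \<rho>s"
    "\<And>xs. length xs = length \<Gamma> \<Longrightarrow> f xs = map (inst xs) ss"
    using assms(1) unfolding definable_def by blast
  obtain ts where ts: "list_all2 (has_ty \<Gamma>) ts \<sigma>s"
    "\<And>xs. length xs = length \<Gamma> \<Longrightarrow> g xs = map (inst xs) ts"
    using assms(2) unfolding definable_def by blast
  show ?thesis
    by (rule definableI[OF typed[OF ss(1) ts(1)]])
      (use ss ts in \<open>simp add: inst list_all2_lengthD\<close>)
qed

lemma definable_hd: "definable (\<sigma> # \<Gamma>) (\<lambda>x. [hd x]) [\<sigma>]"
proof (rule definableI)
  show "[hd xs] = map (inst xs) [Var 0]" if "length xs = length (\<sigma> # \<Gamma>)" for xs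
    using that by (cases xs) simp_all
qed simp

lemma definable_tl: "definable (\<sigma> # \<Gamma>) tl \<Gamma>"
proof (rule definableI)
  show "list_all2 (has_ty (\<sigma> # \<Gamma>)) (map (\<lambda>i. Var (Suc i)) [0..<length \<Gamma>]) \<Gamma>"
    by (simp add: list_all2_conv_all_nth)
  show "tl xs = map (inst xs) (map (\<lambda>i. Var (Suc i)) [0..<length \<Gamma>])"
    if "length xs = length (\<sigma> # \<Gamma>)" for xs
    using that by (intro nth_equalityI) (simp_all add: nth_tl)
qed

lemma definable_append:
  "definable \<Gamma> f \<sigma>s \<Longrightarrow> definable \<Gamma> g \<tau>s \<Longrightarrow> definable \<Gamma> (\<lambda>x. f x @ g x) (\<sigma>s @ \<tau>s)"
  by (erule (1) definable_op2) (auto intro: list_all2_appendI)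

lemma definable_take:
  "definable \<Gamma> f (\<sigma>s @ \<tau>s) \<Longrightarrow> n = length \<sigma>s \<Longrightarrow> definable \<Gamma> (\<lambda>x. take n (f x)) \<sigma>s"
  by (rule definable_op2[OF _ definable_nil, where op = "\<lambda>ss ts. take n ss"])
    (auto simp: take_map intro: list_all2_split)

lemma definable_drop:
  "definable \<Gamma> f (\<sigma>s @ \<tau>s) \<Longrightarrow> n = length \<sigma>s \<Longrightarrow> definable \<Gamma> (\<lambda>x. drop n (f x)) \<tau>s"
  by (rule definable_op2[OF _ definable_nil, where op = "\<lambda>ss ts. drop n ss"])
    (auto simp: drop_map intro: list_all2_split)

lemma definable_apps:
  assumes "definable \<Gamma> f (map (arrs \<sigma>s) \<tau>s)" "definable \<Gamma> g \<sigma>s"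
  shows "definable \<Gamma> (\<lambda>x. map (\<lambda>U. apps U (g x)) (f x)) \<tau>s"
  by (rule definable_op2[OF assms, where op = "\<lambda>Us xs. map (\<lambda>U. apps U xs) Us"])
    (auto simp: inst_apps list_all2_conv_all_nth[of _ _ \<tau>s] list_all2_conv_all_nth[of _ _ "map _ _"]
      intro!: has_ty_apps[of _ _ \<sigma>s])

lemma definable_singletons:
  assumes "definable \<Gamma> f \<tau>s"
  shows "definable \<Gamma> (\<lambda>x. singletons \<tau>s (f x)) (map Seq \<tau>s)"
  by (rule definable_op2[OF assms definable_nil, where op = "\<lambda>ts us. singletons \<tau>s ts"])
    (auto simp: singletons_def list_all2_conv_all_nth intro!: nth_equalityI)

lemma definable_pad:
  assumes "definable \<Gamma> f (map Seq \<tau>s)"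
  shows "definable \<Gamma> (\<lambda>x. pad \<tau>s (f x)) (map Seq \<tau>s)"
  by (rule definable_op2[OF assms definable_nil, where op = "\<lambda>ts us. pad \<tau>s ts"])
    (auto simp: pad_def list_all2_conv_all_nth inst_closed[OF has_ty_null]
      has_ty_closed[OF has_ty_null] intro!: nth_equalityI)

lemma definable_appends:
  assumes "definable \<Gamma> f (map Seq \<tau>s)" "definable \<Gamma> g (map Seq \<tau>s)"
  shows "definable \<Gamma> (\<lambda>x. appends \<tau>s (f x) (g x)) (map Seq \<tau>s)"
  by (rule definable_op2[OF assms])
    (auto simp: appends_def list_all2_conv_all_nth inst_def intro!: nth_equalityI)

lemma definable_conds:
  assumes "definable \<Gamma> h [N]" "definable \<Gamma> f \<tau>s" "definable \<Gamma> g \<tau>s"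
  shows "definable \<Gamma> (\<lambda>x. conds \<tau>s (hd (h x)) (f x) (g x)) \<tau>s"
proof -
  obtain zs where zs: "list_all2 (has_ty \<Gamma>) zs [N]"
    "\<And>xs. length xs = length \<Gamma> \<Longrightarrow> h xs = map (inst xs) zs"
    using assms(1) unfolding definable_def by blast
  then obtain z where z: "has_ty \<Gamma> z N" "\<And>xs. length xs = length \<Gamma> \<Longrightarrow> hd (h xs) = inst xs z"
    by (auto simp: list_all2_Cons2)
  obtain ss where ss: "list_all2 (has_ty \<Gamma>) ss \<tau>s"
    "\<And>xs. length xs = length \<Gamma> \<Longrightarrow> f xs = map (inst xs) ss"
    using assms(2) unfolding definable_def by blast
  obtain ts where ts: "list_all2 (has_ty \<Gamma>) ts \<tau>s"
    "\<And>xs. length xs = length \<Gamma> \<Longrightarrow> g xs = map (inst xs) ts"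
    using assms(3) unfolding definable_def by blast
  show ?thesis
    by (rule definableI[where ts = "conds \<tau>s z ss ts"])
      (use z ss ts in \<open>auto simp: conds_def list_all2_conv_all_nth inst_def intro!: nth_equalityI\<close>)
qed

lemma definable_case:
  assumes f: "definable \<sigma>s f \<rho>s" and f': "definable \<tau>s f' \<rho>s"
  shows "definable (N # \<sigma>s @ \<tau>s)
    (\<lambda>x. conds \<rho>s (hd x) (f (take (length \<sigma>s) (tl x))) (f' (drop (length \<sigma>s) (tl x)))) \<rho>s"
proof -
  have "definable (N # \<sigma>s @ \<tau>s) (\<lambda>x. conds \<rho>s (hd [hd x]) (f (take (length \<sigma>s) (tl x)))
      (f' (drop (length \<sigma>s) (tl x)))) \<rho>s"
    by (rule definable_conds[OF definable_hd
      definable_comp[OF definable_take[OF definable_tl refl] f]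
          definable_comp[OF definable_drop[OF definable_tl refl] f']])
  then show ?thesis by simp
qed

lemma definable_pad_case:
  assumes g: "definable (\<sigma>s @ \<upsilon>s) g (map Seq \<rho>s)" and g': "definable (\<tau>s @ \<upsilon>s) g' (map Seq \<rho>s')"
  shows "definable (N # \<sigma>s @ \<tau>s @ \<upsilon>s)
    (\<lambda>x. pad \<rho>s (g (take (length \<sigma>s) (tl x) @ drop (length \<tau>s) (drop (length \<sigma>s) (tl x)))) @
      pad \<rho>s' (g' (drop (length \<sigma>s) (tl x)))) (map Seq \<rho>s @ map Seq \<rho>s')"
  by (rule definable_append[OF definable_pad[OF definable_comp[OF definable_append[OF
            definable_take[OF definable_tl refl]
              definable_drop[OF definable_drop[OF definable_tl refl] refl]] g]]
        definable_pad[OF definable_comp[OF definable_drop[OF definable_tl refl] g']]])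

context internal_theory
begin

lemma definable_typed: "definable \<Gamma> f \<tau>s \<Longrightarrow> xs \<^bold>:\<^bold>: \<Gamma> \<Longrightarrow> f xs \<^bold>:\<^bold>: \<tau>s"
  by (auto elim!: definableE simp: list_all2_lengthD)
    (auto simp: list_all2_conv_all_nth[of _ _ \<tau>s] list_all2_conv_all_nth[of _ "map _ _"]
      intro: typed_inst)

theorem definable_abstraction:
  assumes "definable (\<Gamma> @ \<Gamma>') f \<tau>s"
  obtains F where "definable \<Gamma> F (map (arrs \<Gamma>') \<tau>s)"
    "\<And>W xs us. xs \<^bold>:\<^bold>: \<Gamma> \<Longrightarrow> us \<^bold>:\<^bold>: \<Gamma>' \<Longrightarrow> eqs W \<tau>s (map (\<lambda>U. apps U us) (F xs)) (f (xs @ us))"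
proof -
  obtain ts where ts: "list_all2 (has_ty (\<Gamma> @ \<Gamma>')) ts \<tau>s"
    "\<And>xs. length xs = length (\<Gamma> @ \<Gamma>') \<Longrightarrow> f xs = map (inst xs) ts"
    using assms unfolding definable_def by blast
  have "\<exists>F. has_ty \<Gamma> F (arrs \<Gamma>' (\<tau>s ! i)) \<and> (\<forall>W xs us. xs \<^bold>:\<^bold>: \<Gamma> \<longrightarrow> us \<^bold>:\<^bold>: \<Gamma>' \<longrightarrow>
    W \<tturnstile> Eq (\<tau>s ! i) (apps (inst xs F) us) (inst (xs @ us) (ts ! i)))" if "i < length \<tau>s" for i
    by (rule combinatory_completeness) (use ts(1) that in \<open>simp add: list_all2_conv_all_nth\<close>)
  then obtain F where F: "\<And>i. i < length \<tau>s \<Longrightarrow> has_ty \<Gamma> (F i) (arrs \<Gamma>' (\<tau>s ! i))"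
    "\<And>i W xs us. i < length \<tau>s \<Longrightarrow> xs \<^bold>:\<^bold>: \<Gamma> \<Longrightarrow> us \<^bold>:\<^bold>: \<Gamma>' \<Longrightarrow>
      W \<tturnstile> Eq (\<tau>s ! i) (apps (inst xs (F i)) us) (inst (xs @ us) (ts ! i))"
    by metis
  show thesis
  proof (rule that)
    show "definable \<Gamma> (\<lambda>xs. map (inst xs) (map F [0..<length \<tau>s])) (map (arrs \<Gamma>') \<tau>s)"
      by (rule definableI[OF _ refl]) (simp add: list_all2_conv_all_nth F(1))
    fix W xs us assume "xs \<^bold>:\<^bold>: \<Gamma>" "us \<^bold>:\<^bold>: \<Gamma>'"
    then show "eqs W \<tau>s (map (\<lambda>U. apps U us) (map (inst xs) (map F [0..<length \<tau>s]))) (f (xs @ us))"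
      using F(2) ts list_all2_lengthD by (simp add: list_all3_conv_all_nth list_all2_lengthD)
  qed
qed

text \<open>Only one inclusion is needed: enlarging a set of challenges never hurts.\<close>

lemma forces_Mem_bigunion:
  assumes U: "term_ctxt (Seq \<tau>) (Seq \<sigma>) U"
    and U_prep: "\<And>W a s. a \<^bold>: \<tau> \<Longrightarrow> s \<^bold>: Seq \<tau> \<Longrightarrow>
      W \<tturnstile> Eq (Seq \<sigma>) (U (prep \<tau> a s)) (append_tm \<sigma> (g \<^bold>\<cdot> a) (U s))"
    and g: "g \<^bold>: \<tau> \<^bold>\<rightarrow> Seq \<sigma>" and z: "W \<tturnstile> Mem \<tau> z s" and y: "W \<tturnstile> Mem \<sigma> y (g \<^bold>\<cdot> z)"
  shows "W \<tturnstile> Mem \<sigma> y (U s)"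
proof -
  let ?Q = "\<lambda>s. Imp (Mem \<tau> z s) (Mem \<sigma> y (U s))"
  have typed: "s \<^bold>: Seq \<tau>" "z \<^bold>: \<tau>" "y \<^bold>: \<sigma>" using forces_MemD[OF z] forces_MemD[OF y] by auto
  have "W \<tturnstile> ?Q s"
  proof (rule forces_seq_induct[where Q = ?Q, OF _ typed(1)])
    show "formula_ctxt (Seq \<tau>) ?Q"
      by (intro formula_ctxt_Imp formula_ctxt_Mem term_ctxt_const term_ctxt_id U typed)
    show "W \<tturnstile> ?Q (Cst (Empty \<tau>))"
    proof (rule forces_ImpI)
      fix W' assume "W' \<tturnstile> Mem \<tau> z (Cst (Empty \<tau>))"
      then show "W' \<tturnstile> Mem \<sigma> y (U (Cst (Empty \<tau>)))"
        by (rule forces_BotE[OF forces_Mem_emptyD]) (use typed term_ctxtD[OF U] in simp_all)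
    qed (use typed in simp_all)
    fix W1 a s assume W1: "W \<le> W1" and a: "a \<^bold>: \<tau>" and s: "s \<^bold>: Seq \<tau>" and IH: "W1 \<tturnstile> ?Q s"
    note unfold = forces_eq_sym[OF U_prep[OF a s]]
    show "W1 \<tturnstile> ?Q (prep \<tau> a s)"
    proof (rule forces_ImpI)
      fix W2 assume W2: "W1 \<le> W2" and mem: "W2 \<tturnstile> Mem \<tau> z (prep \<tau> a s)"
      show "W2 \<tturnstile> Mem \<sigma> y (U (prep \<tau> a s))"
      proof (rule forces_Mem_prepE[OF mem])
        fix W3 assume W3: "W2 \<le> W3" and "W3 \<tturnstile> Eq \<tau> z a"
        then have "W3 \<tturnstile> Eq (Seq \<sigma>) (g \<^bold>\<cdot> z) (g \<^bold>\<cdot> a)"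
          using forces_eq_app[OF forces_eq_refl[OF g]] by blast
        moreover have "W3 \<tturnstile> Mem \<sigma> y (g \<^bold>\<cdot> z)" using y by (rule forces_mono) (use W1 W2 W3 in simp)
        ultimately have "W3 \<tturnstile> Mem \<sigma> y (g \<^bold>\<cdot> a)"
          using forces_Mem_cong forces_eq_refl[OF typed(3)] by blast
        then have "W3 \<tturnstile> Mem \<sigma> y (append_tm \<sigma> (g \<^bold>\<cdot> a) (U s))"
          by (rule forces_Mem_append_left[OF term_ctxtD[OF U s]])
        then show "W3 \<tturnstile> Mem \<sigma> y (U (prep \<tau> a s))"
          by (rule forces_Mem_cong[OF _ forces_eq_refl[OF typed(3)] unfold])
      next
        fix W3 assume W3: "W2 \<le> W3" and "W3 \<tturnstile> Mem \<tau> z s"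
        then have "W3 \<tturnstile> Mem \<sigma> y (U s)"
          using forces_mp[OF forces_mono[OF IH order_trans[OF W2 W3]]] by blast
        then have "W3 \<tturnstile> Mem \<sigma> y (append_tm \<sigma> (g \<^bold>\<cdot> a) (U s))"
          using g a by (intro forces_Mem_append_right) auto
        then show "W3 \<tturnstile> Mem \<sigma> y (U (prep \<tau> a s))"
          by (rule forces_Mem_cong[OF _ forces_eq_refl[OF typed(3)] unfold])
      qed (use typed a s term_ctxtD[OF U] in auto)
    qed (use typed a s in auto)
  qed
  then show ?thesis using z by (rule forces_mp)
qed

lemma bigunion_combinator:
  "\<exists>u. has_ty [] u ((\<tau> \<^bold>\<rightarrow> Seq \<sigma>) \<^bold>\<rightarrow> Seq \<tau> \<^bold>\<rightarrow> Seq \<sigma>) \<and>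
    (\<forall>W g z s y. g \<^bold>: \<tau> \<^bold>\<rightarrow> Seq \<sigma> \<longrightarrow> W \<tturnstile> Mem \<tau> z s \<longrightarrow> W \<tturnstile> Mem \<sigma> y (g \<^bold>\<cdot> z) \<longrightarrow>
      W \<tturnstile> Mem \<sigma> y (u \<^bold>\<cdot> g \<^bold>\<cdot> s))"
proof -
  have "has_ty [\<tau> \<^bold>\<rightarrow> Seq \<sigma>, \<tau>, Seq \<tau>, Seq \<sigma>] (append_tm \<sigma> (Var 0 \<^bold>\<cdot> Var 1) (Var 3)) (Seq \<sigma>)"
    by simp
  then obtain step where step: "has_ty [] step (arrs [\<tau> \<^bold>\<rightarrow> Seq \<sigma>, \<tau>, Seq \<tau>, Seq \<sigma>] (Seq \<sigma>))"
    and step_eq: "\<And>W us. us \<^bold>:\<^bold>: [\<tau> \<^bold>\<rightarrow> Seq \<sigma>, \<tau>, Seq \<tau>, Seq \<sigma>] \<Longrightarrow>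
      W \<tturnstile> Eq (Seq \<sigma>) (apps step us) (inst us (append_tm \<sigma> (Var 0 \<^bold>\<cdot> Var 1) (Var 3)))"
    by (rule closed_combinator) (rule that)
  let ?U = "\<lambda>g s. Cst (LRec \<tau> (Seq \<sigma>)) \<^bold>\<cdot> Cst (Empty \<sigma>) \<^bold>\<cdot> (step \<^bold>\<cdot> g) \<^bold>\<cdot> s"
  have "has_ty [\<tau> \<^bold>\<rightarrow> Seq \<sigma>, Seq \<tau>] (?U (Var 0) (Var 1)) (Seq \<sigma>)"
    using has_ty_closed[OF step] by simp
  then obtain u where u: "has_ty [] u (arrs [\<tau> \<^bold>\<rightarrow> Seq \<sigma>, Seq \<tau>] (Seq \<sigma>))"
    and u_eq: "\<And>W us. us \<^bold>:\<^bold>: [\<tau> \<^bold>\<rightarrow> Seq \<sigma>, Seq \<tau>] \<Longrightarrow>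
      W \<tturnstile> Eq (Seq \<sigma>) (apps u us) (inst us (?U (Var 0) (Var 1)))"
    by (rule closed_combinator) (rule that)
  show ?thesis
  proof (intro HOL.exI[of _ u] conjI HOL.allI HOL.impI u[simplified])
    fix W g z s y assume g: "g \<^bold>: \<tau> \<^bold>\<rightarrow> Seq \<sigma>" and z: "W \<tturnstile> Mem \<tau> z s" and y: "W \<tturnstile> Mem \<sigma> y (g \<^bold>\<cdot> z)"
    have step_g: "step \<^bold>\<cdot> g \<^bold>: \<tau> \<^bold>\<rightarrow> Seq \<tau> \<^bold>\<rightarrow> Seq \<sigma> \<^bold>\<rightarrow> Seq \<sigma>"
      using closed_imp_typed[OF step] g by auto
    have "W \<tturnstile> Mem \<sigma> y (?U g s)"
    proof (rule forces_Mem_bigunion[OF _ _ g z y])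
      show "term_ctxt (Seq \<tau>) (Seq \<sigma>) (?U g)"
        by (rule term_ctxt_App[OF term_ctxt_const term_ctxt_id]) (use step_g in auto)
      fix W a s assume a: "a \<^bold>: \<tau>" and s: "s \<^bold>: Seq \<tau>"
      have "W \<tturnstile> Eq (Seq \<sigma>) (?U g (prep \<tau> a s)) (step \<^bold>\<cdot> g \<^bold>\<cdot> a \<^bold>\<cdot> s \<^bold>\<cdot> ?U g s)"
        by (rule forces_lrec_prep) (use step_g a s in auto)
      also have "W \<tturnstile> Eq (Seq \<sigma>) (step \<^bold>\<cdot> g \<^bold>\<cdot> a \<^bold>\<cdot> s \<^bold>\<cdot> ?U g s) (append_tm \<sigma> (g \<^bold>\<cdot> a) (?U g s))"
        using step_eq[of "[g, a, s, ?U g s]"] step_g g a s by (simp add: inst_def)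
      finally show "W \<tturnstile> Eq (Seq \<sigma>) (?U g (prep \<tau> a s)) (append_tm \<sigma> (g \<^bold>\<cdot> a) (?U g s))" .
    qed
    moreover have "W \<tturnstile> Eq (Seq \<sigma>) (?U g s) (u \<^bold>\<cdot> g \<^bold>\<cdot> s)"
      by (rule forces_eq_sym)
        (use u_eq[of "[g, s]"] forces_MemD[OF z] g in \<open>simp add: inst_closed[OF step]\<close>)
    ultimately show "W \<tturnstile> Mem \<sigma> y (u \<^bold>\<cdot> g \<^bold>\<cdot> s)"
      using forces_Mem_cong forces_eq_refl forces_MemD[OF y] by blast
  qed
qed

lemma bigunion_component:
  assumes "has_ty (\<Gamma> @ \<tau>s) t (Seq \<sigma>)" "list_all2 (has_ty \<Gamma>) Zs (map Seq \<tau>s)"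
  shows "\<exists>b. has_ty \<Gamma> b (Seq \<sigma>) \<and> (\<forall>W xs zs y. xs \<^bold>:\<^bold>: \<Gamma> \<longrightarrow> mems W \<tau>s zs (map (inst xs) Zs) \<longrightarrow>
    W \<tturnstile> Mem \<sigma> y (inst (xs @ zs) t) \<longrightarrow> W \<tturnstile> Mem \<sigma> y (inst xs b))"
  using assms
proof (induction \<tau>s arbitrary: t Zs rule: rev_induct)
  case Nil
  then show ?case by (intro HOL.exI[of _ t]) (simp add: list_all3_conv_all_nth)
next
  case (snoc \<tau> \<tau>s)
  then obtain Zs' Z where Zs: "Zs = Zs' @ [Z]" "list_all2 (has_ty \<Gamma>) Zs' (map Seq \<tau>s)"
    "has_ty \<Gamma> Z (Seq \<tau>)"
    by (auto simp: list_all2_append2 list_all2_Cons2)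
  obtain g where g: "abstracts (\<Gamma> @ \<tau>s) \<tau> (Seq \<sigma>) t g"
    using bracket_abstraction[of "\<Gamma> @ \<tau>s" \<tau> t "Seq \<sigma>"] snoc.prems(1) by auto
  obtain u where u: "has_ty [] u ((\<tau> \<^bold>\<rightarrow> Seq \<sigma>) \<^bold>\<rightarrow> Seq \<tau> \<^bold>\<rightarrow> Seq \<sigma>)"
    and bigunion: "\<And>W g z s y. g \<^bold>: \<tau> \<^bold>\<rightarrow> Seq \<sigma> \<Longrightarrow> W \<tturnstile> Mem \<tau> z s \<Longrightarrow> W \<tturnstile> Mem \<sigma> y (g \<^bold>\<cdot> z) \<Longrightarrow>
      W \<tturnstile> Mem \<sigma> y (u \<^bold>\<cdot> g \<^bold>\<cdot> s)"
    using bigunion_combinator[of \<tau> \<sigma>] by blast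
  have typed: "has_ty (\<Gamma> @ \<tau>s) g (\<tau> \<^bold>\<rightarrow> Seq \<sigma>)" "has_ty (\<Gamma> @ \<tau>s) (u \<^bold>\<cdot> g \<^bold>\<cdot> Z) (Seq \<sigma>)"
    using g has_ty_closed[OF u] has_ty_append[OF Zs(3)] unfolding abstracts_def by auto
  obtain b where b: "has_ty \<Gamma> b (Seq \<sigma>)" and
    mem_b: "\<And>W xs zs y. xs \<^bold>:\<^bold>: \<Gamma> \<Longrightarrow> mems W \<tau>s zs (map (inst xs) Zs') \<Longrightarrow>
      W \<tturnstile> Mem \<sigma> y (inst (xs @ zs) (u \<^bold>\<cdot> g \<^bold>\<cdot> Z)) \<Longrightarrow> W \<tturnstile> Mem \<sigma> y (inst xs b)"
    using snoc.IH[OF typed(2) Zs(2)] by blast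
  have mem_inst_b: "W \<tturnstile> Mem \<sigma> y (inst xs b)" if xs: "xs \<^bold>:\<^bold>: \<Gamma>"
    and zs: "mems W (\<tau>s @ [\<tau>]) zs (map (inst xs) Zs)" and y: "W \<tturnstile> Mem \<sigma> y (inst (xs @ zs) t)"
    for W xs zs y
  proof -
    obtain zs' z where zs': "zs = zs' @ [z]" "length zs' = length \<tau>s"
      using zs by (cases zs rule: rev_cases) (auto simp: list_all3_conv_all_nth)
    then have mems: "mems W \<tau>s zs' (map (inst xs) Zs')" and mem: "W \<tturnstile> Mem \<tau> z (inst xs Z)"
      using zs list_all2_lengthD[OF Zs(2)] by (simp_all add: Zs(1) list_all3_append)
    have xzs: "xs @ zs' \<^bold>:\<^bold>: \<Gamma> @ \<tau>s" using xs mems_typed[OF mems] by (rule list_all2_appendI)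
    have "W \<tturnstile> Eq (Seq \<sigma>) (inst (xs @ zs') g \<^bold>\<cdot> z) (inst (xs @ zs) t)"
      using g xzs forces_MemD[OF mem] unfolding abstracts_def zs'(1) by (simp flip: append_assoc)
    then have "W \<tturnstile> Mem \<sigma> y (inst (xs @ zs') g \<^bold>\<cdot> z)"
      by (intro forces_Mem_cong[OF y forces_eq_refl forces_eq_sym])
        (use forces_MemD[OF y] in simp_all)
    then have "W \<tturnstile> Mem \<sigma> y (u \<^bold>\<cdot> inst (xs @ zs') g \<^bold>\<cdot> inst xs Z)"
      by (rule bigunion[OF typed_inst[OF typed(1) xzs] mem])
    then have "W \<tturnstile> Mem \<sigma> y (inst (xs @ zs') (u \<^bold>\<cdot> g \<^bold>\<cdot> Z))"
      using list_all2_lengthD[OF xs] by (simp add: inst_closed[OF u] inst_append[OF Zs(3)])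
    then show ?thesis by (rule mem_b[OF xs mems])
  qed
  show ?case by (intro HOL.exI[of _ b] conjI HOL.allI HOL.impI b) (rule mem_inst_b; assumption)
qed

theorem definable_bigunion:
  assumes "definable (\<Gamma> @ \<tau>s) f (map Seq \<sigma>s)" "definable \<Gamma> Z (map Seq \<tau>s)"
  obtains B where "definable \<Gamma> B (map Seq \<sigma>s)"
    "\<And>W xs zs ys. xs \<^bold>:\<^bold>: \<Gamma> \<Longrightarrow> mems W \<tau>s zs (Z xs) \<Longrightarrow> mems W \<sigma>s ys (f (xs @ zs)) \<Longrightarrow>
      mems W \<sigma>s ys (B xs)"
proof -
  obtain Zs where Zs: "list_all2 (has_ty \<Gamma>) Zs (map Seq \<tau>s)"
    "\<And>xs. length xs = length \<Gamma> \<Longrightarrow> Z xs = map (inst xs) Zs"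
    using assms(2) unfolding definable_def by blast
  obtain ts where ts: "list_all2 (has_ty (\<Gamma> @ \<tau>s)) ts (map Seq \<sigma>s)"
    "\<And>xs. length xs = length (\<Gamma> @ \<tau>s) \<Longrightarrow> f xs = map (inst xs) ts"
    using assms(1) unfolding definable_def by blast
  have "\<exists>b. has_ty \<Gamma> b (Seq (\<sigma>s ! i)) \<and> (\<forall>W xs zs y. xs \<^bold>:\<^bold>: \<Gamma> \<longrightarrow>
    mems W \<tau>s zs (map (inst xs) Zs) \<longrightarrow> W \<tturnstile> Mem (\<sigma>s ! i) y (inst (xs @ zs) (ts ! i)) \<longrightarrow>
    W \<tturnstile> Mem (\<sigma>s ! i) y (inst xs b))" if "i < length \<sigma>s" for i
    by (rule bigunion_component[OF _ Zs(1)]) (use ts(1) that in \<open>auto simp: list_all2_conv_all_nth\<close>)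
  then obtain b where b: "\<And>i. i < length \<sigma>s \<Longrightarrow> has_ty \<Gamma> (b i) (Seq (\<sigma>s ! i))"
    "\<And>i W xs zs y. i < length \<sigma>s \<Longrightarrow> xs \<^bold>:\<^bold>: \<Gamma> \<Longrightarrow> mems W \<tau>s zs (map (inst xs) Zs) \<Longrightarrow>
      W \<tturnstile> Mem (\<sigma>s ! i) y (inst (xs @ zs) (ts ! i)) \<Longrightarrow> W \<tturnstile> Mem (\<sigma>s ! i) y (inst xs (b i))"
    by metis
  show thesis
  proof (rule that)
    show "definable \<Gamma> (\<lambda>xs. map (inst xs) (map b [0..<length \<sigma>s])) (map Seq \<sigma>s)"
      by (rule definableI[OF _ refl]) (simp add: list_all2_conv_all_nth b(1))
    fix W xs zs ys
    assume xs: "xs \<^bold>:\<^bold>: \<Gamma>" and zs: "mems W \<tau>s zs (Z xs)" and ys: "mems W \<sigma>s ys (f (xs @ zs))"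
    have "mems W \<tau>s zs (map (inst xs) Zs)" using zs Zs(2) list_all2_lengthD[OF xs] by simp
    moreover have "f (xs @ zs) = map (inst (xs @ zs)) ts"
      using zs list_all2_lengthD[OF xs] by (intro ts(2)) (simp add: list_all3_conv_all_nth)
    ultimately have "W \<tturnstile> Mem (\<sigma>s ! i) (ys ! i) (inst xs (b i))" if "i < length \<sigma>s" for i
      using ys ts(1) that
      by (intro b(2)[OF that xs]) (auto simp: list_all3_conv_all_nth dest: list_all2_lengthD)
    then show "mems W \<sigma>s ys (map (inst xs) (map b [0..<length \<sigma>s]))"
      using ys by (simp add: list_all3_conv_all_nth)
  qed
qed

end

section \<open>The matrix of the translation\<close>

definition prefix_subst :: "tm list \<Rightarrow> (nat \<Rightarrow> tm) \<Rightarrow> nat \<Rightarrow> tm" where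
  "prefix_subst ts \<theta> i = (if i < length ts then ts ! i else \<theta> (i - length ts))"

lemma prefix_subst_Nil [simp]: "prefix_subst [] \<theta> = \<theta>"
  by (simp add: fun_eq_iff prefix_subst_def)

lemma tsubst_prefix_subst_tlift:
  "length ts = n \<Longrightarrow> tsubst (prefix_subst ts \<theta>) (tlift n t) = tsubst \<theta> t"
  by (simp add: tsubst_tlift prefix_subst_def)

lemma tsubst_prefix_subst_funpow_up:
  "length ts = n \<Longrightarrow>
    tsubst (prefix_subst ts Var) ((up ^^ n) (case_nat t Var) i) = prefix_subst (ts @ [t]) Var i"
  by (auto simp: funpow_up tsubst_prefix_subst_tlift prefix_subst_def nth_append split: nat.split)

lemma length_vars [simp]: "length (vars n) = n"
  by (simp add: vars_def)

lemma nth_vars: "i < n \<Longrightarrow> vars n ! i = Var (n - Suc i)"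
  by (simp add: vars_def rev_nth)

lemma tsubst_funpow_up_vars: "map (tsubst ((up ^^ n) \<theta>)) (vars n) = vars n"
  by (rule nth_equalityI) (auto simp: nth_vars funpow_up)

lemma tsubst_prefix_subst_vars:
  "length ts = n \<Longrightarrow> map (tsubst (prefix_subst (rev ts) \<theta>)) (vars n) = ts"
  by (rule nth_equalityI) (auto simp: nth_vars prefix_subst_def rev_nth)

lemma has_ty_vars: "list_all2 (has_ty (rev \<tau>s @ \<Gamma>)) (vars (length \<tau>s)) \<tau>s"
  by (auto simp: list_all2_conv_all_nth nth_vars nth_append rev_nth)

lemma fsubst_BAlls:
  "length ss = length \<tau>s \<Longrightarrow>
    fsubst \<theta> (BAlls \<tau>s ss \<phi>) = BAlls \<tau>s (map (tsubst \<theta>) ss) (fsubst ((up ^^ length \<tau>s) \<theta>) \<phi>)"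
proof (induction \<tau>s arbitrary: ss \<theta>)
  case (Cons \<tau> \<tau>s)
  then obtain s ss' where "ss = s # ss'" by (cases ss) auto
  then show ?case using Cons by (simp add: o_def tsubst_up_tlift funpow_swap1)
qed simp

lemma internal_BAlls [simp]: "internal (BAlls \<tau>s ss \<phi>) = internal \<phi>"
  and or_free_BAlls [simp]: "or_free (BAlls \<tau>s ss \<phi>) = or_free \<phi>"
  by (induction \<tau>s ss \<phi> rule: BAlls.induct) auto

lemma internal_Umat [simp]: "internal (Umat \<Phi> as xs ys)"
  and or_free_Umat [simp]: "or_free (Umat \<Phi> as xs ys)"
  by (induction \<Phi> arbitrary: as xs ys) (auto simp: Let_def)

lemma Uty_fsubst [simp]: "Uty (fsubst \<theta> \<Phi>) = Uty \<Phi>"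
  by (induction \<Phi> arbitrary: \<theta>) auto

lemma Uty_finst [simp]: "Uty (finst t \<Phi>) = Uty \<Phi>"
  by (simp add: finst_def)

lemma Uty_flift [simp]: "Uty (flift \<Phi>) = Uty \<Phi>"
  by (simp add: flift_def)

lemma Uty_fsucc [simp]: "Uty (fsucc \<Phi>) = Uty \<Phi>"
  by (simp add: fsucc_def)

lemma Umat_fsubst: "Umat (fsubst \<theta> \<Phi>) as xs ys = Umat \<Phi> (\<lambda>i. tsubst as (\<theta> i)) xs ys"
proof (induction \<Phi> arbitrary: \<theta> as xs ys)
  case (Imp \<Phi> \<Psi>)
  then show ?case by (simp add: Let_def o_def tlift_tsubst)
next
  case (Ex \<sigma> \<Phi>)
  have "tsubst (\<lambda>i. tlift n (up as i)) (up \<theta> i) = tlift n (up (\<lambda>i. tsubst as (\<theta> i)) i)" for n i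
    using arg_cong[OF tsubst_up_up[of as \<theta> i], of "tlift n"] by (simp add: tlift_tsubst)
  then show ?case using Ex by (simp add: Let_def o_def)
next
  case (All \<sigma> \<Phi>)
  then show ?case by (simp add: tsubst_up_up)
next
  case (ExSt \<sigma> \<Phi>)
  then show ?case by (simp add: tsubst_case_nat_up cong: nat.case_cong)
next
  case (AllSt \<sigma> \<Phi>)
  then show ?case by (simp add: Let_def tsubst_case_nat_up cong: nat.case_cong)
qed (simp_all add: tsubst_tsubst Let_def)

lemma Umat_finst: "Umat (finst t \<Phi>) as xs ys = Umat \<Phi> (case_nat (tsubst as t) as) xs ys"
  by (simp add: finst_def Umat_fsubst tsubst_case_nat cong: nat.case_cong)

lemma Umat_subst_cong:
  assumes "wff \<Gamma> \<Phi>" "\<And>i. i < length \<Gamma> \<Longrightarrow> as i = bs i"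
  shows "Umat \<Phi> as xs ys = Umat \<Phi> bs xs ys"
proof -
  let ?\<theta> = "\<lambda>i. if i < length \<Gamma> then Var i else zero"
  have restrict: "fsubst ?\<theta> \<Phi> = \<Phi>" using fsubst_cong[OF assms(1), of _ Var] by simp
  have "Umat (fsubst ?\<theta> \<Phi>) as xs ys = Umat (fsubst ?\<theta> \<Phi>) bs xs ys"
    unfolding Umat_fsubst by (rule arg_cong[where f = "\<lambda>\<theta>. Umat \<Phi> \<theta> xs ys"]) (auto simp: assms(2))
  then show ?thesis unfolding restrict .
qed

lemma Umat_flift: "Umat (flift \<Phi>) as xs ys = Umat \<Phi> (\<lambda>i. as (Suc i)) xs ys"
  by (simp add: flift_def Umat_fsubst)

lemma fsubst_Umat:
  "length xs = length (Uex \<Phi>) \<Longrightarrow> length ys = length (Uall \<Phi>) \<Longrightarrow>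
    fsubst \<theta> (Umat \<Phi> as xs ys) = Umat \<Phi> (\<lambda>i. tsubst \<theta> (as i)) (map (tsubst \<theta>) xs)
      (map (tsubst \<theta>) ys)"
proof (induction \<Phi> arbitrary: \<theta> as xs ys)
  case (St \<sigma> t)
  then show ?case by (cases xs) (auto simp: tsubst_tsubst)
next
  case (Or \<Phi> \<Psi>)
  then show ?case by (cases xs) (auto simp: Let_def take_map drop_map)
next
  case (Imp \<Phi> \<Psi>)
  let ?n = "length (Uall \<Phi>)" and ?xs = "take (length (Uex \<Phi>)) ys"
  have "fsubst ((up ^^ ?n) \<theta>) (Umat \<Phi> (tlift ?n \<circ> as) (map (tlift ?n) ?xs) (vars ?n)) =
      Umat \<Phi> (tlift ?n \<circ> (\<lambda>i. tsubst \<theta> (as i))) (map (tlift ?n) (map (tsubst \<theta>) ?xs)) (vars ?n)"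
    using Imp.prems
    by (subst Imp.IH) (auto simp: tsubst_funpow_up_vars tsubst_funpow_up_tlift o_def)
  then show ?case using Imp.prems
    by (simp add: Let_def fsubst_BAlls take_map drop_map Imp.IH(2) o_def tsubst_apps
      flip: map_append)
next
  case (Ex \<sigma> \<Phi>)
  let ?n = "length (Uall \<Phi>)"
  have "tsubst ((up ^^ ?n) (up \<theta>)) (tlift (?n + 1) t) = tlift (?n + 1) (tsubst \<theta> t)" for t
    using tsubst_funpow_up_tlift[of ?n "up \<theta>" "tlift 1 t"] by (simp add: tsubst_up_tlift)
  moreover have "tsubst ((up ^^ ?n) (up \<theta>)) (tlift ?n (up as i)) =
      tlift ?n (up (\<lambda>i. tsubst \<theta> (as i)) i)" for i
    by (simp add: tsubst_funpow_up_tlift tsubst_up_up)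
  ultimately have "fsubst ((up ^^ ?n) (up \<theta>))
    (Umat \<Phi> (tlift ?n \<circ> up as) (map (tlift (?n + 1)) xs) (vars ?n)) =
      Umat \<Phi> (tlift ?n \<circ> up (\<lambda>i. tsubst \<theta> (as i))) (map (tlift (?n + 1)) (map (tsubst \<theta>) xs))
        (vars ?n)"
    using Ex.prems by (subst Ex.IH) (auto simp: tsubst_funpow_up_vars o_def)
  then show ?case using Ex.prems by (simp add: Let_def fsubst_BAlls o_def tsubst_up_tlift)
next
  case (All \<sigma> \<Phi>)
  then show ?case by (simp add: tsubst_up_up tsubst_up_tlift o_def)
next
  case (ExSt \<sigma> \<Phi>)
  then show ?case by (cases xs) (auto simp: tsubst_case_nat cong: nat.case_cong)
next
  case (AllSt \<sigma> \<Phi>)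
  then show ?case
    by (cases ys rule: rev_cases) (auto simp: Let_def o_def tsubst_case_nat cong: nat.case_cong)
qed (auto simp: tsubst_tsubst Let_def take_map drop_map)

lemma fsubst_prefix_subst_Umat:
  assumes "length xs = length (Uex \<Phi>)" "length ys = length (Uall \<Phi>)" "n = length (Uall \<Phi>)"
  shows "fsubst (prefix_subst (rev ys) Var) (Umat \<Phi> (tlift n \<circ> as) (map (tlift n) xs) (vars n)) =
    Umat \<Phi> as xs ys"
  using assms
  by (subst fsubst_Umat) (auto simp: tsubst_prefix_subst_tlift tsubst_prefix_subst_vars o_def)

text \<open>A generic instance of the matrix reduces its congruence to the Leibniz rule.\<close>

lemma fsubst_Umat_generic:
  assumes "length xs = length (Uex \<Phi>)" "length ys = length (Uall \<Phi>)"
  shows "fsubst (prefix_subst (xs @ ys) as)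
    (Umat \<Phi> (\<lambda>i. Var (i + length (xs @ ys))) (map Var [0..<length xs])
      (map Var [length xs..<length (xs @ ys)])) = Umat \<Phi> as xs ys"
proof -
  have "map (prefix_subst (xs @ ys) as) [0..<length xs] = xs"
    "map (prefix_subst (xs @ ys) as) [length xs..<length (xs @ ys)] = ys"
    by (auto simp: prefix_subst_def nth_append intro: nth_equalityI)
  moreover have "prefix_subst (xs @ ys) as (i + length (xs @ ys)) = as i" for i
    by (simp add: prefix_subst_def)
  ultimately show ?thesis using assms by (simp add: fsubst_Umat o_def)
qed

context variable_supply
begin

lemma typed_subst_funpow_up:
  "typed_subst \<Gamma>' \<theta> \<Gamma> \<Longrightarrow> length \<Theta> = n \<Longrightarrow> typed_subst (\<Theta> @ \<Gamma>') ((up ^^ n) \<theta>) (\<Theta> @ \<Gamma>)"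
  by (induction \<Theta> arbitrary: n) (auto intro: typed_subst_up)

lemma typed_list_tlift:
  "list_all2 (typed \<Gamma>) ts \<sigma>s \<Longrightarrow> length \<Gamma>' = n \<Longrightarrow> list_all2 (typed (\<Gamma>' @ \<Gamma>)) (map (tlift n) ts) \<sigma>s"
  by (simp add: list_all2_conv_all_nth typed_tlift)

lemma typed_list_tlift1:
  "list_all2 (typed \<Gamma>) ts \<sigma>s \<Longrightarrow> list_all2 (typed (\<sigma> # \<Gamma>)) (map (tlift (Suc 0)) ts) \<sigma>s"
  by (simp add: list_all2_conv_all_nth)

lemma typed_list_apps:
  "list_all2 (typed \<Gamma>) Us (map (arrs \<sigma>s) \<tau>s) \<Longrightarrow> list_all2 (typed \<Gamma>) xs \<sigma>s \<Longrightarrow>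
    list_all2 (typed \<Gamma>) (map (\<lambda>U. apps U xs) Us) \<tau>s"
  unfolding list_all2_map1 list_all2_map2 by (erule list_all2_mono) (rule typed_apps)

lemma typed_vars: "list_all2 (typed (rev \<tau>s @ \<Gamma>)) (vars (length \<tau>s)) \<tau>s"
  by (rule list_all2_mono[OF has_ty_vars]) (rule has_ty_imp_typed)

lemma well_formed_BAlls:
  "list_all2 (typed \<Gamma>) ss (map Seq \<tau>s) \<Longrightarrow> well_formed (rev \<tau>s @ \<Gamma>) \<phi> \<Longrightarrow> well_formed \<Gamma> (BAlls \<tau>s ss \<phi>)"
proof (induction \<tau>s arbitrary: \<Gamma> ss)
  case (Cons \<tau> \<tau>s)
  then obtain s ss' where ss: "ss = s # ss'" "typed \<Gamma> s (Seq \<tau>)"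
    "list_all2 (typed \<Gamma>) ss' (map Seq \<tau>s)"
    by (auto simp: list_all2_Cons2)
  have "well_formed (\<tau> # \<Gamma>) (BAlls \<tau>s (map (tlift 1) ss') \<phi>)"
    using Cons.IH[of "\<tau> # \<Gamma>"] Cons.prems(2) typed_list_tlift1[OF ss(3)] by simp
  then show ?case using ss(1,2) by simp
qed simp

definition matrix_typed :: "ty list \<Rightarrow> fm \<Rightarrow> bool" where
  "matrix_typed \<Gamma> \<Phi> \<longleftrightarrow> (\<forall>\<Gamma>' as xs ys. typed_subst \<Gamma>' as \<Gamma> \<longrightarrow> list_all2 (typed \<Gamma>') xs (Uex \<Phi>) \<longrightarrow>
    list_all2 (typed \<Gamma>') ys (Uall \<Phi>) \<longrightarrow> well_formed \<Gamma>' (Umat \<Phi> as xs ys))"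

lemma matrix_typedI:
  assumes "\<And>\<Gamma>' as xs ys. typed_subst \<Gamma>' as \<Gamma> \<Longrightarrow> list_all2 (typed \<Gamma>') xs (Uex \<Phi>) \<Longrightarrow>
    list_all2 (typed \<Gamma>') ys (Uall \<Phi>) \<Longrightarrow> well_formed \<Gamma>' (Umat \<Phi> as xs ys)"
  shows "matrix_typed \<Gamma> \<Phi>"
  unfolding matrix_typed_def using assms by blast

lemma matrix_typedD:
  assumes "matrix_typed \<Gamma> \<Phi>" "typed_subst \<Gamma>' as \<Gamma>" "list_all2 (typed \<Gamma>') xs (Uex \<Phi>)"
    and "list_all2 (typed \<Gamma>') ys (Uall \<Phi>)"
  shows "well_formed \<Gamma>' (Umat \<Phi> as xs ys)"
  using assms unfolding matrix_typed_def by blast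

lemma matrix_typed_lifted:
  assumes "matrix_typed \<Gamma> \<Phi>" "typed_subst \<Gamma>' as \<Gamma>" "list_all2 (typed \<Gamma>') xs (Uex \<Phi>)"
    and n: "n = length (Uall \<Phi>)"
  shows "well_formed (rev (Uall \<Phi>) @ \<Gamma>') (Umat \<Phi> (tlift n \<circ> as) (map (tlift n) xs) (vars n))"
  unfolding n
  by (intro matrix_typedD[OF assms(1)] typed_subst_tlift typed_list_tlift typed_vars assms) simp_all

lemma matrix_typed_bounded:
  assumes "matrix_typed \<Gamma> \<Phi>" "typed_subst \<Gamma>' as \<Gamma>" "list_all2 (typed \<Gamma>') xs (Uex \<Phi>)"
    and "list_all2 (typed \<Gamma>') Ss (map Seq (Uall \<Phi>))" and "n = length (Uall \<Phi>)"
  shows "well_formed \<Gamma>' (BAlls (Uall \<Phi>) Ss (Umat \<Phi> (tlift n \<circ> as) (map (tlift n) xs) (vars n)))"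
  using assms(4) matrix_typed_lifted[OF assms(1-3,5)] by (rule well_formed_BAlls)

lemma matrix_typed_And:
  assumes "matrix_typed \<Gamma> \<Phi>" "matrix_typed \<Gamma> \<Psi>"
  shows "matrix_typed \<Gamma> (And \<Phi> \<Psi>)"
proof (rule matrix_typedI)
  fix \<Gamma>' as xus yvs assume as: "typed_subst \<Gamma>' as \<Gamma>"
    and xus: "list_all2 (typed \<Gamma>') xus (Uex (And \<Phi> \<Psi>))"
    and yvs: "list_all2 (typed \<Gamma>') yvs (Uall (And \<Phi> \<Psi>))"
  note xs_us = list_all2_split[OF xus[simplified]] and ys_vs = list_all2_split[OF yvs[simplified]]
  show "well_formed \<Gamma>' (Umat (And \<Phi> \<Psi>) as xus yvs)"
    using matrix_typedD[OF assms(1) as xs_us(1) ys_vs(1)]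
      matrix_typedD[OF assms(2) as xs_us(2) ys_vs(2)]
    by (simp add: Let_def)
qed

lemma matrix_typed_Or:
  assumes "matrix_typed \<Gamma> \<Phi>" "matrix_typed \<Gamma> \<Psi>"
  shows "matrix_typed \<Gamma> (Or \<Phi> \<Psi>)"
proof (rule matrix_typedI)
  fix \<Gamma>' as zxus yvs assume as: "typed_subst \<Gamma>' as \<Gamma>"
    and zxus: "list_all2 (typed \<Gamma>') zxus (Uex (Or \<Phi> \<Psi>))"
    and yvs: "list_all2 (typed \<Gamma>') yvs (Uall (Or \<Phi> \<Psi>))"
  obtain z xus where z: "zxus = z # xus" "typed \<Gamma>' z N"
    and xus: "list_all2 (typed \<Gamma>') xus (Uex \<Phi> @ Uex \<Psi>)"
    using zxus by (auto simp: list_all2_Cons2)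
  note xs_us = list_all2_split[OF xus] and ys_vs = list_all2_split[OF yvs[simplified]]
  show "well_formed \<Gamma>' (Umat (Or \<Phi> \<Psi>) as zxus yvs)"
    using matrix_typedD[OF assms(1) as xs_us(1) ys_vs(1)]
      matrix_typedD[OF assms(2) as xs_us(2) ys_vs(2)] z
    by (simp add: Let_def)
qed

lemma matrix_typed_Imp:
  assumes "matrix_typed \<Gamma> \<Phi>" "matrix_typed \<Gamma> \<Psi>"
  shows "matrix_typed \<Gamma> (Imp \<Phi> \<Psi>)"
proof (rule matrix_typedI)
  fix \<Gamma>' as UYs xvs assume as: "typed_subst \<Gamma>' as \<Gamma>"
    and UYs: "list_all2 (typed \<Gamma>') UYs (Uex (Imp \<Phi> \<Psi>))"
    and xvs: "list_all2 (typed \<Gamma>') xvs (Uall (Imp \<Phi> \<Psi>))"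
  let ?n = "length (Uall \<Phi>)"
  let ?Us = "take (length (Uex \<Psi>)) UYs" and ?Ys = "drop (length (Uex \<Psi>)) UYs"
  let ?xs = "take (length (Uex \<Phi>)) xvs" and ?vs = "drop (length (Uex \<Phi>)) xvs"
  have Us: "list_all2 (typed \<Gamma>') ?Us (map (arrs (Uex \<Phi>)) (Uex \<Psi>))"
    and Ys: "list_all2 (typed \<Gamma>') ?Ys (map (arrs (Uex \<Phi> @ Uall \<Psi>)) (map Seq (Uall \<Phi>)))"
    using list_all2_split[of "typed \<Gamma>'" UYs "map (arrs (Uex \<Phi>)) (Uex \<Psi>)"] UYs by (auto simp: o_def)
  have xs: "list_all2 (typed \<Gamma>') ?xs (Uex \<Phi>)" and vs: "list_all2 (typed \<Gamma>') ?vs (Uall \<Psi>)"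
    using list_all2_split[of "typed \<Gamma>'" xvs "Uex \<Phi>"] xvs by auto
  have "well_formed \<Gamma>' (BAlls (Uall \<Phi>) (map (\<lambda>Y. apps Y (?xs @ ?vs)) ?Ys)
      (Umat \<Phi> (tlift ?n \<circ> as) (map (tlift ?n) ?xs) (vars ?n)))"
    by (rule matrix_typed_bounded[OF assms(1) as xs
      typed_list_apps[OF Ys list_all2_appendI[OF xs vs]] refl])
  moreover have "well_formed \<Gamma>' (Umat \<Psi> as (map (\<lambda>U. apps U ?xs) ?Us) ?vs)"
    by (rule matrix_typedD[OF assms(2) as typed_list_apps[OF Us xs] vs])
  ultimately show "well_formed \<Gamma>' (Umat (Imp \<Phi> \<Psi>) as UYs xvs)" by (simp add: Let_def)
qed

lemma matrix_typed_All: "matrix_typed (\<sigma> # \<Gamma>) \<Phi> \<Longrightarrow> matrix_typed \<Gamma> (All \<sigma> \<Phi>)"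
  by (rule matrix_typedI) (auto intro!: matrix_typedD typed_subst_up typed_list_tlift1)

lemma matrix_typed_Ex:
  assumes "matrix_typed (\<sigma> # \<Gamma>) \<Phi>"
  shows "matrix_typed \<Gamma> (Ex \<sigma> \<Phi>)"
proof (rule matrix_typedI)
  fix \<Gamma>' as xs Ss assume as: "typed_subst \<Gamma>' as \<Gamma>"
    and xs: "list_all2 (typed \<Gamma>') xs (Uex (Ex \<sigma> \<Phi>))"
    and Ss: "list_all2 (typed \<Gamma>') Ss (Uall (Ex \<sigma> \<Phi>))"
  let ?n = "length (Uall \<Phi>)"
  have "well_formed (\<sigma> # \<Gamma>') (BAlls (Uall \<Phi>) (map (tlift 1) Ss)
      (Umat \<Phi> (tlift ?n \<circ> up as) (map (tlift ?n) (map (tlift 1) xs)) (vars ?n)))"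
    by (rule matrix_typed_bounded[OF assms typed_subst_up[OF as] _ _ refl])
      (use xs Ss typed_list_tlift1 in simp_all)
  then show "well_formed \<Gamma>' (Umat (Ex \<sigma> \<Phi>) as xs Ss)" by (simp add: Let_def o_def)
qed

lemma matrix_typed_ExSt:
  assumes "matrix_typed (\<sigma> # \<Gamma>) \<Phi>"
  shows "matrix_typed \<Gamma> (ExSt \<sigma> \<Phi>)"
proof (rule matrix_typedI)
  fix \<Gamma>' as zxs ys assume as: "typed_subst \<Gamma>' as \<Gamma>"
    and zxs: "list_all2 (typed \<Gamma>') zxs (Uex (ExSt \<sigma> \<Phi>))"
    and ys: "list_all2 (typed \<Gamma>') ys (Uall (ExSt \<sigma> \<Phi>))"
  obtain z xs where split: "zxs = z # xs" and z: "typed \<Gamma>' z \<sigma>"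
    and xs: "list_all2 (typed \<Gamma>') xs (Uex \<Phi>)"
    using zxs by (auto simp: list_all2_Cons2)
  show "well_formed \<Gamma>' (Umat (ExSt \<sigma> \<Phi>) as zxs ys)"
    using matrix_typedD[OF assms typed_subst_case_nat[OF z as] xs] ys split by simp
qed

lemma matrix_typed_AllSt:
  assumes "matrix_typed (\<sigma> # \<Gamma>) \<Phi>"
  shows "matrix_typed \<Gamma> (AllSt \<sigma> \<Phi>)"
proof (rule matrix_typedI)
  fix \<Gamma>' as Xs yzs assume as: "typed_subst \<Gamma>' as \<Gamma>"
    and Xs: "list_all2 (typed \<Gamma>') Xs (Uex (AllSt \<sigma> \<Phi>))"
    and yzs: "list_all2 (typed \<Gamma>') yzs (Uall (AllSt \<sigma> \<Phi>))"
  obtain ys z where split: "yzs = ys @ [z]" and ys: "list_all2 (typed \<Gamma>') ys (Uall \<Phi>)"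
    and z: "typed \<Gamma>' z \<sigma>"
    using yzs by (auto simp: list_all2_append2 list_all2_Cons2)
  have "list_all2 (typed \<Gamma>') (map (\<lambda>X. X \<^bold>\<cdot> z) Xs) (Uex \<Phi>)"
    using typed_list_apps[of \<Gamma>' Xs "[\<sigma>]" "Uex \<Phi>" "[z]"] Xs z by simp
  then show "well_formed \<Gamma>' (Umat (AllSt \<sigma> \<Phi>) as Xs yzs)"
    using matrix_typedD[OF assms typed_subst_case_nat[OF z as] _ ys] split by simp
qed

lemma wff_matrix_typed: "wff \<Gamma> \<Phi> \<Longrightarrow> matrix_typed \<Gamma> \<Phi>"
proof (induction \<Phi> arbitrary: \<Gamma>)
  case (Eq \<sigma> t u)
  then have "has_ty \<Gamma> t \<sigma>" "has_ty \<Gamma> u \<sigma>" by simp_all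
  then show ?case using typed_tsubst by (intro matrix_typedI) auto
next
  case (St \<sigma> t)
  then have "has_ty \<Gamma> t \<sigma>" by simp
  then show ?case using typed_tsubst by (intro matrix_typedI) (auto simp: list_all2_Cons2)
qed (auto intro!: matrix_typedI[of _ Bot] matrix_typed_And matrix_typed_Or matrix_typed_Imp
    matrix_typed_All matrix_typed_Ex matrix_typed_ExSt matrix_typed_AllSt)

lemma well_formed_Umat:
  "wff \<Gamma> \<Phi> \<Longrightarrow> typed_subst \<Gamma>' as \<Gamma> \<Longrightarrow> list_all2 (typed \<Gamma>') xs (Uex \<Phi>) \<Longrightarrow>
    list_all2 (typed \<Gamma>') ys (Uall \<Phi>) \<Longrightarrow> well_formed \<Gamma>' (Umat \<Phi> as xs ys)"
  by (rule matrix_typedD[OF wff_matrix_typed])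

end

section \<open>Forcing the matrix\<close>

context internal_theory
begin

lemma finst_BAlls:
  assumes "length ss = length \<tau>s"
  shows "finst t (Imp (Mem \<tau> (Var 0) (tlift 1 s)) (BAlls \<tau>s (map (tlift 1) ss) \<phi>)) =
    Imp (Mem \<tau> t s) (BAlls \<tau>s ss (fsubst ((up ^^ length \<tau>s) (case_nat t Var)) \<phi>))"
  using assms by (simp add: finst_def fsubst_BAlls o_def)

lemma well_formed_fsubst_funpow_up:
  assumes "well_formed (rev \<tau>s @ [\<tau>]) \<phi>" "y \<^bold>: \<tau>"
  shows "well_formed (rev \<tau>s) (fsubst ((up ^^ length \<tau>s) (case_nat y Var)) \<phi>)"
proof -
  obtain n where "wff (rev \<tau>s @ [\<tau>] @ ctx n) \<phi>" using assms(1) by (auto simp: well_formed_def)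
  moreover have "typed_subst (rev \<tau>s @ []) ((up ^^ length \<tau>s) (case_nat y Var))
    (rev \<tau>s @ [\<tau>] @ ctx n)"
    using typed_subst_funpow_up[OF typed_subst_case_nat[OF assms(2) typed_subst_Var[of n]],
      of "rev \<tau>s"]
    by simp
  ultimately show ?thesis using well_formed_fsubst by fastforce
qed

lemma forces_BAlls_Cons:
  assumes "well_formed (rev (\<tau> # \<tau>s)) \<phi>" "s \<^bold>: Seq \<tau>" "ss \<^bold>:\<^bold>: map Seq \<tau>s"
  shows "W \<tturnstile> BAlls (\<tau> # \<tau>s) (s # ss) \<phi> \<longleftrightarrow> (\<forall>y. y \<^bold>: \<tau> \<longrightarrow> (\<forall>W'\<ge>W. W' \<tturnstile> Mem \<tau> y s \<longrightarrow>
    W' \<tturnstile> BAlls \<tau>s ss (fsubst ((up ^^ length \<tau>s) (case_nat y Var)) \<phi>)))"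
proof -
  have length: "length ss = length \<tau>s" using list_all2_lengthD[OF assms(3)] by simp
  have "well_formed [] (BAlls (\<tau> # \<tau>s) (s # ss) \<phi>)"
    by (rule well_formed_BAlls) (use assms in simp_all)
  then show ?thesis
    unfolding BAlls.simps using assms(2)
    by (simp add: forces_All finst_BAlls[OF length, unfolded One_nat_def] forces_Imp
      del: finst_simps)
qed

lemma forces_BAlls:
  assumes "well_formed (rev \<tau>s) \<phi>" "ss \<^bold>:\<^bold>: map Seq \<tau>s"
  shows "W \<tturnstile> BAlls \<tau>s ss \<phi> \<longleftrightarrow>
    (\<forall>W'\<ge>W. \<forall>ys. mems W' \<tau>s ys ss \<longrightarrow> W' \<tturnstile> fsubst (prefix_subst (rev ys) Var) \<phi>)"
  using assms
proof (induction \<tau>s arbitrary: W ss \<phi>)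
  case Nil
  then show ?case by (auto simp: list_all3_conv_all_nth intro: forces_mono)
next
  case (Cons \<tau> \<tau>s)
  then obtain s ss' where ss: "ss = s # ss'" "s \<^bold>: Seq \<tau>" "ss' \<^bold>:\<^bold>: map Seq \<tau>s"
    by (auto simp: list_all2_Cons2)
  let ?\<phi> = "\<lambda>y. fsubst ((up ^^ length \<tau>s) (case_nat y Var)) \<phi>"
  have IH: "W' \<tturnstile> BAlls \<tau>s ss' (?\<phi> y) \<longleftrightarrow>
      (\<forall>W''\<ge>W'. \<forall>ys. mems W'' \<tau>s ys ss' \<longrightarrow> W'' \<tturnstile> fsubst (prefix_subst (rev (y # ys)) Var) \<phi>)"
    if y: "y \<^bold>: \<tau>" for W' y
    unfolding Cons.IH[OF well_formed_fsubst_funpow_up[OF Cons.prems(1)[simplified] y] ss(3)]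
    by (auto simp: fsubst_fsubst list_all3_conv_all_nth tsubst_prefix_subst_funpow_up)
  show ?case unfolding ss(1) forces_BAlls_Cons[OF Cons.prems(1) ss(2,3)]
  proof (intro iffI HOL.allI HOL.impI)
    fix W' ys assume L: "\<forall>y. y \<^bold>: \<tau> \<longrightarrow> (\<forall>W'\<ge>W. W' \<tturnstile> Mem \<tau> y s \<longrightarrow> W' \<tturnstile> BAlls \<tau>s ss' (?\<phi> y))"
      and W': "W \<le> W'" and mems: "mems W' (\<tau> # \<tau>s) ys (s # ss')"
    obtain y ys' where ys: "ys = y # ys'" "W' \<tturnstile> Mem \<tau> y s" "mems W' \<tau>s ys' ss'"
      using mems by (cases ys) auto
    have y: "y \<^bold>: \<tau>" using forces_MemD[OF ys(2)] by blast
    then have "W' \<tturnstile> BAlls \<tau>s ss' (?\<phi> y)" using L W' ys(2) by blast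
    then show "W' \<tturnstile> fsubst (prefix_subst (rev ys) Var) \<phi>"
      unfolding IH[OF y] ys(1) using ys(3) by blast
  next
    fix y W' assume R: "\<forall>W'\<ge>W. \<forall>ys. mems W' (\<tau> # \<tau>s) ys (s # ss') \<longrightarrow>
        W' \<tturnstile> fsubst (prefix_subst (rev ys) Var) \<phi>"
      and y: "y \<^bold>: \<tau>" and W': "W \<le> W'" and mem: "W' \<tturnstile> Mem \<tau> y s"
    show "W' \<tturnstile> BAlls \<tau>s ss' (?\<phi> y)" unfolding IH[OF y]
    proof (intro HOL.allI HOL.impI)
      fix W'' ys assume W'': "W' \<le> W''" and "mems W'' \<tau>s ys ss'"
      then have "mems W'' (\<tau> # \<tau>s) (y # ys) (s # ss')" using forces_mono[OF mem W''] by simp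
      then show "W'' \<tturnstile> fsubst (prefix_subst (rev (y # ys)) Var) \<phi>"
        using R order_trans[OF W' W''] by blast
    qed
  qed
qed

definition answers :: "fm fset \<Rightarrow> fm \<Rightarrow> (nat \<Rightarrow> tm) \<Rightarrow> tm list \<Rightarrow> tm list \<Rightarrow> bool" where
  "answers W \<Phi> as xs Ss \<longleftrightarrow> (\<forall>W'\<ge>W. \<forall>ys. mems W' (Uall \<Phi>) ys Ss \<longrightarrow> W' \<tturnstile> Umat \<Phi> as xs ys)"

lemma answersD: "answers W \<Phi> as xs Ss \<Longrightarrow> W \<le> W' \<Longrightarrow> mems W' (Uall \<Phi>) ys Ss \<Longrightarrow> W' \<tturnstile> Umat \<Phi> as xs ys"
  by (simp add: answers_def)

lemma answers_mono: "answers W \<Phi> as xs Ss \<Longrightarrow> W \<le> W' \<Longrightarrow> answers W' \<Phi> as xs Ss"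
  unfolding answers_def using order_trans by blast

lemma answers_antimono:
  "answers W \<Phi> as xs Ss \<Longrightarrow>
    (\<And>W' ys. W \<le> W' \<Longrightarrow> mems W' (Uall \<Phi>) ys Ts \<Longrightarrow> mems W' (Uall \<Phi>) ys Ss) \<Longrightarrow> answers W \<Phi> as xs Ts"
  by (simp add: answers_def)

lemma forces_bounded_Umat:
  assumes "wff \<Gamma> \<Phi>" "typed_subst [] as \<Gamma>" "xs \<^bold>:\<^bold>: Uex \<Phi>" "Ss \<^bold>:\<^bold>: map Seq (Uall \<Phi>)"
    and n: "n = length (Uall \<Phi>)"
  shows "W \<tturnstile> BAlls (Uall \<Phi>) Ss (Umat \<Phi> (tlift n \<circ> as) (map (tlift n) xs) (vars n)) \<longleftrightarrow>
    answers W \<Phi> as xs Ss"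
proof -
  let ?U = "Umat \<Phi> (tlift n \<circ> as) (map (tlift n) xs) (vars n)"
  have "well_formed (rev (Uall \<Phi>)) ?U"
    using matrix_typed_lifted[OF wff_matrix_typed[OF assms(1)] assms(2,3) n] by simp
  moreover have "fsubst (prefix_subst (rev ys) Var) ?U = Umat \<Phi> as xs ys"
    if "mems W' (Uall \<Phi>) ys Ss" for W' ys
    using that list_all2_lengthD[OF assms(3)] n
    by (intro fsubst_prefix_subst_Umat) (simp_all add: list_all3_conv_all_nth)
  ultimately show ?thesis using forces_BAlls[OF _ assms(4)] unfolding answers_def by auto
qed

lemma forces_Umat_Imp:
  assumes "wff \<Gamma> \<Phi>" "typed_subst [] as \<Gamma>" "Us \<^bold>:\<^bold>: map (arrs (Uex \<Phi>)) (Uex \<Psi>)"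
    and "Ys \<^bold>:\<^bold>: map (arrs (Uex \<Phi> @ Uall \<Psi>)) (map Seq (Uall \<Phi>))" "xs \<^bold>:\<^bold>: Uex \<Phi>" "vs \<^bold>:\<^bold>: Uall \<Psi>"
  shows "W \<tturnstile> Umat (Imp \<Phi> \<Psi>) as (Us @ Ys) (xs @ vs) \<longleftrightarrow>
    (\<forall>W'\<ge>W. answers W' \<Phi> as xs (map (\<lambda>Y. apps Y (xs @ vs)) Ys) \<longrightarrow>
      W' \<tturnstile> Umat \<Psi> as (map (\<lambda>U. apps U xs) Us) vs)"
proof -
  have Ss: "map (\<lambda>Y. apps Y (xs @ vs)) Ys \<^bold>:\<^bold>: map Seq (Uall \<Phi>)"
    using assms(4) list_all2_appendI[OF assms(5,6)] by (rule typed_list_apps)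
  note answers = forces_bounded_Umat[OF assms(1,2,5) Ss refl]
  have "length Us = length (Uex \<Psi>)" "length xs = length (Uex \<Phi>)"
    using assms(3,5) by (auto dest: list_all2_lengthD)
  then show ?thesis
    using forces_Imp matrix_typed_bounded[OF wff_matrix_typed[OF assms(1)] assms(2,5) Ss refl]
    by (simp add: Let_def answers)
qed

lemma forces_Umat_All:
  assumes "wff (\<sigma> # \<Gamma>) \<Phi>" "typed_subst [] as \<Gamma>" "xs \<^bold>:\<^bold>: Uex \<Phi>" "ys \<^bold>:\<^bold>: Uall \<Phi>"
  shows "W \<tturnstile> Umat (All \<sigma> \<Phi>) as xs ys \<longleftrightarrow> (\<forall>t. t \<^bold>: \<sigma> \<longrightarrow> W \<tturnstile> Umat \<Phi> (case_nat t as) xs ys)"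
proof -
  have "well_formed [] (Umat (All \<sigma> \<Phi>) as xs ys)"
    by (rule well_formed_Umat) (use assms in simp_all)
  moreover have "finst t (Umat \<Phi> (up as) (map (tlift 1) xs) (map (tlift 1) ys)) =
      Umat \<Phi> (case_nat t as) xs ys" for t
    using list_all2_lengthD[OF assms(3)] list_all2_lengthD[OF assms(4)]
    by (simp add: finst_def fsubst_Umat tsubst_case_nat_up o_def cong: nat.case_cong)
  ultimately show ?thesis by (simp add: forces_All)
qed

lemma
  assumes \<Phi>: "wff (\<sigma> # \<Gamma>) \<Phi>" and as: "typed_subst [] as \<Gamma>"
    and xs: "xs \<^bold>:\<^bold>: Uex \<Phi>" and Ss: "Ss \<^bold>:\<^bold>: map Seq (Uall \<Phi>)"
  shows forces_Umat_ExI: "t \<^bold>: \<sigma> \<Longrightarrow> answers W \<Phi> (case_nat t as) xs Ss \<Longrightarrow> W \<tturnstile> Umat (Ex \<sigma> \<Phi>) as xs Ss"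
    and forces_Umat_ExE: "W \<tturnstile> Umat (Ex \<sigma> \<Phi>) as xs Ss \<Longrightarrow> well_formed [] \<chi> \<Longrightarrow>
      (\<And>W' t. W \<le> W' \<Longrightarrow> t \<^bold>: \<sigma> \<Longrightarrow> answers W' \<Phi> (case_nat t as) xs Ss \<Longrightarrow> W' \<tturnstile> \<chi>) \<Longrightarrow> W \<tturnstile> \<chi>"
proof -
  let ?n = "length (Uall \<Phi>)"
  let ?B = "BAlls (Uall \<Phi>) (map (tlift 1) Ss)
    (Umat \<Phi> (tlift ?n \<circ> up as) (map (tlift (?n + 1)) xs) (vars ?n))"
  have Ex: "Umat (Ex \<sigma> \<Phi>) as xs Ss = Ex \<sigma> ?B" by (simp add: Let_def)
  have lengths: "length xs = length (Uex \<Phi>)" "length Ss = length (Uall \<Phi>)"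
    using list_all2_lengthD[OF xs] list_all2_lengthD[OF Ss] by auto
  have "tsubst ((up ^^ ?n) (case_nat t Var)) (tlift (Suc ?n) u) = tlift ?n u" for t u
    using tsubst_funpow_up_tlift[of ?n "case_nat t Var" "tlift 1 u"] by simp
  then have "finst t ?B =
      BAlls (Uall \<Phi>) Ss (Umat \<Phi> (tlift ?n \<circ> case_nat t as) (map (tlift ?n) xs) (vars ?n))" for t
    using lengths
    by (simp add: finst_def fsubst_BAlls fsubst_Umat o_def tsubst_funpow_up_tlift
        tsubst_case_nat_up tsubst_funpow_up_vars cong: nat.case_cong)
  then have answers: "W \<tturnstile> finst t ?B \<longleftrightarrow> answers W \<Phi> (case_nat t as) xs Ss" if "t \<^bold>: \<sigma>" for W t
    using forces_bounded_Umat[OF \<Phi> typed_subst_case_nat[OF that as] xs Ss refl] by simp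
  have "well_formed [] (Umat (Ex \<sigma> \<Phi>) as xs Ss)"
    by (rule well_formed_Umat) (use assms in simp_all)
  then have wf: "well_formed [\<sigma>] ?B" by (simp add: Let_def)
  show "t \<^bold>: \<sigma> \<Longrightarrow> answers W \<Phi> (case_nat t as) xs Ss \<Longrightarrow> W \<tturnstile> Umat (Ex \<sigma> \<Phi>) as xs Ss"
    unfolding Ex using forces_exI[OF _ _ wf] answers by blast
  show "W \<tturnstile> Umat (Ex \<sigma> \<Phi>) as xs Ss \<Longrightarrow> well_formed [] \<chi> \<Longrightarrow>
      (\<And>W' t. W \<le> W' \<Longrightarrow> t \<^bold>: \<sigma> \<Longrightarrow> answers W' \<Phi> (case_nat t as) xs Ss \<Longrightarrow> W' \<tturnstile> \<chi>) \<Longrightarrow> W \<tturnstile> \<chi>"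
    unfolding Ex by (erule forces_exE) (use answers in blast)+
qed

lemma eq_subst_prefix_subst:
  "eqs W \<sigma>s ts us \<Longrightarrow> eq_subst W \<Gamma> \<theta> \<theta>' \<Longrightarrow>
    eq_subst W (\<sigma>s @ \<Gamma>) (prefix_subst ts \<theta>) (prefix_subst us \<theta>')"
  by (auto simp: eq_subst_def prefix_subst_def list_all3_conv_all_nth nth_append)

lemma forces_Umat_cong:
  assumes \<Phi>: "wff \<Gamma> \<Phi>" and "eq_subst W \<Gamma> as bs" "eqs W (Uex \<Phi>) xs us" "eqs W (Uall \<Phi>) ys vs"
    and "W \<tturnstile> Umat \<Phi> as xs ys"
  shows "W \<tturnstile> Umat \<Phi> bs us vs"
proof -
  let ?m = "length (Uex \<Phi>)" and ?n = "length (Uall \<Phi>)" and ?\<sigma>s = "Uex \<Phi> @ Uall \<Phi>"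
  let ?U = "Umat \<Phi> (\<lambda>i. Var (i + (?m + ?n))) (map Var [0..<?m]) (map Var [?m..<?m + ?n])"
  define total where "total \<theta> i = (if i < length \<Gamma> then \<theta> i else Var (i - length \<Gamma>))" for \<theta> i
  have total: "Umat \<Phi> (total \<theta>) = Umat \<Phi> \<theta>" for \<theta>
    by (intro ext Umat_subst_cong[OF \<Phi>]) (simp add: total_def)
  have lengths: "length xs = ?m" "length us = ?m" "length ys = ?n" "length vs = ?n"
    using assms(3,4) by (auto simp: list_all3_conv_all_nth)
  have "well_formed (?\<sigma>s @ \<Gamma>) ?U"
    by (rule well_formed_Umat[OF \<Phi>])
      (auto simp: typed_subst_def list_all2_conv_all_nth nth_append)
  then obtain k where U: "wff ((?\<sigma>s @ \<Gamma>) @ ctx k) ?U" unfolding well_formed_def by blast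
  have "eqs W ?\<sigma>s (xs @ ys) (us @ vs)" using assms(3,4) lengths by (simp add: list_all3_append)
  moreover have "eq_subst W (\<Gamma> @ ctx k) (total as) (total bs)"
    using assms(2) by (auto simp: eq_subst_def total_def nth_append intro: forces_eq_refl)
  ultimately have "eq_subst W ((?\<sigma>s @ \<Gamma>) @ ctx k) (prefix_subst (xs @ ys) (total as))
      (prefix_subst (us @ vs) (total bs))"
    unfolding append_assoc[of ?\<sigma>s] by (rule eq_subst_prefix_subst)
  then have "W \<tturnstile> fsubst (prefix_subst (us @ vs) (total bs)) ?U"
    using U by (rule forces_fsubst_cong)
      (use assms(5) fsubst_Umat_generic[of xs \<Phi> ys "total as"] lengths total in auto)
  then show ?thesis using fsubst_Umat_generic[of us \<Phi> vs "total bs"] lengths total by simp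
qed

lemma answers_cong:
  assumes "wff \<Gamma> \<Phi>" "eq_subst W \<Gamma> as bs" "eqs W (Uex \<Phi>) xs us" "eqs W (map Seq (Uall \<Phi>)) Ss Ts"
    and "answers W \<Phi> as xs Ss"
  shows "answers W \<Phi> bs us Ts"
  unfolding answers_def
proof (intro HOL.allI HOL.impI)
  fix W' ys assume W': "W \<le> W'" and ys: "mems W' (Uall \<Phi>) ys Ts"
  have "mems W' (Uall \<Phi>) ys Ss"
    using ys eqs_mono[OF eqs_sym[OF assms(4)] W'] by (rule mems_cong)
  then have "W' \<tturnstile> Umat \<Phi> as xs ys" by (rule answersD[OF assms(5) W'])
  then show "W' \<tturnstile> Umat \<Phi> bs us ys"
    by (rule forces_Umat_cong[OF assms(1) eq_subst_mono[OF assms(2) W'] eqs_mono[OF assms(3) W']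
          eqs_refl[OF mems_typed[OF ys]]])
qed

end

section \<open>Soundness of logic\<close>

declare Umat.simps(4-8) [simp del]

lemma Umat_And:
  "length xs = length (Uex \<Phi>) \<Longrightarrow> length ys = length (Uall \<Phi>) \<Longrightarrow>
    Umat (And \<Phi> \<Psi>) as (xs @ us) (ys @ vs) = And (Umat \<Phi> as xs ys) (Umat \<Psi> as us vs)"
  by (simp add: Umat.simps Let_def)

lemma Umat_Or:
  "length xs = length (Uex \<Phi>) \<Longrightarrow> length ys = length (Uall \<Phi>) \<Longrightarrow>
    Umat (Or \<Phi> \<Psi>) as (z # xs @ us) (ys @ vs) =
      And (Imp (Eq N z zero) (Umat \<Phi> as xs ys)) (Imp (Neg (Eq N z zero)) (Umat \<Psi> as us vs))"
  by (simp add: Umat.simps Let_def)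

lemma Uex_Imp:
  "Uex (Imp \<Phi> \<Psi>) = map (arrs (Uex \<Phi>)) (Uex \<Psi>) @ map (arrs (Uex \<Phi> @ Uall \<Psi>)) (map Seq (Uall \<Phi>))"
  by (simp add: o_def)

context internal_theory
begin

definition realizes ::
    "ty list \<Rightarrow> fm \<Rightarrow> fm \<Rightarrow> (tm list \<Rightarrow> tm list) \<Rightarrow> (tm list \<Rightarrow> tm list) \<Rightarrow> bool" where
  "realizes \<Gamma> \<Phi> \<Psi> f g \<longleftrightarrow> (\<forall>W as xs vs. typed_subst [] as \<Gamma> \<longrightarrow> xs \<^bold>:\<^bold>: Uex \<Phi> \<longrightarrow> vs \<^bold>:\<^bold>: Uall \<Psi> \<longrightarrow>
    answers W \<Phi> as xs (g (xs @ vs)) \<longrightarrow> W \<tturnstile> Umat \<Psi> as (f xs) vs)"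

definition realizable :: "ty list \<Rightarrow> fm \<Rightarrow> fm \<Rightarrow> bool" where
  "realizable \<Gamma> \<Phi> \<Psi> \<longleftrightarrow> (\<exists>f g. definable (Uex \<Phi>) f (Uex \<Psi>) \<and>
    definable (Uex \<Phi> @ Uall \<Psi>) g (map Seq (Uall \<Phi>)) \<and> realizes \<Gamma> \<Phi> \<Psi> f g)"

lemma realizesD:
  assumes "realizes \<Gamma> \<Phi> \<Psi> f g" "typed_subst [] as \<Gamma>" "xs \<^bold>:\<^bold>: Uex \<Phi>" "vs \<^bold>:\<^bold>: Uall \<Psi>"
    and "answers W \<Phi> as xs (g (xs @ vs))"
  shows "W \<tturnstile> Umat \<Psi> as (f xs) vs"
  using assms unfolding realizes_def by blast

lemma realizableI:
  assumes "definable (Uex \<Phi>) f (Uex \<Psi>)" "definable (Uex \<Phi> @ Uall \<Psi>) g (map Seq (Uall \<Phi>))"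
    and "\<And>W as xs vs. typed_subst [] as \<Gamma> \<Longrightarrow> xs \<^bold>:\<^bold>: Uex \<Phi> \<Longrightarrow> vs \<^bold>:\<^bold>: Uall \<Psi> \<Longrightarrow>
      answers W \<Phi> as xs (g (xs @ vs)) \<Longrightarrow> W \<tturnstile> Umat \<Psi> as (f xs) vs"
  shows "realizable \<Gamma> \<Phi> \<Psi>"
  unfolding realizable_def realizes_def using assms by blast

lemma realizableE:
  assumes "realizable \<Gamma> \<Phi> \<Psi>"
  obtains f g where "definable (Uex \<Phi>) f (Uex \<Psi>)" "definable (Uex \<Phi> @ Uall \<Psi>) g (map Seq (Uall \<Phi>))"
    "realizes \<Gamma> \<Phi> \<Psi> f g"
  using assms unfolding realizable_def by blast

lemma realizable_linear:
  assumes "definable (Uex \<Phi>) f (Uex \<Psi>)" "definable (Uex \<Phi> @ Uall \<Psi>) h (Uall \<Phi>)"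
    and "\<And>W as xs vs. typed_subst [] as \<Gamma> \<Longrightarrow> xs \<^bold>:\<^bold>: Uex \<Phi> \<Longrightarrow> vs \<^bold>:\<^bold>: Uall \<Psi> \<Longrightarrow>
      W \<tturnstile> Umat \<Phi> as xs (h (xs @ vs)) \<Longrightarrow> W \<tturnstile> Umat \<Psi> as (f xs) vs"
  shows "realizable \<Gamma> \<Phi> \<Psi>"
proof (rule realizableI[OF assms(1) definable_singletons[OF assms(2)]])
  fix W as xs vs assume as: "typed_subst [] as \<Gamma>" and xs: "xs \<^bold>:\<^bold>: Uex \<Phi>" and vs: "vs \<^bold>:\<^bold>: Uall \<Psi>"
    and answers: "answers W \<Phi> as xs (singletons (Uall \<Phi>) (h (xs @ vs)))"
  have "mems W (Uall \<Phi>) (h (xs @ vs)) (singletons (Uall \<Phi>) (h (xs @ vs)))"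
    by (rule mems_singletons[OF definable_typed[OF assms(2) list_all2_appendI[OF xs vs]]])
  then have "W \<tturnstile> Umat \<Phi> as xs (h (xs @ vs))" by (rule answersD[OF answers order_refl])
  then show "W \<tturnstile> Umat \<Psi> as (f xs) vs" by (rule assms(3)[OF as xs vs])
qed

lemma realizable_refl: "realizable \<Gamma> \<Phi> \<Phi>"
  by (rule realizable_linear[OF definable_id definable_drop[OF definable_id refl]])
    (simp add: list_all2_lengthD)

lemma realizable_trans:
  assumes "realizable \<Gamma> A B" "realizable \<Gamma> B C"
  shows "realizable \<Gamma> A C"
proof -
  obtain f g where f: "definable (Uex A) f (Uex B)"
    and g: "definable (Uex A @ Uall B) g (map Seq (Uall A))"
    and B: "realizes \<Gamma> A B f g"
    using assms(1) by (rule realizableE) (rule that)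
  obtain f' g' where f': "definable (Uex B) f' (Uex C)"
    and g': "definable (Uex B @ Uall C) g' (map Seq (Uall B))"
    and C: "realizes \<Gamma> B C f' g'"
    using assms(2) by (rule realizableE) (rule that)
  let ?m = "length (Uex A)" and ?p = "length (Uall C)"
  let ?Z = "\<lambda>z. g' (f (take ?m z) @ drop ?m z)" and ?h = "\<lambda>z. g (take ?m z @ drop (?m + ?p) z)"
  have Z: "definable (Uex A @ Uall C) ?Z (map Seq (Uall B))"
    by (rule definable_comp[OF definable_append[OF
      definable_comp[OF definable_take[OF definable_id refl] f]
          definable_drop[OF definable_id refl]] g'])
  have "definable ((Uex A @ Uall C) @ Uall B) (take ?m) (Uex A)"
    unfolding append_assoc by (rule definable_take[OF definable_id refl])
  moreover have "definable ((Uex A @ Uall C) @ Uall B) (drop (?m + ?p)) (Uall B)"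
    by (rule definable_drop[OF definable_id]) simp
  ultimately have "definable ((Uex A @ Uall C) @ Uall B) ?h (map Seq (Uall A))"
    using definable_comp[OF definable_append g] by blast
  then obtain G where G: "definable (Uex A @ Uall C) G (map Seq (Uall A))"
    and mems_G: "\<And>W xs zs ys. xs \<^bold>:\<^bold>: Uex A @ Uall C \<Longrightarrow> mems W (Uall B) zs (?Z xs) \<Longrightarrow>
      mems W (Uall A) ys (?h (xs @ zs)) \<Longrightarrow> mems W (Uall A) ys (G xs)"
    using Z by (rule definable_bigunion) (rule that)
  show ?thesis
  proof (rule realizableI[OF definable_comp[OF f f'] G])
    fix W as xs vs assume as: "typed_subst [] as \<Gamma>" and xs: "xs \<^bold>:\<^bold>: Uex A" and vs: "vs \<^bold>:\<^bold>: Uall C"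
      and answers: "answers W A as xs (G (xs @ vs))"
    note lengths = list_all2_lengthD[OF xs] list_all2_lengthD[OF vs]
    have "W' \<tturnstile> Umat B as (f xs) zs" if W': "W \<le> W'"
      and zs: "mems W' (Uall B) zs (g' (f xs @ vs))" for W' zs
    proof (rule realizesD[OF B as xs mems_typed[OF zs] answers_antimono[OF answers_mono[OF answers W']]])
      fix W'' ys assume "W' \<le> W''" "mems W'' (Uall A) ys (g (xs @ zs))"
      then show "mems W'' (Uall A) ys (G (xs @ vs))"
        using mems_G[OF list_all2_appendI[OF xs vs], of W'' zs ys] mems_mono[OF zs] lengths by simp
    qed
    then show "W \<tturnstile> Umat C as (f' (f xs)) vs"
      using realizesD[OF C as definable_typed[OF f xs] vs] unfolding answers_def by blast
  qed
qed

lemma answers_AndI: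
  assumes "answers W \<Phi> as xs Ss" "answers W \<Psi> as us Ts"
    and "length xs = length (Uex \<Phi>)" "length Ss = length (Uall \<Phi>)"
  shows "answers W (And \<Phi> \<Psi>) as (xs @ us) (Ss @ Ts)"
  unfolding answers_def
proof (intro HOL.allI HOL.impI)
  fix W' yvs assume W': "W \<le> W'" and yvs: "mems W' (Uall (And \<Phi> \<Psi>)) yvs (Ss @ Ts)"
  obtain ys vs where split: "yvs = ys @ vs" "length ys = length (Uall \<Phi>)"
    using yvs by (metis list_all2_append1 list_all2_lengthD mems_typed append_take_drop_id
        length_append list_all2_append2 Uty.simps(4) snd_conv)
  then have "mems W' (Uall \<Phi>) ys Ss" "mems W' (Uall \<Psi>) vs Ts"
    using yvs assms(4) by (simp_all add: list_all3_append)
  then show "W' \<tturnstile> Umat (And \<Phi> \<Psi>) as (xs @ us) yvs"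
    unfolding split(1) Umat_And[OF assms(3) split(2)]
    using answersD[OF assms(1) W'] answersD[OF assms(2) W'] by simp
qed

lemma mems_pad_append:
  assumes "mems W \<sigma>s ys Ss" "Ts \<^bold>:\<^bold>: map Seq \<tau>s"
  shows "mems W (\<sigma>s @ \<tau>s) (ys @ nulls \<tau>s) (pad \<sigma>s Ss @ pad \<tau>s Ts)"
    and "mems W (\<tau>s @ \<sigma>s) (nulls \<tau>s @ ys) (pad \<tau>s Ts @ pad \<sigma>s Ss)"
  using mems_pad[OF assms(1)] mems_nulls_pad[OF assms(2)] list_all2_lengthD[OF assms(2)] assms(1)
  by (auto simp: list_all3_conv_all_nth nth_append)

lemma
  assumes answers: "answers W (And \<Phi> \<Psi>) as (xs @ us) (pad (Uall \<Phi>) Ss @ pad (Uall \<Psi>) Ts)"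
    and xs: "length xs = length (Uex \<Phi>)"
    and Ss: "Ss \<^bold>:\<^bold>: map Seq (Uall \<Phi>)" and Ts: "Ts \<^bold>:\<^bold>: map Seq (Uall \<Psi>)"
  shows answers_And_padD1: "answers W \<Phi> as xs Ss"
    and answers_And_padD2: "answers W \<Psi> as us Ts"
proof -
  show "answers W \<Phi> as xs Ss" unfolding answers_def
  proof (intro HOL.allI HOL.impI)
    fix W' ys assume W': "W \<le> W'" and ys: "mems W' (Uall \<Phi>) ys Ss"
    have "W' \<tturnstile> Umat (And \<Phi> \<Psi>) as (xs @ us) (ys @ nulls (Uall \<Psi>))"
      by (rule answersD[OF answers W']) (use mems_pad_append(1)[OF ys Ts] in simp)
    then show "W' \<tturnstile> Umat \<Phi> as xs ys"
      using Umat_And[OF xs list_all2_lengthD[OF mems_typed[OF ys]]] by simp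
  qed
  show "answers W \<Psi> as us Ts" unfolding answers_def
  proof (intro HOL.allI HOL.impI)
    fix W' vs assume W': "W \<le> W'" and vs: "mems W' (Uall \<Psi>) vs Ts"
    have "W' \<tturnstile> Umat (And \<Phi> \<Psi>) as (xs @ us) (nulls (Uall \<Phi>) @ vs)"
      by (rule answersD[OF answers W']) (use mems_pad_append(2)[OF vs Ss] in simp)
    then show "W' \<tturnstile> Umat \<Psi> as us vs" using Umat_And[OF xs length_nulls] by simp
  qed
qed

lemma
  assumes answers: "answers W (Or \<Phi> \<Psi>) as (z # xs @ us) (pad (Uall \<Phi>) Ss @ pad (Uall \<Psi>) Ts)"
    and xs: "length xs = length (Uex \<Phi>)"
    and Ss: "Ss \<^bold>:\<^bold>: map Seq (Uall \<Phi>)" and Ts: "Ts \<^bold>:\<^bold>: map Seq (Uall \<Psi>)"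
  shows answers_Or_zeroD: "W \<tturnstile> Eq N z zero \<Longrightarrow> answers W \<Phi> as xs Ss"
    and answers_Or_nonzeroD: "W \<tturnstile> Neg (Eq N z zero) \<Longrightarrow> answers W \<Psi> as us Ts"
proof -
  assume zero: "W \<tturnstile> Eq N z zero"
  show "answers W \<Phi> as xs Ss" unfolding answers_def
  proof (intro HOL.allI HOL.impI)
    fix W' ys assume W': "W \<le> W'" and ys: "mems W' (Uall \<Phi>) ys Ss"
    have "W' \<tturnstile> Umat (Or \<Phi> \<Psi>) as (z # xs @ us) (ys @ nulls (Uall \<Psi>))"
      by (rule answersD[OF answers W']) (use mems_pad_append(1)[OF ys Ts] in simp)
    then have "W' \<tturnstile> Imp (Eq N z zero) (Umat \<Phi> as xs ys)"
      using Umat_Or[OF xs list_all2_lengthD[OF mems_typed[OF ys]]] by simp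
    then show "W' \<tturnstile> Umat \<Phi> as xs ys" using forces_mono[OF zero W'] by (rule forces_mp)
  qed
next
  assume nonzero: "W \<tturnstile> Neg (Eq N z zero)"
  show "answers W \<Psi> as us Ts" unfolding answers_def
  proof (intro HOL.allI HOL.impI)
    fix W' vs assume W': "W \<le> W'" and vs: "mems W' (Uall \<Psi>) vs Ts"
    have "W' \<tturnstile> Umat (Or \<Phi> \<Psi>) as (z # xs @ us) (nulls (Uall \<Phi>) @ vs)"
      by (rule answersD[OF answers W']) (use mems_pad_append(2)[OF vs Ss] in simp)
    then have "W' \<tturnstile> Imp (Neg (Eq N z zero)) (Umat \<Psi> as us vs)"
      using Umat_Or[OF xs length_nulls] by simp
    then show "W' \<tturnstile> Umat \<Psi> as us vs" using forces_mono[OF nonzero W'] by (rule forces_mp)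
  qed
qed

lemma realizable_andI:
  assumes "realizable \<Gamma> G A" "realizable \<Gamma> G B"
  shows "realizable \<Gamma> G (And A B)"
proof -
  obtain f g where f: "definable (Uex G) f (Uex A)"
    and g: "definable (Uex G @ Uall A) g (map Seq (Uall G))"
    and A: "realizes \<Gamma> G A f g"
    using assms(1) by (rule realizableE) (rule that)
  obtain f' g' where f': "definable (Uex G) f' (Uex B)"
    and g': "definable (Uex G @ Uall B) g' (map Seq (Uall G))"
    and B: "realizes \<Gamma> G B f' g'"
    using assms(2) by (rule realizableE) (rule that)
  let ?m = "length (Uex G)" and ?n = "length (Uall A)"
  let ?g = "\<lambda>z. g (take ?m z @ take ?n (drop ?m z))"
    and ?g' = "\<lambda>z. g' (take ?m z @ drop ?n (drop ?m z))"
  have union: "definable (Uex G @ Uall A @ Uall B) (\<lambda>z. appends (Uall G) (?g z) (?g' z))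
    (map Seq (Uall G))"
    by (intro definable_appends definable_comp[OF definable_append g]
      definable_comp[OF definable_append g']
        definable_take[OF definable_id refl]
          definable_take[OF definable_drop[OF definable_id refl] refl]
        definable_drop[OF definable_drop[OF definable_id refl] refl])
  show ?thesis
  proof (rule realizableI[where g = "\<lambda>z. appends (Uall G) (?g z) (?g' z)"])
    show "definable (Uex G) (\<lambda>x. f x @ f' x) (Uex (And A B))"
      using definable_append[OF f f'] by simp
    show "definable (Uex G @ Uall (And A B)) (\<lambda>z. appends (Uall G) (?g z) (?g' z))
      (map Seq (Uall G))"
      using union by simp
    fix W as xs vs assume as: "typed_subst [] as \<Gamma>" and xs: "xs \<^bold>:\<^bold>: Uex G"
      and vs: "vs \<^bold>:\<^bold>: Uall (And A B)"
      and answers: "answers W G as xs (appends (Uall G) (?g (xs @ vs)) (?g' (xs @ vs)))"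
    obtain v v' where v: "vs = v @ v'" "v \<^bold>:\<^bold>: Uall A" "v' \<^bold>:\<^bold>: Uall B"
      using vs by (auto simp: list_all2_append2)
    note lengths = list_all2_lengthD[OF xs] list_all2_lengthD[OF v(2)]
    have "answers W G as xs (appends (Uall G) (g (xs @ v)) (g' (xs @ v')))"
      using answers v(1) lengths by simp
    then have "answers W G as xs (g (xs @ v))" "answers W G as xs (g' (xs @ v'))"
      using mems_appends_left mems_appends_right definable_typed[OF g list_all2_appendI[OF xs v(2)]]
        definable_typed[OF g' list_all2_appendI[OF xs v(3)]]
      by (auto elim!: answers_antimono)
    then show "W \<tturnstile> Umat (And A B) as (f xs @ f' xs) vs"
      unfolding v(1) Umat_And[OF definable_length[OF f lengths(1)] lengths(2)]
      using realizesD[OF A as xs v(2)] realizesD[OF B as xs v(3)] by simp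
  qed
qed

lemma realizable_andE1: "realizable \<Gamma> (And A B) A"
proof (rule realizable_linear)
  let ?m = "length (Uex A) + length (Uex B)"
  have "definable ((Uex A @ Uex B) @ Uall A) (\<lambda>z. drop ?m z @ nulls (Uall B)) (Uall A @ Uall B)"
    by (intro definable_append definable_nulls definable_drop[OF definable_id]) simp
  then show "definable (Uex (And A B) @ Uall A) (\<lambda>z. drop ?m z @ nulls (Uall B)) (Uall (And A B))"
    by simp
  show "definable (Uex (And A B)) (take (length (Uex A))) (Uex A)"
    using definable_take[OF definable_id refl] by simp
  fix W as xs vs assume xs: "xs \<^bold>:\<^bold>: Uex (And A B)" and vs: "vs \<^bold>:\<^bold>: Uall A"
    and AB: "W \<tturnstile> Umat (And A B) as xs (drop ?m (xs @ vs) @ nulls (Uall B))"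
  obtain x u where x: "xs = x @ u" "length x = length (Uex A)" "length u = length (Uex B)"
    using xs by (auto simp: list_all2_append2)
  then have "W \<tturnstile> Umat (And A B) as (x @ u) (vs @ nulls (Uall B))" using AB by simp
  then show "W \<tturnstile> Umat A as (take (length (Uex A)) xs) vs"
    using x Umat_And[OF x(2) list_all2_lengthD[OF vs]] by simp
qed

lemma realizable_andE2: "realizable \<Gamma> (And A B) B"
proof (rule realizable_linear)
  let ?m = "length (Uex A) + length (Uex B)"
  have "definable ((Uex A @ Uex B) @ Uall B) (\<lambda>z. nulls (Uall A) @ drop ?m z) (Uall A @ Uall B)"
    by (intro definable_append definable_nulls definable_drop[OF definable_id]) simp
  then show "definable (Uex (And A B) @ Uall B) (\<lambda>z. nulls (Uall A) @ drop ?m z) (Uall (And A B))"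
    by simp
  show "definable (Uex (And A B)) (drop (length (Uex A))) (Uex B)"
    using definable_drop[OF definable_id refl] by simp
  fix W as xs vs assume xs: "xs \<^bold>:\<^bold>: Uex (And A B)" and vs: "vs \<^bold>:\<^bold>: Uall B"
    and AB: "W \<tturnstile> Umat (And A B) as xs (nulls (Uall A) @ drop ?m (xs @ vs))"
  obtain x u where x: "xs = x @ u" "length x = length (Uex A)" "length u = length (Uex B)"
    using xs by (auto simp: list_all2_append2)
  then have "W \<tturnstile> Umat (And A B) as (x @ u) (nulls (Uall A) @ vs)" using AB by simp
  then show "W \<tturnstile> Umat B as (drop (length (Uex A)) xs) vs"
    using x Umat_And[OF x(2) length_nulls] by simp
qed

lemma forces_Umat_ImpI:
  assumes wff: "wff \<Gamma> A" "wff \<Gamma> B" and as: "typed_subst [] as \<Gamma>"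
    and Us: "Us \<^bold>:\<^bold>: map (arrs (Uex A)) (Uex B)"
    and Ys: "Ys \<^bold>:\<^bold>: map (arrs (Uex A @ Uall B)) (map Seq (Uall A))"
    and xs: "xs \<^bold>:\<^bold>: Uex A" and vs: "vs \<^bold>:\<^bold>: Uall B"
    and Us_eq: "\<And>W. eqs W (Uex B) (map (\<lambda>U. apps U xs) Us) us"
    and Ys_eq: "\<And>W. eqs W (map Seq (Uall A)) (map (\<lambda>Y. apps Y (xs @ vs)) Ys) Ss"
    and B: "\<And>W'. W \<le> W' \<Longrightarrow> answers W' A as xs Ss \<Longrightarrow> W' \<tturnstile> Umat B as us vs"
  shows "W \<tturnstile> Umat (Imp A B) as (Us @ Ys) (xs @ vs)"
  unfolding forces_Umat_Imp[OF wff(1) as Us Ys xs vs]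
proof (intro HOL.allI HOL.impI)
  fix W' assume W': "W \<le> W'" and "answers W' A as xs (map (\<lambda>Y. apps Y (xs @ vs)) Ys)"
  then have "answers W' A as xs Ss"
    by (intro answers_cong[OF wff(1) eq_subst_refl[OF as] eqs_refl[OF xs] Ys_eq])
  then have "W' \<tturnstile> Umat B as us vs" by (rule B[OF W'])
  then show "W' \<tturnstile> Umat B as (map (\<lambda>U. apps U xs) Us) vs"
    by (rule forces_Umat_cong[OF wff(2) eq_subst_refl[OF as] eqs_sym[OF Us_eq] eqs_refl[OF vs]])
qed

lemma realizable_impI:
  assumes "realizable \<Gamma> (And G A) B" "wff \<Gamma> A" "wff \<Gamma> B"
  shows "realizable \<Gamma> G (Imp A B)"
proof -
  obtain f g where f: "definable (Uex G @ Uex A) f (Uex B)"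
    and g: "definable (Uex G @ Uex A @ Uall B) g (map Seq (Uall G) @ map Seq (Uall A))"
    and B: "realizes \<Gamma> (And G A) B f g"
    using assms(1) by (rule realizableE) (auto intro: that)
  let ?n = "length (Uall G)"
  have gG: "definable (Uex G @ Uex A @ Uall B) (\<lambda>z. take ?n (g z)) (map Seq (Uall G))"
    and gA: "definable (Uex G @ Uex A @ Uall B) (\<lambda>z. drop ?n (g z)) (map Seq (Uall A))"
    by (rule definable_take[OF g] definable_drop[OF g]; simp)+
  obtain U where U: "definable (Uex G) U (map (arrs (Uex A)) (Uex B))"
    and U_eq: "\<And>W xs us. xs \<^bold>:\<^bold>: Uex G \<Longrightarrow> us \<^bold>:\<^bold>: Uex A \<Longrightarrow>
      eqs W (Uex B) (map (\<lambda>U. apps U us) (U xs)) (f (xs @ us))"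
    using f by (rule definable_abstraction) (rule that)
  obtain Y where Y: "definable (Uex G) Y (map (arrs (Uex A @ Uall B)) (map Seq (Uall A)))"
    and Y_eq: "\<And>W xs us. xs \<^bold>:\<^bold>: Uex G \<Longrightarrow> us \<^bold>:\<^bold>: Uex A @ Uall B \<Longrightarrow>
      eqs W (map Seq (Uall A)) (map (\<lambda>Y. apps Y us) (Y xs)) (drop ?n (g (xs @ us)))"
    using gA by (rule definable_abstraction) (rule that)
  show ?thesis
  proof (rule realizableI[where g = "\<lambda>z. take ?n (g z)"])
    show "definable (Uex G) (\<lambda>x. U x @ Y x) (Uex (Imp A B))"
      unfolding Uex_Imp by (rule definable_append[OF U Y])
    show "definable (Uex G @ Uall (Imp A B)) (\<lambda>z. take ?n (g z)) (map Seq (Uall G))"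
      using gG by simp
    fix W as xs uvs assume as: "typed_subst [] as \<Gamma>" and xs: "xs \<^bold>:\<^bold>: Uex G"
      and uvs: "uvs \<^bold>:\<^bold>: Uall (Imp A B)" and answers_G: "answers W G as xs (take ?n (g (xs @ uvs)))"
    obtain us vs where us: "uvs = us @ vs" "us \<^bold>:\<^bold>: Uex A" and vs: "vs \<^bold>:\<^bold>: Uall B"
      using uvs by (auto simp: list_all2_append2)
    have lengths: "length xs = length (Uex G)" "length (take ?n (g (xs @ uvs))) = ?n"
      using definable_length[OF g, of "xs @ uvs"] list_all2_lengthD[OF xs] list_all2_lengthD[OF uvs]
      by simp_all
    show "W \<tturnstile> Umat (Imp A B) as (U xs @ Y xs) uvs" unfolding us(1)
    proof (rule forces_Umat_ImpI[OF assms(2,3) as definable_typed[OF U xs]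
      definable_typed[OF Y xs] us(2) vs
          U_eq[OF xs us(2)] Y_eq[OF xs list_all2_appendI[OF us(2) vs]]])
      fix W' assume W': "W \<le> W'" and "answers W' A as us (drop ?n (g (xs @ us @ vs)))"
      with answers_mono[OF answers_G W']
        have "answers W' (And G A) as (xs @ us) (g ((xs @ us) @ vs))"
        using answers_AndI[OF _ _ lengths] us(1) by fastforce
      then show "W' \<tturnstile> Umat B as (f (xs @ us)) vs"
        using realizesD[OF B as _ vs] list_all2_appendI[OF xs us(2)] by simp
    qed
  qed
qed

lemma realizable_modus_ponens:
  assumes A: "wff \<Gamma> A"
  shows "realizable \<Gamma> (And (Imp A B) A) B"
proof -
  let ?p = "length (Uex B)" and ?k = "length (Uall A)"
  let ?Us = "map (arrs (Uex A)) (Uex B)" and ?Ys = "map (arrs (Uex A @ Uall B)) (map Seq (Uall A))"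
  let ?f = "\<lambda>z. map (\<lambda>U. apps U (drop ?k (drop ?p z))) (take ?p z)"
  let ?S = "\<lambda>z. map (\<lambda>Y. apps Y (drop ?k (drop ?p z))) (take ?k (drop ?p z))"
  let ?g = "\<lambda>z. pad (Uex A @ Uall B)
    (singletons (Uex A @ Uall B) (drop ?k (drop ?p z))) @ pad (Uall A) (?S z)"
  have drop: "definable (?Us @ ?Ys @ \<Gamma>') (\<lambda>z. drop ?k (drop ?p z)) \<Gamma>'" for \<Gamma>'
    by (intro definable_drop[OF definable_drop[OF definable_id]]) simp_all
  have fB: "definable (?Us @ ?Ys @ Uex A) ?f (Uex B)"
    by (intro definable_apps[OF definable_take[OF definable_id] drop]) simp
  have S: "definable (?Us @ ?Ys @ Uex A @ Uall B) ?S (map Seq (Uall A))"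
    by (intro definable_apps[OF definable_take[OF definable_drop[OF definable_id]] drop]) simp_all
  have g: "definable (?Us @ ?Ys @ Uex A @ Uall B) ?g (map Seq (Uex A @ Uall B) @ map Seq (Uall A))"
    by (intro definable_append definable_pad definable_singletons drop S)
  show ?thesis
  proof (rule realizableI[where g = ?g])
    show "definable (Uex (And (Imp A B) A)) ?f (Uex B)" using fB by (simp add: o_def)
    show "definable (Uex (And (Imp A B) A) @ Uall B) ?g (map Seq (Uall (And (Imp A B) A)))"
      using g by (simp add: o_def)
    fix W as zs vs assume as: "typed_subst [] as \<Gamma>" and "zs \<^bold>:\<^bold>: Uex (And (Imp A B) A)"
      and vs: "vs \<^bold>:\<^bold>: Uall B" and answers: "answers W (And (Imp A B) A) as zs (?g (zs @ vs))"
    then obtain Us Ys xs where split: "zs = Us @ Ys @ xs" and Us: "Us \<^bold>:\<^bold>: ?Us"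
      and Ys: "Ys \<^bold>:\<^bold>: ?Ys"
      and xs: "xs \<^bold>:\<^bold>: Uex A"
      by (auto simp: list_all2_append2 o_def)
    let ?Ss = "map (\<lambda>Y. apps Y (xs @ vs)) Ys"
    have lengths: "length Us = ?p" "length Ys = ?k" "length (Us @ Ys) = length (Uex (Imp A B))"
      using list_all2_lengthD[OF Us] list_all2_lengthD[OF Ys] by simp_all
    have xvs: "xs @ vs \<^bold>:\<^bold>: Uall (Imp A B)" using list_all2_appendI[OF xs vs] by simp
    have Ss: "?Ss \<^bold>:\<^bold>: map Seq (Uall A)"
      by (rule typed_list_apps[OF Ys list_all2_appendI[OF xs vs]])
    have "answers W (And (Imp A B) A) as ((Us @ Ys) @ xs)
        (pad (Uall (Imp A B)) (singletons (Uall (Imp A B)) (xs @ vs)) @ pad (Uall A) ?Ss)"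
      using answers split lengths by simp
    note answers = answers_And_padD1[OF this lengths(3) singletons_typed[OF xvs] Ss]
      answers_And_padD2[OF this lengths(3) singletons_typed[OF xvs] Ss]
    have "W \<tturnstile> Umat (Imp A B) as (Us @ Ys) (xs @ vs)"
      by (rule answersD[OF answers(1) order_refl mems_singletons[OF xvs]])
    then show "W \<tturnstile> Umat B as (?f zs) vs"
      using answers(2) split lengths forces_Umat_Imp[OF A as Us Ys xs vs] by simp
  qed
qed

lemma realizable_mp:
  assumes "realizable \<Gamma> G (Imp A B)" "realizable \<Gamma> G A" "wff \<Gamma> A"
  shows "realizable \<Gamma> G B"
  by (rule realizable_trans[OF realizable_andI[OF assms(1,2)] realizable_modus_ponens[OF assms(3)]])

lemma realizable_botE:
  assumes "wff \<Gamma> A"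
  shows "realizable \<Gamma> Bot A"
proof (rule realizable_linear[where h = "\<lambda>z. []"])
  show "definable (Uex Bot) (\<lambda>z. nulls (Uex A)) (Uex A)" by (rule definable_nulls)
  fix W as xs vs assume "typed_subst [] as \<Gamma>" "vs \<^bold>:\<^bold>: Uall A" "W \<tturnstile> Umat Bot as xs []"
  then show "W \<tturnstile> Umat A as (nulls (Uex A)) vs"
    using forces_BotE well_formed_Umat[OF assms _ nulls_typed] by simp
qed simp

lemma realizable_orI1:
  assumes "wff \<Gamma> A" "wff \<Gamma> B"
  shows "realizable \<Gamma> A (Or A B)"
proof (rule realizable_linear)
  let ?m = "length (Uex A)" and ?n = "length (Uall A)"
  have "definable (Uex A) (\<lambda>x. [zero] @ x @ nulls (Uex B)) ([N] @ Uex A @ Uex B)"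
    by (intro definable_append definable_const definable_id definable_nulls) simp
  then show "definable (Uex A) (\<lambda>x. [zero] @ x @ nulls (Uex B)) (Uex (Or A B))" by simp
  show "definable (Uex A @ Uall (Or A B)) (\<lambda>z. take ?n (drop ?m z)) (Uall A)"
    using definable_take[OF definable_drop[OF definable_id refl] refl] by simp
  fix W as xs yvs assume as: "typed_subst [] as \<Gamma>" and xs: "xs \<^bold>:\<^bold>: Uex A"
    and yvs: "yvs \<^bold>:\<^bold>: Uall (Or A B)" and A: "W \<tturnstile> Umat A as xs (take ?n (drop ?m (xs @ yvs)))"
  obtain ys vs where ys: "yvs = ys @ vs" "ys \<^bold>:\<^bold>: Uall A" and vs: "vs \<^bold>:\<^bold>: Uall B"
    using yvs by (auto simp: list_all2_append2)
  note lengths = list_all2_lengthD[OF xs] list_all2_lengthD[OF ys(2)]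
  have "W \<tturnstile> Imp (Eq N zero zero) (Umat A as xs ys)"
    by (rule forces_ImpI) (use A lengths ys(1) forces_mono in auto)
  moreover have "W \<tturnstile> Imp (Neg (Eq N zero zero)) (Umat B as (nulls (Uex B)) vs)"
  proof (rule forces_ImpI)
    fix W' assume "W' \<tturnstile> Neg (Eq N zero zero)"
    then have "W' \<tturnstile> Bot" by (rule forces_mp) (simp add: forces_eq_refl)
    then show "W' \<tturnstile> Umat B as (nulls (Uex B)) vs"
      by (rule forces_BotE) (rule well_formed_Umat[OF assms(2) as nulls_typed vs], simp)
  qed simp_all
  ultimately show "W \<tturnstile> Umat (Or A B) as ([zero] @ xs @ nulls (Uex B)) yvs"
    using Umat_Or[OF lengths, of B as zero "nulls (Uex B)" vs] ys(1) by simp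
qed

lemma realizable_orI2:
  assumes "wff \<Gamma> A" "wff \<Gamma> B"
  shows "realizable \<Gamma> B (Or A B)"
proof (rule realizable_linear)
  let ?m = "length (Uex B)" and ?n = "length (Uall A)"
  have "definable (Uex B) (\<lambda>x. [suc zero] @ nulls (Uex A) @ x) ([N] @ Uex A @ Uex B)"
    by (intro definable_append definable_const definable_id definable_nulls) simp
  then show "definable (Uex B) (\<lambda>x. [suc zero] @ nulls (Uex A) @ x) (Uex (Or A B))" by simp
  show "definable (Uex B @ Uall (Or A B)) (\<lambda>z. drop ?n (drop ?m z)) (Uall B)"
    using definable_drop[OF definable_drop[OF definable_id refl] refl] by simp
  fix W as xs yvs assume as: "typed_subst [] as \<Gamma>" and xs: "xs \<^bold>:\<^bold>: Uex B"
    and yvs: "yvs \<^bold>:\<^bold>: Uall (Or A B)" and B: "W \<tturnstile> Umat B as xs (drop ?n (drop ?m (xs @ yvs)))"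
  obtain ys vs where ys: "yvs = ys @ vs" "ys \<^bold>:\<^bold>: Uall A" and vs: "vs \<^bold>:\<^bold>: Uall B"
    using yvs by (auto simp: list_all2_append2)
  note lengths = list_all2_lengthD[OF xs] list_all2_lengthD[OF ys(2)]
  have "W \<tturnstile> Imp (Neg (Eq N (suc zero) zero)) (Umat B as xs vs)"
    by (rule forces_ImpI) (use B lengths ys(1) forces_mono in auto)
  moreover have "W \<tturnstile> Imp (Eq N (suc zero) zero) (Umat A as (nulls (Uex A)) ys)"
  proof (rule forces_ImpI)
    fix W' assume "W' \<tturnstile> Eq N (suc zero) zero"
    then have "W' \<tturnstile> Bot" by (rule forces_suc_eq_zeroD)
    then show "W' \<tturnstile> Umat A as (nulls (Uex A)) ys"
      by (rule forces_BotE) (rule well_formed_Umat[OF assms(1) as nulls_typed ys(2)], simp)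
  qed simp_all
  ultimately show "W \<tturnstile> Umat (Or A B) as ([suc zero] @ nulls (Uex A) @ xs) yvs"
    using Umat_Or[OF length_nulls lengths(2), of B as "suc zero" xs vs] ys(1) by simp
qed

lemma forces_Umat_conds:
  assumes "answers W (Or A B) as (z # xs @ us) (pad (Uall A) Ss @ pad (Uall B) Ts)"
    and C: "wff \<Gamma> C" "typed_subst [] as \<Gamma>" "vs \<^bold>:\<^bold>: Uall C"
    and z: "z \<^bold>: N" and xs: "length xs = length (Uex A)"
    and Ss: "Ss \<^bold>:\<^bold>: map Seq (Uall A)" and Ts: "Ts \<^bold>:\<^bold>: map Seq (Uall B)"
    and ps: "ps \<^bold>:\<^bold>: Uex C" and qs: "qs \<^bold>:\<^bold>: Uex C"
    and left: "\<And>W'. W \<le> W' \<Longrightarrow> answers W' A as xs Ss \<Longrightarrow> W' \<tturnstile> Umat C as ps vs"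
    and right: "\<And>W'. W \<le> W' \<Longrightarrow> answers W' B as us Ts \<Longrightarrow> W' \<tturnstile> Umat C as qs vs"
  shows "W \<tturnstile> Umat C as (conds (Uex C) z ps qs) vs"
proof (rule forces_nat_cases[OF z])
  have "conds (Uex C) z ps qs \<^bold>:\<^bold>: Uex C"
    using ps qs z by (simp add: conds_def list_all2_conv_all_nth)
  then show "well_formed [] (Umat C as (conds (Uex C) z ps qs) vs)"
    using C by (intro well_formed_Umat)
  note cong = forces_Umat_cong[OF C(1) eq_subst_refl[OF C(2)] _ eqs_refl[OF C(3)]]
  fix W' assume W': "W \<le> W'"
  note answers = answers_mono[OF assms(1) W']
  {
    assume zero: "W' \<tturnstile> Eq N z zero"
    have "W' \<tturnstile> Umat C as ps vs" by (rule left[OF W' answers_Or_zeroD[OF answers xs Ss Ts zero]])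
    then show "W' \<tturnstile> Umat C as (conds (Uex C) z ps qs) vs"
      by (rule cong[OF eqs_sym[OF conds_zero[OF ps qs zero]]])
  }
  fix k assume suc: "W' \<tturnstile> Eq N z (suc k)"
  have "W' \<tturnstile> Umat C as qs vs"
    by (rule right[OF W' answers_Or_nonzeroD[OF answers xs Ss Ts forces_Neg_eq_zero[OF suc]]])
  then show "W' \<tturnstile> Umat C as (conds (Uex C) z ps qs) vs"
    by (rule cong[OF eqs_sym[OF conds_suc[OF ps qs suc]]])
qed simp_all

lemma realizable_case:
  assumes "realizable \<Gamma> A C" "realizable \<Gamma> B C" "wff \<Gamma> C"
  shows "realizable \<Gamma> (Or A B) C"
proof -
  obtain f g where f: "definable (Uex A) f (Uex C)"
    and g: "definable (Uex A @ Uall C) g (map Seq (Uall A))"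
    and A: "realizes \<Gamma> A C f g"
    using assms(1) by (rule realizableE) (rule that)
  obtain f' g' where f': "definable (Uex B) f' (Uex C)"
    and g': "definable (Uex B @ Uall C) g' (map Seq (Uall B))"
    and B: "realizes \<Gamma> B C f' g'"
    using assms(2) by (rule realizableE) (rule that)
  let ?m = "length (Uex A)" and ?p = "length (Uex B)"
  let ?f = "\<lambda>z. conds (Uex C) (hd z) (f (take ?m (tl z))) (f' (drop ?m (tl z)))"
  let ?g = "\<lambda>z. pad (Uall A) (g (take ?m (tl z) @ drop ?p (drop ?m (tl z)))) @
    pad (Uall B) (g' (drop ?m (tl z)))"
  show ?thesis
  proof (rule realizableI[where g = ?g])
    show "definable (Uex (Or A B)) ?f (Uex C)" using definable_case[OF f f'] by simp
    show "definable (Uex (Or A B) @ Uall C) ?g (map Seq (Uall (Or A B)))"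
      using definable_pad_case[OF g g'] by simp
    fix W as zs vs assume as: "typed_subst [] as \<Gamma>" and zs: "zs \<^bold>:\<^bold>: Uex (Or A B)"
      and vs: "vs \<^bold>:\<^bold>: Uall C" and answers: "answers W (Or A B) as zs (?g (zs @ vs))"
    obtain z xs us where split: "zs = z # xs @ us" and z: "z \<^bold>: N"
      and xs: "xs \<^bold>:\<^bold>: Uex A" and us: "us \<^bold>:\<^bold>: Uex B"
      using zs by (auto simp: list_all2_append2 list_all2_Cons2)
    note lengths = list_all2_lengthD[OF xs] list_all2_lengthD[OF us]
    have "W \<tturnstile> Umat C as (conds (Uex C) z (f xs) (f' us)) vs"
    proof (rule forces_Umat_conds[OF _ assms(3) as vs z lengths(1)])
      show "answers W (Or A B) as (z # xs @ us)
        (pad (Uall A) (g (xs @ vs)) @ pad (Uall B) (g' (us @ vs)))"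
        using answers split lengths by simp
      show "W' \<tturnstile> Umat C as (f xs) vs" if "answers W' A as xs (g (xs @ vs))" for W'
        using realizesD[OF A as xs vs that] .
      show "W' \<tturnstile> Umat C as (f' us) vs" if "answers W' B as us (g' (us @ vs))" for W'
        using realizesD[OF B as us vs that] .
    qed (intro definable_typed[OF f xs] definable_typed[OF f' us] definable_typed[OF g]
        definable_typed[OF g'] list_all2_appendI xs us vs)+
    then show "W \<tturnstile> Umat C as (?f zs) vs" using split lengths by simp
  qed
qed

lemma answers_flift [simp]: "answers W (flift \<Phi>) (case_nat t as) xs Ss = answers W \<Phi> as xs Ss"
  by (simp add: answers_def Umat_flift)

lemma answers_finst: "answers W (finst t \<Phi>) as xs Ss =
  answers W \<Phi> (case_nat (tsubst as t) as) xs Ss"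
  by (simp add: answers_def Umat_finst)

lemma realizable_allI:
  assumes "realizable (\<sigma> # \<Gamma>) (flift G) A" "wff (\<sigma> # \<Gamma>) A"
  shows "realizable \<Gamma> G (All \<sigma> A)"
proof -
  obtain f g where f: "definable (Uex G) f (Uex A)"
    and g: "definable (Uex G @ Uall A) g (map Seq (Uall G))"
    and A: "realizes (\<sigma> # \<Gamma>) (flift G) A f g"
    using assms(1) by (rule realizableE) (auto intro: that)
  show ?thesis
  proof (rule realizableI)
    show "definable (Uex G) f (Uex (All \<sigma> A))"
      "definable (Uex G @ Uall (All \<sigma> A)) g (map Seq (Uall G))"
      using f g by simp_all
    fix W as xs vs assume as: "typed_subst [] as \<Gamma>" and xs: "xs \<^bold>:\<^bold>: Uex G"
      and "vs \<^bold>:\<^bold>: Uall (All \<sigma> A)" and answers: "answers W G as xs (g (xs @ vs))"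
    then have vs: "vs \<^bold>:\<^bold>: Uall A" by simp
    have "W \<tturnstile> Umat A (case_nat t as) (f xs) vs" if "t \<^bold>: \<sigma>" for t
      by (rule realizesD[OF A typed_subst_case_nat[OF that as]]) (simp_all add: xs vs answers)
    then show "W \<tturnstile> Umat (All \<sigma> A) as (f xs) vs"
      unfolding forces_Umat_All[OF assms(2) as definable_typed[OF f xs] vs] by blast
  qed
qed

lemma realizable_allE:
  assumes "has_ty \<Gamma> t \<sigma>" "wff (\<sigma> # \<Gamma>) A"
  shows "realizable \<Gamma> (All \<sigma> A) (finst t A)"
proof (rule realizable_linear)
  show "definable (Uex (All \<sigma> A)) (\<lambda>x. x) (Uex (finst t A))" using definable_id by simp
  show "definable (Uex (All \<sigma> A) @ Uall (finst t A)) (drop (length (Uex A))) (Uall (All \<sigma> A))"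
    using definable_drop[OF definable_id refl] by simp
  fix W as xs vs assume as: "typed_subst [] as \<Gamma>"
    and "xs \<^bold>:\<^bold>: Uex (All \<sigma> A)" "vs \<^bold>:\<^bold>: Uall (finst t A)"
    and All: "W \<tturnstile> Umat (All \<sigma> A) as xs (drop (length (Uex A)) (xs @ vs))"
  then have xs: "xs \<^bold>:\<^bold>: Uex A" and vs: "vs \<^bold>:\<^bold>: Uall A" by simp_all
  have "W \<tturnstile> Umat (All \<sigma> A) as xs vs" using All list_all2_lengthD[OF xs] by simp
  then show "W \<tturnstile> Umat (finst t A) as xs vs"
    unfolding forces_Umat_All[OF assms(2) as xs vs] Umat_finst using typed_tsubst[OF assms(1) as]
    by blast
qed

lemma realizable_exI:
  assumes "has_ty \<Gamma> t \<sigma>" "wff (\<sigma> # \<Gamma>) A"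
  shows "realizable \<Gamma> (finst t A) (Ex \<sigma> A)"
proof (rule realizableI)
  show "definable (Uex (finst t A)) (\<lambda>x. x) (Uex (Ex \<sigma> A))" using definable_id by simp
  show "definable (Uex (finst t A) @ Uall (Ex \<sigma> A)) (drop (length (Uex A)))
    (map Seq (Uall (finst t A)))"
    using definable_drop[OF definable_id refl] by simp
  fix W as xs Ss assume as: "typed_subst [] as \<Gamma>"
    and "xs \<^bold>:\<^bold>: Uex (finst t A)" "Ss \<^bold>:\<^bold>: Uall (Ex \<sigma> A)"
    and answers: "answers W (finst t A) as xs (drop (length (Uex A)) (xs @ Ss))"
  then have xs: "xs \<^bold>:\<^bold>: Uex A" and Ss: "Ss \<^bold>:\<^bold>: map Seq (Uall A)" by simp_all
  have "answers W A (case_nat (tsubst as t) as) xs Ss"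
    using answers list_all2_lengthD[OF xs] by (simp add: answers_finst)
  then show "W \<tturnstile> Umat (Ex \<sigma> A) as xs Ss"
    by (rule forces_Umat_ExI[OF assms(2) as xs Ss typed_tsubst[OF assms(1) as]])
qed

lemma realizable_exE:
  assumes "realizable (\<sigma> # \<Gamma>) A (flift C)" "wff (\<sigma> # \<Gamma>) A" "wff \<Gamma> C"
  shows "realizable \<Gamma> (Ex \<sigma> A) C"
proof -
  obtain f g where f: "definable (Uex A) f (Uex C)"
    and g: "definable (Uex A @ Uall C) g (map Seq (Uall A))"
    and C: "realizes (\<sigma> # \<Gamma>) A (flift C) f g"
    using assms(1) by (rule realizableE) (auto intro: that)
  show ?thesis
  proof (rule realizable_linear)
    show "definable (Uex (Ex \<sigma> A)) f (Uex C)" "definable (Uex (Ex \<sigma> A) @ Uall C) g (Uall (Ex \<sigma> A))"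
      using f g by simp_all
    fix W as xs vs assume as: "typed_subst [] as \<Gamma>" and "xs \<^bold>:\<^bold>: Uex (Ex \<sigma> A)"
      and vs: "vs \<^bold>:\<^bold>: Uall C"
      and Ex: "W \<tturnstile> Umat (Ex \<sigma> A) as xs (g (xs @ vs))"
    then have xs: "xs \<^bold>:\<^bold>: Uex A" by simp
    show "W \<tturnstile> Umat C as (f xs) vs"
    proof (rule forces_Umat_ExE[OF assms(2) as xs
      definable_typed[OF g list_all2_appendI[OF xs vs]] Ex])
      show "well_formed [] (Umat C as (f xs) vs)"
        by (rule well_formed_Umat[OF assms(3) as definable_typed[OF f xs] vs])
      fix W' t assume t: "t \<^bold>: \<sigma>" and answers: "answers W' A (case_nat t as) xs (g (xs @ vs))"
      then have "W' \<tturnstile> Umat (flift C) (case_nat t as) (f xs) vs"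
        by (intro realizesD[OF C typed_subst_case_nat[OF t as] xs]) (simp_all add: vs)
      then show "W' \<tturnstile> Umat C as (f xs) vs" by (simp add: Umat_flift)
    qed
  qed
qed

abbreviation Top :: fm where
  "Top \<equiv> Imp Bot Bot"

lemma realizable_top: "realizable \<Gamma> A Top"
proof (rule realizable_linear)
  show "definable (Uex A) (\<lambda>x. []) (Uex Top)" by simp
  show "definable (Uex A @ Uall Top) (\<lambda>x. nulls (Uall A)) (Uall A)" by (rule definable_nulls)
  show "W \<tturnstile> Umat Top as [] vs" for W as vs
    by (auto simp: Umat.simps Let_def vars_def intro!: forces_ImpI)
qed

lemma realizable_orE:
  assumes "realizable \<Gamma> G (Or A B)" "realizable \<Gamma> (And A G) C" "realizable \<Gamma> (And B G) C"
    and "wff \<Gamma> G" "wff \<Gamma> C"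
  shows "realizable \<Gamma> G C"
proof -
  have "realizable \<Gamma> (Or A B) (Imp G C)"
    by (rule realizable_case) (use assms(2-) realizable_impI in simp_all)
  with assms(1) have "realizable \<Gamma> G (Imp G C)" by (rule realizable_trans)
  then show ?thesis using realizable_refl assms(4) by (rule realizable_mp)
qed

lemma realizable_ex_elim:
  assumes "realizable \<Gamma> G (Ex \<sigma> A)" "realizable (\<sigma> # \<Gamma>) (And A (flift G)) (flift C)"
    and "wff (\<sigma> # \<Gamma>) A" "wff \<Gamma> G" "wff \<Gamma> C"
  shows "realizable \<Gamma> G C"
proof -
  have "realizable (\<sigma> # \<Gamma>) A (flift (Imp G C))"
    using realizable_impI[OF assms(2) wff_flift[OF assms(4)] wff_flift[OF assms(5)]]
    by (simp add: flift_def)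
  then have "realizable \<Gamma> (Ex \<sigma> A) (Imp G C)"
    by (rule realizable_exE) (use assms(3-5) in simp_all)
  with assms(1) have "realizable \<Gamma> G (Imp G C)" by (rule realizable_trans)
  then show ?thesis using realizable_refl assms(4) by (rule realizable_mp)
qed

definition Conj :: "fm list \<Rightarrow> fm" where
  "Conj H = foldr And H Top"

lemma Conj_simps [simp]: "Conj [] = Top" "Conj (\<phi> # H) = And \<phi> (Conj H)"
  by (simp_all add: Conj_def)

lemma Conj_flift: "Conj (map flift H) = flift (Conj H)"
  by (induction H) (simp_all add: flift_def)

lemma wff_Conj: "\<forall>h\<in>set H. wff \<Gamma> h \<Longrightarrow> wff \<Gamma> (Conj H)"
  by (induction H) auto

lemma realizable_hyp: "\<phi> \<in> set H \<Longrightarrow> realizable \<Gamma> (Conj H) \<phi>"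
  by (induction H) (auto intro: realizable_andE1 realizable_trans[OF realizable_andE2])

theorem prv_realizable:
  assumes "prv UNIV Ax \<Gamma> H \<Phi>" and Ax: "\<And>\<Gamma> \<phi>. \<phi> \<in> Ax \<Longrightarrow> wff \<Gamma> \<phi> \<Longrightarrow> realizable \<Gamma> Top \<phi>"
    and "\<forall>h\<in>set H. wff \<Gamma> h"
  shows "realizable \<Gamma> (Conj H) \<Phi>"
  using assms(1,3)
proof (induction rule: prv.induct)
  case (ax \<phi> \<Gamma> H)
  then show ?case using realizable_trans[OF realizable_top Ax] by blast
next
  case (hyp \<phi> H \<Gamma>)
  then show ?case by (simp add: realizable_hyp)
next
  case (botE \<Gamma> H \<phi>)
  then show ?case using realizable_trans[OF _ realizable_botE] by blast
next
  case (andI \<Gamma> H \<phi> \<psi>)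
  then show ?case using realizable_andI by blast
next
  case (andE1 \<Gamma> H \<phi> \<psi>)
  then show ?case using realizable_trans[OF _ realizable_andE1] by blast
next
  case (andE2 \<Gamma> H \<phi> \<psi>)
  then show ?case using realizable_trans[OF _ realizable_andE2] by blast
next
  case (orI1 \<Gamma> H \<phi> \<psi>)
  have "wff \<Gamma> \<phi>" by (rule prv_wff[OF orI1.hyps(1) orI1.prems])
  then show ?case using realizable_trans[OF orI1.IH realizable_orI1] orI1 by blast
next
  case (orI2 \<Gamma> H \<psi> \<phi>)
  have "wff \<Gamma> \<psi>" by (rule prv_wff[OF orI2.hyps(1) orI2.prems])
  then show ?case using realizable_trans[OF orI2.IH realizable_orI2] orI2 by blast
next
  case (orE \<Gamma> H \<phi> \<psi> \<chi>)
  have "wff \<Gamma> (Or \<phi> \<psi>)" by (rule prv_wff[OF orE.hyps(1) orE.prems])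
  then have wff: "\<forall>h\<in>set (\<phi> # H). wff \<Gamma> h" "\<forall>h\<in>set (\<psi> # H). wff \<Gamma> h" using orE.prems by simp_all
  show ?case
    using realizable_orE[OF orE.IH(1)[OF orE.prems] _ _ wff_Conj[OF orE.prems]
      prv_wff[OF orE.hyps(2) wff(1)]]
      orE.IH(2)[OF wff(1)] orE.IH(3)[OF wff(2)]
    by simp
next
  case (impI \<phi> \<Gamma> H \<psi>)
  then have wff: "\<forall>h\<in>set (\<phi> # H). wff \<Gamma> h" by simp
  have "realizable \<Gamma> (And (Conj H) \<phi>) (And \<phi> (Conj H))"
    by (rule realizable_andI[OF realizable_andE2 realizable_andE1])
  then have "realizable \<Gamma> (And (Conj H) \<phi>) \<psi>"
    using impI.IH[OF wff] by (auto intro: realizable_trans)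
  then show ?case using prv_wff[OF impI.hyps(3) wff] impI.hyps by (intro realizable_impI)
next
  case (impE \<Gamma> H \<phi> \<psi>)
  show ?case
    by (rule realizable_mp[OF impE.IH(1,2)[OF impE.prems] prv_wff[OF impE.hyps(2) impE.prems]])
next
  case (allI \<sigma> \<Gamma> H \<phi>)
  have wff: "\<forall>h\<in>set (map flift H). wff (\<sigma> # \<Gamma>) h" using allI.prems by (auto intro: wff_flift)
  show ?case
    using allI.IH[OF wff] prv_wff[OF allI.hyps wff] by (simp add: Conj_flift realizable_allI)
next
  case (allE \<Gamma> H \<sigma> \<phi> t)
  have "wff (\<sigma> # \<Gamma>) \<phi>" using prv_wff[OF allE.hyps(1) allE.prems] by simp
  then show ?case using realizable_trans[OF allE.IH realizable_allE] allE by blast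
next
  case (exI \<sigma> \<phi> \<Gamma> t H)
  then have "wff (\<sigma> # \<Gamma>) \<phi>" by simp
  then show ?case using realizable_trans[OF exI.IH realizable_exI] exI by blast
next
  case (exE \<Gamma> H \<sigma> \<phi> \<chi>)
  have \<phi>: "wff (\<sigma> # \<Gamma>) \<phi>" using prv_wff[OF exE.hyps(1) exE.prems] by simp
  then have wff: "\<forall>h\<in>set (\<phi> # map flift H). wff (\<sigma> # \<Gamma>) h" using exE.prems
    by (auto intro: wff_flift)
  have "wff \<Gamma> \<chi>" by (rule wff_fliftD[OF prv_wff[OF exE.hyps(2) wff]])
  then show ?case
    using exE.IH(2)[OF wff] \<phi> wff_Conj[OF exE.prems]
    by (intro realizable_ex_elim[OF exE.IH(1)[OF exE.prems]]) (simp_all add: Conj_flift)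
qed

end

section \<open>Soundness of the axioms\<close>

lemma Alls_simps [simp]: "Alls [] \<phi> = \<phi>" "Alls (\<tau> # \<tau>s) \<phi> = All \<tau> (Alls \<tau>s \<phi>)"
  by (simp_all add: Alls_def)

lemma fsubst_Alls: "fsubst \<theta> (Alls \<tau>s \<phi>) = Alls \<tau>s (fsubst ((up ^^ length \<tau>s) \<theta>) \<phi>)"
  by (induction \<tau>s arbitrary: \<theta>) (simp_all add: funpow_swap1)

lemma internal_Alls [simp]: "internal (Alls \<tau>s \<phi>) = internal \<phi>"
  and or_free_Alls [simp]: "or_free (Alls \<tau>s \<phi>) = or_free \<phi>"
  by (induction \<tau>s) auto

lemma prv_Alls: "prv L Ax (rev \<tau>s @ \<Gamma>) [] \<phi> \<Longrightarrow> prv L Ax \<Gamma> [] (Alls \<tau>s \<phi>)"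
proof (induction \<tau>s arbitrary: \<Gamma>)
  case (Cons \<tau> \<tau>s)
  then have "prv L Ax (\<tau> # \<Gamma>) [] (Alls \<tau>s \<phi>)" by simp
  then show ?case using prv.allI[of L Ax \<tau> \<Gamma> "[]"] by simp
qed simp

lemma Uty_internal: "internal \<phi> \<Longrightarrow> or_free \<phi> \<Longrightarrow> Uty \<phi> = ([], [])"
  by (induction \<phi>) auto

lemma Umat_internal: "internal \<phi> \<Longrightarrow> or_free \<phi> \<Longrightarrow> Umat \<phi> as xs ys = fsubst as \<phi>"
  by (induction \<phi> arbitrary: as xs ys) (auto simp: Umat.simps Uty_internal Let_def o_def vars_def)

lemma Umat_AllSt:
  "Umat (AllSt \<sigma> \<Phi>) as Xs (ys @ [z]) = Umat \<Phi> (case_nat z as) (map (\<lambda>X. X \<^bold>\<cdot> z) Xs) ys"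
  by simp

lemma Umat_fsucc: "Umat (fsucc \<Phi>) (case_nat t as) xs ys = Umat \<Phi> (case_nat (suc t) as) xs ys"
proof -
  have "(\<lambda>i. tsubst (case_nat t as) (case_nat (suc (Var 0)) (\<lambda>i. Var (Suc i)) i)) =
    case_nat (suc t) as"
    by (auto simp: fun_eq_iff split: nat.split)
  then show ?thesis by (simp add: fsucc_def Umat_fsubst)
qed

lemma wff_hyper: "wff (Seq \<sigma> # \<Gamma>) (hyper \<sigma> (Var 0))"
  by (simp add: hyper_def Mem_def Less_def plus_tm_def len_tm_def nth_tm_def head_tm_def tail_fn_def
      has_ty_closed[OF has_ty_null])

lemma Uty_hyper [simp]: "Uty (hyper \<sigma> s) = ([], [\<sigma>])"
  by (simp add: hyper_def Uty_internal)

lemma Umat_hyper: "Umat (hyper \<sigma> (Var 0)) (case_nat s as) xs [y] = Mem \<sigma> y s"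
  by (simp add: hyper_def Umat_internal)

context internal_theory
begin

lemma answers_Top: "answers W Top as xs Ss"
  by (auto simp: answers_def Umat_internal intro: forces_ImpI)

lemma answers_St: "answers W (St \<sigma> t) as [x] [] \<longleftrightarrow> W \<tturnstile> Eq \<sigma> x (tsubst as t)"
  by (auto simp: answers_def list_all3_conv_all_nth intro: forces_mono)

lemma realizable_imp:
  assumes "realizable \<Gamma> A B" "wff \<Gamma> (Imp A B)"
  shows "realizable \<Gamma> G (Imp A B)"
  using assms by (intro realizable_impI[OF realizable_trans[OF realizable_andE2]]) simp_all

lemma realizable_internal_ax:
  assumes "\<phi> \<in> EHA_or_ax \<union> \<Delta>" "wff \<Gamma> \<phi>"
  shows "realizable \<Gamma> Top \<phi>"
proof -
  have \<phi>: "internal \<phi>" "or_free \<phi>" using ax_internal[OF assms(1)] by blast+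
  show ?thesis
  proof (rule realizable_linear[where f = "\<lambda>x. []" and h = "\<lambda>x. []"])
    fix W as xs vs assume "typed_subst [] as \<Gamma>"
    then show "W \<tturnstile> Umat \<phi> as [] vs"
      unfolding Umat_internal[OF \<phi>]
      by (rule forces_ax[OF ax_fsubst[OF assms(1)] well_formed_fsubst[OF assms(2)]])
  qed (simp_all add: Uty_internal \<phi>)
qed

lemma realizable_if_Umat_eq:
  assumes "Uty A = Uty B"
    and "\<And>as xs ys. length xs = length (Uex A) \<Longrightarrow> Umat A as xs ys = Umat B as xs ys"
  shows "realizable \<Gamma> A B"
proof (rule realizable_linear)
  show "definable (Uex A) (\<lambda>x. x) (Uex B)" using definable_id assms(1) by simp
  show "definable (Uex A @ Uall B) (drop (length (Uex A))) (Uall A)"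
    using definable_drop[OF definable_id refl] assms(1) by simp
  fix W as xs vs assume "xs \<^bold>:\<^bold>: Uex A" "W \<tturnstile> Umat A as xs (drop (length (Uex A)) (xs @ vs))"
  then show "W \<tturnstile> Umat B as xs vs" using assms(2) list_all2_lengthD by fastforce
qed

lemma forces_Umat_Imp_St:
  assumes A: "wff (\<sigma> # \<Gamma>) A" and as: "typed_subst [] as (\<sigma> # \<Gamma>)"
    and Xs: "Xs \<^bold>:\<^bold>: map (Fn \<sigma>) (Uex A)" and z: "z \<^bold>: \<sigma>" and ys: "ys \<^bold>:\<^bold>: Uall A"
  shows "W \<tturnstile> Umat (Imp (St \<sigma> (Var 0)) A) as Xs (z # ys) \<longleftrightarrow>
    (\<forall>W'\<ge>W. W' \<tturnstile> Eq \<sigma> z (as 0) \<longrightarrow> W' \<tturnstile> Umat A as (map (\<lambda>X. X \<^bold>\<cdot> z) Xs) ys)"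
proof -
  have "W \<tturnstile> Umat (Imp (St \<sigma> (Var 0)) A) as (Xs @ []) ([z] @ ys) \<longleftrightarrow>
      (\<forall>W'\<ge>W. answers W' (St \<sigma> (Var 0)) as [z] (map (\<lambda>Y. apps Y ([z] @ ys)) []) \<longrightarrow>
        W' \<tturnstile> Umat A as (map (\<lambda>X. apps X [z]) Xs) ys)"
    using as Xs ys z by (intro forces_Umat_Imp[where \<Gamma> = "\<sigma> # \<Gamma>"]) simp_all
  then show ?thesis by (simp add: answers_St)
qed

lemma realizable_allst_inst:
  assumes A: "wff (\<sigma> # \<Gamma>) A"
  shows "realizable (\<sigma> # \<Gamma>) (flift (AllSt \<sigma> A)) (Imp (St \<sigma> (Var 0)) A)" (is "realizable _ ?F ?I")
proof (rule realizable_linear)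
  let ?m = "length (Uex A)"
  let ?h = "\<lambda>z. drop 1 (drop ?m z) @ take 1 (drop ?m z)"
  show "definable (Uex ?F) (\<lambda>x. x) (Uex ?I)" using definable_id by simp
  have "definable (map (Fn \<sigma>) (Uex A) @ [\<sigma>] @ Uall A) ?h (Uall A @ [\<sigma>])"
    by (intro definable_append definable_drop[OF definable_drop[OF definable_id]]
        definable_take[OF definable_drop[OF definable_id]]) auto
  then show "definable (Uex ?F @ Uall ?I) ?h (Uall ?F)" by simp
  fix W as Xs vs assume as: "typed_subst [] as (\<sigma> # \<Gamma>)" and "Xs \<^bold>:\<^bold>: Uex ?F" "vs \<^bold>:\<^bold>: Uall ?I"
    and AllSt: "W \<tturnstile> Umat ?F as Xs (?h (Xs @ vs))"
  then obtain z ys where split: "vs = z # ys" and z: "z \<^bold>: \<sigma>" and ys: "ys \<^bold>:\<^bold>: Uall A"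
    and Xs: "Xs \<^bold>:\<^bold>: map (Fn \<sigma>) (Uex A)"
    by (auto simp: list_all2_Cons2)
  have "W \<tturnstile> Umat A (case_nat z (\<lambda>i. as (Suc i))) (map (\<lambda>X. X \<^bold>\<cdot> z) Xs) ys"
    using AllSt list_all2_lengthD[OF Xs] by (simp add: Umat_flift split)
  note A_z = forces_mono[OF this]
  show "W \<tturnstile> Umat ?I as Xs vs" unfolding split forces_Umat_Imp_St[OF A as Xs z ys]
  proof (intro HOL.allI HOL.impI)
    fix W' assume W': "W \<le> W'" and eq: "W' \<tturnstile> Eq \<sigma> z (as 0)"
    have tail: "typed_subst [] (\<lambda>i. as (Suc i)) \<Gamma>" using as by (auto simp: typed_subst_def)
    have "case_nat (as 0) (\<lambda>i. as (Suc i)) = as" by (auto simp: fun_eq_iff split: nat.split)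
    then have "eq_subst W' (\<sigma> # \<Gamma>) (case_nat z (\<lambda>i. as (Suc i))) as"
      using eq_subst_case_nat[OF eq eq_subst_refl[OF tail]] by simp
    moreover have "map (\<lambda>X. X \<^bold>\<cdot> z) Xs \<^bold>:\<^bold>: Uex A"
      using typed_list_apps[of "[]" Xs "[\<sigma>]" "Uex A" "[z]"] Xs z by simp
    ultimately show "W' \<tturnstile> Umat A as (map (\<lambda>X. X \<^bold>\<cdot> z) Xs) ys"
      using forces_Umat_cong[OF A _ eqs_refl eqs_refl[OF ys] A_z[OF W']] by blast
  qed
qed

lemma realizable_allst1:
  assumes "wff (\<sigma> # \<Gamma>) A"
  shows "realizable \<Gamma> (AllSt \<sigma> A) (All \<sigma> (Imp (St \<sigma> (Var 0)) A))"
  using assms by (intro realizable_allI realizable_allst_inst) simp_all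

lemma realizable_allst2:
  assumes A: "wff (\<sigma> # \<Gamma>) A"
  shows "realizable \<Gamma> (All \<sigma> (Imp (St \<sigma> (Var 0)) A)) (AllSt \<sigma> A)" (is "realizable \<Gamma> (All \<sigma> ?I) ?A")
proof (rule realizable_linear)
  let ?m = "length (Uex A)" and ?n = "length (Uall A)"
  let ?h = "\<lambda>z. drop ?n (drop ?m z) @ take ?n (drop ?m z)"
  show "definable (Uex (All \<sigma> ?I)) (\<lambda>x. x) (Uex ?A)" using definable_id by simp
  have "definable (map (Fn \<sigma>) (Uex A) @ Uall A @ [\<sigma>]) ?h ([\<sigma>] @ Uall A)"
    by (intro definable_append definable_drop[OF definable_drop[OF definable_id]]
        definable_take[OF definable_drop[OF definable_id]]) auto
  then show "definable (Uex (All \<sigma> ?I) @ Uall ?A) ?h (Uall (All \<sigma> ?I))" by simp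
  fix W as Xs vs assume as: "typed_subst [] as \<Gamma>" and "Xs \<^bold>:\<^bold>: Uex (All \<sigma> ?I)" "vs \<^bold>:\<^bold>: Uall ?A"
    and All: "W \<tturnstile> Umat (All \<sigma> ?I) as Xs (?h (Xs @ vs))"
  then obtain ys z where split: "vs = ys @ [z]" and z: "z \<^bold>: \<sigma>" and ys: "ys \<^bold>:\<^bold>: Uall A"
    and Xs: "Xs \<^bold>:\<^bold>: map (Fn \<sigma>) (Uex A)"
    by (auto simp: list_all2_append2 list_all2_Cons2)
  have "W \<tturnstile> Umat (All \<sigma> ?I) as Xs (z # ys)"
    using All split list_all2_lengthD[OF Xs] list_all2_lengthD[OF ys] by simp
  moreover have "wff (\<sigma> # \<Gamma>) ?I" "Xs \<^bold>:\<^bold>: Uex ?I" "z # ys \<^bold>:\<^bold>: Uall ?I"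
    using A Xs z ys by simp_all
  ultimately have "W \<tturnstile> Umat ?I (case_nat z as) Xs (z # ys)" using forces_Umat_All[OF _ as] z
    by blast
  then have "W \<tturnstile> Umat A (case_nat z as) (map (\<lambda>X. X \<^bold>\<cdot> z) Xs) ys"
    using forces_Umat_Imp_St[OF A typed_subst_case_nat[OF z as] Xs z ys] forces_eq_refl[OF z]
    by auto
  then show "W \<tturnstile> Umat ?A as Xs vs" unfolding split Umat_AllSt .
qed

lemma realizable_exst1:
  assumes A: "wff (\<sigma> # \<Gamma>) A"
  shows "realizable \<Gamma> (ExSt \<sigma> A) (Ex \<sigma> (And (St \<sigma> (Var 0)) A))" (is "realizable \<Gamma> ?A (Ex \<sigma> ?I)")
proof (rule realizableI)
  let ?m = "length (Uex ?A)"
  show "definable (Uex ?A) (\<lambda>x. x) (Uex (Ex \<sigma> ?I))" using definable_id by simp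
  show "definable (Uex ?A @ Uall (Ex \<sigma> ?I)) (drop ?m) (map Seq (Uall ?A))"
    using definable_drop[OF definable_id refl, of "Uex ?A"] by simp
  fix W as zxs Ss assume as: "typed_subst [] as \<Gamma>" and zxs: "zxs \<^bold>:\<^bold>: Uex ?A"
    and Ss: "Ss \<^bold>:\<^bold>: Uall (Ex \<sigma> ?I)" and answers: "answers W ?A as zxs (drop ?m (zxs @ Ss))"
  obtain z xs where split: "zxs = z # xs" and z: "z \<^bold>: \<sigma>" and xs: "xs \<^bold>:\<^bold>: Uex A"
    using zxs by (auto simp: list_all2_Cons2)
  have "answers W A (case_nat z as) xs Ss"
    using answers split list_all2_lengthD[OF zxs] by (simp add: answers_def)
  moreover have "answers W (St \<sigma> (Var 0)) (case_nat z as) [z] []"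
    using z by (simp add: answers_St forces_eq_refl)
  ultimately have "answers W ?I (case_nat z as) ([z] @ xs) ([] @ Ss)"
    by (intro answers_AndI) simp_all
  then show "W \<tturnstile> Umat (Ex \<sigma> ?I) as zxs Ss"
    using A Ss zxs split by (intro forces_Umat_ExI[OF _ as _ _ z]) simp_all
qed

lemma realizable_exst2:
  assumes A: "wff (\<sigma> # \<Gamma>) A"
  shows "realizable \<Gamma> (Ex \<sigma> (And (St \<sigma> (Var 0)) A)) (ExSt \<sigma> A)" (is "realizable \<Gamma> (Ex \<sigma> ?I) ?A")
proof (rule realizable_linear)
  let ?m = "length (Uex ?A)"
  let ?h = "\<lambda>z. singletons (Uall A) (drop ?m z)"
  show "definable (Uex (Ex \<sigma> ?I)) (\<lambda>x. x) (Uex ?A)" using definable_id by simp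
  show "definable (Uex (Ex \<sigma> ?I) @ Uall ?A) ?h (Uall (Ex \<sigma> ?I))"
    using definable_singletons[OF definable_drop[OF definable_id refl, of "Uex ?A" "Uall A"]]
    by simp
  fix W as zxs vs assume as: "typed_subst [] as \<Gamma>" and zxs: "zxs \<^bold>:\<^bold>: Uex (Ex \<sigma> ?I)"
    and "vs \<^bold>:\<^bold>: Uall ?A" and Ex: "W \<tturnstile> Umat (Ex \<sigma> ?I) as zxs (?h (zxs @ vs))"
  then have vs: "vs \<^bold>:\<^bold>: Uall A" by simp
  obtain z xs where split: "zxs = z # xs" and z: "z \<^bold>: \<sigma>" and xs: "xs \<^bold>:\<^bold>: Uex A"
    using zxs by (auto simp: list_all2_Cons2)
  have Ex: "W \<tturnstile> Umat (Ex \<sigma> ?I) as zxs (singletons (Uall A) vs)"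
    using Ex list_all2_lengthD[OF zxs] by simp
  have "wff (\<sigma> # \<Gamma>) ?I" "zxs \<^bold>:\<^bold>: Uex ?I" "singletons (Uall A) vs \<^bold>:\<^bold>: map Seq (Uall ?I)"
    using A zxs singletons_typed[OF vs] by simp_all
  then have "W \<tturnstile> Umat A (case_nat z as) xs vs"
  proof (rule forces_Umat_ExE[OF _ as _ _ Ex])
    show "well_formed [] (Umat A (case_nat z as) xs vs)"
      by (rule well_formed_Umat[OF A typed_subst_case_nat[OF z as] xs vs])
    fix W' t assume t: "t \<^bold>: \<sigma>" and "answers W' ?I (case_nat t as) zxs (singletons (Uall A) vs)"
    then have "W' \<tturnstile> Umat ?I (case_nat t as) (z # xs) vs"
      using mems_singletons[OF vs] split by (auto dest!: answersD[OF _ order_refl])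
    then have eq: "W' \<tturnstile> Eq \<sigma> z t" and A_t: "W' \<tturnstile> Umat A (case_nat t as) xs vs"
      using Umat_And[of "[z]" "St \<sigma> (Var 0)" "[]" A "case_nat t as" xs vs] by simp_all
    show "W' \<tturnstile> Umat A (case_nat z as) xs vs"
      by (rule forces_Umat_cong[OF A eq_subst_case_nat[OF forces_eq_sym[OF eq] eq_subst_refl[OF as]]
            eqs_refl[OF xs] eqs_refl[OF vs] A_t])
  qed
  then show "W \<tturnstile> Umat ?A as zxs vs" using split by simp
qed

lemma realizable_st_eq: "realizable \<Gamma> (And (St \<sigma> t) (Eq \<sigma> t u)) (St \<sigma> u)"
proof (rule realizable_linear[where f = "\<lambda>x. x" and h = "\<lambda>x. []"])
  fix W as xs vs assume "xs \<^bold>:\<^bold>: Uex (And (St \<sigma> t) (Eq \<sigma> t u))"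
    and And: "W \<tturnstile> Umat (And (St \<sigma> t) (Eq \<sigma> t u)) as xs []"
  then obtain x where x: "xs = [x]" by (auto simp: list_all2_Cons2)
  have "W \<tturnstile> Eq \<sigma> x (tsubst as t)" "W \<tturnstile> Eq \<sigma> (tsubst as t) (tsubst as u)"
    using And by (simp_all add: x Umat.simps)
  then have "W \<tturnstile> Eq \<sigma> x (tsubst as u)" by (rule forces_eq_trans)
  then show "W \<tturnstile> Umat (St \<sigma> u) as xs vs" by (simp add: x)
qed (use definable_id in auto)

lemma realizable_st_closed:
  assumes "has_ty [] t \<sigma>"
  shows "realizable \<Gamma> Top (St \<sigma> t)"
proof (rule realizable_linear[where f = "\<lambda>x. [t]" and h = "\<lambda>x. []"])
  show "definable (Uex Top) (\<lambda>x. [t]) (Uex (St \<sigma> t))" by (rule definable_const) (simp add: assms)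
  show "W \<tturnstile> Umat (St \<sigma> t) as [t] vs" for W as vs
    by (simp add: tsubst_closed[OF assms] forces_eq_refl closed_imp_typed[OF assms])
qed simp

lemma realizable_st_app:
  "realizable \<Gamma> (And (St (\<sigma> \<^bold>\<rightarrow> \<tau>) f) (St \<sigma> t)) (St \<tau> (f \<^bold>\<cdot> t))" (is "realizable \<Gamma> ?A ?B")
proof (rule realizable_linear[where h = "\<lambda>x. []"])
  show "definable (Uex ?A) (\<lambda>x. [x ! 0 \<^bold>\<cdot> x ! 1]) (Uex ?B)"
    by (rule definableI[where ts = "[Var 0 \<^bold>\<cdot> Var 1]"]) auto
  fix W as xs vs assume "xs \<^bold>:\<^bold>: Uex ?A" and And: "W \<tturnstile> Umat ?A as xs []"
  then obtain x y where xs: "xs = [x, y]" by (auto simp: list_all2_Cons2)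
  have "W \<tturnstile> Eq (\<sigma> \<^bold>\<rightarrow> \<tau>) x (tsubst as f)" "W \<tturnstile> Eq \<sigma> y (tsubst as t)"
    using And by (simp_all add: xs Umat.simps)
  then have "W \<tturnstile> Eq \<tau> (x \<^bold>\<cdot> y) (tsubst as f \<^bold>\<cdot> tsubst as t)" by (rule forces_eq_app)
  then show "W \<tturnstile> Umat ?B as [xs ! 0 \<^bold>\<cdot> xs ! 1] vs" by (simp add: xs)
qed simp

lemma realizable_OS:
  assumes \<phi>: "internal \<phi>" "or_free \<phi>" "wff (Seq \<sigma> # \<Gamma>) \<phi>"
  shows "realizable \<Gamma> (AllSt (Seq \<sigma>) \<phi>) (Ex (Seq \<sigma>) (And (hyper \<sigma> (Var 0)) \<phi>))"
    (is "realizable \<Gamma> ?A (Ex _ ?I)")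
proof (rule realizable_linear[where f = "\<lambda>x. x" and h = "\<lambda>x. x"])
  note Uty = Uty_internal[OF \<phi>(1,2)] and Umat = Umat_internal[OF \<phi>(1,2)]
  show "definable (Uex ?A) (\<lambda>x. x) (Uex (Ex (Seq \<sigma>) ?I))"
    "definable (Uex ?A @ Uall (Ex (Seq \<sigma>) ?I)) (\<lambda>x. x) (Uall ?A)"
    using definable_id by (simp_all add: Uty)
  fix W as xs vs assume as: "typed_subst [] as \<Gamma>" and "xs \<^bold>:\<^bold>: Uex ?A"
    "vs \<^bold>:\<^bold>: Uall (Ex (Seq \<sigma>) ?I)" and AllSt: "W \<tturnstile> Umat ?A as xs (xs @ vs)"
  then obtain s where s: "vs = [s]" "xs = []" "s \<^bold>: Seq \<sigma>" by (auto simp: Uty list_all2_Cons2)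
  have \<phi>_s: "W \<tturnstile> fsubst (case_nat s as) \<phi>" using AllSt by (simp add: s Umat)
  have "answers W ?I (case_nat s as) [] [s]" unfolding answers_def
  proof (intro HOL.allI HOL.impI)
    fix W' ys assume W': "W \<le> W'" and "mems W' (Uall ?I) ys [s]"
    then obtain y where "ys = [y]" "W' \<tturnstile> Mem \<sigma> y s"
      by (cases ys) (auto simp: Uty list_all3_conv_all_nth)
    then show "W' \<tturnstile> Umat ?I (case_nat s as) [] ys"
      using forces_mono[OF \<phi>_s W'] by (simp add: Umat.simps Uty Umat Umat_hyper)
  qed
  then show "W \<tturnstile> Umat (Ex (Seq \<sigma>) ?I) as xs vs"
    unfolding s(1,2) using \<phi>(3) s(3)
    by (intro forces_Umat_ExI[OF _ as _ _ s(3)]) (simp_all add: Uty wff_hyper)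
qed

lemma realizable_US:
  assumes \<phi>: "internal \<phi>" "or_free \<phi>" "wff (Seq \<sigma> # \<Gamma>) \<phi>"
  shows "realizable \<Gamma> (All (Seq \<sigma>) (Imp (hyper \<sigma> (Var 0)) \<phi>)) (ExSt (Seq \<sigma>) \<phi>)"
    (is "realizable \<Gamma> (All _ ?I) ?A")
proof (rule realizable_linear[where f = "\<lambda>x. x" and h = "\<lambda>x. []"])
  note Uty = Uty_internal[OF \<phi>(1,2)] and Umat = Umat_internal[OF \<phi>(1,2)]
  show "definable (Uex (All (Seq \<sigma>) ?I)) (\<lambda>x. x) (Uex ?A)"
    "definable (Uex (All (Seq \<sigma>) ?I) @ Uall ?A) (\<lambda>x. []) (Uall (All (Seq \<sigma>) ?I))"
    using definable_id by (simp_all add: Uty)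
  fix W as xs vs assume as: "typed_subst [] as \<Gamma>"
    and "xs \<^bold>:\<^bold>: Uex (All (Seq \<sigma>) ?I)" "vs \<^bold>:\<^bold>: Uall ?A"
    and All: "W \<tturnstile> Umat (All (Seq \<sigma>) ?I) as xs []"
  then obtain s where s: "xs = [s]" "vs = []" "s \<^bold>: Seq \<sigma>" by (auto simp: Uty list_all2_Cons2)
  have "W \<tturnstile> Umat ?I (case_nat s as) ([] @ [s]) ([] @ [])"
    using All s \<phi>(3) by (subst (asm) forces_Umat_All[OF _ as]) (simp_all add: Uty wff_hyper)
  moreover have "W \<tturnstile> Umat ?I (case_nat s as) ([] @ [s]) ([] @ []) \<longleftrightarrow>
      (\<forall>W'\<ge>W. answers W' (hyper \<sigma> (Var 0)) (case_nat s as) [] (map (\<lambda>Y. apps Y ([] @ [])) [s]) \<longrightarrow>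
        W' \<tturnstile> Umat \<phi> (case_nat s as) (map (\<lambda>U. apps U []) []) [])"
    by (rule forces_Umat_Imp[OF wff_hyper typed_subst_case_nat[OF s(3) as]])
      (simp_all add: Uty s(3))
  moreover have "answers W (hyper \<sigma> (Var 0)) (case_nat s as) [] [s]" unfolding answers_def
  proof (intro HOL.allI HOL.impI)
    fix W' ys assume "mems W' (Uall (hyper \<sigma> (Var 0))) ys [s]"
    then obtain y where "ys = [y]" "W' \<tturnstile> Mem \<sigma> y s"
      by (cases ys) (auto simp: list_all3_conv_all_nth)
    then show "W' \<tturnstile> Umat (hyper \<sigma> (Var 0)) (case_nat s as) [] ys" by (simp add: Umat_hyper)
  qed
  ultimately have "W \<tturnstile> Umat \<phi> (case_nat s as) [] []" by auto
  then show "W \<tturnstile> Umat ?A as xs vs" by (simp add: s)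
qed

lemma realizable_NU:
  "realizable \<Gamma> (All \<tau> (ExSt \<sigma> \<Phi>))
    (ExSt \<sigma> (All \<tau> (fsubst (case_nat (Var 1) (case_nat (Var 0) (\<lambda>i. Var (i + 2)))) \<Phi>)))"
  (is "realizable \<Gamma> ?A ?B")
proof (rule realizable_if_Umat_eq)
  fix as :: "nat \<Rightarrow> tm" and xs ys :: "tm list" assume "length xs = length (Uex ?A)"
  then obtain x xs' where x: "xs = x # xs'" by (cases xs) auto
  have "tsubst (up (case_nat x as))
        (case_nat (Var (Suc 0)) (case_nat (Var 0) (\<lambda>i. Var (Suc (Suc i)))) i) =
      case_nat (tlift (Suc 0) x) (up as) i" for i
    by (auto split: nat.split simp: up_def)
  then show "Umat ?A as xs ys = Umat ?B as xs ys" by (simp add: x Umat.simps Umat_fsubst)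
qed simp

lemma realizable_AC:
  "realizable \<Gamma> (AllSt \<sigma> (ExSt \<tau> \<Phi>))
    (ExSt (\<sigma> \<^bold>\<rightarrow> \<tau>) (AllSt \<sigma>
      (fsubst (case_nat (Var 1 \<^bold>\<cdot> Var 0) (case_nat (Var 0) (\<lambda>i. Var (i + 2)))) \<Phi>)))"
  (is "realizable \<Gamma> ?A ?B")
proof (rule realizable_if_Umat_eq)
  fix as :: "nat \<Rightarrow> tm" and xs ys :: "tm list" assume "length xs = length (Uex ?A)"
  then obtain x xs' where x: "xs = x # xs'" by (cases xs) auto
  have "tsubst (case_nat z (case_nat x as))
        (case_nat (Var (Suc 0) \<^bold>\<cdot> Var 0) (case_nat (Var 0) (\<lambda>i. Var (Suc (Suc i)))) i) =
      case_nat (x \<^bold>\<cdot> z) (case_nat z as) i" for i z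
    by (auto split: nat.split)
  then show "Umat ?A as xs ys = Umat ?B as xs ys" by (simp add: x Umat_fsubst Let_def)
qed simp

lemma realizable_IP:
  assumes "internal \<phi>" "or_free \<phi>"
  shows "realizable \<Gamma> (Imp (AllSt \<sigma> \<phi>) (ExSt \<tau> \<Psi>)) (ExSt \<tau> (Imp (flift (AllSt \<sigma> \<phi>)) \<Psi>))"
    (is "realizable \<Gamma> ?A ?B")
proof (rule realizable_if_Umat_eq)
  note Uty = Uty_internal[OF assms]
  then show "Uty ?A = Uty ?B" by (simp del: fsubst.simps)
  fix as :: "nat \<Rightarrow> tm" and xs ys :: "tm list" assume "length xs = length (Uex ?A)"
  then obtain x xs' where x: "xs = x # xs'" by (cases xs) auto
  have "Umat (flift (AllSt \<sigma> \<phi>)) (tlift n \<circ> case_nat x as) us vs =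
      Umat (AllSt \<sigma> \<phi>) (tlift n \<circ> as) us vs" for n us vs
    unfolding Umat_flift by (simp add: o_def)
  then show "Umat ?A as xs ys = Umat ?B as xs ys"
    unfolding Umat.simps(6,9) Uty_flift by (simp add: x Let_def Uty del: Umat.simps)
qed

section \<open>External induction\<close>

lemma well_formed_Alls: "well_formed \<Gamma> (Alls \<tau>s \<phi>) \<longleftrightarrow> well_formed (rev \<tau>s @ \<Gamma>) \<phi>"
  by (induction \<tau>s arbitrary: \<Gamma>) auto

lemma forces_Alls:
  "well_formed (rev \<tau>s) \<phi> \<Longrightarrow>
    W \<tturnstile> Alls \<tau>s \<phi> \<longleftrightarrow> (\<forall>ys. ys \<^bold>:\<^bold>: \<tau>s \<longrightarrow> W \<tturnstile> fsubst (prefix_subst (rev ys) Var) \<phi>)"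
proof (induction \<tau>s arbitrary: \<phi>)
  case (Cons \<tau> \<tau>s)
  let ?\<phi> = "\<lambda>y. fsubst ((up ^^ length \<tau>s) (case_nat y Var)) \<phi>"
  have "W \<tturnstile> Alls \<tau>s (?\<phi> y) \<longleftrightarrow> (\<forall>ys. ys \<^bold>:\<^bold>: \<tau>s \<longrightarrow> W \<tturnstile> fsubst (prefix_subst (rev (y # ys)) Var) \<phi>)"
    if "y \<^bold>: \<tau>" for y
    unfolding Cons.IH[OF well_formed_fsubst_funpow_up[OF Cons.prems[simplified] that]]
    by (auto simp: fsubst_fsubst tsubst_prefix_subst_funpow_up list_all2_lengthD)
  moreover have "finst y (Alls \<tau>s \<phi>) = Alls \<tau>s (?\<phi> y)" for y
    by (simp add: finst_def fsubst_Alls)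
  moreover have "well_formed [\<tau>] (Alls \<tau>s \<phi>)" using Cons.prems by (simp add: well_formed_Alls)
  ultimately have "W \<tturnstile> Alls (\<tau> # \<tau>s) \<phi> \<longleftrightarrow> (\<forall>y. y \<^bold>: \<tau> \<longrightarrow>
      (\<forall>ys. ys \<^bold>:\<^bold>: \<tau>s \<longrightarrow> W \<tturnstile> fsubst (prefix_subst (rev (y # ys)) Var) \<phi>))"
    by (simp add: forces_All)
  then show ?case by (auto simp: list_all2_Cons2 simp del: rev.simps)
qed simp

lemma forces_Alls_Umat:
  assumes "wff \<Gamma> \<Phi>" "typed_subst [] as \<Gamma>" "xs \<^bold>:\<^bold>: Uex \<Phi>" and n: "n = length (Uall \<Phi>)"
  shows "W \<tturnstile> Alls (Uall \<Phi>) (Umat \<Phi> (tlift n \<circ> as) (map (tlift n) xs) (vars n)) \<longleftrightarrow>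
    (\<forall>ys. ys \<^bold>:\<^bold>: Uall \<Phi> \<longrightarrow> W \<tturnstile> Umat \<Phi> as xs ys)"
proof -
  let ?U = "Umat \<Phi> (tlift n \<circ> as) (map (tlift n) xs) (vars n)"
  have "well_formed (rev (Uall \<Phi>)) ?U"
    using matrix_typed_lifted[OF wff_matrix_typed[OF assms(1)] assms(2,3) n] by simp
  moreover have "fsubst (prefix_subst (rev ys) Var) ?U = Umat \<Phi> as xs ys" if "ys \<^bold>:\<^bold>: Uall \<Phi>" for ys
    by (rule fsubst_prefix_subst_Umat[OF list_all2_lengthD[OF assms(3)] list_all2_lengthD[OF that] n])
  ultimately show ?thesis using forces_Alls by auto
qed

lemma formula_ctxt_Alls_Umat:
  assumes \<Psi>: "wff (\<sigma> # \<Gamma>) \<Psi>" and as: "typed_subst [] as \<Gamma>" and Xs: "Xs \<^bold>:\<^bold>: map (Fn \<sigma>) (Uex \<Psi>)"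
  obtains Q where "formula_ctxt \<sigma> Q"
    "\<And>W t. t \<^bold>: \<sigma> \<Longrightarrow> W \<tturnstile> Q t \<longleftrightarrow>
      (\<forall>ys. ys \<^bold>:\<^bold>: Uall \<Psi> \<longrightarrow> W \<tturnstile> Umat \<Psi> (case_nat t as) (map (\<lambda>X. X \<^bold>\<cdot> t) Xs) ys)"
proof (rule that)
  let ?n = "length (Uall \<Psi>)"
  let ?U = "Umat \<Psi> (tlift ?n \<circ> up as) (map (\<lambda>X. tlift (Suc ?n) X \<^bold>\<cdot> Var ?n) Xs) (vars ?n)"
  let ?Q = "\<lambda>t. finst t (Alls (Uall \<Psi>) ?U)"
  have "list_all2 (typed (rev (Uall \<Psi>) @ [\<sigma>])) (map (tlift (Suc ?n)) Xs) (map (Fn \<sigma>) (Uex \<Psi>))"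
    using typed_list_tlift[OF Xs, of "rev (Uall \<Psi>) @ [\<sigma>]"] by simp
  then have "list_all2 (typed (rev (Uall \<Psi>) @ [\<sigma>])) (map (\<lambda>X. tlift (Suc ?n) X \<^bold>\<cdot> Var ?n) Xs)
    (Uex \<Psi>)"
    by (auto simp: list_all2_conv_all_nth nth_append)
  then have "well_formed (rev (Uall \<Psi>) @ [\<sigma>]) ?U"
    by (intro well_formed_Umat[OF \<Psi>] typed_subst_tlift typed_subst_up[OF as] typed_vars) simp_all
  then show "formula_ctxt \<sigma> ?Q"
    unfolding formula_ctxt_def by (intro HOL.exI[of _ "Alls (Uall \<Psi>) ?U"])
      (simp add: well_formed_Alls)
  fix W t assume t: "t \<^bold>: \<sigma>"
  have "tsubst ((up ^^ ?n) (case_nat t Var)) (tlift (Suc ?n) X) = tlift ?n X" for X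
    using tsubst_funpow_up_tlift[of ?n "case_nat t Var" "tlift 1 X"] by simp
  then have "?Q t = Alls (Uall \<Psi>) (Umat \<Psi> (tlift ?n \<circ> case_nat t as)
      (map (tlift ?n) (map (\<lambda>X. X \<^bold>\<cdot> t) Xs)) (vars ?n))"
    using list_all2_lengthD[OF Xs]
    by (simp add: finst_def fsubst_Alls fsubst_Umat funpow_up tsubst_funpow_up_vars
        tsubst_funpow_up_tlift tsubst_case_nat_up o_def cong: nat.case_cong)
  moreover have "map (\<lambda>X. X \<^bold>\<cdot> t) Xs \<^bold>:\<^bold>: Uex \<Psi>"
    using typed_list_apps[of "[]" Xs "[\<sigma>]" "Uex \<Psi>" "[t]"] Xs t by simp
  ultimately show "W \<tturnstile> ?Q t \<longleftrightarrow>
      (\<forall>ys. ys \<^bold>:\<^bold>: Uall \<Psi> \<longrightarrow> W \<tturnstile> Umat \<Psi> (case_nat t as) (map (\<lambda>X. X \<^bold>\<cdot> t) Xs) ys)"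
    using forces_Alls_Umat[OF \<Psi> typed_subst_case_nat[OF t as] _ refl, of "map (\<lambda>X. X \<^bold>\<cdot> t) Xs" W]
    by simp
qed

lemma forces_Umat_induct:
  assumes \<Psi>: "wff (N # \<Gamma>) \<Psi>" and as: "typed_subst [] as \<Gamma>" and Xs: "Xs \<^bold>:\<^bold>: map (Fn N) (Uex \<Psi>)"
    and zero: "\<And>ys. ys \<^bold>:\<^bold>: Uall \<Psi> \<Longrightarrow> W \<tturnstile> Umat \<Psi> (case_nat zero as) (map (\<lambda>X. X \<^bold>\<cdot> zero) Xs) ys"
    and suc: "\<And>W' t ys. W \<le> W' \<Longrightarrow> t \<^bold>: N \<Longrightarrow>
      (\<And>ys. ys \<^bold>:\<^bold>: Uall \<Psi> \<Longrightarrow> W' \<tturnstile> Umat \<Psi> (case_nat t as) (map (\<lambda>X. X \<^bold>\<cdot> t) Xs) ys) \<Longrightarrow>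
      ys \<^bold>:\<^bold>: Uall \<Psi> \<Longrightarrow> W' \<tturnstile> Umat \<Psi> (case_nat (suc t) as) (map (\<lambda>X. X \<^bold>\<cdot> suc t) Xs) ys"
    and t: "t \<^bold>: N" and ys: "ys \<^bold>:\<^bold>: Uall \<Psi>"
  shows "W \<tturnstile> Umat \<Psi> (case_nat t as) (map (\<lambda>X. X \<^bold>\<cdot> t) Xs) ys"
proof -
  obtain Q where Q: "formula_ctxt N Q" and Q_iff: "\<And>W t. t \<^bold>: N \<Longrightarrow> W \<tturnstile> Q t \<longleftrightarrow>
      (\<forall>ys. ys \<^bold>:\<^bold>: Uall \<Psi> \<longrightarrow> W \<tturnstile> Umat \<Psi> (case_nat t as) (map (\<lambda>X. X \<^bold>\<cdot> t) Xs) ys)"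
    using \<Psi> as Xs by (rule formula_ctxt_Alls_Umat) (rule that)
  have "W \<tturnstile> Q t"
  proof (rule forces_nat_induct[OF Q t])
    show "W \<tturnstile> Q zero" using zero Q_iff[of zero W] by simp
    fix W' t assume "W \<le> W'" and t: "t \<^bold>: N" and IH: "W' \<tturnstile> Q t"
    then show "W' \<tturnstile> Q (suc t)" using suc Q_iff[OF t, of W'] Q_iff[of "suc t" W'] by simp
  qed
  then show ?thesis using Q_iff[OF t] ys by blast
qed

definition recursors :: "ty list \<Rightarrow> tm list \<Rightarrow> tm list \<Rightarrow> tm list" where
  "recursors \<sigma>s us ss = map (\<lambda>i. apps (Cst (Rec \<sigma>s i)) (us @ ss)) [0..<length \<sigma>s]"

lemma length_recursors [simp]: "length (recursors \<sigma>s us ss) = length \<sigma>s"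
  and nth_recursors [simp]:
    "i < length \<sigma>s \<Longrightarrow> recursors \<sigma>s us ss ! i = apps (Cst (Rec \<sigma>s i)) (us @ ss)"
  by (simp_all add: recursors_def)

lemma has_ty_recursors:
  assumes "list_all2 (has_ty []) us \<sigma>s" "list_all2 (has_ty []) ss (map (\<lambda>\<tau>. N \<^bold>\<rightarrow> arrs \<sigma>s \<tau>) \<sigma>s)"
  shows "list_all2 (has_ty []) (recursors \<sigma>s us ss) (map (Fn N) \<sigma>s)"
  using list_all2_appendI[OF assms]
  by (auto simp: recursors_def list_all2_conv_all_nth[of _ "map _ _"] intro!: has_ty_apps)

lemma
  assumes us: "list_all2 (has_ty []) us \<sigma>s"
    and ss: "list_all2 (has_ty []) ss (map (\<lambda>\<tau>. N \<^bold>\<rightarrow> arrs \<sigma>s \<tau>) \<sigma>s)"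
  shows forces_recursors_zero: "eqs W \<sigma>s (map (\<lambda>X. X \<^bold>\<cdot> zero) (recursors \<sigma>s us ss)) us"
    and forces_recursors_suc: "t \<^bold>: N \<Longrightarrow> eqs W \<sigma>s (map (\<lambda>X. X \<^bold>\<cdot> suc t) (recursors \<sigma>s us ss))
      (map (\<lambda>s. apps (s \<^bold>\<cdot> t) (map (\<lambda>X. X \<^bold>\<cdot> t) (recursors \<sigma>s us ss))) ss)"
proof -
  note lengths = list_all2_lengthD[OF us] list_all2_lengthD[OF ss]
  have typed: "recursors \<sigma>s us ss ! i \<^bold>: N \<^bold>\<rightarrow> \<sigma>s ! i" if "i < length \<sigma>s" for i
    by (rule closed_imp_typed)
      (use list_all2_nthD2[OF has_ty_recursors[OF us ss], of i] that in simp)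
  show "eqs W \<sigma>s (map (\<lambda>X. X \<^bold>\<cdot> zero) (recursors \<sigma>s us ss)) us"
    unfolding list_all3_conv_all_nth
  proof (intro conjI HOL.allI HOL.impI)
    fix i assume i: "i < length \<sigma>s"
    have "us ! i \<^bold>: \<sigma>s ! i"
      by (rule closed_imp_typed) (use list_all2_nthD2[OF us, of i] i lengths in simp)
    then show "W \<tturnstile> Eq (\<sigma>s ! i) (map (\<lambda>X. X \<^bold>\<cdot> zero) (recursors \<sigma>s us ss) ! i) (us ! i)"
      using EHA_or_ax.rec_zero[of us \<sigma>s ss i] typed[OF i] lengths i
      by (auto intro!: forces_ax)
  qed (simp_all add: lengths)
  assume t: "t \<^bold>: N"
  let ?Xs = "map (\<lambda>X. X \<^bold>\<cdot> t) (recursors \<sigma>s us ss)"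
  show "eqs W \<sigma>s (map (\<lambda>X. X \<^bold>\<cdot> suc t) (recursors \<sigma>s us ss)) (map (\<lambda>s. apps (s \<^bold>\<cdot> t) ?Xs) ss)"
    unfolding list_all3_conv_all_nth
  proof (intro conjI HOL.allI HOL.impI)
    fix i assume i: "i < length \<sigma>s"
    have "?Xs \<^bold>:\<^bold>: \<sigma>s" using typed t by (auto simp: list_all2_conv_all_nth)
    moreover have "ss ! i \<^bold>: N \<^bold>\<rightarrow> arrs \<sigma>s (\<sigma>s ! i)"
      by (rule closed_imp_typed) (use list_all2_nthD2[OF ss, of i] i lengths in simp)
    then have "ss ! i \<^bold>\<cdot> t \<^bold>: arrs \<sigma>s (\<sigma>s ! i)" using t by auto
    ultimately have "apps (ss ! i \<^bold>\<cdot> t) ?Xs \<^bold>: \<sigma>s ! i" by (intro typed_apps)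
    moreover have "?Xs = map (\<lambda>j. apps (Cst (Rec \<sigma>s j)) (us @ ss) \<^bold>\<cdot> t) [0..<length \<sigma>s]"
      by (simp add: recursors_def)
    ultimately show "W \<tturnstile> Eq (\<sigma>s ! i) (map (\<lambda>X. X \<^bold>\<cdot> suc t) (recursors \<sigma>s us ss) ! i)
        (map (\<lambda>s. apps (s \<^bold>\<cdot> t) ?Xs) ss ! i)"
      using EHA_or_ax.rec_suc[of us \<sigma>s ss i t] typed[OF i] t lengths i
      by (auto intro!: forces_ax)
  qed (simp_all add: lengths)
qed

lemma simultaneous_recursion:
  assumes us: "list_all2 (has_ty []) us \<sigma>s" and f: "definable (N # \<sigma>s) f \<sigma>s"
  obtains Xs where "list_all2 (has_ty []) Xs (map (Fn N) \<sigma>s)"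
    "\<And>W. eqs W \<sigma>s us (map (\<lambda>X. X \<^bold>\<cdot> zero) Xs)"
    "\<And>W t. t \<^bold>: N \<Longrightarrow>
      eqs W \<sigma>s (f (t # map (\<lambda>X. X \<^bold>\<cdot> t) Xs)) (map (\<lambda>X. X \<^bold>\<cdot> suc t) Xs)"
proof -
  have "definable ([] @ N # \<sigma>s) f \<sigma>s" using f by simp
  then obtain F where F: "definable [] F (map (arrs (N # \<sigma>s)) \<sigma>s)" and F_eq:
      "\<And>W xs vs. xs \<^bold>:\<^bold>: [] \<Longrightarrow> vs \<^bold>:\<^bold>: N # \<sigma>s \<Longrightarrow> eqs W \<sigma>s (map (\<lambda>U. apps U vs) (F xs)) (f (xs @ vs))"
    by (rule definable_abstraction) (rule that)
  have ss: "list_all2 (has_ty []) (F []) (map (\<lambda>\<tau>. N \<^bold>\<rightarrow> arrs \<sigma>s \<tau>) \<sigma>s)"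
    using definable_closed[OF F] by (simp add: arrs_def[abs_def] o_def)
  let ?Xs = "recursors \<sigma>s us (F [])"
  have Xs: "list_all2 (has_ty []) ?Xs (map (Fn N) \<sigma>s)" using us ss by (rule has_ty_recursors)
  show thesis
  proof (rule that[OF Xs])
    show "eqs W \<sigma>s us (map (\<lambda>X. X \<^bold>\<cdot> zero) ?Xs)" for W
      by (rule eqs_sym[OF forces_recursors_zero[OF us ss]])
    fix W t assume t: "t \<^bold>: N"
    have "?Xs \<^bold>:\<^bold>: map (Fn N) \<sigma>s"
      by (rule list_all2_mono[OF Xs]) (rule closed_imp_typed)
    then have "map (\<lambda>X. X \<^bold>\<cdot> t) ?Xs \<^bold>:\<^bold>: \<sigma>s"
      using typed_list_apps[of "[]" ?Xs "[N]" \<sigma>s "[t]"] t by simp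
    then have "eqs W \<sigma>s (map (\<lambda>U. apps U (t # map (\<lambda>X. X \<^bold>\<cdot> t) ?Xs)) (F []))
      (f (t # map (\<lambda>X. X \<^bold>\<cdot> t) ?Xs))"
      using F_eq[of "[]" "t # map (\<lambda>X. X \<^bold>\<cdot> t) ?Xs"] t by simp
    then show "eqs W \<sigma>s (f (t # map (\<lambda>X. X \<^bold>\<cdot> t) ?Xs)) (map (\<lambda>X. X \<^bold>\<cdot> suc t) ?Xs)"
      using eqs_sym[OF eqs_trans[OF forces_recursors_suc[OF us ss t]]] by simp
  qed
qed

lemma answers_StI:
  assumes "t \<^bold>: \<sigma>" "\<And>ys. ys \<^bold>:\<^bold>: Uall \<Psi> \<Longrightarrow> W \<tturnstile> Umat \<Psi> (case_nat t as) xs ys"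
  shows "answers W (And (St \<sigma> (Var 0)) \<Psi>) (case_nat t as) (t # xs) Ss"
proof -
  have "answers W \<Psi> (case_nat t as) xs Ss"
    unfolding answers_def using forces_mono[OF assms(2)] mems_typed by blast
  moreover have "answers W (St \<sigma> (Var 0)) (case_nat t as) [t] []"
    using assms(1) by (simp add: answers_St forces_eq_refl)
  ultimately have "answers W (And (St \<sigma> (Var 0)) \<Psi>) (case_nat t as) ([t] @ xs) ([] @ Ss)"
    by (intro answers_AndI) simp_all
  then show ?thesis by simp
qed

lemma realizable_induct:
  assumes \<Psi>: "wff (N # \<Gamma>) \<Psi>" and base: "realizable \<Gamma> Top (finst zero \<Psi>)"
    and step: "realizable (N # \<Gamma>) (And (St N (Var 0)) \<Psi>) (fsucc \<Psi>)"
  shows "realizable \<Gamma> Top (AllSt N \<Psi>)"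
proof -
  obtain f g where f: "definable [] f (Uex \<Psi>)"
    and zero: "realizes \<Gamma> Top (finst zero \<Psi>) f g"
    using base by (rule realizableE) (auto intro: that)
  obtain f' g' where f': "definable (N # Uex \<Psi>) f' (Uex \<Psi>)"
    and suc: "realizes (N # \<Gamma>) (And (St N (Var 0)) \<Psi>) (fsucc \<Psi>) f' g'"
    using step by (rule realizableE) (auto intro: that)
  obtain Xs where Xs: "list_all2 (has_ty []) Xs (map (Fn N) (Uex \<Psi>))"
    and Xs_zero: "\<And>W. eqs W (Uex \<Psi>) (f []) (map (\<lambda>X. X \<^bold>\<cdot> zero) Xs)"
    and Xs_suc: "\<And>W t. t \<^bold>: N \<Longrightarrow>
      eqs W (Uex \<Psi>) (f' (t # map (\<lambda>X. X \<^bold>\<cdot> t) Xs)) (map (\<lambda>X. X \<^bold>\<cdot> suc t) Xs)"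
    using definable_closed[OF f] f' by (rule simultaneous_recursion) (rule that)
  have Xs_typed: "Xs \<^bold>:\<^bold>: map (Fn N) (Uex \<Psi>)"
    by (rule list_all2_mono[OF Xs]) (rule closed_imp_typed)
  show ?thesis
  proof (rule realizable_linear[where f = "\<lambda>x. Xs" and h = "\<lambda>x. []"])
    show "definable (Uex Top) (\<lambda>x. Xs) (Uex (AllSt N \<Psi>))" using definable_const[OF Xs] by simp
    fix W as xs vs assume as: "typed_subst [] as \<Gamma>" and "vs \<^bold>:\<^bold>: Uall (AllSt N \<Psi>)"
    then obtain ys n where split: "vs = ys @ [n]" and ys: "ys \<^bold>:\<^bold>: Uall \<Psi>" and n: "n \<^bold>: N"
      by (auto simp: list_all2_append2 list_all2_Cons2)
    have "W \<tturnstile> Umat \<Psi> (case_nat n as) (map (\<lambda>X. X \<^bold>\<cdot> n) Xs) ys"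
      using \<Psi> as Xs_typed _ _ n ys
    proof (rule forces_Umat_induct)
      fix ys assume ys: "ys \<^bold>:\<^bold>: Uall \<Psi>"
      have "W \<tturnstile> Umat \<Psi> (case_nat zero as) (f []) ys"
        using realizesD[OF zero as, of "[]" ys] ys by (simp add: Umat_finst answers_Top)
      then show "W \<tturnstile> Umat \<Psi> (case_nat zero as) (map (\<lambda>X. X \<^bold>\<cdot> zero) Xs) ys"
        by (rule forces_Umat_cong[OF \<Psi> eq_subst_refl Xs_zero eqs_refl[OF ys], rotated])
          (simp add: typed_subst_case_nat[OF _ as])
    next
      fix W' t ys assume W': "W \<le> W'" and t: "t \<^bold>: N" and ys: "ys \<^bold>:\<^bold>: Uall \<Psi>"
        and IH: "\<And>ys. ys \<^bold>:\<^bold>: Uall \<Psi> \<Longrightarrow> W' \<tturnstile> Umat \<Psi> (case_nat t as) (map (\<lambda>X. X \<^bold>\<cdot> t) Xs) ys"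
      let ?Xs = "map (\<lambda>X. X \<^bold>\<cdot> t) Xs"
      have "?Xs \<^bold>:\<^bold>: Uex \<Psi>" using typed_list_apps[of "[]" Xs "[N]" "Uex \<Psi>" "[t]"] Xs_typed t by simp
      then have xs: "t # ?Xs \<^bold>:\<^bold>: N # Uex \<Psi>" using t by simp
      have "W' \<tturnstile> Umat \<Psi> (case_nat (suc t) as) (f' (t # ?Xs)) ys"
        using realizesD[OF suc typed_subst_case_nat[OF t as], of "t # ?Xs" ys] xs ys answers_StI[OF t IH]
        by (simp add: Umat_fsucc)
      then show "W' \<tturnstile> Umat \<Psi> (case_nat (suc t) as) (map (\<lambda>X. X \<^bold>\<cdot> suc t) Xs) ys"
        by (rule forces_Umat_cong[OF \<Psi> eq_subst_refl Xs_suc[OF t] eqs_refl[OF ys], rotated])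
          (simp add: typed_subst_case_nat[OF _ as] t)
    qed
    then show "W \<tturnstile> Umat (AllSt N \<Psi>) as Xs vs" unfolding split Umat_AllSt .
  qed simp
qed

lemma realizable_flift:
  assumes "realizable \<Gamma> A B"
  shows "realizable (\<sigma> # \<Gamma>) (flift A) (flift B)"
proof -
  obtain f g where f: "definable (Uex A) f (Uex B)"
    and g: "definable (Uex A @ Uall B) g (map Seq (Uall A))"
    and B: "realizes \<Gamma> A B f g"
    using assms by (rule realizableE) (rule that)
  show ?thesis
  proof (rule realizableI)
    fix W as xs vs assume as: "typed_subst [] as (\<sigma> # \<Gamma>)" and "xs \<^bold>:\<^bold>: Uex (flift A)"
      "vs \<^bold>:\<^bold>: Uall (flift B)" and answers: "answers W (flift A) as xs (g (xs @ vs))"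
    moreover have "typed_subst [] (\<lambda>i. as (Suc i)) \<Gamma>" using as by (auto simp: typed_subst_def)
    ultimately show "W \<tturnstile> Umat (flift B) as (f xs) vs"
      unfolding Umat_flift by (intro realizesD[OF B]) (simp_all add: answers_def Umat_flift)
  qed (use f g in simp_all)
qed

lemma realizable_allst_at:
  assumes "realizable \<Gamma> G (AllSt \<sigma> A)" "wff (\<sigma> # \<Gamma>) A"
  shows "realizable (\<sigma> # \<Gamma>) (And (flift G) (St \<sigma> (Var 0))) A"
  using realizable_mp[OF realizable_trans[OF realizable_andE1 realizable_trans[OF
        realizable_flift[OF assms(1)] realizable_allst_inst[OF assms(2)]]] realizable_andE2]
  by simp

lemma realizable_allstI:
  assumes "realizable (\<sigma> # \<Gamma>) (And (flift G) (St \<sigma> (Var 0))) A" "wff (\<sigma> # \<Gamma>) A"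
  shows "realizable \<Gamma> G (AllSt \<sigma> A)"
  using assms realizable_trans[OF realizable_allI[OF realizable_impI[OF assms(1)]]
    realizable_allst2]
  by simp

text \<open>With \<open>P\<close> the premise of the axiom, the induction rule is applied to \<open>P \<longrightarrow> \<Phi>(n)\<close>: its base and
  step are derivable, hence realized by terms that work for all challenges, and collecting the
  challenges to \<open>P\<close> along the recursion is left to the logical rules.\<close>

lemma realizable_ext_induction:
  assumes \<Phi>: "wff (N # \<Gamma>) \<Phi>"
  shows "realizable \<Gamma> (And (finst zero \<Phi>) (AllSt N (Imp \<Phi> (fsucc \<Phi>)))) (AllSt N \<Phi>)"
    (is "realizable \<Gamma> ?P _")
proof -
  let ?S = "St N (Var 0)" and ?\<Psi> = "Imp (flift ?P) \<Phi>"
  have I: "wff (N # \<Gamma>) (Imp \<Phi> (fsucc \<Phi>))" using \<Phi> wff_fsucc by simp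
  have P: "wff \<Gamma> ?P" using \<Phi> I wff_finst[OF \<Phi>] by simp
  note P' = wff_flift[OF P]
  have \<Psi>: "wff (N # \<Gamma>) ?\<Psi>" using P' \<Phi> by simp
  have "finst zero ?\<Psi> = Imp ?P (finst zero \<Phi>)" by simp
  then have base: "realizable \<Gamma> Top (finst zero ?\<Psi>)"
    using realizable_imp[OF realizable_andE1] P wff_finst[OF \<Phi>] by simp
  have step: "realizable (N # \<Gamma>) (And ?S ?\<Psi>) (fsucc ?\<Psi>)"
  proof -
    let ?G = "And (And ?S ?\<Psi>) (flift ?P)"
    have S: "realizable (N # \<Gamma>) ?G ?S"
      by (rule realizable_trans[OF realizable_andE1 realizable_andE1])
    have \<Phi>_n: "realizable (N # \<Gamma>) ?G \<Phi>"
      by (rule realizable_mp[OF realizable_trans[OF realizable_andE1 realizable_andE2]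
        realizable_andE2 P'])
    have "realizable (N # \<Gamma>) (And (flift ?P) ?S) (Imp \<Phi> (fsucc \<Phi>))"
      by (rule realizable_allst_at[OF realizable_andE2 I])
    then have "realizable (N # \<Gamma>) ?G (Imp \<Phi> (fsucc \<Phi>))"
      by (rule realizable_trans[OF realizable_andI[OF realizable_andE2 S]])
    from realizable_mp[OF this \<Phi>_n \<Phi>]
    have "realizable (N # \<Gamma>) (And ?S ?\<Psi>) (Imp (flift ?P) (fsucc \<Phi>))"
      using P' wff_fsucc[OF \<Phi>] by (rule realizable_impI)
    moreover have "fsucc ?\<Psi> = Imp (flift ?P) (fsucc \<Phi>)"
      using fsucc_flift[of ?P] by (simp add: fsucc_def)
    ultimately show ?thesis by simp
  qed
  have "realizable \<Gamma> ?P (AllSt N ?\<Psi>)"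
    by (rule realizable_trans[OF realizable_top realizable_induct[OF \<Psi> base step]])
  then have "realizable (N # \<Gamma>) (And (flift ?P) ?S) ?\<Psi>" using \<Psi> by (rule realizable_allst_at)
  from realizable_mp[OF this realizable_andE1 P'] show ?thesis using \<Phi> by (rule realizable_allstI)
qed

lemma realizable_st_ax:
  assumes "\<phi> \<in> st_ax" "wff \<Gamma> \<phi>"
  shows "realizable \<Gamma> Top \<phi>"
  using assms
proof cases
  case (allst1 \<sigma> \<Phi>)
  then show ?thesis using assms(2) by (auto intro!: realizable_imp realizable_allst1)
next
  case (allst2 \<sigma> \<Phi>)
  then show ?thesis using assms(2) by (auto intro!: realizable_imp realizable_allst2)
next
  case (exst1 \<sigma> \<Phi>)
  then show ?thesis using assms(2) by (auto intro!: realizable_imp realizable_exst1)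
next
  case (exst2 \<sigma> \<Phi>)
  then show ?thesis using assms(2) by (auto intro!: realizable_imp realizable_exst2)
next
  case (st_eq \<sigma> t u)
  then show ?thesis using realizable_imp[OF realizable_st_eq] assms(2) by blast
next
  case (st_closed t \<sigma>)
  then show ?thesis using realizable_st_closed by blast
next
  case (st_app \<sigma> \<tau> f t)
  then show ?thesis using realizable_imp[OF realizable_st_app] assms(2) by blast
next
  case (ext_induction \<Phi>)
  then have "wff (N # \<Gamma>) \<Phi>" using assms(2) by simp
  then show ?thesis using realizable_imp[OF realizable_ext_induction] ext_induction assms(2)
    by blast
qed

theorem realizable_ax:
  assumes "\<phi> \<in> EHA_or_ax \<union> st_ax \<union> (OS_or \<union> US_or \<union> NU \<union> AC_st \<union> IP_or \<union> \<Delta>)" "wff \<Gamma> \<phi>"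
  shows "realizable \<Gamma> Top \<phi>"
proof -
  consider "\<phi> \<in> EHA_or_ax \<union> \<Delta>" | "\<phi> \<in> st_ax" | (OS) "\<phi> \<in> OS_or" | (US) "\<phi> \<in> US_or"
    | (NU) "\<phi> \<in> NU" | (AC) "\<phi> \<in> AC_st" | (IP) "\<phi> \<in> IP_or"
    using assms(1) by blast
  then show ?thesis
  proof cases
    case OS
    then show ?thesis using assms(2)
      by (cases rule: OS_or.cases) (auto intro!: realizable_imp realizable_OS)
  next
    case US
    then show ?thesis using assms(2)
      by (cases rule: US_or.cases) (auto intro!: realizable_imp realizable_US)
  next
    case NU
    then show ?thesis using assms(2)
      by (cases rule: NU.cases) (use realizable_imp[OF realizable_NU] in blast)
  next
    case AC
    then show ?thesis using assms(2)
      by (cases rule: AC_st.cases) (use realizable_imp[OF realizable_AC] in blast)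
  next
    case IP
    then show ?thesis using assms(2)
      by (cases rule: IP_or.cases) (use realizable_imp[OF realizable_IP] in blast)
  qed (rule realizable_internal_ax[OF _ assms(2)] realizable_st_ax[OF _ assms(2)]; assumption)+
qed

lemma EHA_or_if_forces:
  assumes "{||} \<tturnstile> \<phi>" and \<theta>: "\<And>i. has_ty \<Gamma> (\<theta> i) (\<nu> i)"
  shows "EHA_or \<Delta> \<Gamma> (fsubst \<theta> \<phi>)"
proof -
  obtain n where "derivable n [] \<phi>"
    using assms(1) set_hyps[of "{||}"] unfolding forces_def by auto
  moreover have "subst_ty \<Gamma> \<theta> (ctx n)" using \<theta> by (simp add: subst_ty_def)
  ultimately have "prv {\<psi>. internal \<psi>} (EHA_or_ax \<union> \<Delta>) \<Gamma> (map (fsubst \<theta>) []) (fsubst \<theta> \<phi>)"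
    by (rule prv_fsubst) (simp, rule ax_fsubst)
  then show ?thesis by (simp add: EHA_or_def)
qed

theorem EHA_or_if_realizable:
  assumes "realizable \<Gamma> Top \<Phi>" "wff \<Gamma> \<Phi>"
    and \<nu>: "\<And>i. i < length (rev (Uall \<Phi>) @ \<Gamma>) \<Longrightarrow> \<nu> i = (rev (Uall \<Phi>) @ \<Gamma>) ! i"
  shows "\<exists>ts. list_all2 (has_ty []) ts (Uex \<Phi>) \<and> EHA_or \<Delta> \<Gamma> (Alls (Uall \<Phi>)
    (Umat \<Phi> (\<lambda>i. Var (i + length (Uall \<Phi>))) ts (vars (length (Uall \<Phi>)))))"
proof -
  let ?n = "length (Uall \<Phi>)" and ?\<Gamma> = "rev (Uall \<Phi>) @ \<Gamma>"
  obtain f g where f: "definable [] f (Uex \<Phi>)"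
    and \<Phi>: "realizes \<Gamma> Top \<Phi> f g"
    using assms(1) by (rule realizableE) (auto intro: that)
  let ?U = "Umat \<Phi> (\<lambda>i. Var (i + ?n)) (f []) (vars ?n)"
  let ?\<theta> = "\<lambda>i. if i < length ?\<Gamma> then Var i else null_tm (\<nu> i)"
  have ts: "list_all2 (has_ty []) (f []) (Uex \<Phi>)" using f by (rule definable_closed)
  have "{||} \<tturnstile> ?U"
  proof (rule realizesD[OF \<Phi> _ _ _ answers_Top])
    show "typed_subst [] (\<lambda>i. Var (i + ?n)) \<Gamma>" using \<nu> by (simp add: typed_subst_def nth_append)
    show "vars ?n \<^bold>:\<^bold>: Uall \<Phi>" using \<nu>
      by (auto simp: list_all2_conv_all_nth nth_vars nth_append rev_nth)
  qed simp
  moreover have "has_ty ?\<Gamma> (?\<theta> i) (\<nu> i)" for i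
    using \<nu> has_ty_closed[OF has_ty_null] by simp
  ultimately have "EHA_or \<Delta> ?\<Gamma> (fsubst ?\<theta> ?U)" by (rule EHA_or_if_forces)
  moreover have "fsubst ?\<theta> ?U = ?U"
  proof -
    have "map (tsubst ?\<theta>) (f []) = f []"
      by (rule map_idI) (use ts in \<open>auto simp: list_all2_conv_all_nth in_set_conv_nth
        tsubst_closed\<close>)
    moreover have "map (tsubst ?\<theta>) (vars ?n) = vars ?n"
      by (rule nth_equalityI) (auto simp: nth_vars)
    ultimately show ?thesis
      using list_all2_lengthD[OF ts] by (auto simp: fsubst_Umat intro: Umat_subst_cong[OF assms(2)])
  qed
  ultimately have "EHA_or \<Delta> \<Gamma> (Alls (Uall \<Phi>) ?U)" unfolding EHA_or_def by (simp add: prv_Alls)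
  with ts show ?thesis by blast
qed

end

instance ty :: countable
  by countable_datatype

lemma infinite_supply_extending:
  obtains \<nu> :: "nat \<Rightarrow> ty" where "variable_supply \<nu>" "\<And>i. i < length \<Gamma> \<Longrightarrow> \<nu> i = \<Gamma> ! i"
proof -
  define \<nu> where "\<nu> i = (if i < length \<Gamma> then \<Gamma> ! i else from_nat (fst (prod_decode i)))" for i
  have "infinite {i. \<nu> i = \<sigma>}" for \<sigma>
  proof (rule infinite_super)
    let ?index = "\<lambda>j. prod_encode (to_nat \<sigma>, length \<Gamma> + j)"
    have "\<not> ?index j < length \<Gamma>" for j
      using le_prod_encode_2[of "length \<Gamma> + j" "to_nat \<sigma>"] by linarith
    then show "range ?index \<subseteq> {i. \<nu> i = \<sigma>}" by (auto simp: \<nu>_def)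
    show "infinite (range ?index)" by (simp add: finite_image_iff inj_on_def)
  qed
  then have "variable_supply \<nu>" by unfold_locales
  then show thesis by (rule that) (simp add: \<nu>_def)
qed

theorem mainTheorem13:
  fixes \<Delta> :: "fm set" and \<Gamma> :: "ty list" and \<Phi> :: fm
  assumes "\<forall>\<delta>\<in>\<Delta>. sentence \<delta> \<and> internal \<delta> \<and> or_free \<delta>"
    and "EHA_st_or (OS_or \<union> US_or \<union> NU \<union> AC_st \<union> IP_or \<union> \<Delta>) \<Gamma> \<Phi>"
  shows "\<exists>ts. list_all2 (has_ty []) ts (Uex \<Phi>) \<and>
    EHA_or \<Delta> \<Gamma>
      (Alls (Uall \<Phi>)
        (Umat \<Phi> (\<lambda>i. Var (i + length (Uall \<Phi>))) ts (vars (length (Uall \<Phi>)))))"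
proof -
  obtain \<nu> where variables: "variable_supply \<nu>"
    and \<nu>: "\<And>i. i < length (rev (Uall \<Phi>) @ \<Gamma>) \<Longrightarrow> \<nu> i = (rev (Uall \<Phi>) @ \<Gamma>) ! i"
    by (rule infinite_supply_extending[of "rev (Uall \<Phi>) @ \<Gamma>"]) (rule that)
  interpret internal_theory \<nu> \<Delta>
    by (rule internal_theory.intro[OF variables]) (unfold_locales, use assms(1) in blast)
  note prv = assms(2)[unfolded EHA_st_or_def]
  have "realizable \<Gamma> Top \<Phi>" using prv_realizable[OF prv realizable_ax] by simp
  moreover have "wff \<Gamma> \<Phi>" using prv_wff[OF prv] by simp
  ultimately show ?thesis using \<nu> by (rule EHA_or_if_realizable)
qed

end
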